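(* Let $k$ be a commutative ring and let $H$ be a monoidal $k$-prebialgebra (satisfying (lm) and (rm)). Then the forgetful functor $U:{}_H\mathcal{M}\to{}_k\mathcal{M}$ from the monoidal category $({}_H\mathcal{M},\otimes^l,H_L^* )$ of left $H$-modules to the monoidal category of $k$-modules is monoidal and opmonoidal (with the structure maps given in the context). If moreover any of (rc) and (lc) holds, then $U$ is essentially strong monoidal and essentially strong opmonoidal.
   Context: Conventions. $k$ is a commutative ring and $\otimes=\otimes_k$. A $k$-prebialgebra is a $k$-module $H$ that is both an associative unital $k$-algebra (unit $1$) and a coassociative counital $k$-coalgebra (comultiplication $\Delta$, counit $\varepsilon$) such that $\Delta(hk)=\Delta(h)\Delta(k)$ for all $h,k\in H$; it is not required that $\Delta(1)=1\otimes 1$ nor that $\varepsilon$ is multiplicative. Sweedler notation: $\Delta(h)=h_{(1)}\otimes h_{(2)}$, $\Delta(1)=1_{(1)}\otimes 1_{(2)}=1_{(1')}\otimes 1_{(2')}$, $\Delta^2=(\Delta\otimes H)\circ\Delta$. Axioms (for all $h,k,l\in H$): (lm) $\varepsilon(hkl)=\varepsilon(hk_{(1)})\varepsilon(k_{(2)}l)$; (rm) $\varepsilon(hkl)=\varepsilon(hk_{(2)})\varepsilon(k_{(1)}l)$; (lc) $\Delta^2(1)=1_{(1)}\otimes 1_{(2)}1_{(1')}\otimes 1_{(2')}$; (rc) $\Delta^2(1)=1_{(1)}\otimes 1_{(1')}1_{(2)}\otimes 1_{(2')}$. Monoidal structure on ${}_H\mathcal{M}$ (for $H$ satisfying (lm)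 and (rm)). Let $H^*=\mathrm{Hom}_k(H,k)$, $f(h^* )=\langle h^*,1_{(1)}\rangle 1_{(2)}$, $f'(h^* )=\langle h^*,1_{(2)}\rangle 1_{(1)}$ for $h^*\in H^*$, and $g(h)=\langle\varepsilon,-h\rangle\in H^*$ for $h\in H$. Put $H_L^*=\mathrm{Im}(g)$, a left $H$-module via $k\cdot g(h)=g(kh)$; note $\varepsilon=g(1)\in H_L^*$. For left $H$-modules $M,N$ let $\pi:M\otimes N\to M\otimes N$, $\pi(m\otimes n)=1_{(1)}m\otimes 1_{(2)}n$, and $M\otimes^l N=\mathrm{Im}(\pi)$ with action $h\cdot(m\otimes n)=h_{(1)}m\otimes h_{(2)}n$. The associativity constraint is induced by that of $k$-modules, the unit object is $H_L^*$, and the unit constraints are the restrictions to $H_L^*\otimes^l M$ and $M\otimes^l H_L^*$ of $\varphi\otimes m\mapsto f(\varphi)m$ and $m\otimes\varphi\mapsto f'(\varphi)m$. Structure maps of $U$. Monoidal structure: $M\otimes N\to M\otimes^l N$ given by $\pi$, and $k\to H_L^*$, $x\mapsto x\varepsilon$. Opmonoidal structure: the inclusion $M\otimes^l N\hookrightarrow M\otimes N$, and $H_L^*\to k$, $\varphi\mapsto\langle\varphi,1\rangle$. Essentially strong (op)monoidal. Let $U:(\mathcal{C},\boxtimes,I)\to{}_k\mathcal{M}$ be a monoidal functor, with maps $U(M)\otimes U(N)\to U(M\boxtimes N)$ and $k\to U(I)$. Then $U(I)$ is a $k$-algebra, each $U(M)$ is a $U(I)$-bimodule (via the structure maps and unit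 constraints), and $U$ factors through a monoidal functor $\mathcal{C}\to{}_{U(I)}\mathcal{M}_{U(I)}$ into $U(I)$-bimodules; $U$ is essentially strong monoidal if the latter is strong monoidal, i.e. the induced maps $U(M)\otimes_{U(I)}U(N)\to U(M\boxtimes N)$ are isomorphisms for all $M,N$. Dually, if $U$ is opmonoidal, with maps $U(M\boxtimes N)\to U(M)\otimes U(N)$ and $U(I)\to k$, then $U(I)$ is a $k$-coalgebra, each $U(M)$ is a $U(I)$-bicomodule, and $U$ is essentially strong opmonoidal if the induced maps from $U(M\boxtimes N)$ to the cotensor product of $U(M)$ and $U(N)$ over $U(I)$ are isomorphisms for all $M,N$; here the cotensor product over a coalgebra $C$ of a right $C$-comodule $M$ and a left $C$-comodule $N$ is the set of $\sum_i m_i\otimes n_i\in M\otimes N$ with $\sum_i m_{i[0]}\otimes m_{i[1]}\otimes n_i=\sum_i m_i\otimes n_{i[-1]}\otimes n_{i[0]}$. *)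

theory Defs
  imports "HOL-Algebra.Module" "HOL-Algebra.AbelCoset"
begin

section \<open>Tensor products over a commutative ring\<close>

text \<open>
  A list of pairs over \<open>M \<times> N\<close> stands for the formal sum of the corresponding pure tensors.  The
  relation \<open>teq\<close> is the congruence on formal sums generated by the tensor relations; modulo it the
  formal sums are the module \<open>M \<otimes> N\<close> (the negative of a pure tensor is obtained by negating its
  left factor).  An element of the tensor product is stored as one chosen formal sum per class,
  so that Sweedler notation becomes summation over a list.
\<close>

inductive teq ::
  "'k ring \<Rightarrow> ('k, 'm, 'r) module_scheme \<Rightarrow> ('k, 'n, 's) module_scheme
    \<Rightarrow> ('m \<times> 'n) list \<Rightarrow> ('m \<times> 'n) list \<Rightarrow> bool"
  for k M N where
  refl: "set s \<subseteq> carrier M \<times> carrier N \<Longrightarrow> teq k M N s s"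
| sym: "teq k M N s t \<Longrightarrow> teq k M N t s"
| trans: "teq k M N s t \<Longrightarrow> teq k M N t u \<Longrightarrow> teq k M N s u"
| append: "teq k M N s t \<Longrightarrow> teq k M N s' t' \<Longrightarrow> teq k M N (s @ s') (t @ t')"
| comm: "set s \<subseteq> carrier M \<times> carrier N \<Longrightarrow> set t \<subseteq> carrier M \<times> carrier N
    \<Longrightarrow> teq k M N (s @ t) (t @ s)"
| zero: "n \<in> carrier N \<Longrightarrow> teq k M N [(\<zero>\<^bsub>M\<^esub>, n)] []"
| add_left: "m \<in> carrier M \<Longrightarrow> m' \<in> carrier M \<Longrightarrow> n \<in> carrier N
    \<Longrightarrow> teq k M N [(m \<oplus>\<^bsub>M\<^esub> m', n)] [(m, n), (m', n)]"
| add_right: "m \<in> carrier M \<Longrightarrow> n \<in> carrier N \<Longrightarrow> n' \<in> carrier N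
    \<Longrightarrow> teq k M N [(m, n \<oplus>\<^bsub>N\<^esub> n')] [(m, n), (m, n')]"
| balanced: "x \<in> carrier k \<Longrightarrow> m \<in> carrier M \<Longrightarrow> n \<in> carrier N
    \<Longrightarrow> teq k M N [(x \<odot>\<^bsub>M\<^esub> m, n)] [(m, x \<odot>\<^bsub>N\<^esub> n)]"

definition nf ::
  "'k ring \<Rightarrow> ('k, 'm, 'r) module_scheme \<Rightarrow> ('k, 'n, 's) module_scheme
    \<Rightarrow> ('m \<times> 'n) list \<Rightarrow> ('m \<times> 'n) list" where
  "nf k M N s = (SOME t. teq k M N s t)"

text \<open>
  The library's module record also has ring multiplication fields; they are meaningless for a
  mere module and left \<^const>\<open>undefined\<close>.
\<close>

definition tensor ::
  "'k ring \<Rightarrow> ('k, 'm, 'r) module_scheme \<Rightarrow> ('k, 'n, 's) module_scheme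
    \<Rightarrow> ('k, ('m \<times> 'n) list) module" where
  "tensor k M N =
    \<lparr>carrier = nf k M N ` lists (carrier M \<times> carrier N),
     mult = undefined, one = undefined,
     zero = nf k M N [],
     add = (\<lambda>s t. nf k M N (s @ t)),
     smult = (\<lambda>x s. nf k M N (map (\<lambda>(m, n). (x \<odot>\<^bsub>M\<^esub> m, n)) s))\<rparr>"

definition pure ::
  "'k ring \<Rightarrow> ('k, 'm, 'r) module_scheme \<Rightarrow> ('k, 'n, 's) module_scheme
    \<Rightarrow> 'm \<Rightarrow> 'n \<Rightarrow> ('m \<times> 'n) list" where
  "pure k M N m n = nf k M N [(m, n)]"

text \<open>\<open>tmap k M' N' f g\<close> is the map \<open>f \<otimes> g\<close> with values in \<open>M' \<otimes> N'\<close>.\<close>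

definition tmap ::
  "'k ring \<Rightarrow> ('k, 'p, 'r) module_scheme \<Rightarrow> ('k, 'q, 's) module_scheme
    \<Rightarrow> ('m \<Rightarrow> 'p) \<Rightarrow> ('n \<Rightarrow> 'q) \<Rightarrow> ('m \<times> 'n) list \<Rightarrow> ('p \<times> 'q) list" where
  "tmap k M' N' f g t = nf k M' N' (map (map_prod f g) t)"

definition lsum :: "('a, 'r) ring_scheme \<Rightarrow> 'a list \<Rightarrow> 'a" where
  "lsum M xs = foldr (add M) xs \<zero>\<^bsub>M\<^esub>"

definition linear_map ::
  "'k ring \<Rightarrow> ('k, 'm, 'r) module_scheme \<Rightarrow> ('k, 'n, 's) module_scheme \<Rightarrow> ('m \<Rightarrow> 'n) \<Rightarrow> bool" where
  "linear_map k M N f \<longleftrightarrow>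
    f \<in> carrier M \<rightarrow> carrier N \<and>
    (\<forall>m\<in>carrier M. \<forall>m'\<in>carrier M. f (m \<oplus>\<^bsub>M\<^esub> m') = f m \<oplus>\<^bsub>N\<^esub> f m') \<and>
    (\<forall>x\<in>carrier k. \<forall>m\<in>carrier M. f (x \<odot>\<^bsub>M\<^esub> m) = x \<odot>\<^bsub>N\<^esub> f m)"

definition module_iso ::
  "'k ring \<Rightarrow> ('k, 'm, 'r) module_scheme \<Rightarrow> ('k, 'n, 's) module_scheme \<Rightarrow> ('m \<Rightarrow> 'n) \<Rightarrow> bool" where
  "module_iso k M N f \<longleftrightarrow> linear_map k M N f \<and> bij_betw f (carrier M) (carrier N)"

definition regular_module :: "'k ring \<Rightarrow> ('k, 'k) module" where
  "regular_module k = ring.extend k \<lparr>smult = mult k\<rparr>"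

definition span_of :: "'k ring \<Rightarrow> ('k, 'm, 'r) module_scheme \<Rightarrow> 'm set \<Rightarrow> 'm set" where
  "span_of k M G = \<Inter> {S. submodule S k M \<and> G \<subseteq> S}"

definition quotient_module ::
  "('k, 'm, 'r) module_scheme \<Rightarrow> 'm set \<Rightarrow> ('k, 'm set) module" where
  "quotient_module M K =
    \<lparr>carrier = a_rcosets\<^bsub>M\<^esub> K,
     mult = undefined, one = undefined,
     zero = K,
     add = set_add M,
     smult = (\<lambda>x X. \<Union>m\<in>X. K +>\<^bsub>M\<^esub> (x \<odot>\<^bsub>M\<^esub> m))\<rparr>"


section \<open>Prebialgebras\<close>

record ('k, 'h) prebialg = "('k, 'h) module" +
  comult :: "'h \<Rightarrow> ('h \<times> 'h) list"
  counit :: "'h \<Rightarrow> 'k"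

definition tens_mult :: "'k ring \<Rightarrow> ('k, 'h) prebialg \<Rightarrow> ('h \<times> 'h) list \<Rightarrow> ('h \<times> 'h) list \<Rightarrow> ('h \<times> 'h) list"
  where "tens_mult k H s t = nf k H H [(a \<otimes>\<^bsub>H\<^esub> c, b \<otimes>\<^bsub>H\<^esub> d). (a, b) \<leftarrow> s, (c, d) \<leftarrow> t]"

definition tens_assoc ::
  "'k ring \<Rightarrow> ('k, 'm, 'r) module_scheme \<Rightarrow> ('k, 'n, 's) module_scheme \<Rightarrow> ('k, 'p, 't) module_scheme
    \<Rightarrow> (('m \<times> 'n) list \<times> 'p) list \<Rightarrow> ('m \<times> ('n \<times> 'p) list) list" where
  "tens_assoc k M N P t =
    nf k M (tensor k N P) [(m, pure k N P n p). (s, p) \<leftarrow> t, (m, n) \<leftarrow> s]"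

text \<open>
  The k-algebra structure on \<open>H\<close> is a ring structure with bilinear multiplication.  The library
  locale \<^locale>\<open>algebra\<close> is not usable here, since it requires commutativity.
\<close>

locale prebialgebra =
  k: cring k + H: module k H + H: ring H
  for k :: "'k ring" and H :: "('k, 'h) prebialg" +
  assumes smult_mult_left: "\<lbrakk>x \<in> carrier k; h \<in> carrier H; l \<in> carrier H\<rbrakk>
      \<Longrightarrow> (x \<odot>\<^bsub>H\<^esub> h) \<otimes>\<^bsub>H\<^esub> l = x \<odot>\<^bsub>H\<^esub> (h \<otimes>\<^bsub>H\<^esub> l)"
    and smult_mult_right: "\<lbrakk>x \<in> carrier k; h \<in> carrier H; l \<in> carrier H\<rbrakk>
      \<Longrightarrow> h \<otimes>\<^bsub>H\<^esub> (x \<odot>\<^bsub>H\<^esub> l) = x \<odot>\<^bsub>H\<^esub> (h \<otimes>\<^bsub>H\<^esub> l)"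
    and comult_linear: "linear_map k H (tensor k H H) (comult H)"
    and counit_linear: "linear_map k H (regular_module k) (counit H)"
    and coassoc: "h \<in> carrier H \<Longrightarrow>
      tens_assoc k H H H (tmap k (tensor k H H) H (comult H) id (comult H h))
        = tmap k H (tensor k H H) id (comult H) (comult H h)"
    and counit_left: "h \<in> carrier H \<Longrightarrow> lsum H [counit H a \<odot>\<^bsub>H\<^esub> b. (a, b) \<leftarrow> comult H h] = h"
    and counit_right: "h \<in> carrier H \<Longrightarrow> lsum H [counit H b \<odot>\<^bsub>H\<^esub> a. (a, b) \<leftarrow> comult H h] = h"
    and comult_mult: "\<lbrakk>h \<in> carrier H; l \<in> carrier H\<rbrakk>
      \<Longrightarrow> comult H (h \<otimes>\<^bsub>H\<^esub> l) = tens_mult k H (comult H h) (comult H l)"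

definition left_monoidal :: "'k ring \<Rightarrow> ('k, 'h) prebialg \<Rightarrow> bool" where
  "left_monoidal k H \<longleftrightarrow> (\<forall>h\<in>carrier H. \<forall>u\<in>carrier H. \<forall>l\<in>carrier H.
    counit H (h \<otimes>\<^bsub>H\<^esub> u \<otimes>\<^bsub>H\<^esub> l)
      = lsum k [counit H (h \<otimes>\<^bsub>H\<^esub> a) \<otimes>\<^bsub>k\<^esub> counit H (b \<otimes>\<^bsub>H\<^esub> l). (a, b) \<leftarrow> comult H u])"

definition right_monoidal :: "'k ring \<Rightarrow> ('k, 'h) prebialg \<Rightarrow> bool" where
  "right_monoidal k H \<longleftrightarrow> (\<forall>h\<in>carrier H. \<forall>u\<in>carrier H. \<forall>l\<in>carrier H.
    counit H (h \<otimes>\<^bsub>H\<^esub> u \<otimes>\<^bsub>H\<^esub> l)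
      = lsum k [counit H (h \<otimes>\<^bsub>H\<^esub> b) \<otimes>\<^bsub>k\<^esub> counit H (a \<otimes>\<^bsub>H\<^esub> l). (a, b) \<leftarrow> comult H u])"

locale monoidal_prebialgebra = prebialgebra +
  assumes lm: "left_monoidal k H" and rm: "right_monoidal k H"

definition left_comonoidal :: "'k ring \<Rightarrow> ('k, 'h) prebialg \<Rightarrow> bool" where
  "left_comonoidal k H \<longleftrightarrow>
    tmap k (tensor k H H) H (comult H) id (comult H \<one>\<^bsub>H\<^esub>)
      = nf k (tensor k H H) H
          [(pure k H H a (b \<otimes>\<^bsub>H\<^esub> c), d). (a, b) \<leftarrow> comult H \<one>\<^bsub>H\<^esub>, (c, d) \<leftarrow> comult H \<one>\<^bsub>H\<^esub>]"

definition right_comonoidal :: "'k ring \<Rightarrow> ('k, 'h) prebialg \<Rightarrow> bool" where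
  "right_comonoidal k H \<longleftrightarrow>
    tmap k (tensor k H H) H (comult H) id (comult H \<one>\<^bsub>H\<^esub>)
      = nf k (tensor k H H) H
          [(pure k H H a (c \<otimes>\<^bsub>H\<^esub> b), d). (a, b) \<leftarrow> comult H \<one>\<^bsub>H\<^esub>, (c, d) \<leftarrow> comult H \<one>\<^bsub>H\<^esub>]"


section \<open>Monoidal categories and (op)monoidal functors\<close>

record ('o, 'a) cat =
  Ob :: "'o set"
  Ar :: "'a set"
  Src :: "'a \<Rightarrow> 'o"
  Tgt :: "'a \<Rightarrow> 'o"
  Idn :: "'o \<Rightarrow> 'a"
  Cmp :: "'a \<Rightarrow> 'a \<Rightarrow> 'a" (infixr \<open>\<cdot>\<index>\<close> 55)

definition Hom :: "('o, 'a, 'z) cat_scheme \<Rightarrow> 'o \<Rightarrow> 'o \<Rightarrow> 'a set" where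
  "Hom C A B = {f \<in> Ar C. Src C f = A \<and> Tgt C f = B}"

definition inverse_pair :: "('o, 'a, 'z) cat_scheme \<Rightarrow> 'a \<Rightarrow> 'a \<Rightarrow> bool" where
  "inverse_pair C f g \<longleftrightarrow> f \<in> Ar C \<and> g \<in> Hom C (Tgt C f) (Src C f) \<and>
    g \<cdot>\<^bsub>C\<^esub> f = Idn C (Src C f) \<and> f \<cdot>\<^bsub>C\<^esub> g = Idn C (Tgt C f)"

definition iso_arrow :: "('o, 'a, 'z) cat_scheme \<Rightarrow> 'a \<Rightarrow> bool" where
  "iso_arrow C f \<longleftrightarrow> (\<exists>g. inverse_pair C f g)"

definition inverse_arrow :: "('o, 'a, 'z) cat_scheme \<Rightarrow> 'a \<Rightarrow> 'a" where
  "inverse_arrow C f = (THE g. inverse_pair C f g)"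

locale category =
  fixes C :: "('o, 'a, 'z) cat_scheme" (structure)
  assumes Src_Ob: "f \<in> Ar C \<Longrightarrow> Src C f \<in> Ob C"
    and Tgt_Ob: "f \<in> Ar C \<Longrightarrow> Tgt C f \<in> Ob C"
    and Idn_Hom: "A \<in> Ob C \<Longrightarrow> Idn C A \<in> Hom C A A"
    and Cmp_Hom: "\<lbrakk>f \<in> Hom C A B; g \<in> Hom C B D\<rbrakk> \<Longrightarrow> g \<cdot> f \<in> Hom C A D"
    and Idn_left: "f \<in> Hom C A B \<Longrightarrow> Idn C B \<cdot> f = f"
    and Idn_right: "f \<in> Hom C A B \<Longrightarrow> f \<cdot> Idn C A = f"
    and Cmp_assoc: "\<lbrakk>f \<in> Hom C A B; g \<in> Hom C B D; h \<in> Hom C D E\<rbrakk>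
      \<Longrightarrow> h \<cdot> (g \<cdot> f) = (h \<cdot> g) \<cdot> f"

record ('o, 'a) mcat = "('o, 'a) cat" +
  TensO :: "'o \<Rightarrow> 'o \<Rightarrow> 'o" (infixr \<open>\<diamondop>\<index>\<close> 65)
  TensA :: "'a \<Rightarrow> 'a \<Rightarrow> 'a" (infixr \<open>\<star>\<index>\<close> 65)
  UnitO :: "'o"
  Asc :: "'o \<Rightarrow> 'o \<Rightarrow> 'o \<Rightarrow> 'a"
  Lun :: "'o \<Rightarrow> 'a"
  Run :: "'o \<Rightarrow> 'a"

locale monoidal_category = category C
  for C :: "('o, 'a, 'z) mcat_scheme" (structure) +
  assumes TensO_Ob: "\<lbrakk>A \<in> Ob C; B \<in> Ob C\<rbrakk> \<Longrightarrow> A \<diamondop> B \<in> Ob C"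
    and TensA_Hom: "\<lbrakk>f \<in> Hom C A B; g \<in> Hom C A' B'\<rbrakk> \<Longrightarrow> f \<star> g \<in> Hom C (A \<diamondop> A') (B \<diamondop> B')"
    and TensA_Idn: "\<lbrakk>A \<in> Ob C; B \<in> Ob C\<rbrakk> \<Longrightarrow> Idn C A \<star> Idn C B = Idn C (A \<diamondop> B)"
    and TensA_Cmp: "\<lbrakk>f \<in> Hom C A B; g \<in> Hom C B D; f' \<in> Hom C A' B'; g' \<in> Hom C B' D'\<rbrakk>
      \<Longrightarrow> (g \<cdot> f) \<star> (g' \<cdot> f') = (g \<star> g') \<cdot> (f \<star> f')"
    and UnitO_Ob: "UnitO C \<in> Ob C"
    and Asc_Hom: "\<lbrakk>A \<in> Ob C; B \<in> Ob C; D \<in> Ob C\<rbrakk>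
      \<Longrightarrow> Asc C A B D \<in> Hom C ((A \<diamondop> B) \<diamondop> D) (A \<diamondop> (B \<diamondop> D))"
    and Asc_iso: "\<lbrakk>A \<in> Ob C; B \<in> Ob C; D \<in> Ob C\<rbrakk> \<Longrightarrow> iso_arrow C (Asc C A B D)"
    and Asc_natural: "\<lbrakk>f \<in> Hom C A A'; g \<in> Hom C B B'; h \<in> Hom C D D'\<rbrakk>
      \<Longrightarrow> Asc C A' B' D' \<cdot> ((f \<star> g) \<star> h) = (f \<star> (g \<star> h)) \<cdot> Asc C A B D"
    and Lun_Hom: "A \<in> Ob C \<Longrightarrow> Lun C A \<in> Hom C (UnitO C \<diamondop> A) A"
    and Lun_iso: "A \<in> Ob C \<Longrightarrow> iso_arrow C (Lun C A)"
    and Lun_natural: "f \<in> Hom C A B \<Longrightarrow> Lun C B \<cdot> (Idn C (UnitO C) \<star> f) = f \<cdot> Lun C A"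
    and Run_Hom: "A \<in> Ob C \<Longrightarrow> Run C A \<in> Hom C (A \<diamondop> UnitO C) A"
    and Run_iso: "A \<in> Ob C \<Longrightarrow> iso_arrow C (Run C A)"
    and Run_natural: "f \<in> Hom C A B \<Longrightarrow> Run C B \<cdot> (f \<star> Idn C (UnitO C)) = f \<cdot> Run C A"
    and pentagon: "\<lbrakk>A \<in> Ob C; B \<in> Ob C; D \<in> Ob C; E \<in> Ob C\<rbrakk>
      \<Longrightarrow> (Idn C A \<star> Asc C B D E) \<cdot> Asc C A (B \<diamondop> D) E \<cdot> (Asc C A B D \<star> Idn C E)
        = Asc C A B (D \<diamondop> E) \<cdot> Asc C (A \<diamondop> B) D E"
    and triangle: "\<lbrakk>A \<in> Ob C; B \<in> Ob C\<rbrakk>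
      \<Longrightarrow> (Idn C A \<star> Lun C B) \<cdot> Asc C A (UnitO C) B = Run C A \<star> Idn C B"

locale cat_functor = C: category C + D: category D
  for C :: "('o, 'a, 'z) cat_scheme" and D :: "('p, 'b, 'y) cat_scheme" +
  fixes Fo :: "'o \<Rightarrow> 'p" and Fa :: "'a \<Rightarrow> 'b"
  assumes Fo_Ob: "A \<in> Ob C \<Longrightarrow> Fo A \<in> Ob D"
    and Fa_Hom: "f \<in> Hom C A B \<Longrightarrow> Fa f \<in> Hom D (Fo A) (Fo B)"
    and Fa_Idn: "A \<in> Ob C \<Longrightarrow> Fa (Idn C A) = Idn D (Fo A)"
    and Fa_Cmp: "\<lbrakk>f \<in> Hom C A B; g \<in> Hom C B E\<rbrakk> \<Longrightarrow> Fa (g \<cdot>\<^bsub>C\<^esub> f) = Fa g \<cdot>\<^bsub>D\<^esub> Fa f"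

locale monoidal_functor =
  C: monoidal_category C + D: monoidal_category D + cat_functor C D Fo Fa
  for C :: "('o, 'a, 'z) mcat_scheme" and D :: "('p, 'b, 'y) mcat_scheme"
    and Fo :: "'o \<Rightarrow> 'p" and Fa :: "'a \<Rightarrow> 'b" +
  fixes mu2 :: "'o \<Rightarrow> 'o \<Rightarrow> 'b" and mu0 :: "'b"
  assumes mu2_Hom: "\<lbrakk>A \<in> Ob C; B \<in> Ob C\<rbrakk>
      \<Longrightarrow> mu2 A B \<in> Hom D (Fo A \<diamondop>\<^bsub>D\<^esub> Fo B) (Fo (A \<diamondop>\<^bsub>C\<^esub> B))"
    and mu2_natural: "\<lbrakk>f \<in> Hom C A A'; g \<in> Hom C B B'\<rbrakk>
      \<Longrightarrow> mu2 A' B' \<cdot>\<^bsub>D\<^esub> (Fa f \<star>\<^bsub>D\<^esub> Fa g) = Fa (f \<star>\<^bsub>C\<^esub> g) \<cdot>\<^bsub>D\<^esub> mu2 A B"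
    and mu0_Hom: "mu0 \<in> Hom D (UnitO D) (Fo (UnitO C))"
    and mu2_assoc: "\<lbrakk>A \<in> Ob C; B \<in> Ob C; E \<in> Ob C\<rbrakk>
      \<Longrightarrow> Fa (Asc C A B E) \<cdot>\<^bsub>D\<^esub> mu2 (A \<diamondop>\<^bsub>C\<^esub> B) E \<cdot>\<^bsub>D\<^esub> (mu2 A B \<star>\<^bsub>D\<^esub> Idn D (Fo E))
        = mu2 A (B \<diamondop>\<^bsub>C\<^esub> E) \<cdot>\<^bsub>D\<^esub> (Idn D (Fo A) \<star>\<^bsub>D\<^esub> mu2 B E) \<cdot>\<^bsub>D\<^esub> Asc D (Fo A) (Fo B) (Fo E)"
    and mu0_left: "A \<in> Ob C
      \<Longrightarrow> Fa (Lun C A) \<cdot>\<^bsub>D\<^esub> mu2 (UnitO C) A \<cdot>\<^bsub>D\<^esub> (mu0 \<star>\<^bsub>D\<^esub> Idn D (Fo A)) = Lun D (Fo A)"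
    and mu0_right: "A \<in> Ob C
      \<Longrightarrow> Fa (Run C A) \<cdot>\<^bsub>D\<^esub> mu2 A (UnitO C) \<cdot>\<^bsub>D\<^esub> (Idn D (Fo A) \<star>\<^bsub>D\<^esub> mu0) = Run D (Fo A)"

locale opmonoidal_functor =
  C: monoidal_category C + D: monoidal_category D + cat_functor C D Fo Fa
  for C :: "('o, 'a, 'z) mcat_scheme" and D :: "('p, 'b, 'y) mcat_scheme"
    and Fo :: "'o \<Rightarrow> 'p" and Fa :: "'a \<Rightarrow> 'b" +
  fixes nu2 :: "'o \<Rightarrow> 'o \<Rightarrow> 'b" and nu0 :: "'b"
  assumes nu2_Hom: "\<lbrakk>A \<in> Ob C; B \<in> Ob C\<rbrakk>
      \<Longrightarrow> nu2 A B \<in> Hom D (Fo (A \<diamondop>\<^bsub>C\<^esub> B)) (Fo A \<diamondop>\<^bsub>D\<^esub> Fo B)"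
    and nu2_natural: "\<lbrakk>f \<in> Hom C A A'; g \<in> Hom C B B'\<rbrakk>
      \<Longrightarrow> nu2 A' B' \<cdot>\<^bsub>D\<^esub> Fa (f \<star>\<^bsub>C\<^esub> g) = (Fa f \<star>\<^bsub>D\<^esub> Fa g) \<cdot>\<^bsub>D\<^esub> nu2 A B"
    and nu0_Hom: "nu0 \<in> Hom D (Fo (UnitO C)) (UnitO D)"
    and nu2_assoc: "\<lbrakk>A \<in> Ob C; B \<in> Ob C; E \<in> Ob C\<rbrakk>
      \<Longrightarrow> Asc D (Fo A) (Fo B) (Fo E) \<cdot>\<^bsub>D\<^esub> (nu2 A B \<star>\<^bsub>D\<^esub> Idn D (Fo E)) \<cdot>\<^bsub>D\<^esub> nu2 (A \<diamondop>\<^bsub>C\<^esub> B) E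
        = (Idn D (Fo A) \<star>\<^bsub>D\<^esub> nu2 B E) \<cdot>\<^bsub>D\<^esub> nu2 A (B \<diamondop>\<^bsub>C\<^esub> E) \<cdot>\<^bsub>D\<^esub> Fa (Asc C A B E)"
    and nu0_left: "A \<in> Ob C
      \<Longrightarrow> Lun D (Fo A) \<cdot>\<^bsub>D\<^esub> (nu0 \<star>\<^bsub>D\<^esub> Idn D (Fo A)) \<cdot>\<^bsub>D\<^esub> nu2 (UnitO C) A = Fa (Lun C A)"
    and nu0_right: "A \<in> Ob C
      \<Longrightarrow> Run D (Fo A) \<cdot>\<^bsub>D\<^esub> (Idn D (Fo A) \<star>\<^bsub>D\<^esub> nu0) \<cdot>\<^bsub>D\<^esub> nu2 A (UnitO C) = Fa (Run C A)"


section \<open>The monoidal category of k-modules\<close>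

text \<open>
  To have one category, all modules live in one type \<open>elt\<close>.  It contains arbitrary elements
  \<open>Atom a\<close> (with \<^typ>\<open>'x\<close> arbitrary, so that every module is isomorphic to one in a suitable
  instance), the elements of the two unit objects (scalars, and functionals on \<open>H\<close>), and it is
  closed under forming tensor products: \<open>Formal\<close> embeds the lists representing tensors.
\<close>

datatype ('k, 'h, 'x) elt =
    Atom 'x
  | Scalar (the_scalar: 'k)
  | Functional (the_functional: "'h \<Rightarrow> 'k")
  | Formal (terms: "(('k, 'h, 'x) elt \<times> ('k, 'h, 'x) elt) list")

definition unf ::
  "'k ring \<Rightarrow> ('k, ('k, 'h, 'x) elt, 'r) module_scheme \<Rightarrow> ('k, ('k, 'h, 'x) elt, 's) module_scheme
    \<Rightarrow> (('k, 'h, 'x) elt \<times> ('k, 'h, 'x) elt) list \<Rightarrow> ('k, 'h, 'x) elt" where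
  "unf k M N s = Formal (nf k M N s)"

definition utensor ::
  "'k ring \<Rightarrow> ('k, ('k, 'h, 'x) elt, 'r) module_scheme \<Rightarrow> ('k, ('k, 'h, 'x) elt, 's) module_scheme
    \<Rightarrow> ('k, ('k, 'h, 'x) elt) module" where
  "utensor k M N = (let T = tensor k M N in
    \<lparr>carrier = Formal ` carrier T,
     mult = undefined, one = undefined,
     zero = Formal \<zero>\<^bsub>T\<^esub>,
     add = (\<lambda>s t. Formal (terms s \<oplus>\<^bsub>T\<^esub> terms t)),
     smult = (\<lambda>x s. Formal (x \<odot>\<^bsub>T\<^esub> terms s))\<rparr>)"

definition upure ::
  "'k ring \<Rightarrow> ('k, ('k, 'h, 'x) elt, 'r) module_scheme \<Rightarrow> ('k, ('k, 'h, 'x) elt, 's) module_scheme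
    \<Rightarrow> ('k, 'h, 'x) elt \<Rightarrow> ('k, 'h, 'x) elt \<Rightarrow> ('k, 'h, 'x) elt" where
  "upure k M N m n = unf k M N [(m, n)]"

definition umap ::
  "'k ring \<Rightarrow> ('k, ('k, 'h, 'x) elt, 'r) module_scheme \<Rightarrow> ('k, ('k, 'h, 'x) elt, 's) module_scheme
    \<Rightarrow> (('k, 'h, 'x) elt \<Rightarrow> ('k, 'h, 'x) elt) \<Rightarrow> (('k, 'h, 'x) elt \<Rightarrow> ('k, 'h, 'x) elt)
    \<Rightarrow> ('k, 'h, 'x) elt \<Rightarrow> ('k, 'h, 'x) elt" where
  "umap k M' N' f g t = unf k M' N' (map (map_prod f g) (terms t))"

text \<open>Arrows carry source and target; the underlying function is \<^const>\<open>extensional\<close>.\<close>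

datatype ('o, 'u) mor = Mor (src: 'o) (tgt: 'o) (fn: "'u \<Rightarrow> 'u")

definition unit_module :: "'k ring \<Rightarrow> ('k, ('k, 'h, 'x) elt) module" where
  "unit_module k =
    \<lparr>carrier = Scalar ` carrier k,
     mult = undefined, one = undefined,
     zero = Scalar \<zero>\<^bsub>k\<^esub>,
     add = (\<lambda>r s. Scalar (the_scalar r \<oplus>\<^bsub>k\<^esub> the_scalar s)),
     smult = (\<lambda>x r. Scalar (x \<otimes>\<^bsub>k\<^esub> the_scalar r))\<rparr>"

definition kmod_cat ::
  "'k ring \<Rightarrow> (('k, ('k, 'h, 'x) elt) module,
              (('k, ('k, 'h, 'x) elt) module, ('k, 'h, 'x) elt) mor) mcat" where
  "kmod_cat k =
    \<lparr>Ob = {M. module k M},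
     Ar = {f. module k (src f) \<and> module k (tgt f) \<and> linear_map k (src f) (tgt f) (fn f) \<and>
              fn f \<in> extensional (carrier (src f))},
     Src = src, Tgt = tgt,
     Idn = (\<lambda>M. Mor M M (\<lambda>m\<in>carrier M. m)),
     Cmp = (\<lambda>g f. Mor (src f) (tgt g) (compose (carrier (src f)) (fn g) (fn f))),
     TensO = utensor k,
     TensA = (\<lambda>f g. Mor (utensor k (src f) (src g)) (utensor k (tgt f) (tgt g))
               (\<lambda>t\<in>carrier (utensor k (src f) (src g)). umap k (tgt f) (tgt g) (fn f) (fn g) t)),
     UnitO = unit_module k,
     Asc = (\<lambda>M N P. Mor (utensor k (utensor k M N) P) (utensor k M (utensor k N P))
             (\<lambda>t\<in>carrier (utensor k (utensor k M N) P).
                unf k M (utensor k N P) [(m, upure k N P n p). (s, p) \<leftarrow> terms t, (m, n) \<leftarrow> terms s])),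
     Lun = (\<lambda>M. Mor (utensor k (unit_module k) M) M
             (\<lambda>t\<in>carrier (utensor k (unit_module k) M).
                lsum M [the_scalar r \<odot>\<^bsub>M\<^esub> m. (r, m) \<leftarrow> terms t])),
     Run = (\<lambda>M. Mor (utensor k M (unit_module k)) M
             (\<lambda>t\<in>carrier (utensor k M (unit_module k)).
                lsum M [the_scalar r \<odot>\<^bsub>M\<^esub> m. (m, r) \<leftarrow> terms t]))\<rparr>"


section \<open>The monoidal category of left modules over a monoidal prebialgebra\<close>

record ('k, 'u, 'h) hmodule = "('k, 'u) module" +
  hact :: "'h \<Rightarrow> 'u \<Rightarrow> 'u"

locale left_module = module k M
  for k :: "'k ring" and H :: "('k, 'h) prebialg" and M :: "('k, 'u, 'h) hmodule" +
  assumes hact_closed: "\<lbrakk>h \<in> carrier H; m \<in> carrier M\<rbrakk> \<Longrightarrow> hact M h m \<in> carrier M"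
    and hact_add: "\<lbrakk>h \<in> carrier H; m \<in> carrier M; m' \<in> carrier M\<rbrakk>
      \<Longrightarrow> hact M h (m \<oplus>\<^bsub>M\<^esub> m') = hact M h m \<oplus>\<^bsub>M\<^esub> hact M h m'"
    and add_hact: "\<lbrakk>h \<in> carrier H; h' \<in> carrier H; m \<in> carrier M\<rbrakk>
      \<Longrightarrow> hact M (h \<oplus>\<^bsub>H\<^esub> h') m = hact M h m \<oplus>\<^bsub>M\<^esub> hact M h' m"
    and hact_smult: "\<lbrakk>x \<in> carrier k; h \<in> carrier H; m \<in> carrier M\<rbrakk>
      \<Longrightarrow> hact M h (x \<odot>\<^bsub>M\<^esub> m) = x \<odot>\<^bsub>M\<^esub> hact M h m"
    and smult_hact: "\<lbrakk>x \<in> carrier k; h \<in> carrier H; m \<in> carrier M\<rbrakk>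
      \<Longrightarrow> hact M (x \<odot>\<^bsub>H\<^esub> h) m = x \<odot>\<^bsub>M\<^esub> hact M h m"
    and mult_hact: "\<lbrakk>h \<in> carrier H; h' \<in> carrier H; m \<in> carrier M\<rbrakk>
      \<Longrightarrow> hact M (h \<otimes>\<^bsub>H\<^esub> h') m = hact M h (hact M h' m)"
    and one_hact: "m \<in> carrier M \<Longrightarrow> hact M \<one>\<^bsub>H\<^esub> m = m"

definition diag_act ::
  "'k ring \<Rightarrow> ('k, 'h) prebialg \<Rightarrow> ('k, ('k, 'h, 'x) elt, 'h) hmodule \<Rightarrow> ('k, ('k, 'h, 'x) elt, 'h) hmodule
    \<Rightarrow> 'h \<Rightarrow> ('k, 'h, 'x) elt \<Rightarrow> ('k, 'h, 'x) elt" where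
  "diag_act k H M N h t =
    unf k M N [(hact M a m, hact N b n). (a, b) \<leftarrow> comult H h, (m, n) \<leftarrow> terms t]"

abbreviation (input) proj ("\<pi>") where
  "\<pi> k H M N \<equiv> diag_act k H M N \<one>\<^bsub>H\<^esub>"

definition ltensor ::
  "'k ring \<Rightarrow> ('k, 'h) prebialg \<Rightarrow> ('k, ('k, 'h, 'x) elt, 'h) hmodule \<Rightarrow> ('k, ('k, 'h, 'x) elt, 'h) hmodule
    \<Rightarrow> ('k, ('k, 'h, 'x) elt, 'h) hmodule" where
  "ltensor k H M N = (let T = utensor k M N in
    \<lparr>carrier = \<pi> k H M N ` carrier T,
     mult = undefined, one = undefined,
     zero = \<zero>\<^bsub>T\<^esub>, add = add T, smult = smult T,
     hact = diag_act k H M N\<rparr>)"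

text \<open>
  Functionals on \<open>H\<close> are extensional functions on its carrier.  \<open>gmap\<close> is \<open>g\<close>, \<open>fmap_left\<close> is \<open>f\<close>
  and \<open>fmap_right\<close> is \<open>f'\<close>.
\<close>

definition gmap :: "('k, 'h) prebialg \<Rightarrow> 'h \<Rightarrow> 'h \<Rightarrow> 'k" where
  "gmap H h = (\<lambda>u\<in>carrier H. counit H (u \<otimes>\<^bsub>H\<^esub> h))"

definition fmap_left :: "('k, 'h) prebialg \<Rightarrow> ('h \<Rightarrow> 'k) \<Rightarrow> 'h" where
  "fmap_left H \<phi> = lsum H [\<phi> a \<odot>\<^bsub>H\<^esub> b. (a, b) \<leftarrow> comult H \<one>\<^bsub>H\<^esub>]"

definition fmap_right :: "('k, 'h) prebialg \<Rightarrow> ('h \<Rightarrow> 'k) \<Rightarrow> 'h" where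
  "fmap_right H \<phi> = lsum H [\<phi> b \<odot>\<^bsub>H\<^esub> a. (a, b) \<leftarrow> comult H \<one>\<^bsub>H\<^esub>]"

text \<open>
  The action is \<open>l \<cdot> g h = g (l h)\<close>, with \<open>h\<close> a chosen preimage; the result does not depend on
  the choice.
\<close>

definition HL :: "'k ring \<Rightarrow> ('k, 'h) prebialg \<Rightarrow> ('k, ('k, 'h, 'x) elt, 'h) hmodule" where
  "HL k H =
    \<lparr>carrier = Functional ` gmap H ` carrier H,
     mult = undefined, one = undefined,
     zero = Functional (\<lambda>u\<in>carrier H. \<zero>\<^bsub>k\<^esub>),
     add = (\<lambda>\<phi> \<psi>. Functional (\<lambda>u\<in>carrier H. the_functional \<phi> u \<oplus>\<^bsub>k\<^esub> the_functional \<psi> u)),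
     smult = (\<lambda>x \<phi>. Functional (\<lambda>u\<in>carrier H. x \<otimes>\<^bsub>k\<^esub> the_functional \<phi> u)),
     hact = (\<lambda>l \<phi>. Functional (gmap H (l \<otimes>\<^bsub>H\<^esub> inv_into (carrier H) (gmap H) (the_functional \<phi>))))\<rparr>"

text \<open>
  The associativity constraint of \<open>\<otimes>\<^sup>l\<close> is the composite of the inclusion into
  \<open>(M \<otimes> N) \<otimes> P\<close>, the associativity constraint of k-modules, and \<open>M \<otimes> \<pi>\<close>.  The last map only
  serves to express elements of the submodule \<open>M \<otimes>\<^sup>l (N \<otimes>\<^sup>l P)\<close> of \<open>M \<otimes> (N \<otimes> P)\<close> as elements
  of \<open>M \<otimes> (N \<otimes>\<^sup>l P)\<close>; \<open>M \<otimes> \<pi>\<close> splits the inclusion \<open>M \<otimes> (N \<otimes>\<^sup>l P) \<rightarrow> M \<otimes> (N \<otimes> P)\<close>.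
\<close>

definition hmod_cat ::
  "'k ring \<Rightarrow> ('k, 'h) prebialg \<Rightarrow> (('k, ('k, 'h, 'x) elt, 'h) hmodule,
              (('k, ('k, 'h, 'x) elt, 'h) hmodule, ('k, 'h, 'x) elt) mor) mcat" where
  "hmod_cat k H =
    \<lparr>Ob = {M. left_module k H M},
     Ar = {f. left_module k H (src f) \<and> left_module k H (tgt f) \<and>
              linear_map k (src f) (tgt f) (fn f) \<and>
              (\<forall>h\<in>carrier H. \<forall>m\<in>carrier (src f). fn f (hact (src f) h m) = hact (tgt f) h (fn f m)) \<and>
              fn f \<in> extensional (carrier (src f))},
     Src = src, Tgt = tgt,
     Idn = (\<lambda>M. Mor M M (\<lambda>m\<in>carrier M. m)),
     Cmp = (\<lambda>g f. Mor (src f) (tgt g) (compose (carrier (src f)) (fn g) (fn f))),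
     TensO = ltensor k H,
     TensA = (\<lambda>f g. Mor (ltensor k H (src f) (src g)) (ltensor k H (tgt f) (tgt g))
               (\<lambda>t\<in>carrier (ltensor k H (src f) (src g)). umap k (tgt f) (tgt g) (fn f) (fn g) t)),
     UnitO = HL k H,
     Asc = (\<lambda>M N P. Mor (ltensor k H (ltensor k H M N) P) (ltensor k H M (ltensor k H N P))
             (\<lambda>t\<in>carrier (ltensor k H (ltensor k H M N) P).
                unf k M (ltensor k H N P)
                  [(m, \<pi> k H N P (upure k N P n p)). (s, p) \<leftarrow> terms t, (m, n) \<leftarrow> terms s])),
     Lun = (\<lambda>M. Mor (ltensor k H (HL k H) M) M
             (\<lambda>t\<in>carrier (ltensor k H (HL k H) M).
                lsum M [hact M (fmap_left H (the_functional \<phi>)) m. (\<phi>, m) \<leftarrow> terms t])),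
     Run = (\<lambda>M. Mor (ltensor k H M (HL k H)) M
             (\<lambda>t\<in>carrier (ltensor k H M (HL k H)).
                lsum M [hact M (fmap_right H (the_functional \<phi>)) m. (m, \<phi>) \<leftarrow> terms t]))\<rparr>"


section \<open>The forgetful functor and its structure maps\<close>

definition forget_ob :: "('k, 'u, 'h) hmodule \<Rightarrow> ('k, 'u) module" where
  "forget_ob M = module.truncate M"

definition forget_ar :: "(('k, 'u, 'h) hmodule, 'u) mor \<Rightarrow> (('k, 'u) module, 'u) mor" where
  "forget_ar f = Mor (forget_ob (src f)) (forget_ob (tgt f)) (fn f)"

context
  fixes k :: "'k ring" and H :: "('k, 'h) prebialg"
begin

definition forget_mu2 ::
  "('k, ('k, 'h, 'x) elt, 'h) hmodule \<Rightarrow> ('k, ('k, 'h, 'x) elt, 'h) hmodule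
    \<Rightarrow> (('k, ('k, 'h, 'x) elt) module, ('k, 'h, 'x) elt) mor" where
  "forget_mu2 M N = Mor (utensor k (forget_ob M) (forget_ob N)) (forget_ob (ltensor k H M N))
    (\<lambda>t\<in>carrier (utensor k M N). \<pi> k H M N t)"

definition forget_mu0 :: "(('k, ('k, 'h, 'x) elt) module, ('k, 'h, 'x) elt) mor" where
  "forget_mu0 = Mor (unit_module k) (forget_ob (HL k H))
    (\<lambda>r\<in>carrier (unit_module k). Functional (\<lambda>u\<in>carrier H. the_scalar r \<otimes>\<^bsub>k\<^esub> counit H u))"

definition forget_nu2 ::
  "('k, ('k, 'h, 'x) elt, 'h) hmodule \<Rightarrow> ('k, ('k, 'h, 'x) elt, 'h) hmodule
    \<Rightarrow> (('k, ('k, 'h, 'x) elt) module, ('k, 'h, 'x) elt) mor" where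
  "forget_nu2 M N = Mor (forget_ob (ltensor k H M N)) (utensor k (forget_ob M) (forget_ob N))
    (\<lambda>t\<in>carrier (ltensor k H M N). t)"

definition forget_nu0 :: "(('k, ('k, 'h, 'x) elt) module, ('k, 'h, 'x) elt) mor" where
  "forget_nu0 = Mor (forget_ob (HL k H)) (unit_module k)
    (\<lambda>\<phi>\<in>carrier (HL k H). Scalar (the_functional \<phi> \<one>\<^bsub>H\<^esub>))"

end


section \<open>Essentially strong (op)monoidal functors to k-modules\<close>

context
  fixes k :: "'k ring"
    and C :: "('o, 'a) mcat"
    and Uo :: "'o \<Rightarrow> ('k, ('k, 'h, 'x) elt) module"
    and Ua :: "'a \<Rightarrow> (('k, ('k, 'h, 'x) elt) module, ('k, 'h, 'x) elt) mor"
begin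

subsection \<open>Monoidal case\<close>

context
  fixes mu2 :: "'o \<Rightarrow> 'o \<Rightarrow> (('k, ('k, 'h, 'x) elt) module, ('k, 'h, 'x) elt) mor"
begin

text \<open>
  The actions of \<open>U I\<close> on \<open>U M\<close>.  That \<open>U I\<close> is an algebra, that these make \<open>U M\<close> a bimodule, and
  that \<open>mu2 M N\<close> is constant on the cosets below, holds for every monoidal functor and is not
  imposed as an extra condition.
\<close>

definition lact :: "'o \<Rightarrow> ('k, 'h, 'x) elt \<Rightarrow> ('k, 'h, 'x) elt \<Rightarrow> ('k, 'h, 'x) elt" where
  "lact M r m = fn (Ua (Lun C M) \<cdot>\<^bsub>kmod_cat k\<^esub> mu2 (UnitO C) M) (upure k (Uo (UnitO C)) (Uo M) r m)"

definition ract :: "'o \<Rightarrow> ('k, 'h, 'x) elt \<Rightarrow> ('k, 'h, 'x) elt \<Rightarrow> ('k, 'h, 'x) elt" where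
  "ract M m r = fn (Ua (Run C M) \<cdot>\<^bsub>kmod_cat k\<^esub> mu2 M (UnitO C)) (upure k (Uo M) (Uo (UnitO C)) m r)"

text \<open>The tensor product of \<open>U M\<close> and \<open>U N\<close> over \<open>U I\<close>, as a quotient of the one over \<open>k\<close>.\<close>

definition rel_tensor_kernel :: "'o \<Rightarrow> 'o \<Rightarrow> ('k, 'h, 'x) elt set" where
  "rel_tensor_kernel M N = span_of k (utensor k (Uo M) (Uo N))
    {upure k (Uo M) (Uo N) (ract M m r) n \<ominus>\<^bsub>utensor k (Uo M) (Uo N)\<^esub>
       upure k (Uo M) (Uo N) m (lact N r n) | m r n.
     m \<in> carrier (Uo M) \<and> r \<in> carrier (Uo (UnitO C)) \<and> n \<in> carrier (Uo N)}"

definition rel_tensor :: "'o \<Rightarrow> 'o \<Rightarrow> ('k, ('k, 'h, 'x) elt set) module" where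
  "rel_tensor M N = quotient_module (utensor k (Uo M) (Uo N)) (rel_tensor_kernel M N)"

definition rel_tensor_lact :: "'o \<Rightarrow> 'o \<Rightarrow> ('k, 'h, 'x) elt \<Rightarrow> ('k, 'h, 'x) elt set \<Rightarrow> ('k, 'h, 'x) elt set" where
  "rel_tensor_lact M N r X = (\<Union>t\<in>X. rel_tensor_kernel M N +>\<^bsub>utensor k (Uo M) (Uo N)\<^esub>
    umap k (Uo M) (Uo N) (lact M r) id t)"

definition rel_tensor_ract :: "'o \<Rightarrow> 'o \<Rightarrow> ('k, 'h, 'x) elt set \<Rightarrow> ('k, 'h, 'x) elt \<Rightarrow> ('k, 'h, 'x) elt set" where
  "rel_tensor_ract M N X r = (\<Union>t\<in>X. rel_tensor_kernel M N +>\<^bsub>utensor k (Uo M) (Uo N)\<^esub>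
    umap k (Uo M) (Uo N) id (\<lambda>n. ract N n r) t)"

definition induced_map :: "'o \<Rightarrow> 'o \<Rightarrow> ('k, 'h, 'x) elt set \<Rightarrow> ('k, 'h, 'x) elt" where
  "induced_map M N X = the_elem (fn (mu2 M N) ` X)"

text \<open>Strength into \<open>U I\<close>-bimodules: the induced maps are bijective and respect both actions.\<close>

definition ess_strong_monoidal ::
    "(('k, ('k, 'h, 'x) elt) module, ('k, 'h, 'x) elt) mor \<Rightarrow> bool" where
  "ess_strong_monoidal mu0 \<longleftrightarrow>
    monoidal_functor C (kmod_cat k) Uo Ua mu2 mu0 \<and>
    (\<forall>M\<in>Ob C. \<forall>N\<in>Ob C.
      module_iso k (rel_tensor M N) (Uo (M \<diamondop>\<^bsub>C\<^esub> N)) (induced_map M N) \<and>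
      (\<forall>r\<in>carrier (Uo (UnitO C)). \<forall>X\<in>carrier (rel_tensor M N).
        induced_map M N (rel_tensor_lact M N r X) = lact (M \<diamondop>\<^bsub>C\<^esub> N) r (induced_map M N X) \<and>
        induced_map M N (rel_tensor_ract M N X r) = ract (M \<diamondop>\<^bsub>C\<^esub> N) (induced_map M N X) r))"

end

subsection \<open>Opmonoidal case\<close>

context
  fixes nu2 :: "'o \<Rightarrow> 'o \<Rightarrow> (('k, ('k, 'h, 'x) elt) module, ('k, 'h, 'x) elt) mor"
begin

text \<open>The right and left coactions of \<open>U I\<close> on \<open>U M\<close>.\<close>

definition rcoact :: "'o \<Rightarrow> (('k, ('k, 'h, 'x) elt) module, ('k, 'h, 'x) elt) mor" where
  "rcoact M = nu2 M (UnitO C) \<cdot>\<^bsub>kmod_cat k\<^esub> Ua (inverse_arrow C (Run C M))"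

definition lcoact :: "'o \<Rightarrow> (('k, ('k, 'h, 'x) elt) module, ('k, 'h, 'x) elt) mor" where
  "lcoact M = nu2 (UnitO C) M \<cdot>\<^bsub>kmod_cat k\<^esub> Ua (inverse_arrow C (Lun C M))"

definition cotensor :: "'o \<Rightarrow> 'o \<Rightarrow> ('k, ('k, 'h, 'x) elt) module" where
  "cotensor M N = (let K = kmod_cat k in (utensor k (Uo M) (Uo N))
    \<lparr>carrier := {t \<in> carrier (utensor k (Uo M) (Uo N)).
       fn (Asc K (Uo M) (Uo (UnitO C)) (Uo N) \<cdot>\<^bsub>K\<^esub> (rcoact M \<star>\<^bsub>K\<^esub> Idn K (Uo N))) t
         = fn (Idn K (Uo M) \<star>\<^bsub>K\<^esub> lcoact N) t}\<rparr>)"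

definition ess_strong_opmonoidal ::
    "(('k, ('k, 'h, 'x) elt) module, ('k, 'h, 'x) elt) mor \<Rightarrow> bool" where
  "ess_strong_opmonoidal nu0 \<longleftrightarrow>
    opmonoidal_functor C (kmod_cat k) Uo Ua nu2 nu0 \<and>
    (\<forall>M\<in>Ob C. \<forall>N\<in>Ob C. module_iso k (Uo (M \<diamondop>\<^bsub>C\<^esub> N)) (cotensor M N) (fn (nu2 M N)))"

end

end

end

theory Submission
  imports Defs
begin

text \<open>
Write \<open>m \<otimes>\<^sup>l n\<close> for \<open>\<pi> (m \<otimes> n) \<in> M \<otimes>\<^sup>l N\<close>.  These elements span \<open>M \<otimes>\<^sup>l N\<close>, and in terms of them the
category of \<open>H\<close>-modules looks exactly like that of \<open>k\<close>-modules: the associativity constraint is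
\<open>(m \<otimes>\<^sup>l n) \<otimes>\<^sup>l p \<mapsto> m \<otimes>\<^sup>l (n \<otimes>\<^sup>l p)\<close>, the unit constraints are \<open>\<phi> \<otimes>\<^sup>l m \<mapsto> f \<phi> m\<close> and \<open>m \<otimes>\<^sup>l \<phi> \<mapsto> f' \<phi> m\<close>, and the
monoidal structure of \<open>U\<close> is \<open>m \<otimes> n \<mapsto> m \<otimes>\<^sup>l n\<close>.  Coherence of the category and of the monoidal structure is
therefore checked on iterated pure elements, where both sides are visibly equal; the locale
\<open>generated_monoidal_category\<close> carries out this argument once for both categories.  The
axioms of \<open>H\<close> enter through the following facts.

Coassociativity makes the associativity constraint well defined, \<open>H\<close>-linear and invertible
(\<open>assoc_fun_diag_act\<close>, \<open>assoc_fun_inverse\<close>) and makes the inclusions \<open>M \<otimes>\<^sup>l N \<rightarrow> M \<otimes> N\<close> coherent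
(\<open>inclusion_assoc\<close>).

From (rm) and (lm) respectively one gets \<open>u (f (g h)) = \<epsilon> (u\<^sub>1 h) u\<^sub>2\<close> (\<open>mult_fg\<close>) and
\<open>u (f' (g h)) = \<epsilon> (u\<^sub>2 h) u\<^sub>1\<close> (\<open>mult_fg'\<close>).  So \<open>m \<otimes>\<^sup>l f \<phi> n\<close> and \<open>f' \<phi> m \<otimes>\<^sup>l n\<close> are both equal to
\<open>\<epsilon> (1\<^sub>2 h) 1\<^sub>1 m \<otimes> 1\<^sub>3 n\<close> for \<open>\<phi> = g h\<close>: this balance (\<open>lpure_balanced\<close>) is the triangle identity.
Together with \<open>g (u h) = \<epsilon> (u\<^sub>2 h) g u\<^sub>1 = \<epsilon> (u\<^sub>1 h) g u\<^sub>2\<close> they show that \<open>m \<mapsto> \<epsilon> \<otimes>\<^sup>l m\<close> and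
\<open>m \<mapsto> m \<otimes>\<^sup>l \<epsilon>\<close> invert the unit constraints.

For essential strength, \<open>U I\<close> acts on \<open>U M\<close> from the left through \<open>f\<close> and from the right through \<open>f'\<close>,
so by balance the relations that define the tensor product over \<open>U I\<close> lie in the kernel of \<open>\<pi>\<close>.
Under (rc) one has \<open>1\<^sub>1 \<otimes> 1\<^sub>2 = 1\<^sub>1 \<otimes> f (g 1\<^sub>2)\<close>, under (lc) \<open>1\<^sub>1 \<otimes> 1\<^sub>2 = f' (g 1\<^sub>1) \<otimes> 1\<^sub>2\<close>; with
\<open>f' (g 1\<^sub>2) 1\<^sub>1 = 1 = f (g 1\<^sub>1) 1\<^sub>2\<close> either of them shows that \<open>m \<otimes> n\<close> and \<open>\<pi> (m \<otimes> n)\<close> agree modulo the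
relations, so the relations span the kernel (\<open>balanced_kernel\<close>).  On the opmonoidal side, every
opmonoidal functor maps into the cotensor product (\<open>nu2_cotensor\<close>).  Conversely, contracting the
middle factor of the two sides of the cotensor equation by \<open>f\<close> (under (rc)) or by \<open>f'\<close> (under (lc))
turns one side into \<open>t\<close> and the other into \<open>\<pi> t\<close> (\<open>cotensor_fixed\<close>).
\<close>

section \<open>Sums over formal sums of pure tensors\<close>

text \<open>
  If \<open>s\<close> represents an element of \<open>M \<otimes> N\<close> and \<open>B\<close> is bilinear, then \<open>tsum P B s\<close> is the value at that
  element of the linear map \<open>M \<otimes> N \<rightarrow> P\<close> that corresponds to \<open>B\<close>.
\<close>

definition tsum :: "('p, 'r) ring_scheme \<Rightarrow> ('a \<Rightarrow> 'b \<Rightarrow> 'p) \<Rightarrow> ('a \<times> 'b) list \<Rightarrow> 'p" where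
  "tsum P B s = lsum P (map (\<lambda>(a, b). B a b) s)"

lemma lsum_simps [simp]: "lsum M [] = \<zero>\<^bsub>M\<^esub>" "lsum M (x # xs) = x \<oplus>\<^bsub>M\<^esub> lsum M xs"
  by (simp_all add: lsum_def)

lemma tsum_simps [simp]:
  "tsum P B [] = \<zero>\<^bsub>P\<^esub>" "tsum P B ((a, b) # s) = B a b \<oplus>\<^bsub>P\<^esub> tsum P B s"
  by (simp_all add: tsum_def)

lemma tsum_cong:
  assumes "\<And>a b. (a, b) \<in> set s \<Longrightarrow> B a b = B' a b"
  shows "tsum P B s = tsum P B' s"
proof -
  have "map (\<lambda>(a, b). B a b) s = map (\<lambda>(a, b). B' a b) s" using assms by auto
  then show ?thesis by (simp only: tsum_def)
qed

lemma tsum_cong':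
  assumes "set s \<subseteq> A \<times> A'" "\<And>a b. a \<in> A \<Longrightarrow> b \<in> A' \<Longrightarrow> B a b = B' a b"
  shows "tsum P B s = tsum P B' s"
  using assms by (intro tsum_cong) auto

lemma tsum_map_prod: "tsum P B (map (map_prod f g) s) = tsum P (\<lambda>a b. B (f a) (g b)) s"
  by (induction s) auto

lemma (in abelian_group) lsum_closed: "set xs \<subseteq> carrier G \<Longrightarrow> lsum G xs \<in> carrier G"
  by (induction xs) auto

lemma (in abelian_group) tsum_closed:
  assumes "set s \<subseteq> A \<times> A'" "\<And>a b. a \<in> A \<Longrightarrow> b \<in> A' \<Longrightarrow> B a b \<in> carrier G"
  shows "tsum G B s \<in> carrier G"
  unfolding tsum_def using assms by (intro lsum_closed) auto

lemma (in abelian_group) lsum_append: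
  "set xs \<subseteq> carrier G \<Longrightarrow> set ys \<subseteq> carrier G \<Longrightarrow> lsum G (xs @ ys) = lsum G xs \<oplus> lsum G ys"
  by (induction xs) (auto simp: lsum_closed a_assoc)

lemma (in abelian_group) tsum_append:
  assumes "set s \<subseteq> A \<times> A'" "set t \<subseteq> A \<times> A'" "\<And>a b. a \<in> A \<Longrightarrow> b \<in> A' \<Longrightarrow> B a b \<in> carrier G"
  shows "tsum G B (s @ t) = tsum G B s \<oplus> tsum G B t"
  unfolding tsum_def map_append using assms by (intro lsum_append) auto

lemma (in abelian_group) tsum_add:
  assumes "set s \<subseteq> A \<times> A'" "\<And>a b. a \<in> A \<Longrightarrow> b \<in> A' \<Longrightarrow> B a b \<in> carrier G"
    and "\<And>a b. a \<in> A \<Longrightarrow> b \<in> A' \<Longrightarrow> B' a b \<in> carrier G"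
  shows "tsum G (\<lambda>a b. B a b \<oplus> B' a b) s = tsum G B s \<oplus> tsum G B' s"
  using assms(1)
proof (induction s)
  case (Cons p s)
  obtain a b where p: "p = (a, b)" by (cases p)
  have c: "tsum G B s \<in> carrier G" "tsum G B' s \<in> carrier G"
    using Cons.prems assms(2,3) by (auto intro!: tsum_closed[of s A A'])
  show ?case using Cons p c assms(2)[of a b] assms(3)[of a b]
    by (simp add: a_ac)
qed simp

lemma (in abelian_group) tsum_zero: "tsum G (\<lambda>a b. \<zero>) s = \<zero>"
  by (induction s) auto

lemma (in abelian_group) tsum_swap:
  assumes "set s \<subseteq> A \<times> A'" "set t \<subseteq> C \<times> C'"
    and "\<And>a b c d. a \<in> A \<Longrightarrow> b \<in> A' \<Longrightarrow> c \<in> C \<Longrightarrow> d \<in> C' \<Longrightarrow> B a b c d \<in> carrier G"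
  shows "tsum G (\<lambda>a b. tsum G (\<lambda>c d. B a b c d) t) s = tsum G (\<lambda>c d. tsum G (\<lambda>a b. B a b c d) s) t"
  using assms(1)
proof (induction s)
  case Nil
  then show ?case by (simp add: tsum_zero)
next
  case (Cons p s)
  obtain a b where p: "p = (a, b)" by (cases p)
  have "tsum G (\<lambda>c d. B a b c d \<oplus> tsum G (\<lambda>a b. B a b c d) s) t =
    tsum G (\<lambda>c d. B a b c d) t \<oplus> tsum G (\<lambda>c d. tsum G (\<lambda>a b. B a b c d) s) t"
    using Cons.prems p assms(2,3) by (intro tsum_add[of t C C'] tsum_closed[of s A A']) auto
  then show ?case using Cons p by simp
qed

lemma (in abelian_group) tsum_concat:
  assumes "set s \<subseteq> A \<times> A'" "\<And>a b. a \<in> A \<Longrightarrow> b \<in> A' \<Longrightarrow> set (F a b) \<subseteq> C \<times> C'"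
    and "\<And>a b. a \<in> C \<Longrightarrow> b \<in> C' \<Longrightarrow> B a b \<in> carrier G"
  shows "tsum G B (concat (map (\<lambda>(a, b). F a b) s)) = tsum G (\<lambda>a b. tsum G B (F a b)) s"
  using assms(1)
proof (induction s)
  case (Cons p s)
  obtain a b where p: "p = (a, b)" by (cases p)
  have "tsum G B (F a b @ concat (map (\<lambda>(a, b). F a b) s)) =
      tsum G B (F a b) \<oplus> tsum G B (concat (map (\<lambda>(a, b). F a b) s))"
    using Cons.prems p assms(2,3) by (intro tsum_append[of _ C C']) force+
  then show ?case using Cons p by simp
qed simp

section \<open>Linear and bilinear maps\<close>

lemma linear_map_closed: "linear_map k M N f \<Longrightarrow> m \<in> carrier M \<Longrightarrow> f m \<in> carrier N"
  by (auto simp: linear_map_def)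

lemma linear_map_add:
  "linear_map k M N f \<Longrightarrow> m \<in> carrier M \<Longrightarrow> m' \<in> carrier M \<Longrightarrow> f (m \<oplus>\<^bsub>M\<^esub> m') = f m \<oplus>\<^bsub>N\<^esub> f m'"
  by (auto simp: linear_map_def)

lemma linear_map_smult:
  "linear_map k M N f \<Longrightarrow> x \<in> carrier k \<Longrightarrow> m \<in> carrier M \<Longrightarrow> f (x \<odot>\<^bsub>M\<^esub> m) = x \<odot>\<^bsub>N\<^esub> f m"
  by (auto simp: linear_map_def)

lemma linear_mapI:
  assumes "\<And>m. m \<in> carrier M \<Longrightarrow> f m \<in> carrier N"
    and "\<And>m m'. m \<in> carrier M \<Longrightarrow> m' \<in> carrier M \<Longrightarrow> f (m \<oplus>\<^bsub>M\<^esub> m') = f m \<oplus>\<^bsub>N\<^esub> f m'"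
    and "\<And>x m. x \<in> carrier k \<Longrightarrow> m \<in> carrier M \<Longrightarrow> f (x \<odot>\<^bsub>M\<^esub> m) = x \<odot>\<^bsub>N\<^esub> f m"
  shows "linear_map k M N f"
  using assms by (auto simp: linear_map_def)

lemma module_abelian_group: "module k M \<Longrightarrow> abelian_group M"
  by (simp add: module_def)

lemma linear_map_zero:
  assumes "module k M" "module k N" "linear_map k M N f"
  shows "f \<zero>\<^bsub>M\<^esub> = \<zero>\<^bsub>N\<^esub>"
proof -
  interpret M: module k M by fact
  interpret N: module k N by fact
  have "f (\<zero>\<^bsub>M\<^esub> \<oplus>\<^bsub>M\<^esub> \<zero>\<^bsub>M\<^esub>) = f \<zero>\<^bsub>M\<^esub> \<oplus>\<^bsub>N\<^esub> f \<zero>\<^bsub>M\<^esub>"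
    using linear_map_add[OF assms(3)] by blast
  then show ?thesis using linear_map_closed[OF assms(3)] by simp
qed

lemma linear_map_tsum:
  assumes "module k M" "module k N" "linear_map k M N f"
    and "set s \<subseteq> A \<times> A'" "\<And>a b. a \<in> A \<Longrightarrow> b \<in> A' \<Longrightarrow> B a b \<in> carrier M"
  shows "f (tsum M B s) = tsum N (\<lambda>a b. f (B a b)) s"
  using assms(4)
proof (induction s)
  case Nil
  then show ?case by (simp add: linear_map_zero[OF assms(1-3)])
next
  case (Cons p s)
  interpret M: module k M by fact
  obtain a b where p: "p = (a, b)" by (cases p)
  have "tsum M B s \<in> carrier M"
    using Cons.prems assms(5) by (auto intro!: M.tsum_closed[of s A A'])
  then show ?case using Cons p assms(5)[of a b] by (simp add: linear_map_add[OF assms(3)])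
qed

text \<open>
  These rules prove linearity in one argument by following the syntax of an expression.
\<close>

named_theorems linear_intros

lemma linear_map_id [linear_intros]: "linear_map k M M (\<lambda>m. m)"
  by (simp add: linear_map_def)

lemma linear_map_compose:
  "linear_map k M N f \<Longrightarrow> linear_map k N P g \<Longrightarrow> linear_map k M P (\<lambda>m. g (f m))"
  by (auto simp: linear_map_def Pi_iff)

lemma linear_map_cong:
  assumes "module k M" "linear_map k M N f" "\<And>m. m \<in> carrier M \<Longrightarrow> f m = g m"
  shows "linear_map k M N g"
proof -
  interpret module k M by fact
  show ?thesis using assms(2,3) by (simp add: linear_map_def Pi_iff)
qed

lemma linear_map_smult_const [linear_intros]:
  assumes "module k N" "x \<in> carrier k" "linear_map k M N f"
  shows "linear_map k M N (\<lambda>m. x \<odot>\<^bsub>N\<^esub> f m)"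
proof -
  interpret N: module k N by fact
  show ?thesis using assms(2,3)
    by (auto simp: linear_map_def N.smult_r_distr Pi_iff N.smult_assoc1[symmetric] N.R.m_comm)
qed

lemma linear_map_tsum_family [linear_intros]:
  assumes "module k M" "module k N" "set s \<subseteq> A \<times> A'" "\<And>a b. a \<in> A \<Longrightarrow> b \<in> A' \<Longrightarrow> linear_map k M N (B a b)"
  shows "linear_map k M N (\<lambda>m. tsum N (\<lambda>a b. B a b m) s)"
proof -
  interpret M: module k M by fact
  interpret N: module k N by fact
  have c: "B a b m \<in> carrier N" if "a \<in> A" "b \<in> A'" "m \<in> carrier M" for a b m
    using assms(4) that linear_map_closed by metis
  show ?thesis
  proof (rule linear_mapI)
    fix m m' assume m: "m \<in> carrier M" "m' \<in> carrier M"
    have "tsum N (\<lambda>a b. B a b (m \<oplus>\<^bsub>M\<^esub> m')) s = tsum N (\<lambda>a b. B a b m \<oplus>\<^bsub>N\<^esub> B a b m') s"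
      using m assms(3,4) by (intro tsum_cong) (auto intro!: linear_map_add)
    also have "\<dots> = tsum N (\<lambda>a b. B a b m) s \<oplus>\<^bsub>N\<^esub> tsum N (\<lambda>a b. B a b m') s"
      using m c by (intro N.tsum_add[OF assms(3)]) auto
    finally show "tsum N (\<lambda>a b. B a b (m \<oplus>\<^bsub>M\<^esub> m')) s = \<dots>" .
  next
    fix x m assume m: "x \<in> carrier k" "m \<in> carrier M"
    have "tsum N (\<lambda>a b. B a b (x \<odot>\<^bsub>M\<^esub> m)) s = tsum N (\<lambda>a b. x \<odot>\<^bsub>N\<^esub> B a b m) s"
      using m assms(3,4) by (intro tsum_cong) (auto intro!: linear_map_smult)
    also have "\<dots> = x \<odot>\<^bsub>N\<^esub> tsum N (\<lambda>a b. B a b m) s"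
      using m c by (intro linear_map_tsum[OF assms(2,2) _ assms(3), symmetric] linear_intros assms) auto
    finally show "tsum N (\<lambda>a b. B a b (x \<odot>\<^bsub>M\<^esub> m)) s = \<dots>" .
  qed (use c N.tsum_closed[OF assms(3)] in auto)
qed

definition bilinear ::
  "'k ring \<Rightarrow> ('k, 'm, 'r) module_scheme \<Rightarrow> ('k, 'n, 's) module_scheme \<Rightarrow> ('k, 'p, 't) module_scheme
    \<Rightarrow> ('m \<Rightarrow> 'n \<Rightarrow> 'p) \<Rightarrow> bool" where
  "bilinear k M N P B \<longleftrightarrow> (\<forall>m\<in>carrier M. linear_map k N P (B m)) \<and>
    (\<forall>n\<in>carrier N. linear_map k M P (\<lambda>m. B m n))"

lemma bilinearI [linear_intros]:
  assumes "\<And>m. m \<in> carrier M \<Longrightarrow> linear_map k N P (B m)"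
    and "\<And>n. n \<in> carrier N \<Longrightarrow> linear_map k M P (\<lambda>m. B m n)"
  shows "bilinear k M N P B"
  using assms by (auto simp: bilinear_def)

lemma bilinear_closed:
  "bilinear k M N P B \<Longrightarrow> m \<in> carrier M \<Longrightarrow> n \<in> carrier N \<Longrightarrow> B m n \<in> carrier P"
  by (auto simp: bilinear_def linear_map_def)

lemma bilinear_right:
  "bilinear k M N P B \<Longrightarrow> m \<in> carrier M \<Longrightarrow> linear_map k L N f \<Longrightarrow> linear_map k L P (\<lambda>x. B m (f x))"
  by (auto simp: bilinear_def intro: linear_map_compose)

lemma bilinear_left:
  "bilinear k M N P B \<Longrightarrow> n \<in> carrier N \<Longrightarrow> linear_map k L M f \<Longrightarrow> linear_map k L P (\<lambda>x. B (f x) n)"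
  unfolding bilinear_def by (metis linear_map_compose[of k L M f P "\<lambda>m. B m n"])

lemma bilinear_compose:
  "bilinear k M N P B \<Longrightarrow> linear_map k P Q f \<Longrightarrow> bilinear k M N Q (\<lambda>m n. f (B m n))"
  by (auto simp: bilinear_def intro: linear_map_compose)

lemma bilinear_compose2:
  assumes "bilinear k M N P B" "linear_map k M' M f" "linear_map k N' N g"
  shows "bilinear k M' N' P (\<lambda>m n. B (f m) (g n))"
  using assms by (intro bilinearI bilinear_left[OF assms(1)] bilinear_right[OF assms(1)])
    (auto intro: linear_map_closed)

section \<open>The tensor product as a module and its universal property\<close>

lemma teq_valid:
  assumes "module k M" "module k N" "teq k M N s t"
  shows "set s \<subseteq> carrier M \<times> carrier N" "set t \<subseteq> carrier M \<times> carrier N"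
proof -
  interpret M: module k M by fact
  interpret N: module k N by fact
  from assms(3) have "set s \<subseteq> carrier M \<times> carrier N \<and> set t \<subseteq> carrier M \<times> carrier N"
    by induction auto
  then show "set s \<subseteq> carrier M \<times> carrier N" "set t \<subseteq> carrier M \<times> carrier N" by auto
qed

text \<open>
  Every generating relation of \<open>teq\<close> becomes an identity under a bilinear map.
\<close>

lemma tsum_teq:
  assumes "module k M" "module k N" "module k P" "bilinear k M N P B" "teq k M N s t"
  shows "tsum P B s = tsum P B t"
  using assms(5)
proof induction
  interpret M: module k M by fact
  interpret N: module k N by fact
  interpret P: module k P by fact
  have B: "B m n \<in> carrier P" if "m \<in> carrier M" "n \<in> carrier N" for m n
    using bilinear_closed[OF assms(4)] that .
  have lr: "linear_map k N P (B m)" if "m \<in> carrier M" for m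
    using assms(4) that by (auto simp: bilinear_def)
  have ll: "linear_map k M P (\<lambda>m. B m n)" if "n \<in> carrier N" for n
    using assms(4) that by (auto simp: bilinear_def)
  {
    case (append s t s' t')
    then show ?case
      using P.tsum_append[of s "carrier M" "carrier N" s' B] P.tsum_append[of t "carrier M" "carrier N" t' B]
        teq_valid[OF assms(1,2)] B by metis
  next
    case (comm s t)
    then show ?case
      using P.tsum_append[of s "carrier M" "carrier N" t B] P.tsum_append[of t "carrier M" "carrier N" s B] B
        P.tsum_closed[of s "carrier M" "carrier N" B] P.tsum_closed[of t "carrier M" "carrier N" B]
      by (simp add: P.a_comm)
  next
    case (zero n)
    then show ?case using linear_map_zero[OF assms(1,3) ll[of n]] by simp
  next
    case (add_left m m' n)
    then show ?case using linear_map_add[OF ll[of n]] B by (simp add: P.a_assoc)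
  next
    case (add_right m n n')
    then show ?case using linear_map_add[OF lr[of m]] B by (simp add: P.a_assoc)
  next
    case (balanced x m n)
    then show ?case using linear_map_smult[OF lr[of m], of x n] linear_map_smult[OF ll[of n], of x m] B by simp
  }
qed auto

lemma nf_teq: "set s \<subseteq> carrier M \<times> carrier N \<Longrightarrow> teq k M N s (nf k M N s)"
  unfolding nf_def by (rule someI) (rule teq.refl)

lemma nf_eq: "teq k M N s t \<Longrightarrow> nf k M N s = nf k M N t"
  unfolding nf_def by (rule arg_cong[of _ _ Eps], rule ext) (metis teq.sym teq.trans)

locale tensor_pair = M: module k M + N: module k N
  for k :: "'k ring" and M :: "('k, 'm, 'r) module_scheme" and N :: "('k, 'n, 's) module_scheme"
begin

abbreviation "V \<equiv> lists (carrier M \<times> carrier N)"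

lemma V_iff: "s \<in> V \<longleftrightarrow> set s \<subseteq> carrier M \<times> carrier N"
  by (auto simp: in_lists_conv_set)

lemma nf_valid: "s \<in> V \<Longrightarrow> nf k M N s \<in> V"
  using teq_valid(2)[OF M.module_axioms N.module_axioms nf_teq] by (simp add: V_iff)

lemma nf_nf: "s \<in> V \<Longrightarrow> nf k M N (nf k M N s) = nf k M N s"
  using nf_teq nf_eq V_iff by metis

lemma nf_append: "s \<in> V \<Longrightarrow> t \<in> V \<Longrightarrow> nf k M N (nf k M N s @ nf k M N t) = nf k M N (s @ t)"
  by (intro nf_eq teq.append teq.sym[OF nf_teq]) (simp_all add: V_iff)

lemma tensor_simps:
  "carrier (tensor k M N) = nf k M N ` V"
  "zero (tensor k M N) = nf k M N []"
  "add (tensor k M N) s t = nf k M N (s @ t)"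
  "smult (tensor k M N) x s = nf k M N (map (\<lambda>(m, n). (x \<odot>\<^bsub>M\<^esub> m, n)) s)"
  by (simp_all add: tensor_def)

lemma nf_in: "s \<in> V \<Longrightarrow> nf k M N s \<in> carrier (tensor k M N)"
  by (simp add: tensor_simps)

lemma tensor_add_nf: "s \<in> V \<Longrightarrow> t \<in> V \<Longrightarrow> nf k M N s \<oplus>\<^bsub>tensor k M N\<^esub> nf k M N t = nf k M N (s @ t)"
  by (simp add: tensor_simps nf_append)

lemma teq_smult: "teq k M N s t \<Longrightarrow> x \<in> carrier k \<Longrightarrow>
   teq k M N (map (\<lambda>(m, n). (x \<odot>\<^bsub>M\<^esub> m, n)) s) (map (\<lambda>(m, n). (x \<odot>\<^bsub>M\<^esub> m, n)) t)"
proof (induction rule: teq.induct)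
  case (refl s)
  then show ?case by (intro teq.refl) auto
next
  case (sym s t)
  then show ?case by (metis teq.sym)
next
  case (trans s t u)
  then show ?case by (metis teq.trans)
next
  case (append s t s' t')
  then show ?case by (simp add: teq.append)
next
  case (comm s t)
  then show ?case unfolding map_append by (intro teq.comm) auto
next
  case (zero n)
  then show ?case by (simp add: teq.zero)
next
  case (add_left m m' n)
  then show ?case by (simp add: M.smult_r_distr teq.add_left)
next
  case (add_right m n n')
  then show ?case by (simp add: teq.add_right)
next
  case (balanced y m n)
  then show ?case using teq.balanced[of y k "x \<odot>\<^bsub>M\<^esub> m" M n N]
    by (simp add: M.smult_assoc1[symmetric] M.R.m_comm)
qed

lemma tensor_smult_nf: "s \<in> V \<Longrightarrow> x \<in> carrier k \<Longrightarrow>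
   x \<odot>\<^bsub>tensor k M N\<^esub> nf k M N s = nf k M N (map (\<lambda>(m, n). (x \<odot>\<^bsub>M\<^esub> m, n)) s)"
  unfolding tensor_simps by (intro nf_eq teq_smult teq.sym[OF nf_teq]) (simp_all add: V_iff)

lemma nf_add_left: "m \<in> carrier M \<Longrightarrow> m' \<in> carrier M \<Longrightarrow> n \<in> carrier N \<Longrightarrow>
   nf k M N [(m \<oplus>\<^bsub>M\<^esub> m', n)] = nf k M N [(m, n)] \<oplus>\<^bsub>tensor k M N\<^esub> nf k M N [(m', n)]"
  by (subst tensor_add_nf) (auto intro!: nf_eq teq.add_left)

lemma abelian_monoid_tensor: "abelian_monoid (tensor k M N)"
proof (rule abelian_monoidI)
  fix x y assume "x \<in> carrier (tensor k M N)" "y \<in> carrier (tensor k M N)"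
  then obtain s t where st: "s \<in> V" "t \<in> V" "x = nf k M N s" "y = nf k M N t" by (auto simp: tensor_simps)
  then show "x \<oplus>\<^bsub>tensor k M N\<^esub> y \<in> carrier (tensor k M N)"
    by (simp add: tensor_add_nf nf_in)
  have "nf k M N (s @ t) = nf k M N (t @ s)"
    using st by (intro nf_eq teq.comm) (simp_all add: V_iff)
  then show "x \<oplus>\<^bsub>tensor k M N\<^esub> y = y \<oplus>\<^bsub>tensor k M N\<^esub> x" using st by (simp add: tensor_add_nf)
  have "nf k M N [] \<oplus>\<^bsub>tensor k M N\<^esub> nf k M N s = nf k M N s"
    using st by (subst tensor_add_nf) auto
  then show "\<zero>\<^bsub>tensor k M N\<^esub> \<oplus>\<^bsub>tensor k M N\<^esub> x = x" using st by (simp add: tensor_simps(2))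
  fix z assume "z \<in> carrier (tensor k M N)"
  then obtain u where "u \<in> V" "z = nf k M N u" by (auto simp: tensor_simps)
  then show "x \<oplus>\<^bsub>tensor k M N\<^esub> y \<oplus>\<^bsub>tensor k M N\<^esub> z = x \<oplus>\<^bsub>tensor k M N\<^esub> (y \<oplus>\<^bsub>tensor k M N\<^esub> z)"
    using st by (simp add: tensor_add_nf)
qed (simp add: tensor_simps)

lemma nf_Cons: "m \<in> carrier M \<Longrightarrow> n \<in> carrier N \<Longrightarrow> s \<in> V \<Longrightarrow>
  nf k M N ((m, n) # s) = nf k M N [(m, n)] \<oplus>\<^bsub>tensor k M N\<^esub> nf k M N s"
  by (subst tensor_add_nf) auto

lemma module_tensor: "module k (tensor k M N)"
proof -
  interpret T: abelian_monoid "tensor k M N" by (rule abelian_monoid_tensor)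
  let ?sm = "\<lambda>x. map (\<lambda>(m, n). (x \<odot>\<^bsub>M\<^esub> m, n))"
  have sm: "?sm x s \<in> V" if "x \<in> carrier k" "s \<in> V" for x s
    using that by (auto simp: V_iff)
  have dist: "nf k M N (?sm (x \<oplus>\<^bsub>k\<^esub> y) s) = nf k M N (?sm x s) \<oplus>\<^bsub>tensor k M N\<^esub> nf k M N (?sm y s)"
    if "x \<in> carrier k" "y \<in> carrier k" "s \<in> V" for x y s
    using that(3)
  proof (induction s)
    case Nil
    then show ?case by (simp flip: tensor_simps(2))
  next
    case (Cons p s)
    obtain m n where p: "p = (m, n)" by (cases p)
    have mn: "m \<in> carrier M" "n \<in> carrier N" using Cons p by auto
    have c: "nf k M N (?sm x s) \<in> carrier (tensor k M N)" "nf k M N (?sm y s) \<in> carrier (tensor k M N)"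
       "nf k M N [(x \<odot>\<^bsub>M\<^esub> m, n)] \<in> carrier (tensor k M N)" "nf k M N [(y \<odot>\<^bsub>M\<^esub> m, n)] \<in> carrier (tensor k M N)"
      using that(1,2) mn nf_in[OF sm[OF that(1) Cons.hyps(2)]] nf_in[OF sm[OF that(2) Cons.hyps(2)]]
      by (simp_all add: nf_in)
    show ?case unfolding p using that mn Cons.hyps Cons.IH c
      by (simp add: nf_Cons[of _ _ "?sm _ s"] sm M.smult_l_distr nf_add_left T.a_ac)
  qed
  \<comment> \<open>negation is multiplication by \<open>-1\<close>, and \<open>0 s = 0\<close> by the relation for a zero left factor\<close>
  have inv: "nf k M N (?sm (\<ominus>\<^bsub>k\<^esub> \<one>\<^bsub>k\<^esub>) s) \<oplus>\<^bsub>tensor k M N\<^esub> nf k M N s = \<zero>\<^bsub>tensor k M N\<^esub>" if "s \<in> V" for s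
  proof -
    have "?sm \<one>\<^bsub>k\<^esub> s = s" using that by (auto simp: V_iff intro!: map_idI)
    moreover have "nf k M N (?sm \<zero>\<^bsub>k\<^esub> s) = nf k M N []" using that
    proof (induction s)
      case (Cons p s)
      obtain m n where p: "p = (m, n)" by (cases p)
      have "nf k M N [(\<zero>\<^bsub>M\<^esub>, n)] = nf k M N []" using Cons p by (intro nf_eq teq.zero) auto
      then show ?case using Cons p sm[of "\<zero>\<^bsub>k\<^esub>" s]
        by (simp add: nf_Cons[of _ _ "?sm _ s"] tensor_add_nf)
    qed simp
    ultimately show ?thesis using dist[of "\<ominus>\<^bsub>k\<^esub> \<one>\<^bsub>k\<^esub>" "\<one>\<^bsub>k\<^esub>" s] that
      by (simp add: tensor_simps(2) M.R.l_neg)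
  qed
  show ?thesis
  proof (rule moduleI)
    show "abelian_group (tensor k M N)"
    proof (rule abelian_groupI)
      fix x assume "x \<in> carrier (tensor k M N)"
      then obtain s where s: "s \<in> V" "x = nf k M N s" by (auto simp: tensor_simps)
      then show "\<exists>y\<in>carrier (tensor k M N). y \<oplus>\<^bsub>tensor k M N\<^esub> x = \<zero>\<^bsub>tensor k M N\<^esub>"
        using inv[of s] sm[of "\<ominus>\<^bsub>k\<^esub> \<one>\<^bsub>k\<^esub>" s] nf_in by auto
    qed (auto simp: T.a_ac)
  next
    fix x t assume x: "x \<in> carrier k" "t \<in> carrier (tensor k M N)"
    then obtain s where s: "s \<in> V" "t = nf k M N s" by (auto simp: tensor_simps)
    show "x \<odot>\<^bsub>tensor k M N\<^esub> t \<in> carrier (tensor k M N)"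
      using x s by (simp add: tensor_smult_nf sm nf_in)
    {
      fix y assume y: "y \<in> carrier k"
      show "(x \<oplus>\<^bsub>k\<^esub> y) \<odot>\<^bsub>tensor k M N\<^esub> t = x \<odot>\<^bsub>tensor k M N\<^esub> t \<oplus>\<^bsub>tensor k M N\<^esub> y \<odot>\<^bsub>tensor k M N\<^esub> t"
        using x y s by (simp add: tensor_smult_nf dist)
      have "?sm (x \<otimes>\<^bsub>k\<^esub> y) s = ?sm x (?sm y s)"
        using x y s by (auto simp: V_iff M.smult_assoc1)
      then have "nf k M N (?sm (x \<otimes>\<^bsub>k\<^esub> y) s) = nf k M N (?sm x (?sm y s))" by (simp only:)
      then show "(x \<otimes>\<^bsub>k\<^esub> y) \<odot>\<^bsub>tensor k M N\<^esub> t = x \<odot>\<^bsub>tensor k M N\<^esub> (y \<odot>\<^bsub>tensor k M N\<^esub> t)"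
        using x y s by (simp add: tensor_smult_nf sm del: map_map)
    next
      fix t' assume "t' \<in> carrier (tensor k M N)"
      then obtain s' where s': "s' \<in> V" "t' = nf k M N s'" by (auto simp: tensor_simps)
      show "x \<odot>\<^bsub>tensor k M N\<^esub> (t \<oplus>\<^bsub>tensor k M N\<^esub> t') = x \<odot>\<^bsub>tensor k M N\<^esub> t \<oplus>\<^bsub>tensor k M N\<^esub> x \<odot>\<^bsub>tensor k M N\<^esub> t'"
        using x s s' by (simp add: tensor_smult_nf tensor_add_nf sm)
    }
  next
    fix t assume "t \<in> carrier (tensor k M N)"
    then obtain s where s: "s \<in> V" "t = nf k M N s" by (auto simp: tensor_simps)
    have "?sm \<one>\<^bsub>k\<^esub> s = s" using s by (auto simp: V_iff intro!: map_idI)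
    then show "\<one>\<^bsub>k\<^esub> \<odot>\<^bsub>tensor k M N\<^esub> t = t" using s by (simp add: tensor_smult_nf)
  qed (rule M.R.is_cring)
qed

lemma bilinear_pure: "bilinear k M N (tensor k M N) (pure k M N)"
proof (intro bilinearI linear_mapI)
  fix m n assume mn: "m \<in> carrier M" "n \<in> carrier N"
  show "pure k M N m n \<in> carrier (tensor k M N)" "pure k M N m n \<in> carrier (tensor k M N)"
    using mn by (auto simp: pure_def intro!: nf_in)
  {
    fix n' assume "n' \<in> carrier N"
    then show "pure k M N m (n \<oplus>\<^bsub>N\<^esub> n') = pure k M N m n \<oplus>\<^bsub>tensor k M N\<^esub> pure k M N m n'"
      using mn unfolding pure_def by (subst tensor_add_nf) (auto intro!: nf_eq teq.add_right)
  next
    fix m' assume "m' \<in> carrier M"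
    then show "pure k M N (m \<oplus>\<^bsub>M\<^esub> m') n = pure k M N m n \<oplus>\<^bsub>tensor k M N\<^esub> pure k M N m' n"
      using mn unfolding pure_def by (simp add: nf_add_left)
  next
    fix x assume x: "x \<in> carrier k"
    then show "pure k M N (x \<odot>\<^bsub>M\<^esub> m) n = x \<odot>\<^bsub>tensor k M N\<^esub> pure k M N m n"
      using mn unfolding pure_def by (simp add: tensor_smult_nf)
    moreover have "pure k M N (x \<odot>\<^bsub>M\<^esub> m) n = pure k M N m (x \<odot>\<^bsub>N\<^esub> n)"
      using mn x unfolding pure_def by (intro nf_eq teq.balanced)
    ultimately show "pure k M N m (x \<odot>\<^bsub>N\<^esub> n) = x \<odot>\<^bsub>tensor k M N\<^esub> pure k M N m n" by simp
  }
qed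

text \<open>
  An element of the tensor product is the sum of the pure tensors in the list that represents it,
  so that \<open>tsum\<close> over this list can be used for all computations.
\<close>

lemma nf_tsum: "s \<in> V \<Longrightarrow> nf k M N s = tsum (tensor k M N) (pure k M N) s"
proof (induction s)
  case Nil
  then show ?case by (simp add: tensor_simps)
next
  case (Cons p s)
  then show ?case by (cases p) (simp add: nf_Cons[of _ _ s] pure_def)
qed

lemma tensor_carrier: "t \<in> carrier (tensor k M N) \<Longrightarrow> t \<in> V \<and> nf k M N t = t"
  using nf_valid nf_nf by (auto simp: tensor_simps)

text \<open>
  Sums of bilinear expressions may be taken over any representative; this is the existence part
  of the universal property.
\<close>

lemma tsum_nf: "module k P \<Longrightarrow> bilinear k M N P B \<Longrightarrow> s \<in> V \<Longrightarrow> tsum P B (nf k M N s) = tsum P B s"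
  by (rule tsum_teq[OF M.module_axioms N.module_axioms _ _ teq.sym[OF nf_teq]]) (auto simp: V_iff)

lemma linear_map_tensor_lift:
  assumes P: "module k P" and B: "bilinear k M N P B"
  shows "linear_map k (tensor k M N) P (tsum P B)"
proof -
  interpret P: module k P by fact
  note c = bilinear_closed[OF B]
  have app: "tsum P B (s @ t) = tsum P B s \<oplus>\<^bsub>P\<^esub> tsum P B t" if "s \<in> V" "t \<in> V" for s t
    using that c by (intro P.tsum_append[of _ "carrier M" "carrier N"]) (auto simp: V_iff)
  show ?thesis
  proof (rule linear_mapI)
    fix s assume "s \<in> carrier (tensor k M N)"
    then have s: "s \<in> V" using tensor_carrier by blast
    show "tsum P B s \<in> carrier P" using s c by (intro P.tsum_closed[of s "carrier M" "carrier N"]) (auto simp: V_iff)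
    {
      fix t assume "t \<in> carrier (tensor k M N)"
      then have t: "t \<in> V" using tensor_carrier by blast
      show "tsum P B (s \<oplus>\<^bsub>tensor k M N\<^esub> t) = tsum P B s \<oplus>\<^bsub>P\<^esub> tsum P B t"
        using s t by (simp add: tensor_simps(3) tsum_nf[OF P B] app)
    next
      fix x assume x: "x \<in> carrier k"
      have v: "map (\<lambda>(m, n). (x \<odot>\<^bsub>M\<^esub> m, n)) s \<in> V" using s x by (auto simp: V_iff)
      have "tsum P B (map (\<lambda>(m, n). (x \<odot>\<^bsub>M\<^esub> m, n)) s) = tsum P (\<lambda>m n. B (x \<odot>\<^bsub>M\<^esub> m) n) s"
        using tsum_map_prod[of P B "\<lambda>m. x \<odot>\<^bsub>M\<^esub> m" "\<lambda>n. n" s] by (simp add: map_prod_def)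
      also have "\<dots> = tsum P (\<lambda>m n. x \<odot>\<^bsub>P\<^esub> B m n) s"
        using s x B by (intro tsum_cong'[of s "carrier M" "carrier N"] linear_map_smult) (auto simp: V_iff bilinear_def)
      also have "\<dots> = x \<odot>\<^bsub>P\<^esub> tsum P B s"
        using s c x P by (intro linear_map_tsum[OF P P, symmetric] linear_intros) (auto simp: V_iff)
      finally show "tsum P B (x \<odot>\<^bsub>tensor k M N\<^esub> s) = x \<odot>\<^bsub>P\<^esub> tsum P B s"
        using v by (simp add: tensor_simps(4) tsum_nf[OF P B])
    }
  qed
qed

end

section \<open>Tensor products of modules with elements in a common type\<close>

locale utensor_pair = tensor_pair k M N
  for k :: "'k ring" and M :: "('k, ('k, 'h, 'x) elt, 'r) module_scheme"
    and N :: "('k, ('k, 'h, 'x) elt, 's) module_scheme"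
begin

abbreviation "U \<equiv> utensor k M N"
abbreviation "u \<equiv> upure k M N"

lemma utensor_simps:
  "carrier U = Formal ` carrier (tensor k M N)"
  "zero U = Formal (zero (tensor k M N))"
  "add U s t = Formal (terms s \<oplus>\<^bsub>tensor k M N\<^esub> terms t)"
  "smult U x s = Formal (x \<odot>\<^bsub>tensor k M N\<^esub> terms s)"
  by (simp_all add: utensor_def Let_def)

lemma module_utensor: "module k U"
proof -
  interpret T: module k "tensor k M N" by (rule module_tensor)
  show ?thesis
  proof (rule moduleI)
    show "abelian_group U"
    proof (rule abelian_groupI)
      fix x assume "x \<in> carrier U"
      then obtain t where "t \<in> carrier (tensor k M N)" "x = Formal t" by (auto simp: utensor_simps)
      then show "\<exists>y\<in>carrier U. y \<oplus>\<^bsub>U\<^esub> x = \<zero>\<^bsub>U\<^esub>"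
        by (auto simp: utensor_simps intro!: bexI[of _ "\<ominus>\<^bsub>tensor k M N\<^esub> t"] T.l_neg)
    qed (auto simp: utensor_simps T.a_ac)
  qed (auto simp: utensor_simps T.smult_l_distr T.smult_r_distr T.smult_assoc1 M.R.is_cring)
qed

lemma linear_map_Formal: "linear_map k (tensor k M N) U Formal"
  by (auto simp: linear_map_def utensor_simps)

lemma linear_map_terms: "linear_map k U (tensor k M N) terms"
  by (auto simp: linear_map_def utensor_simps module.smult_closed[OF module_tensor]
     abelian_monoid.a_closed[OF abelian_monoid_tensor])

lemma upure_eq: "u m n = Formal (pure k M N m n)"
  by (simp add: upure_def unf_def pure_def)

lemma bilinear_upure: "bilinear k M N U u"
  using bilinear_compose[OF bilinear_pure linear_map_Formal] by (simp add: upure_eq[abs_def])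

lemma upure_closed: "m \<in> carrier M \<Longrightarrow> n \<in> carrier N \<Longrightarrow> u m n \<in> carrier U"
  by (rule bilinear_closed[OF bilinear_upure])

lemma unf_tsum: "set s \<subseteq> carrier M \<times> carrier N \<Longrightarrow> unf k M N s = tsum U u s"
proof -
  assume s: "set s \<subseteq> carrier M \<times> carrier N"
  then have "unf k M N s = Formal (tsum (tensor k M N) (pure k M N) s)"
    by (simp add: unf_def nf_tsum V_iff)
  also have "\<dots> = tsum U u s"
    unfolding upure_eq using bilinear_closed[OF bilinear_pure]
    by (rule linear_map_tsum[OF module_tensor module_utensor linear_map_Formal s])
  finally show ?thesis .
qed

lemma utensor_terms:
  assumes "t \<in> carrier U"
  shows "set (terms t) \<subseteq> carrier M \<times> carrier N" "tsum U u (terms t) = t"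
proof -
  obtain s where s: "s \<in> carrier (tensor k M N)" "t = Formal s" using assms by (auto simp: utensor_simps)
  then show v: "set (terms t) \<subseteq> carrier M \<times> carrier N"
    using tensor_carrier by (auto simp: V_iff)
  have "unf k M N (terms t) = t" using s tensor_carrier[of s] by (simp add: unf_def)
  then show "tsum U u (terms t) = t" using unf_tsum[OF v] by simp
qed

lemma linear_map_lift:
  assumes "module k P" "bilinear k M N P B"
  shows "linear_map k U P (\<lambda>t. tsum P B (terms t))"
  by (rule linear_map_compose[OF linear_map_terms linear_map_tensor_lift[OF assms]])

text \<open>
  With \<open>linear_map_lift\<close> this is the existence part of the universal property.
\<close>

lemma lift_upure:
  assumes P: "module k P" and B: "bilinear k M N P B" and mn: "m \<in> carrier M" "n \<in> carrier N"
  shows "tsum P B (terms (u m n)) = B m n"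
proof -
  interpret P: module k P by fact
  show ?thesis using mn bilinear_closed[OF B mn] by (simp add: upure_def unf_def tsum_nf[OF P B] V_iff)
qed

text \<open>
  The uniqueness part of the universal property.
\<close>

lemma utensor_ext:
  assumes P: "module k P" and f: "linear_map k U P f" and g: "linear_map k U P g"
    and eq: "\<And>m n. m \<in> carrier M \<Longrightarrow> n \<in> carrier N \<Longrightarrow> f (u m n) = g (u m n)"
    and t: "t \<in> carrier U"
  shows "f t = g t"
proof -
  note v = utensor_terms[OF t]
  have "f t = tsum P (\<lambda>m n. f (u m n)) (terms t)"
    using linear_map_tsum[OF module_utensor P f v(1), of u] upure_closed v(2) by simp
  also have "\<dots> = tsum P (\<lambda>m n. g (u m n)) (terms t)"
    using eq by (rule tsum_cong'[OF v(1)])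
  also have "\<dots> = g t"
    using linear_map_tsum[OF module_utensor P g v(1), of u] upure_closed v(2) by simp
  finally show ?thesis .
qed

end

lemma linear_map_upure_left [linear_intros]:
  assumes "module k M" "module k N" "linear_map k L M f" "n \<in> carrier N"
  shows "linear_map k L (utensor k M N) (\<lambda>x. upure k M N (f x) n)"
proof -
  interpret utensor_pair k M N by (simp add: utensor_pair_def tensor_pair_def assms)
  show ?thesis by (rule bilinear_left[OF bilinear_upure assms(4,3)])
qed

lemma linear_map_upure_right [linear_intros]:
  assumes "module k M" "module k N" "linear_map k L N f" "m \<in> carrier M"
  shows "linear_map k L (utensor k M N) (\<lambda>x. upure k M N m (f x))"
proof -
  interpret utensor_pair k M N by (simp add: utensor_pair_def tensor_pair_def assms)
  show ?thesis by (rule bilinear_right[OF bilinear_upure assms(4,3)])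
qed

lemma utensor_pairI: "module k M \<Longrightarrow> module k N \<Longrightarrow> utensor_pair k M N"
  by (simp add: utensor_pair_def tensor_pair_def)

lemmas module_utensor = utensor_pair.module_utensor[OF utensor_pairI]
lemmas upure_closed = utensor_pair.upure_closed[OF utensor_pairI]
lemmas bilinear_upure = utensor_pair.bilinear_upure[OF utensor_pairI]
lemmas utensor_ext = utensor_pair.utensor_ext[OF utensor_pairI]
lemmas lift_upure = utensor_pair.lift_upure[OF utensor_pairI]
lemmas linear_map_lift = utensor_pair.linear_map_lift[OF utensor_pairI]

lemma umap_tsum:
  assumes "module k M'" "module k N'" "module k M" "module k N"
    "f \<in> carrier M \<rightarrow> carrier M'" "g \<in> carrier N \<rightarrow> carrier N'" "t \<in> carrier (utensor k M N)"
  shows "umap k M' N' f g t = tsum (utensor k M' N') (\<lambda>m n. upure k M' N' (f m) (g n)) (terms t)"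
proof -
  interpret A: utensor_pair k M N by (rule utensor_pairI) fact+
  interpret B: utensor_pair k M' N' by (rule utensor_pairI) fact+
  have "set (map (map_prod f g) (terms t)) \<subseteq> carrier M' \<times> carrier N'"
    using A.utensor_terms(1)[OF assms(7)] assms(5,6) by auto
  then show ?thesis unfolding umap_def by (simp add: B.unf_tsum tsum_map_prod)
qed

lemma
  assumes "module k M'" "module k N'" "module k M" "module k N"
    and fg: "linear_map k M M' f" "linear_map k N N' g"
  shows linear_map_umap: "linear_map k (utensor k M N) (utensor k M' N') (umap k M' N' f g)"
    and umap_upure: "\<lbrakk>m \<in> carrier M; n \<in> carrier N\<rbrakk>
       \<Longrightarrow> umap k M' N' f g (upure k M N m n) = upure k M' N' (f m) (g n)"
proof -
  interpret A: utensor_pair k M N by (rule utensor_pairI) fact+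
  interpret B: utensor_pair k M' N' by (rule utensor_pairI) fact+
  have b: "bilinear k M N B.U (\<lambda>m n. B.u (f m) (g n))"
    by (rule bilinear_compose2[OF B.bilinear_upure fg])
  have e: "umap k M' N' f g t = tsum B.U (\<lambda>m n. B.u (f m) (g n)) (terms t)" if "t \<in> carrier A.U" for t
    using that fg by (intro umap_tsum[OF assms(1-4)]) (auto simp: linear_map_def)
  show "linear_map k A.U B.U (umap k M' N' f g)"
    by (rule linear_map_cong[OF A.module_utensor A.linear_map_lift[OF B.module_utensor b]]) (simp add: e)
  show "umap k M' N' f g (upure k M N m n) = upure k M' N' (f m) (g n)" if "m \<in> carrier M" "n \<in> carrier N"
    using that by (simp add: e A.upure_closed A.lift_upure[OF B.module_utensor b])
qed

section \<open>Sweedler calculus\<close>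

lemma module_regular: "cring k \<Longrightarrow> module k (regular_module k)"
proof -
  assume "cring k"
  then interpret cring k .
  show ?thesis
    by (intro moduleI abelian_groupI)
      (auto simp: regular_module_def ring.defs a_ac l_distr r_distr m_assoc is_cring intro: add.l_inv_ex)
qed

lemma regular_simps [simp]:
  "carrier (regular_module k) = carrier k" "add (regular_module k) = add k"
  "zero (regular_module k) = zero k" "smult (regular_module k) = mult k"
  by (simp_all add: regular_module_def ring.defs)

lemma linear_map_scale [linear_intros]:
  assumes "module k P" "linear_map k M (regular_module k) f" "p \<in> carrier P"
  shows "linear_map k M P (\<lambda>m. f m \<odot>\<^bsub>P\<^esub> p)"
proof -
  interpret module k P by fact
  show ?thesis using assms by (auto simp: linear_map_def smult_l_distr smult_assoc1 Pi_iff)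
qed

text \<open>
  Only the case of three equal factors occurs, as a function of the three legs of an iterated
  coproduct.
\<close>

definition trilinear ::
  "'k ring \<Rightarrow> ('k, 'm, 'r) module_scheme \<Rightarrow> ('k, 'p, 't) module_scheme
    \<Rightarrow> ('m \<Rightarrow> 'm \<Rightarrow> 'm \<Rightarrow> 'p) \<Rightarrow> bool" where
  "trilinear k M P T \<longleftrightarrow> (\<forall>a\<in>carrier M. bilinear k M M P (T a)) \<and>
    (\<forall>a\<in>carrier M. \<forall>b\<in>carrier M. linear_map k M P (\<lambda>x. T x a b))"

lemma trilinearI:
  assumes "\<And>a b. a \<in> carrier M \<Longrightarrow> b \<in> carrier M \<Longrightarrow> linear_map k M P (\<lambda>x. T x a b)"
    "\<And>a b. a \<in> carrier M \<Longrightarrow> b \<in> carrier M \<Longrightarrow> linear_map k M P (\<lambda>x. T a x b)"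
    "\<And>a b. a \<in> carrier M \<Longrightarrow> b \<in> carrier M \<Longrightarrow> linear_map k M P (\<lambda>x. T a b x)"
  shows "trilinear k M P T"
  using assms by (auto simp: trilinear_def bilinear_def)

lemma set_concat_pairs:
  assumes "set s \<subseteq> A \<times> A'" "\<And>a b. a \<in> A \<Longrightarrow> b \<in> A' \<Longrightarrow> set (F a b) \<subseteq> X"
  shows "set (concat (map (\<lambda>(a, b). F a b) s)) \<subseteq> X"
  using assms(1)
proof (induction s)
  case (Cons p s)
  then show ?case using assms(2)[of "fst p" "snd p"] by (cases p) simp
qed simp

context prebialgebra
begin

abbreviation times_H (infixl "\<bullet>" 70) where "h \<bullet> l \<equiv> h \<otimes>\<^bsub>H\<^esub> l"
abbreviation one_H ("\<one>\<^sub>H") where "\<one>\<^sub>H \<equiv> \<one>\<^bsub>H\<^esub>"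

text \<open>
  The Sweedler sum of \<open>B h\<^sub>1 h\<^sub>2\<close> over \<open>\<Delta> h\<close>.  The coalgebra axioms are used below in the form of
  rules for such sums with values in an arbitrary module.
\<close>

definition sw :: "('k, 'p, 't) module_scheme \<Rightarrow> ('h \<Rightarrow> 'h \<Rightarrow> 'p) \<Rightarrow> 'h \<Rightarrow> 'p" where
  "sw P B h = tsum P B (comult H h)"

lemma HH: "tensor_pair k H H" by (simp add: tensor_pair_def H.module_axioms)

lemma comult_valid: "h \<in> carrier H \<Longrightarrow> set (comult H h) \<subseteq> carrier H \<times> carrier H"
  using linear_map_closed[OF comult_linear] tensor_pair.tensor_carrier[OF HH] tensor_pair.V_iff[OF HH] by blast

lemma sw_cong:
  "h \<in> carrier H \<Longrightarrow> (\<And>a b. a \<in> carrier H \<Longrightarrow> b \<in> carrier H \<Longrightarrow> B a b = B' a b) \<Longrightarrow> sw P B h = sw P B' h"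
  unfolding sw_def by (rule tsum_cong'[OF comult_valid])

lemma sw_closed:
  "module k P \<Longrightarrow> h \<in> carrier H \<Longrightarrow> (\<And>a b. a \<in> carrier H \<Longrightarrow> b \<in> carrier H \<Longrightarrow> B a b \<in> carrier P)
    \<Longrightarrow> sw P B h \<in> carrier P"
  unfolding sw_def by (rule abelian_group.tsum_closed[OF module_abelian_group comult_valid])

lemma sw_swap:
  assumes "module k P" "h \<in> carrier H" "l \<in> carrier H"
    "\<And>a b c d. a \<in> carrier H \<Longrightarrow> b \<in> carrier H \<Longrightarrow> c \<in> carrier H \<Longrightarrow> d \<in> carrier H \<Longrightarrow> B a b c d \<in> carrier P"
  shows "sw P (\<lambda>a b. sw P (\<lambda>c d. B a b c d) l) h = sw P (\<lambda>c d. sw P (\<lambda>a b. B a b c d) h) l"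
  unfolding sw_def
  by (rule abelian_group.tsum_swap[OF module_abelian_group[OF assms(1)] comult_valid[OF assms(2)] comult_valid[OF assms(3)] assms(4)])

lemma sw_linear_image:
  assumes "module k P" "module k Q" "linear_map k P Q f" "h \<in> carrier H"
    "\<And>a b. a \<in> carrier H \<Longrightarrow> b \<in> carrier H \<Longrightarrow> B a b \<in> carrier P"
  shows "f (sw P B h) = sw Q (\<lambda>a b. f (B a b)) h"
  unfolding sw_def by (rule linear_map_tsum[OF assms(1-3) comult_valid[OF assms(4)] assms(5)])

lemma linear_map_sw [linear_intros]:
  assumes "module k P" "bilinear k H H P B" "linear_map k M H f"
  shows "linear_map k M P (\<lambda>m. sw P B (f m))"
  unfolding sw_def
  by (rule linear_map_compose[OF linear_map_compose[OF assms(3) comult_linear]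
    tensor_pair.linear_map_tensor_lift[OF HH assms(1,2)]])

lemma linear_map_sw_family [linear_intros]:
  assumes "module k M" "module k P" "h \<in> carrier H"
    "\<And>a b. a \<in> carrier H \<Longrightarrow> b \<in> carrier H \<Longrightarrow> linear_map k M P (B a b)"
  shows "linear_map k M P (\<lambda>m. sw P (\<lambda>a b. B a b m) h)"
  unfolding sw_def by (rule linear_map_tsum_family[OF assms(1,2) comult_valid[OF assms(3)] assms(4)])

lemma linear_map_mult_left [linear_intros]:
  "linear_map k M H f \<Longrightarrow> l \<in> carrier H \<Longrightarrow> linear_map k M H (\<lambda>x. f x \<bullet> l)"
  by (auto simp: linear_map_def H.l_distr smult_mult_left Pi_iff)

lemma linear_map_mult_right [linear_intros]:
  "linear_map k M H f \<Longrightarrow> l \<in> carrier H \<Longrightarrow> linear_map k M H (\<lambda>x. l \<bullet> f x)"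
  by (auto simp: linear_map_def H.r_distr smult_mult_right Pi_iff)

lemma linear_map_counit [linear_intros]:
  "linear_map k M H f \<Longrightarrow> linear_map k M (regular_module k) (\<lambda>x. counit H (f x))"
  by (rule linear_map_compose[OF _ counit_linear])

lemma counit_closed [simp]: "h \<in> carrier H \<Longrightarrow> counit H h \<in> carrier k"
  using linear_map_closed[OF counit_linear] by simp

lemma sw_counit_left:
  assumes "module k P" "linear_map k H P f" "h \<in> carrier H"
  shows "sw P (\<lambda>a b. counit H a \<odot>\<^bsub>P\<^esub> f b) h = f h"
proof -
  have "f h = f (tsum H (\<lambda>a b. counit H a \<odot>\<^bsub>H\<^esub> b) (comult H h))"
    using counit_left[OF assms(3)] by (simp add: tsum_def)
  also have "\<dots> = tsum P (\<lambda>a b. f (counit H a \<odot>\<^bsub>H\<^esub> b)) (comult H h)"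
    by (rule linear_map_tsum[OF H.module_axioms assms(1,2) comult_valid[OF assms(3)]]) auto
  also have "\<dots> = tsum P (\<lambda>a b. counit H a \<odot>\<^bsub>P\<^esub> f b) (comult H h)"
    by (rule tsum_cong'[OF comult_valid[OF assms(3)]]) (auto simp: linear_map_smult[OF assms(2)])
  finally show ?thesis by (simp add: sw_def)
qed

lemma sw_counit_right:
  assumes "module k P" "linear_map k H P f" "h \<in> carrier H"
  shows "sw P (\<lambda>a b. counit H b \<odot>\<^bsub>P\<^esub> f a) h = f h"
proof -
  have "f h = f (tsum H (\<lambda>a b. counit H b \<odot>\<^bsub>H\<^esub> a) (comult H h))"
    using counit_right[OF assms(3)] by (simp add: tsum_def)
  also have "\<dots> = tsum P (\<lambda>a b. f (counit H b \<odot>\<^bsub>H\<^esub> a)) (comult H h)"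
    by (rule linear_map_tsum[OF H.module_axioms assms(1,2) comult_valid[OF assms(3)]]) auto
  also have "\<dots> = tsum P (\<lambda>a b. counit H b \<odot>\<^bsub>P\<^esub> f a) (comult H h)"
    by (rule tsum_cong'[OF comult_valid[OF assms(3)]]) (auto simp: linear_map_smult[OF assms(2)])
  finally show ?thesis by (simp add: sw_def)
qed

lemma sw_mult:
  assumes P: "module k P" and B: "bilinear k H H P B" and hl: "h \<in> carrier H" "l \<in> carrier H"
  shows "sw P B (h \<bullet> l) = sw P (\<lambda>a b. sw P (\<lambda>c d. B (a \<bullet> c) (b \<bullet> d)) l) h"
proof -
  interpret HH: tensor_pair k H H by (rule HH)
  interpret P: module k P by fact
  let ?s = "[(a \<bullet> c, b \<bullet> d). (a, b) \<leftarrow> comult H h, (c, d) \<leftarrow> comult H l]"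
  let ?F = "\<lambda>a b. map (map_prod ((\<bullet>) a) ((\<bullet>) b)) (comult H l)"
  note v = comult_valid[OF hl(1)] comult_valid[OF hl(2)]
  have F: "set (?F a b) \<subseteq> carrier H \<times> carrier H" if "a \<in> carrier H" "b \<in> carrier H" for a b
    using v(2) that by auto
  have s: "?s = concat (map (\<lambda>(a, b). ?F a b) (comult H h))"
    by (simp add: map_prod_def)
  have V: "?s \<in> HH.V" unfolding HH.V_iff s by (rule set_concat_pairs[OF v(1) F])
  have "sw P B (h \<bullet> l) = tsum P B ?s"
    unfolding sw_def comult_mult[OF hl] tens_mult_def by (rule HH.tsum_nf[OF P B V])
  also have "\<dots> = tsum P (\<lambda>a b. tsum P B (?F a b)) (comult H h)"
    unfolding s by (rule P.tsum_concat[OF v(1) F bilinear_closed[OF B]])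
  finally show ?thesis unfolding sw_def tsum_map_prod .
qed

lemma bilinear_tensor_left:
  assumes P: "module k P" and T: "trilinear k H P T"
  shows "bilinear k (tensor k H H) H P (\<lambda>t b. tsum P (\<lambda>x y. T x y b) t)"
proof -
  interpret HH: tensor_pair k H H by (rule HH)
  have T2: "bilinear k H H P (T a)" if "a \<in> carrier H" for a
    using T that by (auto simp: trilinear_def)
  have T3: "bilinear k H H P (\<lambda>x y. T x y b)" if "b \<in> carrier H" for b
    using T that by (auto simp: trilinear_def bilinear_def)
  show ?thesis
  proof (rule bilinearI)
    fix t assume "t \<in> carrier (tensor k H H)"
    then have t: "set t \<subseteq> carrier H \<times> carrier H" using HH.tensor_carrier HH.V_iff by blast
    show "linear_map k H P (\<lambda>b. tsum P (\<lambda>x y. T x y b) t)"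
      by (rule linear_map_tsum_family[OF H.module_axioms P t]) (use T2 in \<open>auto simp: bilinear_def\<close>)
  qed (rule HH.linear_map_tensor_lift[OF P T3])
qed

text \<open>
  Evaluates a trilinear map at \<open>(\<Delta> \<otimes> H) (\<Delta> h)\<close>.
\<close>

lemma tsum_comult_left:
  assumes P: "module k P" and T: "trilinear k H P T" and h: "h \<in> carrier H"
  shows "tsum P (\<lambda>t b. tsum P (\<lambda>x y. T x y b) t) (tmap k (tensor k H H) H (comult H) id (comult H h)) =
    sw P (\<lambda>a b. sw P (\<lambda>c d. T c d b) a) h"
proof -
  interpret HH: tensor_pair k H H by (rule HH)
  interpret L: tensor_pair k "tensor k H H" H by (simp add: tensor_pair_def HH.module_tensor H.module_axioms)
  have V: "map (map_prod (comult H) id) (comult H h) \<in> L.V"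
    using comult_valid[OF h] linear_map_closed[OF comult_linear] by (auto simp: L.V_iff)
  show ?thesis
    unfolding tmap_def sw_def L.tsum_nf[OF P bilinear_tensor_left[OF P T] V] tsum_map_prod by simp
qed

text \<open>
  Coassociativity, read off by applying to both sides of the axiom the linear map
  \<open>H \<otimes> (H \<otimes> H) \<rightarrow> P\<close> that corresponds to \<open>T\<close>.
\<close>

lemma sw_coassoc:
  assumes P: "module k P" and T: "trilinear k H P T" and h: "h \<in> carrier H"
  shows "sw P (\<lambda>a b. sw P (\<lambda>c d. T c d b) a) h = sw P (\<lambda>a b. sw P (\<lambda>c d. T a c d) b) h"
proof -
  interpret HH: tensor_pair k H H by (rule HH)
  interpret P: module k P by fact
  let ?HH = "tensor k H H"
  interpret L: tensor_pair k ?HH H by (simp add: tensor_pair_def HH.module_tensor H.module_axioms)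
  interpret R: tensor_pair k H ?HH by (simp add: tensor_pair_def HH.module_tensor H.module_axioms)
  note v = comult_valid[OF h]
  have T1: "linear_map k H P (\<lambda>x. T x a b)" if "a \<in> carrier H" "b \<in> carrier H" for a b
    using T that by (auto simp: trilinear_def)
  have T2: "bilinear k H H P (T a)" if "a \<in> carrier H" for a
    using T that by (auto simp: trilinear_def)
  have tv: "set t \<subseteq> carrier H \<times> carrier H" if "t \<in> carrier ?HH" for t
    using that HH.tensor_carrier HH.V_iff by blast
  have bR: "bilinear k H ?HH P (\<lambda>a t. tsum P (T a) t)"
  proof (rule bilinearI)
    fix t assume "t \<in> carrier ?HH"
    then show "linear_map k H P (\<lambda>a. tsum P (T a) t)"
      using linear_map_tsum_family[OF H.module_axioms P tv[of t] T1[of _ _], of "\<lambda>a b. a" "\<lambda>a b. b"] by simp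
  qed (rule HH.linear_map_tensor_lift[OF P T2])
  let ?l = "map (map_prod (comult H) id) (comult H h)"
  let ?L = "tmap k ?HH H (comult H) id (comult H h)"
  let ?r = "map (map_prod id (comult H)) (comult H h)"
  have lV: "?l \<in> L.V" using v linear_map_closed[OF comult_linear] by (auto simp: L.V_iff)
  have rV: "?r \<in> R.V" using v linear_map_closed[OF comult_linear] by (auto simp: R.V_iff)
  have LV: "set ?L \<subseteq> carrier ?HH \<times> carrier H"
    unfolding tmap_def using L.nf_valid[OF lV] by (simp add: L.V_iff)
  let ?F = "\<lambda>s p. map (\<lambda>(m, n). (m, pure k H H n p)) s"
  have F: "set (?F s p) \<subseteq> carrier H \<times> carrier ?HH" if "s \<in> carrier ?HH" "p \<in> carrier H" for s p
    using that tv bilinear_closed[OF HH.bilinear_pure] by fastforce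
  have "sw P (\<lambda>a b. sw P (\<lambda>c d. T c d b) a) h = tsum P (\<lambda>t b. tsum P (\<lambda>x y. T x y b) t) ?L"
    by (rule tsum_comult_left[OF P T h, symmetric])
  also have "\<dots> = tsum P (\<lambda>t b. tsum P (\<lambda>a t. tsum P (T a) t) (?F t b)) ?L"
  proof (rule tsum_cong'[OF LV])
    fix t b assume tb: "t \<in> carrier ?HH" "b \<in> carrier H"
    have "tsum P (\<lambda>a t. tsum P (T a) t) (?F t b) = tsum P (\<lambda>x y. tsum P (T x) (pure k H H y b)) t"
      unfolding tsum_def by (simp add: comp_def case_prod_beta')
    also have "\<dots> = tsum P (\<lambda>x y. T x y b) t"
    proof (rule tsum_cong'[OF tv[OF tb(1)]])
      fix x y assume "x \<in> carrier H" "y \<in> carrier H"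
      then show "tsum P (T x) (pure k H H y b) = T x y b"
        using tb T2 bilinear_closed[OF T2]
          by (simp add: pure_def HH.tsum_nf[OF P] HH.V_iff)
    qed
    finally show "tsum P (\<lambda>x y. T x y b) t = tsum P (\<lambda>a t. tsum P (T a) t) (?F t b)" by simp
  qed
  also have "\<dots> = tsum P (\<lambda>a t. tsum P (T a) t) (concat (map (\<lambda>(t, b). ?F t b) ?L))"
    by (rule P.tsum_concat[OF LV F bilinear_closed[OF bR], symmetric])
  also have "\<dots> = tsum P (\<lambda>a t. tsum P (T a) t) (tens_assoc k H H H ?L)"
  proof -
    have "concat (map (\<lambda>(t, b). ?F t b) ?L) \<in> R.V"
      unfolding R.V_iff by (rule set_concat_pairs[OF LV F])
    then show ?thesis unfolding tens_assoc_def by (rule R.tsum_nf[OF P bR, symmetric])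
  qed
  also have "\<dots> = tsum P (\<lambda>a t. tsum P (T a) t) (tmap k H ?HH id (comult H) (comult H h))"
    by (simp only: coassoc[OF h])
  also have "\<dots> = tsum P (\<lambda>a t. tsum P (T a) t) ?r"
    unfolding tmap_def by (rule R.tsum_nf[OF P bR rV])
  also have "\<dots> = sw P (\<lambda>a b. sw P (\<lambda>c d. T a c d) b) h"
    unfolding sw_def tsum_map_prod by simp
  finally show ?thesis .
qed

text \<open>
  The common form of (lc) and (rc), where \<open>F b c\<close> is \<open>b c\<close> and \<open>c b\<close> respectively.
\<close>

lemma sw_unit_middle:
  assumes P: "module k P" and T: "trilinear k H P T"
    and F: "\<And>b c. b \<in> carrier H \<Longrightarrow> c \<in> carrier H \<Longrightarrow> F b c \<in> carrier H"
    and eq: "tmap k (tensor k H H) H (comult H) id (comult H \<one>\<^sub>H)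
      = nf k (tensor k H H) H [(pure k H H a (F b c), d). (a, b) \<leftarrow> comult H \<one>\<^sub>H, (c, d) \<leftarrow> comult H \<one>\<^sub>H]"
  shows "sw P (\<lambda>a b. sw P (\<lambda>c d. T c d b) a) \<one>\<^sub>H = sw P (\<lambda>a b. sw P (\<lambda>c d. T a (F b c) d) \<one>\<^sub>H) \<one>\<^sub>H"
proof -
  interpret HH: tensor_pair k H H by (rule HH)
  interpret P: module k P by fact
  interpret L: tensor_pair k "tensor k H H" H by (simp add: tensor_pair_def HH.module_tensor H.module_axioms)
  let ?B = "\<lambda>t b. tsum P (\<lambda>x y. T x y b) t"
  let ?G = "\<lambda>a b. map (map_prod (\<lambda>c. pure k H H a (F b c)) id) (comult H \<one>\<^sub>H)"
  note v = comult_valid[OF H.one_closed]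
  note B = bilinear_tensor_left[OF P T]
  have G: "set (?G a b) \<subseteq> carrier (tensor k H H) \<times> carrier H" if "a \<in> carrier H" "b \<in> carrier H" for a b
    using v that F bilinear_closed[OF HH.bilinear_pure] by auto
  have V: "concat (map (\<lambda>(a, b). ?G a b) (comult H \<one>\<^sub>H)) \<in> L.V"
    unfolding L.V_iff by (rule set_concat_pairs[OF v G])
  have T3: "bilinear k H H P (\<lambda>x y. T x y b)" if "b \<in> carrier H" for b
    using T that by (auto simp: trilinear_def bilinear_def)
  have pure: "?B (pure k H H a (F b c)) d = T a (F b c) d"
    if "a \<in> carrier H" "b \<in> carrier H" "c \<in> carrier H" "d \<in> carrier H" for a b c d
    using that F bilinear_closed[OF T3] by (simp add: pure_def HH.tsum_nf[OF P T3] HH.V_iff)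
  have "sw P (\<lambda>a b. sw P (\<lambda>c d. T c d b) a) \<one>\<^sub>H =
     tsum P ?B (nf k (tensor k H H) H (concat (map (\<lambda>(a, b). ?G a b) (comult H \<one>\<^sub>H))))"
    using tsum_comult_left[OF P T H.one_closed] eq by (simp add: map_prod_def)
  also have "\<dots> = tsum P ?B (concat (map (\<lambda>(a, b). ?G a b) (comult H \<one>\<^sub>H)))"
    by (rule L.tsum_nf[OF P B V])
  also have "\<dots> = tsum P (\<lambda>a b. tsum P ?B (?G a b)) (comult H \<one>\<^sub>H)"
    by (rule P.tsum_concat[OF v G bilinear_closed[OF B]])
  also have "\<dots> = sw P (\<lambda>a b. sw P (\<lambda>c d. ?B (pure k H H a (F b c)) d) \<one>\<^sub>H) \<one>\<^sub>H"
    by (simp add: sw_def tsum_map_prod)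
  also have "\<dots> = sw P (\<lambda>a b. sw P (\<lambda>c d. T a (F b c) d) \<one>\<^sub>H) \<one>\<^sub>H"
    by (intro sw_cong pure H.one_closed)
  finally show ?thesis .
qed

end

section \<open>Modules spanned by the values of a bilinear map\<close>

text \<open>
  Both \<open>M \<otimes> N\<close> and \<open>M \<otimes>\<^sup>l N\<close> are spanned by the values \<open>p m n\<close> of a bilinear map, and this is all
  that is needed to compare linear maps out of them.
\<close>

definition generated ::
  "'k ring \<Rightarrow> ('k, 'm, 'r) module_scheme \<Rightarrow> ('k, 'n, 's) module_scheme \<Rightarrow> ('k, 'p, 't) module_scheme
    \<Rightarrow> ('m \<Rightarrow> 'n \<Rightarrow> 'p) \<Rightarrow> bool" where
  "generated k M N T p \<longleftrightarrow> module k M \<and> module k N \<and> module k T \<and> bilinear k M N T p \<and>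
    (\<forall>t\<in>carrier T. \<exists>s. set s \<subseteq> carrier M \<times> carrier N \<and> t = tsum T p s)"

lemma generatedD:
  assumes "generated k M N T p"
  shows "module k M" "module k N" "module k T" "bilinear k M N T p"
    "m \<in> carrier M \<Longrightarrow> n \<in> carrier N \<Longrightarrow> p m n \<in> carrier T"
  using assms bilinear_closed[of k M N T p m n] by (auto simp: generated_def)

lemma generated_ext:
  assumes g: "generated k M N T p" and P: "module k P" and f: "linear_map k T P f" "linear_map k T P f'"
    and eq: "\<And>m n. m \<in> carrier M \<Longrightarrow> n \<in> carrier N \<Longrightarrow> f (p m n) = f' (p m n)"
    and t: "t \<in> carrier T"
  shows "f t = f' t"
proof -
  obtain s where s: "set s \<subseteq> carrier M \<times> carrier N" "t = tsum T p s"
    using g t by (auto simp: generated_def)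
  note c = generatedD[OF g]
  have "f t = tsum P (\<lambda>m n. f (p m n)) s"
    unfolding s(2) by (rule linear_map_tsum[OF c(3) P f(1) s(1) c(5)])
  also have "\<dots> = tsum P (\<lambda>m n. f' (p m n)) s" using eq by (rule tsum_cong'[OF s(1)])
  also have "\<dots> = f' t"
    unfolding s(2) by (rule linear_map_tsum[OF c(3) P f(2) s(1) c(5), symmetric])
  finally show ?thesis .
qed

lemma generated_ext_left:
  assumes g: "generated k M N T p" and g': "generated k T N' T' p'"
    and P: "module k P" and f: "linear_map k T' P f" "linear_map k T' P f'"
    and eq: "\<And>m n n'. m \<in> carrier M \<Longrightarrow> n \<in> carrier N \<Longrightarrow> n' \<in> carrier N' \<Longrightarrow> f (p' (p m n) n') = f' (p' (p m n) n')"
    and t: "t \<in> carrier T'"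
  shows "f t = f' t"
proof (rule generated_ext[OF g' P f _ t])
  fix s n' assume s: "s \<in> carrier T" and n': "n' \<in> carrier N'"
  have l: "linear_map k T T' (\<lambda>s. p' s n')" by (rule bilinear_left[OF generatedD(4)[OF g'] n' linear_map_id])
  show "f (p' s n') = f' (p' s n')"
    by (rule generated_ext[OF g P linear_map_compose[OF l f(1)] linear_map_compose[OF l f(2)] eq[OF _ _ n'] s])
qed

lemma generated_ext_right:
  assumes g: "generated k M N T p" and g': "generated k N' T T' p'"
    and P: "module k P" and f: "linear_map k T' P f" "linear_map k T' P f'"
    and eq: "\<And>n' m n. n' \<in> carrier N' \<Longrightarrow> m \<in> carrier M \<Longrightarrow> n \<in> carrier N \<Longrightarrow> f (p' n' (p m n)) = f' (p' n' (p m n))"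
    and t: "t \<in> carrier T'"
  shows "f t = f' t"
proof (rule generated_ext[OF g' P f _ t])
  fix s n' assume s: "s \<in> carrier T" and n': "n' \<in> carrier N'"
  have l: "linear_map k T T' (\<lambda>s. p' n' s)" by (rule bilinear_right[OF generatedD(4)[OF g'] n' linear_map_id])
  show "f (p' n' s) = f' (p' n' s)"
    by (rule generated_ext[OF g P linear_map_compose[OF l f(1)] linear_map_compose[OF l f(2)] eq[OF n'] s])
qed

lemma generated_utensor: "module k M \<Longrightarrow> module k N \<Longrightarrow> generated k M N (utensor k M N) (upure k M N)"
  unfolding generated_def
  by (metis module_utensor bilinear_upure utensor_pair.utensor_terms[OF utensor_pairI])

section \<open>The truncated tensor product of modules\<close>

lemma left_module_module: "left_module k H M \<Longrightarrow> module k M"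
  by (simp add: left_module_def)

context prebialgebra
begin

lemma linear_map_hact_right [linear_intros]:
  "left_module k H M \<Longrightarrow> h \<in> carrier H \<Longrightarrow> linear_map k L M f \<Longrightarrow> linear_map k L M (\<lambda>x. hact M h (f x))"
  by (auto simp: linear_map_def Pi_iff left_module.hact_closed left_module.hact_add left_module.hact_smult)

lemma linear_map_hact_left [linear_intros]:
  "left_module k H M \<Longrightarrow> m \<in> carrier M \<Longrightarrow> linear_map k L H f \<Longrightarrow> linear_map k L M (\<lambda>x. hact M (f x) m)"
  by (auto simp: linear_map_def Pi_iff left_module.hact_closed left_module.add_hact left_module.smult_hact)

lemma hact_closed: "left_module k H M \<Longrightarrow> h \<in> carrier H \<Longrightarrow> m \<in> carrier M \<Longrightarrow> hact M h m \<in> carrier M"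
  by (rule left_module.hact_closed)

lemma ltensor_simps:
  "carrier (ltensor k H M N) = diag_act k H M N \<one>\<^sub>H ` carrier (utensor k M N)"
  "zero (ltensor k H M N) = zero (utensor k M N)"
  "add (ltensor k H M N) = add (utensor k M N)"
  "smult (ltensor k H M N) = smult (utensor k M N)"
  "hact (ltensor k H M N) = diag_act k H M N"
  by (simp_all add: ltensor_def Let_def)

end

text \<open>
  \<open>D h\<close> is the action of \<open>h\<close> on \<open>M \<otimes> N\<close> by \<open>h\<^sub>1 m \<otimes> h\<^sub>2 n\<close>.  It is multiplicative in \<open>h\<close>, but
  \<open>D 1 = \<pi>\<close> is only an idempotent; on its image \<open>M \<otimes>\<^sup>l N\<close> the action is unital.
\<close>

locale two_modules = prebialgebra k H + utensor_pair k M N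
  for k :: "'k ring" and H :: "('k, 'h) prebialg"
    and M N :: "('k, ('k, 'h, 'x) elt, 'h) hmodule" +
  assumes lM: "left_module k H M" and lN: "left_module k H N"
begin

abbreviation "D \<equiv> diag_act k H M N"
abbreviation "L \<equiv> ltensor k H M N"

lemma hact_M: "h \<in> carrier H \<Longrightarrow> m \<in> carrier M \<Longrightarrow> hact M h m \<in> carrier M"
  by (rule hact_closed[OF lM])

lemma hact_N: "h \<in> carrier H \<Longrightarrow> m \<in> carrier N \<Longrightarrow> hact N h m \<in> carrier N"
  by (rule hact_closed[OF lN])

lemma bilinear_sw_upure:
  assumes h: "h \<in> carrier H"
  shows "bilinear k M N U (\<lambda>m n. sw U (\<lambda>a b. u (hact M a m) (hact N b n)) h)"
  by (intro linear_intros M.module_axioms N.module_axioms module_utensor h hact_M hact_N lM lN)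

lemma bilinear_upure_hact:
  assumes "m \<in> carrier M" "n \<in> carrier N"
  shows "bilinear k H H U (\<lambda>a b. u (hact M a m) (hact N b n))"
  by (intro linear_intros M.module_axioms N.module_axioms hact_M hact_N lM lN assms)

lemma diag_act_tsum:
  assumes t: "t \<in> carrier U" and h: "h \<in> carrier H"
  shows "D h t = tsum U (\<lambda>m n. sw U (\<lambda>a b. u (hact M a m) (hact N b n)) h) (terms t)"
proof -
  interpret U: module k U by (rule module_utensor)
  note v = utensor_terms(1)[OF t]
  let ?F = "\<lambda>a b. map (map_prod (hact M a) (hact N b)) (terms t)"
  have F: "set (?F a b) \<subseteq> carrier M \<times> carrier N" if "a \<in> carrier H" "b \<in> carrier H" for a b
    using v that hact_M hact_N by auto
  have "D h t = unf k M N (concat (map (\<lambda>(a, b). ?F a b) (comult H h)))"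
    by (simp add: diag_act_def map_prod_def)
  also have "\<dots> = tsum U u (concat (map (\<lambda>(a, b). ?F a b) (comult H h)))"
    by (rule unf_tsum) (rule set_concat_pairs[OF comult_valid[OF h] F])
  also have "\<dots> = tsum U (\<lambda>a b. tsum U u (?F a b)) (comult H h)"
    by (rule U.tsum_concat[OF comult_valid[OF h] F upure_closed])
  also have "\<dots> = tsum U (\<lambda>a b. tsum U (\<lambda>m n. u (hact M a m) (hact N b n)) (terms t)) (comult H h)"
    by (simp only: tsum_map_prod)
  also have "\<dots> = tsum U (\<lambda>m n. sw U (\<lambda>a b. u (hact M a m) (hact N b n)) h) (terms t)"
    unfolding sw_def
    by (rule U.tsum_swap[OF comult_valid[OF h] v]) (intro upure_closed hact_M hact_N)
  finally show ?thesis .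
qed

lemma linear_map_diag_act: "h \<in> carrier H \<Longrightarrow> linear_map k U U (D h)"
  by (rule linear_map_cong[OF module_utensor linear_map_lift[OF module_utensor bilinear_sw_upure]])
    (simp_all add: diag_act_tsum)

lemma linear_map_diag_act_left:
  assumes t: "t \<in> carrier U"
  shows "linear_map k H U (\<lambda>h. D h t)"
proof (rule linear_map_cong[OF H.module_axioms])
  show "linear_map k H U (\<lambda>h. tsum U (\<lambda>m n. sw U (\<lambda>a b. u (hact M a m) (hact N b n)) h) (terms t))"
    by (rule linear_map_tsum_family[OF H.module_axioms module_utensor utensor_terms(1)[OF t]])
      (intro linear_map_sw linear_map_id module_utensor bilinear_upure_hact)
qed (simp add: diag_act_tsum t)

lemma diag_act_closed: "h \<in> carrier H \<Longrightarrow> t \<in> carrier U \<Longrightarrow> D h t \<in> carrier U"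
  by (rule linear_map_closed[OF linear_map_diag_act])

lemma diag_act_upure:
  assumes "h \<in> carrier H" "m \<in> carrier M" "n \<in> carrier N"
  shows "D h (u m n) = sw U (\<lambda>a b. u (hact M a m) (hact N b n)) h"
  using assms by (simp add: diag_act_tsum upure_closed lift_upure[OF module_utensor bilinear_sw_upure])

lemma diag_act_mult:
  assumes h: "h \<in> carrier H" and l: "l \<in> carrier H" and t: "t \<in> carrier U"
  shows "D (h \<bullet> l) t = D h (D l t)"
proof (rule utensor_ext[OF module_utensor _ _ _ t])
  show "linear_map k U U (D (h \<bullet> l))" using h l by (simp add: linear_map_diag_act)
  show "linear_map k U U (\<lambda>t. D h (D l t))"
    using h l by (intro linear_map_compose[OF linear_map_diag_act[OF l]] linear_map_diag_act)
  fix m n assume mn: "m \<in> carrier M" "n \<in> carrier N"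
  have "D (h \<bullet> l) (u m n) = sw U (\<lambda>a b. u (hact M a m) (hact N b n)) (h \<bullet> l)"
    using h l mn by (simp add: diag_act_upure)
  also have "\<dots> = sw U (\<lambda>a b. sw U (\<lambda>c d. u (hact M (a \<bullet> c) m) (hact N (b \<bullet> d) n)) l) h"
    by (rule sw_mult[OF module_utensor bilinear_upure_hact[OF mn] h l])
  also have "\<dots> = sw U (\<lambda>a b. sw U (\<lambda>c d. u (hact M a (hact M c m)) (hact N b (hact N d n))) l) h"
    using h l mn by (intro sw_cong)
      (simp_all add: left_module.mult_hact[OF lM] left_module.mult_hact[OF lN])
  also have "\<dots> = sw U (\<lambda>c d. sw U (\<lambda>a b. u (hact M a (hact M c m)) (hact N b (hact N d n))) h) l"
    using h l mn by (intro sw_swap) (simp_all add: module_utensor upure_closed hact_M hact_N)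
  also have "\<dots> = sw U (\<lambda>c d. D h (u (hact M c m) (hact N d n))) l"
    using h l mn by (intro sw_cong) (simp_all add: diag_act_upure hact_M hact_N)
  also have "\<dots> = D h (sw U (\<lambda>c d. u (hact M c m) (hact N d n)) l)"
    using h l mn by (intro sw_linear_image[symmetric])
      (simp_all add: module_utensor linear_map_diag_act upure_closed hact_M hact_N)
  also have "\<dots> = D h (D l (u m n))" using l mn by (simp add: diag_act_upure)
  finally show "D (h \<bullet> l) (u m n) = D h (D l (u m n))" .
qed

text \<open>
  \<open>\<pi>\<close> is idempotent because \<open>\<Delta> 1 \<Delta> 1 = \<Delta> 1\<close>; its image is its set of fixed points.
\<close>

lemma carrier_ltensor: "t \<in> carrier L \<longleftrightarrow> t \<in> carrier U \<and> D \<one>\<^sub>H t = t"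
proof
  assume "t \<in> carrier L"
  then obtain s where s: "s \<in> carrier U" "t = D \<one>\<^sub>H s" by (auto simp: ltensor_simps)
  then show "t \<in> carrier U \<and> D \<one>\<^sub>H t = t"
    using diag_act_mult[of "\<one>\<^sub>H" "\<one>\<^sub>H" s] by (simp add: diag_act_closed)
next
  assume "t \<in> carrier U \<and> D \<one>\<^sub>H t = t"
  then show "t \<in> carrier L" unfolding ltensor_simps by (metis image_eqI)
qed

lemma diag_act_in: "h \<in> carrier H \<Longrightarrow> t \<in> carrier U \<Longrightarrow> D h t \<in> carrier L"
  using diag_act_mult[of "\<one>\<^sub>H" h t] by (simp add: carrier_ltensor diag_act_closed)

lemma module_ltensor: "module k L"
proof -
  interpret U: module k U by (rule module_utensor)
  note lin = linear_map_diag_act[OF H.one_closed]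
  have cl: "s \<oplus>\<^bsub>U\<^esub> t \<in> carrier L" if "s \<in> carrier L" "t \<in> carrier L" for s t
    using that linear_map_add[OF lin] by (simp add: carrier_ltensor)
  have sm: "x \<odot>\<^bsub>U\<^esub> t \<in> carrier L" if "x \<in> carrier k" "t \<in> carrier L" for x t
    using that linear_map_smult[OF lin] by (simp add: carrier_ltensor)
  have z: "\<zero>\<^bsub>U\<^esub> \<in> carrier L"
    using linear_map_zero[OF module_utensor module_utensor lin] by (simp add: carrier_ltensor)
  have sub: "t \<in> carrier U" if "t \<in> carrier L" for t using that by (simp add: carrier_ltensor)
  have inv: "\<exists>y\<in>carrier L. y \<oplus>\<^bsub>U\<^esub> t = \<zero>\<^bsub>U\<^esub>" if t: "t \<in> carrier L" for t
  proof (rule bexI)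
    show "(\<ominus>\<^bsub>k\<^esub> \<one>\<^bsub>k\<^esub>) \<odot>\<^bsub>U\<^esub> t \<oplus>\<^bsub>U\<^esub> t = \<zero>\<^bsub>U\<^esub>"
      using sub[OF t] U.smult_l_minus[of "\<one>\<^bsub>k\<^esub>" t] by (simp add: U.l_neg)
  qed (simp add: sm t)
  show ?thesis
  proof (rule moduleI)
    show "abelian_group L"
      by (rule abelian_groupI) (use cl z inv sub in \<open>simp_all add: ltensor_simps(2-) U.a_ac\<close>)
  qed (use sm sub in \<open>simp_all add: ltensor_simps(2-) U.smult_l_distr U.smult_r_distr U.smult_assoc1 k.is_cring\<close>)
qed

lemma left_module_ltensor: "left_module k H L"
proof (rule left_module.intro[OF module_ltensor], rule left_module_axioms.intro)
  have sub: "t \<in> carrier U" if "t \<in> carrier L" for t using that by (simp add: carrier_ltensor)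
  show "hact L \<one>\<^sub>H m = m" if "m \<in> carrier L" for m
    using that by (simp add: ltensor_simps(5) carrier_ltensor)
  fix h m assume h: "h \<in> carrier H" and m: "m \<in> carrier L"
  note mU = sub[OF m]
  show "hact L h m \<in> carrier L" using h mU by (simp add: ltensor_simps(5) diag_act_in)
  {
    fix m' assume "m' \<in> carrier L"
    then show "hact L h (m \<oplus>\<^bsub>L\<^esub> m') = hact L h m \<oplus>\<^bsub>L\<^esub> hact L h m'"
      using linear_map_add[OF linear_map_diag_act[OF h] mU] sub by (simp add: ltensor_simps(2-))
  next
    fix h' assume h': "h' \<in> carrier H"
    then show "hact L (h \<oplus>\<^bsub>H\<^esub> h') m = hact L h m \<oplus>\<^bsub>L\<^esub> hact L h' m"
      using linear_map_add[OF linear_map_diag_act_left[OF mU] h] by (simp add: ltensor_simps(2-))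
    show "hact L (h \<bullet> h') m = hact L h (hact L h' m)"
      using h h' mU by (simp add: ltensor_simps(5) diag_act_mult)
  next
    fix x assume x: "x \<in> carrier k"
    then show "hact L h (x \<odot>\<^bsub>L\<^esub> m) = x \<odot>\<^bsub>L\<^esub> hact L h m"
      using linear_map_smult[OF linear_map_diag_act[OF h] x mU] by (simp add: ltensor_simps(2-))
    show "hact L (x \<odot>\<^bsub>H\<^esub> h) m = x \<odot>\<^bsub>L\<^esub> hact L h m"
      using linear_map_smult[OF linear_map_diag_act_left[OF mU] x h] by (simp add: ltensor_simps(2-))
  }
qed

lemma linear_map_from_ltensor: "linear_map k U P f \<Longrightarrow> linear_map k L P f"
  by (auto simp: linear_map_def Pi_iff carrier_ltensor ltensor_simps(2-))

lemma linear_map_into_ltensor: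
  "linear_map k P U f \<Longrightarrow> (\<And>x. x \<in> carrier P \<Longrightarrow> f x \<in> carrier L) \<Longrightarrow> linear_map k P L f"
  by (auto simp: linear_map_def Pi_iff ltensor_simps(2-))

lemma linear_map_ltensor_into: "linear_map k P L f \<Longrightarrow> linear_map k P U f"
  by (auto simp: linear_map_def Pi_iff carrier_ltensor ltensor_simps(2-))

text \<open>
  These are the elements \<open>m \<otimes>\<^sup>l n\<close>; they span \<open>M \<otimes>\<^sup>l N\<close> because pure tensors span
  \<open>M \<otimes> N\<close>.
\<close>

definition lpure where "lpure m n = D \<one>\<^sub>H (u m n)"

lemma lpure_closed: "m \<in> carrier M \<Longrightarrow> n \<in> carrier N \<Longrightarrow> lpure m n \<in> carrier L"
  unfolding lpure_def by (simp add: diag_act_in upure_closed)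

lemma linear_map_proj: "linear_map k U L (D \<one>\<^sub>H)"
  by (rule linear_map_into_ltensor[OF linear_map_diag_act]) (simp_all add: diag_act_in)

lemma bilinear_lpure: "bilinear k M N L lpure"
  unfolding lpure_def[abs_def] by (rule bilinear_compose[OF bilinear_upure linear_map_proj])

text \<open>
  \<open>h (m \<otimes>\<^sup>l n) = h\<^sub>1 m \<otimes> h\<^sub>2 n\<close>, since \<open>\<Delta> h \<Delta> 1 = \<Delta> h\<close>.
\<close>

lemma hact_lpure: "h \<in> carrier H \<Longrightarrow> m \<in> carrier M \<Longrightarrow> n \<in> carrier N \<Longrightarrow> hact L h (lpure m n) = D h (u m n)"
  using diag_act_mult[of h "\<one>\<^sub>H" "u m n"] by (simp add: lpure_def ltensor_simps(5) upure_closed)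

lemma hact_lpure_sw:
  assumes "h \<in> carrier H" "m \<in> carrier M" "n \<in> carrier N"
  shows "hact L h (lpure m n) = sw L (\<lambda>a b. lpure (hact M a m) (hact N b n)) h"
proof -
  have "hact L h (lpure m n) = D \<one>\<^sub>H (D h (u m n))"
    using assms diag_act_mult[of "\<one>\<^sub>H" h "u m n"] by (simp add: hact_lpure upure_closed)
  also have "D h (u m n) = sw U (\<lambda>a b. u (hact M a m) (hact N b n)) h"
    using assms by (simp add: diag_act_upure)
  also have "D \<one>\<^sub>H \<dots> = sw L (\<lambda>a b. lpure (hact M a m) (hact N b n)) h"
    unfolding lpure_def using assms
    by (intro sw_linear_image[OF module_utensor module_ltensor linear_map_proj]) (simp_all add: upure_closed hact_M hact_N)
  finally show ?thesis .
qed

lemma generated_ltensor: "generated k M N L lpure"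
proof -
  have "\<exists>s. set s \<subseteq> carrier M \<times> carrier N \<and> t = tsum L lpure s" if t: "t \<in> carrier L" for t
  proof (intro exI conjI)
    have tU: "t \<in> carrier U" using t by (simp add: carrier_ltensor)
    show v: "set (terms t) \<subseteq> carrier M \<times> carrier N" by (rule utensor_terms(1)[OF tU])
    have "t = D \<one>\<^sub>H (tsum U u (terms t))" using t utensor_terms(2)[OF tU] by (simp add: carrier_ltensor)
    also have "\<dots> = tsum L lpure (terms t)"
      unfolding lpure_def[abs_def]
      by (rule linear_map_tsum[OF module_utensor module_ltensor linear_map_proj v upure_closed])
    finally show "t = tsum L lpure (terms t)" .
  qed
  then show ?thesis
    unfolding generated_def by (simp add: M.module_axioms N.module_axioms module_ltensor bilinear_lpure)
qed

lemma linear_map_lift_ltensor: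
  "module k P \<Longrightarrow> bilinear k M N P B \<Longrightarrow> linear_map k L P (\<lambda>t. tsum P B (terms t))"
  by (rule linear_map_from_ltensor[OF linear_map_lift])

lemma lift_diag_act:
  assumes P: "module k P" and B: "bilinear k M N P B" and "h \<in> carrier H" "m \<in> carrier M" "n \<in> carrier N"
  shows "tsum P B (terms (D h (u m n))) = sw P (\<lambda>a b. B (hact M a m) (hact N b n)) h"
proof -
  have "tsum P B (terms (D h (u m n))) = tsum P B (terms (sw U (\<lambda>a b. u (hact M a m) (hact N b n)) h))"
    using assms by (simp add: diag_act_upure)
  also have "\<dots> = sw P (\<lambda>a b. tsum P B (terms (u (hact M a m) (hact N b n)))) h"
    using assms by (intro sw_linear_image[OF module_utensor P linear_map_lift[OF P B]]) (simp_all add: upure_closed hact_M hact_N)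
  also have "\<dots> = sw P (\<lambda>a b. B (hact M a m) (hact N b n)) h"
    using assms by (intro sw_cong) (simp_all add: lift_upure hact_M hact_N)
  finally show ?thesis .
qed

end

context prebialgebra
begin

lemma two_modulesI: "left_module k H M \<Longrightarrow> left_module k H N \<Longrightarrow> two_modules k H M N"
  by (intro two_modules.intro two_modules_axioms.intro utensor_pairI left_module_module prebialgebra_axioms)

abbreviation "tpure M N \<equiv> two_modules.lpure k H M N"

lemmas left_module_ltensor = two_modules.left_module_ltensor[OF two_modulesI]
lemmas module_ltensor = two_modules.module_ltensor[OF two_modulesI]
lemmas generated_ltensor = two_modules.generated_ltensor[OF two_modulesI]
lemmas lpure_closed = two_modules.lpure_closed[OF two_modulesI]
lemmas bilinear_lpure = two_modules.bilinear_lpure[OF two_modulesI]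

lemma linear_map_lpure_left [linear_intros]:
  assumes "left_module k H M" "left_module k H N" "linear_map k L M f" "n \<in> carrier N"
  shows "linear_map k L (ltensor k H M N) (\<lambda>x. tpure M N (f x) n)"
  by (rule bilinear_left[OF bilinear_lpure[OF assms(1,2)] assms(4,3)])

lemma linear_map_lpure_right [linear_intros]:
  assumes "left_module k H M" "left_module k H N" "linear_map k L N f" "m \<in> carrier M"
  shows "linear_map k L (ltensor k H M N) (\<lambda>x. tpure M N m (f x))"
  by (rule bilinear_right[OF bilinear_lpure[OF assms(1,2)] assms(4,3)])

definition hlinear where
  "hlinear M N f \<longleftrightarrow> linear_map k M N f \<and>
    (\<forall>h\<in>carrier H. \<forall>m\<in>carrier M. f (hact M h m) = hact N h (f m))"

lemma umap_diag_act:
  assumes M: "left_module k H M" "left_module k H N" "left_module k H M'" "left_module k H N'"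
    and f: "hlinear M M' f" and g: "hlinear N N' g" and h: "h \<in> carrier H" and t: "t \<in> carrier (utensor k M N)"
  shows "umap k M' N' f g (diag_act k H M N h t) = diag_act k H M' N' h (umap k M' N' f g t)"
proof -
  interpret A: two_modules k H M N by (rule two_modulesI) fact+
  interpret B: two_modules k H M' N' by (rule two_modulesI) fact+
  have fl: "linear_map k M M' f" and gl: "linear_map k N N' g" using f g by (auto simp: hlinear_def)
  note um = linear_map_umap[OF B.M.module_axioms B.N.module_axioms A.M.module_axioms A.N.module_axioms fl gl]
  note up = umap_upure[OF B.M.module_axioms B.N.module_axioms A.M.module_axioms A.N.module_axioms fl gl]
  show ?thesis
  proof (rule A.utensor_ext[OF B.module_utensor _ _ _ t])
    show "linear_map k A.U B.U (\<lambda>t. umap k M' N' f g (A.D h t))"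
      by (rule linear_map_compose[OF A.linear_map_diag_act[OF h] um])
    show "linear_map k A.U B.U (\<lambda>t. B.D h (umap k M' N' f g t))"
      by (rule linear_map_compose[OF um B.linear_map_diag_act[OF h]])
    fix m n assume mn: "m \<in> carrier M" "n \<in> carrier N"
    have "umap k M' N' f g (A.D h (A.u m n)) = sw B.U (\<lambda>a b. umap k M' N' f g (A.u (hact M a m) (hact N b n))) h"
      unfolding A.diag_act_upure[OF h mn] using mn
      by (intro sw_linear_image[OF A.module_utensor B.module_utensor um h]) (simp add: A.upure_closed A.hact_M A.hact_N)
    also have "\<dots> = sw B.U (\<lambda>a b. B.u (hact M' a (f m)) (hact N' b (g n))) h"
      using f g mn by (intro sw_cong[OF h]) (simp add: up A.hact_M A.hact_N hlinear_def)
    also have "\<dots> = B.D h (umap k M' N' f g (A.u m n))"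
      using mn linear_map_closed[OF fl] linear_map_closed[OF gl] by (simp add: up B.diag_act_upure[OF h])
    finally show "umap k M' N' f g (A.D h (A.u m n)) = B.D h (umap k M' N' f g (A.u m n))" .
  qed
qed

lemma umap_ltensor:
  assumes M: "left_module k H M" "left_module k H N" "left_module k H M'" "left_module k H N'"
    and f: "hlinear M M' f" and g: "hlinear N N' g"
  shows "hlinear (ltensor k H M N) (ltensor k H M' N') (umap k M' N' f g)"
    and "\<lbrakk>m \<in> carrier M; n \<in> carrier N\<rbrakk> \<Longrightarrow> umap k M' N' f g (tpure M N m n) = tpure M' N' (f m) (g n)"
proof -
  interpret A: two_modules k H M N by (rule two_modulesI) fact+
  interpret B: two_modules k H M' N' by (rule two_modulesI) fact+
  have fl: "linear_map k M M' f" and gl: "linear_map k N N' g" using f g by (auto simp: hlinear_def)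
  note um = linear_map_umap[OF B.M.module_axioms B.N.module_axioms A.M.module_axioms A.N.module_axioms fl gl]
  note up = umap_upure[OF B.M.module_axioms B.N.module_axioms A.M.module_axioms A.N.module_axioms fl gl]
  note eq = umap_diag_act[OF M f g]
  have in_L: "umap k M' N' f g t \<in> carrier B.L" if "t \<in> carrier A.L" for t
    using that eq[of "\<one>\<^sub>H" t] linear_map_closed[OF um] by (simp add: A.carrier_ltensor B.carrier_ltensor)
  show "hlinear A.L B.L (umap k M' N' f g)"
    unfolding hlinear_def
    using B.linear_map_into_ltensor[OF A.linear_map_from_ltensor[OF um] in_L] eq
    by (simp add: ltensor_simps(5) A.carrier_ltensor)
  show "umap k M' N' f g (A.lpure m n) = B.lpure (f m) (g n)" if "m \<in> carrier M" "n \<in> carrier N"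
    using that eq[of "\<one>\<^sub>H" "A.u m n"] by (simp add: A.lpure_def B.lpure_def A.upure_closed up)
qed

end

section \<open>Reassociating threefold tensor products\<close>

text \<open>
  The associativity constraints of both categories are instances of one formula, with
  \<open>S = M \<otimes> N\<close>, \<open>Q = N \<otimes> P\<close> or \<open>S = M \<otimes>\<^sup>l N\<close>, \<open>Q = N \<otimes>\<^sup>l P\<close>.  All that is needed of \<open>S\<close> is that
  its elements are formal sums over which bilinear maps can be summed; \<open>q\<close> forms the new inner
  tensor.
\<close>

lemma
  fixes M :: "('k, ('k, 'h, 'x) elt, 'r) module_scheme" and N :: "('k, ('k, 'h, 'x) elt, 's) module_scheme"
    and P :: "('k, ('k, 'h, 'x) elt, 't) module_scheme" and S :: "('k, ('k, 'h, 'x) elt, 'v) module_scheme"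
    and Q :: "('k, ('k, 'h, 'x) elt, 'w) module_scheme"
  assumes M: "module k M" and N: "module k N" and P: "module k P" and S: "module k S" and Q: "module k Q"
    and q: "bilinear k N P Q q"
    and valid: "\<And>s. s \<in> carrier S \<Longrightarrow> set (terms s) \<subseteq> carrier M \<times> carrier N"
    and lift: "\<And>B. bilinear k M N (utensor k M Q) B \<Longrightarrow>
        linear_map k S (utensor k M Q) (\<lambda>s. tsum (utensor k M Q) B (terms s))"
  shows bilinear_assoc: "bilinear k S P (utensor k M Q)
      (\<lambda>s p. tsum (utensor k M Q) (\<lambda>m n. upure k M Q m (q n p)) (terms s))"
    and assoc_tsum: "t \<in> carrier (utensor k S P) \<Longrightarrow>
      unf k M Q [(m, q n p). (s, p) \<leftarrow> terms t, (m, n) \<leftarrow> terms s] =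
      tsum (utensor k M Q) (\<lambda>s p. tsum (utensor k M Q) (\<lambda>m n. upure k M Q m (q n p)) (terms s)) (terms t)"
proof -
  interpret MQ: utensor_pair k M Q by (rule utensor_pairI) fact+
  interpret SP: utensor_pair k S P by (rule utensor_pairI) fact+
  interpret W: module k MQ.U by (rule MQ.module_utensor)
  show "bilinear k S P MQ.U (\<lambda>s p. tsum MQ.U (\<lambda>m n. MQ.u m (q n p)) (terms s))"
  proof (rule bilinearI)
    fix p assume p: "p \<in> carrier P"
    have "bilinear k M N MQ.U (\<lambda>m n. MQ.u m (q n p))"
      by (intro bilinearI bilinear_right[OF MQ.bilinear_upure _ bilinear_left[OF q p linear_map_id]]
        bilinear_left[OF MQ.bilinear_upure _ linear_map_id] bilinear_closed[OF q] p)
    then show "linear_map k S MQ.U (\<lambda>s. tsum MQ.U (\<lambda>m n. MQ.u m (q n p)) (terms s))" by (rule lift)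
  next
    fix s assume s: "s \<in> carrier S"
    show "linear_map k P MQ.U (\<lambda>p. tsum MQ.U (\<lambda>m n. MQ.u m (q n p)) (terms s))"
      by (rule linear_map_tsum_family[OF P MQ.module_utensor valid[OF s]])
        (intro bilinear_right[OF MQ.bilinear_upure] bilinear_right[OF q] linear_map_id)
  qed
  assume t: "t \<in> carrier SP.U"
  note v = SP.utensor_terms(1)[OF t]
  let ?F = "\<lambda>s p. map (\<lambda>(m, n). (m, q n p)) (terms s)"
  have F: "set (?F s p) \<subseteq> carrier M \<times> carrier Q" if "s \<in> carrier S" "p \<in> carrier P" for s p
    using valid[OF that(1)] that(2) bilinear_closed[OF q] by auto
  have F_sum: "tsum MQ.U MQ.u (?F s p) = tsum MQ.U (\<lambda>m n. MQ.u m (q n p)) (terms s)" for s p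
    using tsum_map_prod[of MQ.U MQ.u "\<lambda>m. m" "\<lambda>n. q n p" "terms s"] by (simp add: map_prod_def)
  have "unf k M Q (concat (map (\<lambda>(s, p). ?F s p) (terms t))) =
      tsum MQ.U MQ.u (concat (map (\<lambda>(s, p). ?F s p) (terms t)))"
    by (rule MQ.unf_tsum, rule set_concat_pairs[OF v F])
  also have "\<dots> = tsum MQ.U (\<lambda>s p. tsum MQ.U MQ.u (?F s p)) (terms t)"
    by (rule W.tsum_concat[OF v F MQ.upure_closed])
  finally show "unf k M Q (concat (map (\<lambda>(s, p). ?F s p) (terms t))) =
      tsum MQ.U (\<lambda>s p. tsum MQ.U (\<lambda>m n. MQ.u m (q n p)) (terms s)) (terms t)"
    by (simp only: F_sum)
qed

lemma bilinear_assoc_inverse: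
  fixes N :: "('k, ('k, 'h, 'x) elt, 's) module_scheme" and P :: "('k, ('k, 'h, 'x) elt, 't) module_scheme"
    and T :: "('k, ('k, 'h, 'x) elt, 'w) module_scheme"
  assumes M: "module k M" and N: "module k N" and P: "module k P" and S: "module k S" and T: "module k T"
    and q: "bilinear k M N S q"
    and valid: "\<And>s. s \<in> carrier T \<Longrightarrow> set (terms s) \<subseteq> carrier N \<times> carrier P"
    and lift: "\<And>B. bilinear k N P (utensor k S P) B \<Longrightarrow>
        linear_map k T (utensor k S P) (\<lambda>s. tsum (utensor k S P) B (terms s))"
  shows "bilinear k M T (utensor k S P)
      (\<lambda>m s. tsum (utensor k S P) (\<lambda>n p. upure k S P (q m n) p) (terms s))"
proof -
  interpret SP: utensor_pair k S P by (rule utensor_pairI) fact+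
  show ?thesis
  proof (rule bilinearI)
    fix m assume m: "m \<in> carrier M"
    have "bilinear k N P SP.U (\<lambda>n p. SP.u (q m n) p)"
      by (intro bilinearI bilinear_left[OF SP.bilinear_upure _ bilinear_right[OF q m linear_map_id]]
        bilinear_right[OF SP.bilinear_upure _ linear_map_id] bilinear_closed[OF q] m)
    then show "linear_map k T SP.U (\<lambda>s. tsum SP.U (\<lambda>n p. SP.u (q m n) p) (terms s))" by (rule lift)
  next
    fix s assume s: "s \<in> carrier T"
    show "linear_map k M SP.U (\<lambda>m. tsum SP.U (\<lambda>n p. SP.u (q m n) p) (terms s))"
      by (rule linear_map_tsum_family[OF M SP.module_utensor valid[OF s]])
        (intro bilinear_left[OF SP.bilinear_upure] bilinear_left[OF q] linear_map_id)
  qed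
qed

lemma (in two_modules) ltensor_terms: "t \<in> carrier L \<Longrightarrow> set (terms t) \<subseteq> carrier M \<times> carrier N"
  using utensor_terms(1) by (simp add: carrier_ltensor)

context prebialgebra
begin

definition assoc_fun where
  "assoc_fun M N P t = unf k M (ltensor k H N P)
     [(m, diag_act k H N P \<one>\<^sub>H (upure k N P n p)). (s, p) \<leftarrow> terms t, (m, n) \<leftarrow> terms s]"

context
  fixes M N P :: "('k, ('k, 'h, 'x) elt, 'h) hmodule"
  assumes lmods: "left_module k H M" "left_module k H N" "left_module k H P"
begin

interpretation MN: two_modules k H M N by (rule two_modulesI) (rule lmods)+
interpretation NP: two_modules k H N P by (rule two_modulesI) (rule lmods)+
interpretation l: two_modules k H MN.L P by (rule two_modulesI) (rule lmods MN.left_module_ltensor)+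
interpretation r: two_modules k H M NP.L by (rule two_modulesI) (rule lmods NP.left_module_ltensor)+

text \<open>
  On \<open>s \<otimes> p\<close> with \<open>s = h\<^sub>1 m \<otimes> h\<^sub>2 n\<close> the associator reads off the two factors of \<open>s\<close>.  Coassociativity
  then moves the inner coproduct to the right, where \<open>h\<^sub>2 n \<otimes>\<^sup>l h\<^sub>3 p\<close> is the action on \<open>n \<otimes>\<^sup>l p\<close>.  The case
  \<open>h = 1\<close> is the formula on generators; the general case is \<open>H\<close>-linearity.
\<close>

lemma
  shows linear_map_assoc_fun: "linear_map k l.U r.U (assoc_fun M N P)"
    and assoc_fun_diag_act: "\<lbrakk>h \<in> carrier H; m \<in> carrier M; n \<in> carrier N; p \<in> carrier P\<rbrakk> \<Longrightarrow>
      assoc_fun M N P (l.D h (l.u (MN.lpure m n) p)) = r.D h (r.u m (NP.lpure n p))"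
proof -
  let ?A = "\<lambda>s p. tsum r.U (\<lambda>m n. r.u m (NP.lpure n p)) (terms s)"
  note ax = MN.M.module_axioms MN.N.module_axioms NP.N.module_axioms l.M.module_axioms r.N.module_axioms
    NP.bilinear_lpure MN.ltensor_terms MN.linear_map_lift_ltensor[OF r.module_utensor]
  have A: "bilinear k MN.L P r.U ?A" by (rule bilinear_assoc[OF ax])
  have eq: "assoc_fun M N P t = tsum r.U ?A (terms t)" if "t \<in> carrier l.U" for t
    using assoc_tsum[OF ax that] by (simp add: assoc_fun_def NP.lpure_def)
  show "linear_map k l.U r.U (assoc_fun M N P)"
    by (rule linear_map_cong[OF l.module_utensor l.linear_map_lift[OF r.module_utensor A]]) (simp add: eq)
  fix h m n p assume a: "h \<in> carrier H" "m \<in> carrier M" "n \<in> carrier N" "p \<in> carrier P"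
  have B: "bilinear k M N r.U (\<lambda>m n. r.u m (NP.lpure n p'))" if "p' \<in> carrier P" for p'
    by (intro linear_intros lmods NP.left_module_ltensor MN.M.module_axioms NP.module_ltensor NP.lpure_closed that)
  have T: "trilinear k H r.U (\<lambda>x y z. r.u (hact M x m) (NP.lpure (hact N y n) (hact P z p)))"
    using a by (intro trilinearI linear_intros lmods NP.left_module_ltensor MN.M.module_axioms NP.module_ltensor
       NP.lpure_closed MN.hact_M MN.hact_N NP.hact_N)
  have "assoc_fun M N P (l.D h (l.u (MN.lpure m n) p)) =
      sw r.U (\<lambda>x y. ?A (hact MN.L x (MN.lpure m n)) (hact P y p)) h"
    using a by (simp add: eq l.diag_act_closed l.upure_closed MN.lpure_closed l.lift_diag_act[OF r.module_utensor A])
  also have "\<dots> = sw r.U (\<lambda>x y. sw r.U (\<lambda>c d. r.u (hact M c m) (NP.lpure (hact N d n) (hact P y p))) x) h"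
    using a by (intro sw_cong) (simp_all add: MN.hact_lpure NP.hact_N MN.lift_diag_act[OF r.module_utensor B])
  also have "\<dots> = sw r.U (\<lambda>x y. sw r.U (\<lambda>c d. r.u (hact M x m) (NP.lpure (hact N c n) (hact P d p))) y) h"
    by (rule sw_coassoc[OF r.module_utensor T a(1)])
  also have "\<dots> = sw r.U (\<lambda>x y. r.u (hact M x m) (sw NP.L (\<lambda>c d. NP.lpure (hact N c n) (hact P d p)) y)) h"
    using a by (intro sw_cong sw_linear_image[symmetric, OF NP.module_ltensor r.module_utensor])
      (simp_all add: r.bilinear_upure bilinear_right[OF r.bilinear_upure] linear_map_id NP.lpure_closed MN.hact_M MN.hact_N NP.hact_N)
  also have "\<dots> = sw r.U (\<lambda>x y. r.u (hact M x m) (hact NP.L y (NP.lpure n p))) h"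
    using a by (intro sw_cong) (simp_all add: NP.hact_lpure_sw)
  also have "\<dots> = r.D h (r.u m (NP.lpure n p))"
    using a by (simp add: r.diag_act_upure NP.lpure_closed)
  finally show "assoc_fun M N P (l.D h (l.u (MN.lpure m n) p)) = r.D h (r.u m (NP.lpure n p))" .
qed

lemma assoc_fun_lpure: "\<lbrakk>m \<in> carrier M; n \<in> carrier N; p \<in> carrier P\<rbrakk> \<Longrightarrow>
  assoc_fun M N P (l.lpure (MN.lpure m n) p) = r.lpure m (NP.lpure n p)"
  by (simp add: l.lpure_def r.lpure_def assoc_fun_diag_act)

text \<open>
  The associator takes values in \<open>M \<otimes> (N \<otimes>\<^sup>l P)\<close>; that they lie in \<open>M \<otimes>\<^sup>l (N \<otimes>\<^sup>l P)\<close> is the statement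
  that \<open>\<pi>\<close> fixes them, which can be checked on generators.
\<close>

lemma hlinear_assoc_fun: "hlinear l.L r.L (assoc_fun M N P)"
proof -
  let ?a = "assoc_fun M N P"
  note ext = generated_ext_left[OF MN.generated_ltensor l.generated_ltensor]
  note lin = l.linear_map_from_ltensor[OF linear_map_assoc_fun]
  have in_L: "?a t \<in> carrier r.L" if t: "t \<in> carrier l.L" for t
  proof -
    have "?a t = r.D \<one>\<^sub>H (?a t)"
    proof (rule ext[OF r.module_utensor lin _ _ t])
      show "linear_map k l.L r.U (\<lambda>t. r.D \<one>\<^sub>H (?a t))"
        by (rule linear_map_compose[OF lin r.linear_map_diag_act]) simp
      fix m n p assume "m \<in> carrier M" "n \<in> carrier N" "p \<in> carrier P"
      then show "?a (l.lpure (MN.lpure m n) p) = r.D \<one>\<^sub>H (?a (l.lpure (MN.lpure m n) p))"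
        using r.lpure_closed[of m "NP.lpure n p"] by (simp add: assoc_fun_lpure NP.lpure_closed r.carrier_ltensor)
    qed
    then show ?thesis using linear_map_closed[OF lin t] by (simp add: r.carrier_ltensor)
  qed
  have act: "?a (l.D h t) = r.D h (?a t)" if h: "h \<in> carrier H" and t: "t \<in> carrier l.L" for h t
  proof (rule ext[OF r.module_utensor _ _ _ t])
    show "linear_map k l.L r.U (\<lambda>t. ?a (l.D h t))"
      by (rule l.linear_map_from_ltensor[OF linear_map_compose[OF l.linear_map_diag_act[OF h] linear_map_assoc_fun]])
    show "linear_map k l.L r.U (\<lambda>t. r.D h (?a t))"
      by (rule linear_map_compose[OF lin r.linear_map_diag_act[OF h]])
    fix m n p assume a: "m \<in> carrier M" "n \<in> carrier N" "p \<in> carrier P"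
    have "l.D h (l.lpure (MN.lpure m n) p) = l.D h (l.u (MN.lpure m n) p)"
      "r.D h (r.lpure m (NP.lpure n p)) = r.D h (r.u m (NP.lpure n p))"
      using a h l.hact_lpure[of h "MN.lpure m n" p] r.hact_lpure[of h m "NP.lpure n p"]
      by (simp_all add: MN.lpure_closed NP.lpure_closed ltensor_simps(5))
    then show "?a (l.D h (l.lpure (MN.lpure m n) p)) = r.D h (?a (l.lpure (MN.lpure m n) p))"
      using a h by (simp add: assoc_fun_lpure assoc_fun_diag_act)
  qed
  show ?thesis
    unfolding hlinear_def using r.linear_map_into_ltensor[OF lin in_L] act by (simp add: ltensor_simps(5))
qed

lemma assoc_fun_inverse:
  "\<exists>j. linear_map k r.L l.L j \<and> (\<forall>m\<in>carrier M. \<forall>n\<in>carrier N. \<forall>p\<in>carrier P.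
     j (r.lpure m (NP.lpure n p)) = l.lpure (MN.lpure m n) p)"
proof -
  let ?B = "\<lambda>m s. tsum l.U (\<lambda>n p. l.u (MN.lpure m n) p) (terms s)"
  let ?b = "\<lambda>t. tsum l.U ?B (terms t)"
  have B: "bilinear k M NP.L l.U ?B"
    by (rule bilinear_assoc_inverse[OF MN.M.module_axioms MN.N.module_axioms NP.N.module_axioms l.M.module_axioms
      r.N.module_axioms MN.bilinear_lpure NP.ltensor_terms NP.linear_map_lift_ltensor[OF l.module_utensor]])
  have lin: "linear_map k r.U l.U ?b" by (rule r.linear_map_lift[OF l.module_utensor B])
  have eq: "?b (r.lpure m (NP.lpure n p)) = l.lpure (MN.lpure m n) p"
    if a: "m \<in> carrier M" "n \<in> carrier N" "p \<in> carrier P" for m n p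
  proof -
    have B': "bilinear k N P l.U (\<lambda>n p. l.u (MN.lpure m' n) p)" if "m' \<in> carrier M" for m'
      by (intro linear_intros lmods MN.left_module_ltensor MN.module_ltensor NP.N.module_axioms MN.lpure_closed that)
    have T: "trilinear k H l.U (\<lambda>x y z. l.u (MN.lpure (hact M x m) (hact N y n)) (hact P z p))"
      using a by (intro trilinearI linear_intros lmods MN.left_module_ltensor MN.module_ltensor NP.N.module_axioms
         MN.lpure_closed MN.hact_M MN.hact_N NP.hact_N)
    have "?b (r.lpure m (NP.lpure n p)) =
      sw l.U (\<lambda>x y. ?B (hact M x m) (hact NP.L y (NP.lpure n p))) \<one>\<^sub>H"
      using a by (simp add: r.lpure_def NP.lpure_closed r.lift_diag_act[OF l.module_utensor B])
    also have "\<dots> = sw l.U (\<lambda>x y. sw l.U (\<lambda>c d. l.u (MN.lpure (hact M x m) (hact N c n)) (hact P d p)) y) \<one>\<^sub>H"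
      using a by (intro sw_cong) (simp_all add: NP.hact_lpure MN.hact_M NP.lift_diag_act[OF l.module_utensor B'])
    also have "\<dots> = sw l.U (\<lambda>x y. sw l.U (\<lambda>c d. l.u (MN.lpure (hact M c m) (hact N d n)) (hact P y p)) x) \<one>\<^sub>H"
      by (rule sw_coassoc[OF l.module_utensor T, symmetric]) simp
    also have "\<dots> = sw l.U (\<lambda>x y. l.u (sw MN.L (\<lambda>c d. MN.lpure (hact M c m) (hact N d n)) x) (hact P y p)) \<one>\<^sub>H"
      using a by (intro sw_cong sw_linear_image[symmetric, OF MN.module_ltensor l.module_utensor])
        (simp_all add: bilinear_left[OF l.bilinear_upure] linear_map_id MN.lpure_closed MN.hact_M MN.hact_N NP.hact_N)
    also have "\<dots> = sw l.U (\<lambda>x y. l.u (hact MN.L x (MN.lpure m n)) (hact P y p)) \<one>\<^sub>H"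
      using a by (intro sw_cong) (simp_all add: MN.hact_lpure_sw)
    also have "\<dots> = l.lpure (MN.lpure m n) p"
      using a by (simp add: l.lpure_def l.diag_act_upure MN.lpure_closed)
    finally show ?thesis .
  qed
  note lin' = r.linear_map_from_ltensor[OF lin]
  have in_L: "?b t \<in> carrier l.L" if t: "t \<in> carrier r.L" for t
  proof -
    have "?b t = l.D \<one>\<^sub>H (?b t)"
    proof (rule generated_ext_right[OF NP.generated_ltensor r.generated_ltensor l.module_utensor lin' _ _ t])
      show "linear_map k r.L l.U (\<lambda>t. l.D \<one>\<^sub>H (?b t))"
        by (rule linear_map_compose[OF lin' l.linear_map_diag_act]) simp
      fix m n p assume "m \<in> carrier M" "n \<in> carrier N" "p \<in> carrier P"
      then show "?b (r.lpure m (NP.lpure n p)) = l.D \<one>\<^sub>H (?b (r.lpure m (NP.lpure n p)))"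
        using l.lpure_closed[of "MN.lpure m n" p] by (simp add: eq MN.lpure_closed l.carrier_ltensor)
    qed
    then show ?thesis using linear_map_closed[OF lin' t] by (simp add: l.carrier_ltensor)
  qed
  show ?thesis
    by (rule exI[of _ ?b]) (use eq l.linear_map_into_ltensor[OF lin' in_L] in auto)
qed

end

end

section \<open>The maps f and f' on the functionals g h\<close>

lemma lsum_regular: "lsum (regular_module k) xs = lsum k xs"
  by (induction xs) simp_all

locale unit_calculus = monoidal_prebialgebra k H
  for k :: "'k ring" and H :: "('k, 'h) prebialg"
begin

abbreviation "R \<equiv> regular_module k"

lemma module_R: "module k R" by (rule module_regular[OF k.is_cring])

lemma counit_lm:
  assumes "h \<in> carrier H" "u \<in> carrier H" "l \<in> carrier H"
  shows "counit H (h \<bullet> u \<bullet> l) = sw R (\<lambda>a b. counit H (h \<bullet> a) \<otimes>\<^bsub>k\<^esub> counit H (b \<bullet> l)) u"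
  using lm assms by (simp add: left_monoidal_def sw_def tsum_def lsum_regular)

lemma counit_rm:
  assumes "h \<in> carrier H" "u \<in> carrier H" "l \<in> carrier H"
  shows "counit H (h \<bullet> u \<bullet> l) = sw R (\<lambda>a b. counit H (h \<bullet> b) \<otimes>\<^bsub>k\<^esub> counit H (a \<bullet> l)) u"
  using rm assms by (simp add: right_monoidal_def sw_def tsum_def lsum_regular)

text \<open>
  \<open>fg\<close> and \<open>fg'\<close> are \<open>f \<circ> g\<close> and \<open>f' \<circ> g\<close>.  Since \<open>H\<^sub>L\<^sup>*\<close> is the image of \<open>g\<close>, they determine \<open>f\<close> and
  \<open>f'\<close> on the unit object.
\<close>

definition fg where "fg h = fmap_left H (gmap H h)"
definition fg' where "fg' h = fmap_right H (gmap H h)"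

lemma fg_sw: "h \<in> carrier H \<Longrightarrow> fg h = sw H (\<lambda>a b. counit H (a \<bullet> h) \<odot>\<^bsub>H\<^esub> b) \<one>\<^sub>H"
  unfolding fg_def fmap_left_def sw_def tsum_def[symmetric]
  by (rule tsum_cong'[OF comult_valid]) (simp_all add: gmap_def)

lemma fg'_sw: "h \<in> carrier H \<Longrightarrow> fg' h = sw H (\<lambda>a b. counit H (b \<bullet> h) \<odot>\<^bsub>H\<^esub> a) \<one>\<^sub>H"
  unfolding fg'_def fmap_right_def sw_def tsum_def[symmetric]
  by (rule tsum_cong'[OF comult_valid]) (simp_all add: gmap_def)

lemma fg_closed: "h \<in> carrier H \<Longrightarrow> fg h \<in> carrier H"
  unfolding fg_sw by (rule sw_closed[OF H.module_axioms]) simp_all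

lemma fg'_closed: "h \<in> carrier H \<Longrightarrow> fg' h \<in> carrier H"
  unfolding fg'_sw by (rule sw_closed[OF H.module_axioms]) simp_all

lemma fg_one: "fg \<one>\<^sub>H = \<one>\<^sub>H"
proof -
  have "fg \<one>\<^sub>H = sw H (\<lambda>a b. counit H a \<odot>\<^bsub>H\<^esub> b) \<one>\<^sub>H"
    unfolding fg_sw[OF H.one_closed] by (intro sw_cong) simp_all
  then show ?thesis by (simp add: sw_counit_left H.module_axioms linear_map_id)
qed

lemma fg'_one: "fg' \<one>\<^sub>H = \<one>\<^sub>H"
proof -
  have "fg' \<one>\<^sub>H = sw H (\<lambda>a b. counit H b \<odot>\<^bsub>H\<^esub> a) \<one>\<^sub>H"
    unfolding fg'_sw[OF H.one_closed] by (intro sw_cong) simp_all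
  then show ?thesis by (simp add: sw_counit_right H.module_axioms linear_map_id)
qed

lemma linear_map_fg [linear_intros]: "linear_map k M H f \<Longrightarrow> linear_map k M H (\<lambda>x. fg (f x))"
proof (rule linear_map_compose[of k M H f])
  show "linear_map k H H fg"
    by (rule linear_map_cong[OF H.module_axioms, where f = "\<lambda>h. sw H (\<lambda>a b. counit H (a \<bullet> h) \<odot>\<^bsub>H\<^esub> b) \<one>\<^sub>H"])
      (intro linear_intros H.module_axioms H.one_closed, simp_all add: fg_sw)
qed

lemma linear_map_fg' [linear_intros]: "linear_map k M H f \<Longrightarrow> linear_map k M H (\<lambda>x. fg' (f x))"
proof (rule linear_map_compose[of k M H f])
  show "linear_map k H H fg'"
    by (rule linear_map_cong[OF H.module_axioms, where f = "\<lambda>h. sw H (\<lambda>a b. counit H (b \<bullet> h) \<odot>\<^bsub>H\<^esub> a) \<one>\<^sub>H"])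
      (intro linear_intros H.module_axioms H.one_closed, simp_all add: fg'_sw)
qed

text \<open>
  Expand the right-hand side for \<open>u = u 1\<close> as \<open>\<epsilon> (u\<^sub>1 1\<^sub>1 h) u\<^sub>2 1\<^sub>2\<close>, split \<open>\<epsilon> (u\<^sub>1 1\<^sub>1 h)\<close> by (rm) at
  the middle factor \<open>1\<^sub>1\<close> and use coassociativity of \<open>\<Delta>\<close> at \<open>1\<close>.  This gives
  \<open>\<epsilon> (1\<^sub>1 h) \<epsilon> (u\<^sub>1 1\<^sub>2) u\<^sub>2 1\<^sub>3\<close>, and the last three factors are the counit identity for \<open>u 1\<^sub>2\<close>.
\<close>

lemma mult_fg:
  assumes u: "u \<in> carrier H" and h: "h \<in> carrier H"
  shows "u \<bullet> fg h = sw H (\<lambda>a b. counit H (a \<bullet> h) \<odot>\<^bsub>H\<^esub> b) u"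
proof -
  note cl = H.module_axioms H.m_closed H.smult_closed counit_closed H.one_closed sw_closed
  have B: "bilinear k H H H (\<lambda>a b. counit H (a \<bullet> h) \<odot>\<^bsub>H\<^esub> b)"
    by (intro linear_intros cl h)
  have T: "trilinear k H H (\<lambda>x y z. counit H (x \<bullet> h) \<odot>\<^bsub>H\<^esub> (counit H (a \<bullet> y) \<odot>\<^bsub>H\<^esub> (b \<bullet> z)))"
    if "a \<in> carrier H" "b \<in> carrier H" for a b
    by (intro trilinearI linear_intros cl h that)
  have step: "counit H (a \<bullet> c \<bullet> h) \<odot>\<^bsub>H\<^esub> (b \<bullet> d) =
      sw H (\<lambda>x y. counit H (x \<bullet> h) \<odot>\<^bsub>H\<^esub> (counit H (a \<bullet> y) \<odot>\<^bsub>H\<^esub> (b \<bullet> d))) c"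
    if a: "a \<in> carrier H" "b \<in> carrier H" "c \<in> carrier H" "d \<in> carrier H" for a b c d
  proof -
    have "counit H (a \<bullet> c \<bullet> h) \<odot>\<^bsub>H\<^esub> (b \<bullet> d) =
       sw H (\<lambda>x y. (counit H (a \<bullet> y) \<otimes>\<^bsub>k\<^esub> counit H (x \<bullet> h)) \<odot>\<^bsub>H\<^esub> (b \<bullet> d)) c"
      unfolding counit_rm[OF a(1,3) h] using a h
      by (intro sw_linear_image[OF module_R] linear_intros H.module_axioms) simp_all
    also have "\<dots> = sw H (\<lambda>x y. counit H (x \<bullet> h) \<odot>\<^bsub>H\<^esub> (counit H (a \<bullet> y) \<odot>\<^bsub>H\<^esub> (b \<bullet> d))) c"
      using a h by (intro sw_cong) (simp_all add: H.smult_assoc1[symmetric] k.m_comm)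
    finally show ?thesis .
  qed
  have fin: "sw H (\<lambda>a b. sw H (\<lambda>x y. counit H (c \<bullet> h) \<odot>\<^bsub>H\<^esub> (counit H (a \<bullet> x) \<odot>\<^bsub>H\<^esub> (b \<bullet> y))) d) u
      = counit H (c \<bullet> h) \<odot>\<^bsub>H\<^esub> (u \<bullet> d)"
    if c: "c \<in> carrier H" "d \<in> carrier H" for c d
  proof -
    have "counit H (c \<bullet> h) \<odot>\<^bsub>H\<^esub> (u \<bullet> d) =
      counit H (c \<bullet> h) \<odot>\<^bsub>H\<^esub> sw H (\<lambda>a b. counit H a \<odot>\<^bsub>H\<^esub> b) (u \<bullet> d)"
      using sw_counit_left[OF H.module_axioms linear_map_id, of "u \<bullet> d"] u c by simp
    also have "\<dots> = counit H (c \<bullet> h) \<odot>\<^bsub>H\<^esub>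
        sw H (\<lambda>a b. sw H (\<lambda>x y. counit H (a \<bullet> x) \<odot>\<^bsub>H\<^esub> (b \<bullet> y)) d) u"
      by (subst sw_mult[OF H.module_axioms _ u c(2)]) (intro linear_intros cl, simp_all)
    also have "\<dots> = sw H (\<lambda>a b. counit H (c \<bullet> h) \<odot>\<^bsub>H\<^esub>
        sw H (\<lambda>x y. counit H (a \<bullet> x) \<odot>\<^bsub>H\<^esub> (b \<bullet> y)) d) u"
      using u c h by (intro sw_linear_image linear_intros cl)
    also have "\<dots> = sw H (\<lambda>a b. sw H (\<lambda>x y. counit H (c \<bullet> h) \<odot>\<^bsub>H\<^esub> (counit H (a \<bullet> x) \<odot>\<^bsub>H\<^esub> (b \<bullet> y))) d) u"
      using u c h by (intro sw_cong sw_linear_image linear_intros cl)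
    finally show ?thesis by simp
  qed
  have "sw H (\<lambda>a b. counit H (a \<bullet> h) \<odot>\<^bsub>H\<^esub> b) u = sw H (\<lambda>a b. counit H (a \<bullet> h) \<odot>\<^bsub>H\<^esub> b) (u \<bullet> \<one>\<^sub>H)"
    using u by simp
  also have "\<dots> = sw H (\<lambda>a b. sw H (\<lambda>c d. counit H (a \<bullet> c \<bullet> h) \<odot>\<^bsub>H\<^esub> (b \<bullet> d)) \<one>\<^sub>H) u"
    by (rule sw_mult[OF H.module_axioms B u H.one_closed])
  also have "\<dots> = sw H (\<lambda>a b. sw H (\<lambda>c d. sw H (\<lambda>x y.
      counit H (x \<bullet> h) \<odot>\<^bsub>H\<^esub> (counit H (a \<bullet> y) \<odot>\<^bsub>H\<^esub> (b \<bullet> d))) c) \<one>\<^sub>H) u"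
    by (intro sw_cong u H.one_closed step)
  also have "\<dots> = sw H (\<lambda>a b. sw H (\<lambda>c d. sw H (\<lambda>x y.
      counit H (c \<bullet> h) \<odot>\<^bsub>H\<^esub> (counit H (a \<bullet> x) \<odot>\<^bsub>H\<^esub> (b \<bullet> y))) d) \<one>\<^sub>H) u"
    by (intro sw_cong u sw_coassoc[OF H.module_axioms T]) simp_all
  also have "\<dots> = sw H (\<lambda>c d. sw H (\<lambda>a b. sw H (\<lambda>x y.
      counit H (c \<bullet> h) \<odot>\<^bsub>H\<^esub> (counit H (a \<bullet> x) \<odot>\<^bsub>H\<^esub> (b \<bullet> y))) d) u) \<one>\<^sub>H"
    by (intro sw_swap cl u h)
  also have "\<dots> = sw H (\<lambda>c d. counit H (c \<bullet> h) \<odot>\<^bsub>H\<^esub> (u \<bullet> d)) \<one>\<^sub>H"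
    by (intro sw_cong H.one_closed fin)
  also have "\<dots> = sw H (\<lambda>c d. u \<bullet> (counit H (c \<bullet> h) \<odot>\<^bsub>H\<^esub> d)) \<one>\<^sub>H"
    using u h by (intro sw_cong) (simp_all add: smult_mult_right)
  also have "\<dots> = u \<bullet> fg h"
    unfolding fg_sw[OF h] using u h
    by (intro sw_linear_image[symmetric] linear_intros cl)
  finally show ?thesis by simp
qed

text \<open>
  The mirror image, with (lm) in place of (rm).
\<close>

lemma mult_fg':
  assumes u: "u \<in> carrier H" and h: "h \<in> carrier H"
  shows "u \<bullet> fg' h = sw H (\<lambda>a b. counit H (b \<bullet> h) \<odot>\<^bsub>H\<^esub> a) u"
proof -
  note cl = H.module_axioms H.m_closed H.smult_closed counit_closed H.one_closed sw_closed
  have B: "bilinear k H H H (\<lambda>a b. counit H (b \<bullet> h) \<odot>\<^bsub>H\<^esub> a)"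
    by (intro linear_intros cl h)
  have T: "trilinear k H H (\<lambda>x y z. counit H (z \<bullet> h) \<odot>\<^bsub>H\<^esub> (counit H (b \<bullet> y) \<odot>\<^bsub>H\<^esub> (a \<bullet> x)))"
    if "a \<in> carrier H" "b \<in> carrier H" for a b
    by (intro trilinearI linear_intros cl h that)
  have step: "counit H (b \<bullet> d \<bullet> h) \<odot>\<^bsub>H\<^esub> (a \<bullet> c) =
      sw H (\<lambda>x y. counit H (y \<bullet> h) \<odot>\<^bsub>H\<^esub> (counit H (b \<bullet> x) \<odot>\<^bsub>H\<^esub> (a \<bullet> c))) d"
    if a: "a \<in> carrier H" "b \<in> carrier H" "c \<in> carrier H" "d \<in> carrier H" for a b c d
  proof -
    have "counit H (b \<bullet> d \<bullet> h) \<odot>\<^bsub>H\<^esub> (a \<bullet> c) =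
       sw H (\<lambda>x y. (counit H (b \<bullet> x) \<otimes>\<^bsub>k\<^esub> counit H (y \<bullet> h)) \<odot>\<^bsub>H\<^esub> (a \<bullet> c)) d"
      unfolding counit_lm[OF a(2,4) h] using a h
      by (intro sw_linear_image[OF module_R] linear_intros H.module_axioms) simp_all
    also have "\<dots> = sw H (\<lambda>x y. counit H (y \<bullet> h) \<odot>\<^bsub>H\<^esub> (counit H (b \<bullet> x) \<odot>\<^bsub>H\<^esub> (a \<bullet> c))) d"
      using a h by (intro sw_cong) (simp_all add: H.smult_assoc1[symmetric] k.m_comm)
    finally show ?thesis .
  qed
  have fin: "sw H (\<lambda>a b. sw H (\<lambda>x y. counit H (d \<bullet> h) \<odot>\<^bsub>H\<^esub> (counit H (b \<bullet> y) \<odot>\<^bsub>H\<^esub> (a \<bullet> x))) c) u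
      = counit H (d \<bullet> h) \<odot>\<^bsub>H\<^esub> (u \<bullet> c)"
    if c: "c \<in> carrier H" "d \<in> carrier H" for c d
  proof -
    have "counit H (d \<bullet> h) \<odot>\<^bsub>H\<^esub> (u \<bullet> c) =
      counit H (d \<bullet> h) \<odot>\<^bsub>H\<^esub> sw H (\<lambda>a b. counit H b \<odot>\<^bsub>H\<^esub> a) (u \<bullet> c)"
      using sw_counit_right[OF H.module_axioms linear_map_id, of "u \<bullet> c"] u c by simp
    also have "\<dots> = counit H (d \<bullet> h) \<odot>\<^bsub>H\<^esub>
        sw H (\<lambda>a b. sw H (\<lambda>x y. counit H (b \<bullet> y) \<odot>\<^bsub>H\<^esub> (a \<bullet> x)) c) u"
      by (subst sw_mult[OF H.module_axioms _ u c(1)]) (intro linear_intros cl, simp_all)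
    also have "\<dots> = sw H (\<lambda>a b. counit H (d \<bullet> h) \<odot>\<^bsub>H\<^esub>
        sw H (\<lambda>x y. counit H (b \<bullet> y) \<odot>\<^bsub>H\<^esub> (a \<bullet> x)) c) u"
      using u c h by (intro sw_linear_image linear_intros cl)
    also have "\<dots> = sw H (\<lambda>a b. sw H (\<lambda>x y. counit H (d \<bullet> h) \<odot>\<^bsub>H\<^esub> (counit H (b \<bullet> y) \<odot>\<^bsub>H\<^esub> (a \<bullet> x))) c) u"
      using u c h by (intro sw_cong sw_linear_image linear_intros cl)
    finally show ?thesis by simp
  qed
  have "sw H (\<lambda>a b. counit H (b \<bullet> h) \<odot>\<^bsub>H\<^esub> a) u = sw H (\<lambda>a b. counit H (b \<bullet> h) \<odot>\<^bsub>H\<^esub> a) (u \<bullet> \<one>\<^sub>H)"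
    using u by simp
  also have "\<dots> = sw H (\<lambda>a b. sw H (\<lambda>c d. counit H (b \<bullet> d \<bullet> h) \<odot>\<^bsub>H\<^esub> (a \<bullet> c)) \<one>\<^sub>H) u"
    by (rule sw_mult[OF H.module_axioms B u H.one_closed])
  also have "\<dots> = sw H (\<lambda>a b. sw H (\<lambda>c d. sw H (\<lambda>x y.
      counit H (y \<bullet> h) \<odot>\<^bsub>H\<^esub> (counit H (b \<bullet> x) \<odot>\<^bsub>H\<^esub> (a \<bullet> c))) d) \<one>\<^sub>H) u"
    by (intro sw_cong u H.one_closed step)
  also have "\<dots> = sw H (\<lambda>a b. sw H (\<lambda>c d. sw H (\<lambda>x y.
      counit H (d \<bullet> h) \<odot>\<^bsub>H\<^esub> (counit H (b \<bullet> y) \<odot>\<^bsub>H\<^esub> (a \<bullet> x))) c) \<one>\<^sub>H) u"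
    by (intro sw_cong u sw_coassoc[OF H.module_axioms T, symmetric]) simp_all
  also have "\<dots> = sw H (\<lambda>c d. sw H (\<lambda>a b. sw H (\<lambda>x y.
      counit H (d \<bullet> h) \<odot>\<^bsub>H\<^esub> (counit H (b \<bullet> y) \<odot>\<^bsub>H\<^esub> (a \<bullet> x))) c) u) \<one>\<^sub>H"
    by (intro sw_swap cl u h)
  also have "\<dots> = sw H (\<lambda>c d. counit H (d \<bullet> h) \<odot>\<^bsub>H\<^esub> (u \<bullet> c)) \<one>\<^sub>H"
    by (intro sw_cong H.one_closed fin)
  also have "\<dots> = sw H (\<lambda>c d. u \<bullet> (counit H (d \<bullet> h) \<odot>\<^bsub>H\<^esub> c)) \<one>\<^sub>H"
    using u h by (intro sw_cong) (simp_all add: smult_mult_right)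
  also have "\<dots> = u \<bullet> fg' h"
    unfolding fg'_sw[OF h] using u h
    by (intro sw_linear_image[symmetric] linear_intros cl)
  finally show ?thesis by simp
qed

end

context unit_calculus
begin

text \<open>
  The left-hand side is \<open>\<epsilon> (1\<^sub>1 u\<^sub>1 h) 1\<^sub>2 u\<^sub>2\<close>, a sum over \<open>\<Delta> 1 \<Delta> u = \<Delta> u\<close>.  The identity says that
  the left unit constraint is \<open>H\<close>-linear; for \<open>u = h = 1\<close> it is \<open>f (g 1\<^sub>1) 1\<^sub>2 = 1\<close>.
\<close>

lemma sw_fg_mult:
  assumes u: "u \<in> carrier H" and h: "h \<in> carrier H"
  shows "sw H (\<lambda>a b. fg (a \<bullet> h) \<bullet> b) u = u \<bullet> fg h"
proof -
  note cl = H.module_axioms H.m_closed H.smult_closed counit_closed H.one_closed sw_closed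
  have "sw H (\<lambda>a b. fg (a \<bullet> h) \<bullet> b) u =
      sw H (\<lambda>a b. sw H (\<lambda>c d. (counit H (c \<bullet> (a \<bullet> h)) \<odot>\<^bsub>H\<^esub> d) \<bullet> b) \<one>\<^sub>H) u"
  proof (rule sw_cong[OF u])
    fix a b assume a: "a \<in> carrier H" "b \<in> carrier H"
    show "fg (a \<bullet> h) \<bullet> b =
      sw H (\<lambda>c d. (counit H (c \<bullet> (a \<bullet> h)) \<odot>\<^bsub>H\<^esub> d) \<bullet> b) \<one>\<^sub>H"
      unfolding fg_sw[OF H.m_closed[OF a(1) h]] by (intro sw_linear_image linear_intros cl a h)
  qed
  also have "\<dots> = sw H (\<lambda>a b. sw H (\<lambda>c d. counit H (c \<bullet> a \<bullet> h) \<odot>\<^bsub>H\<^esub> (d \<bullet> b)) \<one>\<^sub>H) u"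
    using u h by (intro sw_cong) (simp_all add: smult_mult_left H.m_assoc)
  also have "\<dots> = sw H (\<lambda>c d. sw H (\<lambda>a b. counit H (c \<bullet> a \<bullet> h) \<odot>\<^bsub>H\<^esub> (d \<bullet> b)) u) \<one>\<^sub>H"
    by (intro sw_swap cl u h)
  also have "\<dots> = sw H (\<lambda>a b. counit H (a \<bullet> h) \<odot>\<^bsub>H\<^esub> b) (\<one>\<^sub>H \<bullet> u)"
    by (rule sw_mult[symmetric, OF H.module_axioms _ H.one_closed u]) (intro linear_intros cl h)
  also have "\<dots> = u \<bullet> fg h" using u h by (simp add: mult_fg)
  finally show ?thesis .
qed

lemma sw_fg'_mult:
  assumes u: "u \<in> carrier H" and h: "h \<in> carrier H"
  shows "sw H (\<lambda>a b. fg' (b \<bullet> h) \<bullet> a) u = u \<bullet> fg' h"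
proof -
  note cl = H.module_axioms H.m_closed H.smult_closed counit_closed H.one_closed sw_closed
  have "sw H (\<lambda>a b. fg' (b \<bullet> h) \<bullet> a) u =
      sw H (\<lambda>a b. sw H (\<lambda>c d. (counit H (d \<bullet> (b \<bullet> h)) \<odot>\<^bsub>H\<^esub> c) \<bullet> a) \<one>\<^sub>H) u"
  proof (rule sw_cong[OF u])
    fix a b assume a: "a \<in> carrier H" "b \<in> carrier H"
    show "fg' (b \<bullet> h) \<bullet> a =
      sw H (\<lambda>c d. (counit H (d \<bullet> (b \<bullet> h)) \<odot>\<^bsub>H\<^esub> c) \<bullet> a) \<one>\<^sub>H"
      unfolding fg'_sw[OF H.m_closed[OF a(2) h]] by (intro sw_linear_image linear_intros cl a h)
  qed
  also have "\<dots> = sw H (\<lambda>a b. sw H (\<lambda>c d. counit H (d \<bullet> b \<bullet> h) \<odot>\<^bsub>H\<^esub> (c \<bullet> a)) \<one>\<^sub>H) u"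
    using u h by (intro sw_cong) (simp_all add: smult_mult_left H.m_assoc)
  also have "\<dots> = sw H (\<lambda>c d. sw H (\<lambda>a b. counit H (d \<bullet> b \<bullet> h) \<odot>\<^bsub>H\<^esub> (c \<bullet> a)) u) \<one>\<^sub>H"
    by (intro sw_swap cl u h)
  also have "\<dots> = sw H (\<lambda>a b. counit H (b \<bullet> h) \<odot>\<^bsub>H\<^esub> a) (\<one>\<^sub>H \<bullet> u)"
    by (rule sw_mult[symmetric, OF H.module_axioms _ H.one_closed u]) (intro linear_intros cl h)
  also have "\<dots> = u \<bullet> fg' h" using u h by (simp add: mult_fg')
  finally show ?thesis .
qed

lemma hact_mult_fg:
  assumes M: "left_module k H M" and a: "a \<in> carrier H" and h: "h \<in> carrier H" and m: "m \<in> carrier M"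
  shows "hact M a (hact M (fg h) m) = sw M (\<lambda>c d. counit H (c \<bullet> h) \<odot>\<^bsub>M\<^esub> hact M d m) a"
proof -
  have "hact M a (hact M (fg h) m) = hact M (sw H (\<lambda>c d. counit H (c \<bullet> h) \<odot>\<^bsub>H\<^esub> d) a) m"
    using a h m by (simp add: left_module.mult_hact[OF M, symmetric] fg_closed mult_fg)
  also have "\<dots> = sw M (\<lambda>c d. hact M (counit H (c \<bullet> h) \<odot>\<^bsub>H\<^esub> d) m) a"
    using h by (intro sw_linear_image H.module_axioms left_module_module[OF M] linear_intros M m a) simp_all
  also have "\<dots> = sw M (\<lambda>c d. counit H (c \<bullet> h) \<odot>\<^bsub>M\<^esub> hact M d m) a"
    using h m a by (intro sw_cong) (simp_all add: left_module.smult_hact[OF M])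
  finally show ?thesis .
qed

lemma hact_mult_fg':
  assumes M: "left_module k H M" and a: "a \<in> carrier H" and h: "h \<in> carrier H" and m: "m \<in> carrier M"
  shows "hact M a (hact M (fg' h) m) = sw M (\<lambda>c d. counit H (d \<bullet> h) \<odot>\<^bsub>M\<^esub> hact M c m) a"
proof -
  have "hact M a (hact M (fg' h) m) = hact M (sw H (\<lambda>c d. counit H (d \<bullet> h) \<odot>\<^bsub>H\<^esub> c) a) m"
    using a h m by (simp add: left_module.mult_hact[OF M, symmetric] fg'_closed mult_fg')
  also have "\<dots> = sw M (\<lambda>c d. hact M (counit H (d \<bullet> h) \<odot>\<^bsub>H\<^esub> c) m) a"
    using h by (intro sw_linear_image H.module_axioms left_module_module[OF M] linear_intros M m a) simp_all
  also have "\<dots> = sw M (\<lambda>c d. counit H (d \<bullet> h) \<odot>\<^bsub>M\<^esub> hact M c m) a"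
    using h m a by (intro sw_cong) (simp_all add: left_module.smult_hact[OF M])
  finally show ?thesis .
qed

section \<open>The unit object and its constraints\<close>

text \<open>
  \<open>g h\<close> as an element of the unit object.
\<close>

definition G :: "'h \<Rightarrow> ('k, 'h, 'x) elt" where "G h = Functional (gmap H h)"

lemma G_apply: "v \<in> carrier H \<Longrightarrow> the_functional (G h) v = counit H (v \<bullet> h)"
  by (simp add: G_def gmap_def)

lemma G_eqI: "(\<And>v. v \<in> carrier H \<Longrightarrow> counit H (v \<bullet> h) = counit H (v \<bullet> l)) \<Longrightarrow> G h = G l"
  unfolding G_def gmap_def by (auto intro!: restrict_ext)

lemma Functional_eq_G: "(\<And>v. v \<in> carrier H \<Longrightarrow> f v = counit H (v \<bullet> l)) \<Longrightarrow> Functional (restrict f (carrier H)) = G l"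
  unfolding G_def gmap_def by (auto intro!: restrict_ext)

text \<open>
  On the unit object all operations are those of \<open>H\<close>, transported along \<open>g\<close>.  For the action this
  needs that \<open>g (l h)\<close> depends on \<open>g h\<close> only, which holds since \<open>g (l h) v = g h (v l)\<close>.
\<close>

lemma HL_simps:
  "carrier (HL k H) = G ` carrier H"
  "\<zero>\<^bsub>HL k H\<^esub> = G \<zero>\<^bsub>H\<^esub>"
  "h \<in> carrier H \<Longrightarrow> l \<in> carrier H \<Longrightarrow> G h \<oplus>\<^bsub>HL k H\<^esub> G l = G (h \<oplus>\<^bsub>H\<^esub> l)"
  "x \<in> carrier k \<Longrightarrow> h \<in> carrier H \<Longrightarrow> x \<odot>\<^bsub>HL k H\<^esub> G h = G (x \<odot>\<^bsub>H\<^esub> h)"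
  "h \<in> carrier H \<Longrightarrow> l \<in> carrier H \<Longrightarrow> hact (HL k H) l (G h) = G (l \<bullet> h)"
proof -
  show "carrier (HL k H) = G ` carrier H" by (auto simp: HL_def G_def)
  have cz: "counit H \<zero>\<^bsub>H\<^esub> = \<zero>\<^bsub>k\<^esub>"
    using linear_map_zero[OF H.module_axioms module_R counit_linear] by simp
  show "\<zero>\<^bsub>HL k H\<^esub> = G \<zero>\<^bsub>H\<^esub>"
    by (simp add: HL_def) (rule Functional_eq_G, simp add: cz)
  show "G h \<oplus>\<^bsub>HL k H\<^esub> G l = G (h \<oplus>\<^bsub>H\<^esub> l)" if "h \<in> carrier H" "l \<in> carrier H"
    using that linear_map_add[OF counit_linear]
    by (simp add: HL_def) (rule Functional_eq_G, simp add: G_apply H.r_distr)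
  show "x \<odot>\<^bsub>HL k H\<^esub> G h = G (x \<odot>\<^bsub>H\<^esub> h)" if "x \<in> carrier k" "h \<in> carrier H"
    using that linear_map_smult[OF counit_linear]
    by (simp add: HL_def) (rule Functional_eq_G, simp add: G_apply smult_mult_right)
  show "hact (HL k H) l (G h) = G (l \<bullet> h)" if hl: "h \<in> carrier H" "l \<in> carrier H"
  proof -
    let ?h = "inv_into (carrier H) (gmap H) (gmap H h)"
    have h': "?h \<in> carrier H" "gmap H ?h = gmap H h"
      using hl by (auto intro: inv_into_into f_inv_into_f)
    have "counit H (v \<bullet> ?h) = counit H (v \<bullet> h)" if "v \<in> carrier H" for v
      using fun_cong[OF h'(2), of v] that by (simp add: gmap_def)
    then have "G (l \<bullet> ?h) = G (l \<bullet> h)"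
      using hl h'(1) by (intro G_eqI) (simp add: H.m_assoc[symmetric])
    then show ?thesis by (simp add: HL_def G_def)
  qed
qed

lemma G_closed: "h \<in> carrier H \<Longrightarrow> G h \<in> carrier (HL k H)"
  by (simp add: HL_simps)

lemma module_HL: "module k (HL k H)"
proof (rule moduleI[OF k.is_cring])
  show "abelian_group (HL k H)"
  proof (rule abelian_groupI)
    fix x assume "x \<in> carrier (HL k H)"
    then obtain h where "h \<in> carrier H" "x = G h" by (auto simp: HL_simps)
    then show "\<exists>y\<in>carrier (HL k H). y \<oplus>\<^bsub>HL k H\<^esub> x = \<zero>\<^bsub>HL k H\<^esub>"
      by (auto simp: HL_simps H.l_neg intro!: bexI[of _ "\<ominus>\<^bsub>H\<^esub> h"])
  qed (auto simp: HL_simps H.a_ac)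
qed (auto simp: HL_simps H.smult_l_distr H.smult_r_distr H.smult_assoc1)

lemma left_module_HL: "left_module k H (HL k H)"
  by (rule left_module.intro[OF module_HL], rule left_module_axioms.intro)
    (auto simp: HL_simps H.r_distr H.l_distr smult_mult_left smult_mult_right H.m_assoc)

lemma linear_map_G [linear_intros]: "linear_map k M H f \<Longrightarrow> linear_map k M (HL k H) (\<lambda>x. G (f x))"
  by (rule linear_map_compose[of k M H f]) (auto simp: linear_map_def HL_simps)

lemma linear_map_eval: "v \<in> carrier H \<Longrightarrow> linear_map k (HL k H) R (\<lambda>\<phi>. the_functional \<phi> v)"
  using linear_map_add[OF counit_linear] linear_map_smult[OF counit_linear]
  by (auto simp: linear_map_def HL_simps G_apply H.r_distr smult_mult_right)

lemma HL_ext: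
  assumes "\<phi> \<in> carrier (HL k H)" "\<psi> \<in> carrier (HL k H)"
    "\<And>v. v \<in> carrier H \<Longrightarrow> the_functional \<phi> v = the_functional \<psi> v"
  shows "\<phi> = \<psi>"
  using assms by (auto simp: HL_simps G_apply intro!: G_eqI)

text \<open>
  (lm) and (rm) as identities in \<open>H\<^sub>L\<^sup>*\<close>, obtained by evaluating the functionals.  Stated in this way
  they can be applied inside a tensor product with factor \<open>H\<^sub>L\<^sup>*\<close>, where elements need not be
  separated by evaluation.
\<close>

lemma G_mult_lm:
  assumes u: "u \<in> carrier H" and h: "h \<in> carrier H"
  shows "(G (u \<bullet> h) :: ('k, 'h, 'x) elt) = sw (HL k H) (\<lambda>a b. counit H (b \<bullet> h) \<odot>\<^bsub>HL k H\<^esub> G a) u"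
proof (rule HL_ext)
  have c: "counit H (b \<bullet> h) \<odot>\<^bsub>HL k H\<^esub> G a \<in> carrier (HL k H)" if "a \<in> carrier H" "b \<in> carrier H" for a b
    using that h by (intro module.smult_closed[OF module_HL] G_closed) simp_all
  show "G (u \<bullet> h) \<in> carrier (HL k H)" using u h by (simp add: G_closed)
  show "sw (HL k H) (\<lambda>a b. counit H (b \<bullet> h) \<odot>\<^bsub>HL k H\<^esub> G a) u \<in> carrier (HL k H)"
    by (rule sw_closed[OF module_HL u c])
  fix v assume v: "v \<in> carrier H"
  have "the_functional (sw (HL k H) (\<lambda>a b. counit H (b \<bullet> h) \<odot>\<^bsub>HL k H\<^esub> (G a :: ('k, 'h, 'x) elt)) u) v =
    sw R (\<lambda>a b. the_functional (counit H (b \<bullet> h) \<odot>\<^bsub>HL k H\<^esub> (G a :: ('k, 'h, 'x) elt)) v) u"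
    by (rule sw_linear_image[OF module_HL module_R linear_map_eval[OF v] u c])
  also have "\<dots> = sw R (\<lambda>a b. counit H (v \<bullet> a) \<otimes>\<^bsub>k\<^esub> counit H (b \<bullet> h)) u"
    using u v h by (intro sw_cong)
      (simp_all add: linear_map_smult[OF linear_map_eval] G_apply G_closed k.m_comm)
  also have "\<dots> = the_functional (G (u \<bullet> h) :: ('k, 'h, 'x) elt) v"
    using u v h by (simp add: G_apply counit_lm[symmetric] H.m_assoc)
  finally show "the_functional (G (u \<bullet> h) :: ('k, 'h, 'x) elt) v =
    the_functional (sw (HL k H) (\<lambda>a b. counit H (b \<bullet> h) \<odot>\<^bsub>HL k H\<^esub> (G a :: ('k, 'h, 'x) elt)) u) v" by simp
qed

lemma G_mult_rm:
  assumes u: "u \<in> carrier H" and h: "h \<in> carrier H"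
  shows "(G (u \<bullet> h) :: ('k, 'h, 'x) elt) = sw (HL k H) (\<lambda>a b. counit H (a \<bullet> h) \<odot>\<^bsub>HL k H\<^esub> G b) u"
proof (rule HL_ext)
  have c: "counit H (a \<bullet> h) \<odot>\<^bsub>HL k H\<^esub> G b \<in> carrier (HL k H)" if "a \<in> carrier H" "b \<in> carrier H" for a b
    using that h by (intro module.smult_closed[OF module_HL] G_closed) simp_all
  show "G (u \<bullet> h) \<in> carrier (HL k H)" using u h by (simp add: G_closed)
  show "sw (HL k H) (\<lambda>a b. counit H (a \<bullet> h) \<odot>\<^bsub>HL k H\<^esub> G b) u \<in> carrier (HL k H)"
    by (rule sw_closed[OF module_HL u c])
  fix v assume v: "v \<in> carrier H"
  have "the_functional (sw (HL k H) (\<lambda>a b. counit H (a \<bullet> h) \<odot>\<^bsub>HL k H\<^esub> (G b :: ('k, 'h, 'x) elt)) u) v =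
    sw R (\<lambda>a b. the_functional (counit H (a \<bullet> h) \<odot>\<^bsub>HL k H\<^esub> (G b :: ('k, 'h, 'x) elt)) v) u"
    by (rule sw_linear_image[OF module_HL module_R linear_map_eval[OF v] u c])
  also have "\<dots> = sw R (\<lambda>a b. counit H (v \<bullet> b) \<otimes>\<^bsub>k\<^esub> counit H (a \<bullet> h)) u"
    using u v h by (intro sw_cong)
      (simp_all add: linear_map_smult[OF linear_map_eval] G_apply G_closed k.m_comm)
  also have "\<dots> = the_functional (G (u \<bullet> h) :: ('k, 'h, 'x) elt) v"
    using u v h by (simp add: G_apply counit_rm[symmetric] H.m_assoc)
  finally show "the_functional (G (u \<bullet> h) :: ('k, 'h, 'x) elt) v =
    the_functional (sw (HL k H) (\<lambda>a b. counit H (a \<bullet> h) \<odot>\<^bsub>HL k H\<^esub> (G b :: ('k, 'h, 'x) elt)) u) v" by simp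
qed

lemma fmap_G: "fmap_left H (the_functional (G h)) = fg h" "fmap_right H (the_functional (G h)) = fg' h"
  by (simp_all add: G_def fg_def fg'_def)

lemma linear_map_fmap_left: "linear_map k (HL k H) H (\<lambda>\<phi>. fmap_left H (the_functional \<phi>))"
  using linear_map_fg[OF linear_map_id] by (auto simp: linear_map_def HL_simps fmap_G)

lemma linear_map_fmap_right: "linear_map k (HL k H) H (\<lambda>\<phi>. fmap_right H (the_functional \<phi>))"
  using linear_map_fg'[OF linear_map_id] by (auto simp: linear_map_def HL_simps fmap_G)

definition "lunit_fun M t = lsum M [hact M (fmap_left H (the_functional \<phi>)) m. (\<phi>, m) \<leftarrow> terms t]"
definition "runit_fun M t = lsum M [hact M (fmap_right H (the_functional \<phi>)) m. (m, \<phi>) \<leftarrow> terms t]"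

context
  fixes M :: "('k, ('k, 'h, 'x) elt, 'h) hmodule"
  assumes M: "left_module k H M"
begin

interpretation l: two_modules k H "HL k H" M by (rule two_modulesI[OF left_module_HL M])
interpretation r: two_modules k H M "HL k H" by (rule two_modulesI[OF M left_module_HL])

lemma
  shows linear_map_lunit_fun: "linear_map k l.U M (lunit_fun M)"
    and lunit_fun_diag_act: "\<lbrakk>h \<in> carrier H; l \<in> carrier H; m \<in> carrier M\<rbrakk> \<Longrightarrow>
      lunit_fun M (l.D h (l.u (G l) m)) = hact M h (hact M (fg l) m)"
proof -
  have eq: "lunit_fun M = (\<lambda>t. tsum M (\<lambda>\<phi> m. hact M (fmap_left H (the_functional \<phi>)) m) (terms t))"
    by (simp add: lunit_fun_def tsum_def fun_eq_iff)
  have B: "bilinear k (HL k H :: ('k, ('k, 'h, 'x) elt, 'h) hmodule) M M (\<lambda>\<phi> m. hact M (fmap_left H (the_functional \<phi>)) m)"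
    by (intro linear_intros M linear_map_closed[OF linear_map_fmap_left] linear_map_fmap_left)
  show "linear_map k l.U M (lunit_fun M)"
    unfolding eq by (rule l.linear_map_lift[OF l.N.module_axioms B])
  assume a: "h \<in> carrier H" "l \<in> carrier H" "m \<in> carrier M"
  have "lunit_fun M (l.D h (l.u (G l) m)) =
     sw M (\<lambda>a b. hact M (fmap_left H (the_functional (hact (HL k H) a (G l :: ('k, 'h, 'x) elt)))) (hact M b m)) h"
    unfolding eq by (rule l.lift_diag_act[OF l.N.module_axioms B a(1) G_closed[OF a(2)] a(3)])
  also have "\<dots> = sw M (\<lambda>a b. hact M (fg (a \<bullet> l) \<bullet> b) m) h"
    using a by (intro sw_cong) (simp_all add: HL_simps fmap_G left_module.mult_hact[OF M] fg_closed)
  also have "\<dots> = hact M (sw H (\<lambda>a b. fg (a \<bullet> l) \<bullet> b) h) m"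
    using a by (intro sw_linear_image[symmetric] H.module_axioms l.N.module_axioms linear_intros M) (simp_all add: fg_closed)
  also have "\<dots> = hact M h (hact M (fg l) m)"
    using a by (simp add: sw_fg_mult left_module.mult_hact[OF M] fg_closed)
  finally show "lunit_fun M (l.D h (l.u (G l) m)) = hact M h (hact M (fg l) m)" .
qed

lemma
  shows linear_map_runit_fun: "linear_map k r.U M (runit_fun M)"
    and runit_fun_diag_act: "\<lbrakk>h \<in> carrier H; l \<in> carrier H; m \<in> carrier M\<rbrakk> \<Longrightarrow>
      runit_fun M (r.D h (r.u m (G l))) = hact M h (hact M (fg' l) m)"
proof -
  have eq: "runit_fun M = (\<lambda>t. tsum M (\<lambda>m \<phi>. hact M (fmap_right H (the_functional \<phi>)) m) (terms t))"
    by (simp add: runit_fun_def tsum_def fun_eq_iff)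
  have B: "bilinear k M (HL k H :: ('k, ('k, 'h, 'x) elt, 'h) hmodule) M (\<lambda>m \<phi>. hact M (fmap_right H (the_functional \<phi>)) m)"
    by (intro linear_intros M linear_map_closed[OF linear_map_fmap_right] linear_map_fmap_right)
  show "linear_map k r.U M (runit_fun M)"
    unfolding eq by (rule r.linear_map_lift[OF l.N.module_axioms B])
  assume a: "h \<in> carrier H" "l \<in> carrier H" "m \<in> carrier M"
  have "runit_fun M (r.D h (r.u m (G l))) =
     sw M (\<lambda>a b. hact M (fmap_right H (the_functional (hact (HL k H) b (G l :: ('k, 'h, 'x) elt)))) (hact M a m)) h"
    unfolding eq by (rule r.lift_diag_act[OF l.N.module_axioms B a(1) a(3) G_closed[OF a(2)]])
  also have "\<dots> = sw M (\<lambda>a b. hact M (fg' (b \<bullet> l) \<bullet> a) m) h"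
    using a by (intro sw_cong) (simp_all add: HL_simps fmap_G left_module.mult_hact[OF M] fg'_closed)
  also have "\<dots> = hact M (sw H (\<lambda>a b. fg' (b \<bullet> l) \<bullet> a) h) m"
    using a by (intro sw_linear_image[symmetric] H.module_axioms l.N.module_axioms linear_intros M) (simp_all add: fg'_closed)
  also have "\<dots> = hact M h (hact M (fg' l) m)"
    using a by (simp add: sw_fg'_mult left_module.mult_hact[OF M] fg'_closed)
  finally show "runit_fun M (r.D h (r.u m (G l))) = hact M h (hact M (fg' l) m)" .
qed

lemma lunit_fun_lpure: "l \<in> carrier H \<Longrightarrow> m \<in> carrier M \<Longrightarrow> lunit_fun M (l.lpure (G l) m) = hact M (fg l) m"
  using lunit_fun_diag_act[of "\<one>\<^sub>H" l m] hact_closed[OF M fg_closed]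
  by (simp add: l.lpure_def left_module.one_hact[OF M])

lemma runit_fun_lpure: "l \<in> carrier H \<Longrightarrow> m \<in> carrier M \<Longrightarrow> runit_fun M (r.lpure m (G l)) = hact M (fg' l) m"
  using runit_fun_diag_act[of "\<one>\<^sub>H" l m] hact_closed[OF M fg'_closed]
  by (simp add: r.lpure_def left_module.one_hact[OF M])

lemma hlinear_lunit_fun: "hlinear l.L M (lunit_fun M)"
  unfolding hlinear_def
proof (intro conjI ballI)
  show lin: "linear_map k l.L M (lunit_fun M)" by (rule l.linear_map_from_ltensor[OF linear_map_lunit_fun])
  fix h t assume h: "h \<in> carrier H" and t: "t \<in> carrier l.L"
  show "lunit_fun M (hact l.L h t) = hact M h (lunit_fun M t)"
  proof (rule generated_ext[OF l.generated_ltensor l.N.module_axioms _ _ _ t])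
    show "linear_map k l.L M (\<lambda>t. lunit_fun M (hact l.L h t))"
      by (rule linear_map_compose[OF linear_map_hact_right[OF l.left_module_ltensor h linear_map_id] lin])
    show "linear_map k l.L M (\<lambda>t. hact M h (lunit_fun M t))"
      by (rule linear_map_hact_right[OF M h lin])
    fix \<phi> :: "('k, 'h, 'x) elt" and m assume "\<phi> \<in> carrier (HL k H)" and m: "m \<in> carrier M"
    then obtain l where "l \<in> carrier H" "\<phi> = G l" by (auto simp: HL_simps)
    then show "lunit_fun M (hact l.L h (l.lpure \<phi> m)) = hact M h (lunit_fun M (l.lpure \<phi> m))"
      using h m by (simp add: lunit_fun_lpure l.hact_lpure G_closed lunit_fun_diag_act)
  qed
qed

lemma hlinear_runit_fun: "hlinear r.L M (runit_fun M)"
  unfolding hlinear_def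
proof (intro conjI ballI)
  show lin: "linear_map k r.L M (runit_fun M)" by (rule r.linear_map_from_ltensor[OF linear_map_runit_fun])
  fix h t assume h: "h \<in> carrier H" and t: "t \<in> carrier r.L"
  show "runit_fun M (hact r.L h t) = hact M h (runit_fun M t)"
  proof (rule generated_ext[OF r.generated_ltensor l.N.module_axioms _ _ _ t])
    show "linear_map k r.L M (\<lambda>t. runit_fun M (hact r.L h t))"
      by (rule linear_map_compose[OF linear_map_hact_right[OF r.left_module_ltensor h linear_map_id] lin])
    show "linear_map k r.L M (\<lambda>t. hact M h (runit_fun M t))"
      by (rule linear_map_hact_right[OF M h lin])
    fix \<phi> :: "('k, 'h, 'x) elt" and m assume "\<phi> \<in> carrier (HL k H)" and m: "m \<in> carrier M"
    then obtain l where "l \<in> carrier H" "\<phi> = G l" by (auto simp: HL_simps)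
    then show "runit_fun M (hact r.L h (r.lpure m \<phi>)) = hact M h (runit_fun M (r.lpure m \<phi>))"
      using h m by (simp add: runit_fun_lpure r.hact_lpure G_closed runit_fun_diag_act)
  qed
qed

text \<open>
  \<open>\<epsilon> \<otimes>\<^sup>l f (g h) m = g 1\<^sub>1 \<otimes> 1\<^sub>2 f (g h) m\<close>.  By \<open>mult_fg\<close> this is \<open>g 1\<^sub>1 \<otimes> \<epsilon> (1\<^sub>2 h) 1\<^sub>3 m\<close>, and
  (lm) collects the first two legs into \<open>g (1\<^sub>1 h) \<otimes> 1\<^sub>2 m\<close>.  So \<open>m \<mapsto> \<epsilon> \<otimes>\<^sup>l m\<close> inverts the left unit
  constraint.
\<close>

lemma lpure_unit_left:
  assumes h: "h \<in> carrier H" and m: "m \<in> carrier M"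
  shows "l.lpure (G \<one>\<^sub>H) (hact M (fg h) m) = l.lpure (G h) m"
proof -
  note cl = H.module_axioms l.M.module_axioms l.N.module_axioms l.module_utensor H.m_closed G_closed l.upure_closed
    l.hact_N H.one_closed M l.M.smult_closed l.N.smult_closed counit_closed
  interpret U: module k l.U by (rule l.module_utensor)
  have T: "trilinear k H l.U (\<lambda>a c d. counit H (c \<bullet> h) \<odot>\<^bsub>l.U\<^esub> l.u (G a) (hact M d m))"
    by (intro trilinearI linear_intros cl h m)
  have "l.lpure (G \<one>\<^sub>H) (hact M (fg h) m) =
    sw l.U (\<lambda>a b. l.u (hact (HL k H) a (G \<one>\<^sub>H)) (hact M b (hact M (fg h) m))) \<one>\<^sub>H"
    using h m by (simp add: l.lpure_def l.diag_act_upure G_closed l.hact_N fg_closed)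
  also have "\<dots> = sw l.U (\<lambda>a b. l.u (G a) (sw M (\<lambda>c d. counit H (c \<bullet> h) \<odot>\<^bsub>M\<^esub> hact M d m) b)) \<one>\<^sub>H"
    using h m by (intro sw_cong) (simp_all add: HL_simps hact_mult_fg[OF M])
  also have "\<dots> = sw l.U (\<lambda>a b. sw l.U (\<lambda>c d. l.u (G a) (counit H (c \<bullet> h) \<odot>\<^bsub>M\<^esub> hact M d m)) b) \<one>\<^sub>H"
    by (intro sw_cong sw_linear_image linear_intros cl h m)
  also have "\<dots> = sw l.U (\<lambda>a b. sw l.U (\<lambda>c d. counit H (c \<bullet> h) \<odot>\<^bsub>l.U\<^esub> l.u (G a) (hact M d m)) b) \<one>\<^sub>H"
    by (intro sw_cong linear_map_smult[OF bilinear_right[OF l.bilinear_upure _ linear_map_id]] cl h m)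
  also have "\<dots> = sw l.U (\<lambda>a b. sw l.U (\<lambda>c d. counit H (d \<bullet> h) \<odot>\<^bsub>l.U\<^esub> l.u (G c) (hact M b m)) a) \<one>\<^sub>H"
    by (rule sw_coassoc[OF l.module_utensor T H.one_closed, symmetric])
  also have "\<dots> = sw l.U (\<lambda>a b. sw l.U (\<lambda>c d. l.u (counit H (d \<bullet> h) \<odot>\<^bsub>HL k H\<^esub> G c) (hact M b m)) a) \<one>\<^sub>H"
    by (intro sw_cong linear_map_smult[OF bilinear_left[OF l.bilinear_upure _ linear_map_id], symmetric] cl h m)
  also have "\<dots> = sw l.U (\<lambda>a b. l.u (sw (HL k H) (\<lambda>c d. counit H (d \<bullet> h) \<odot>\<^bsub>HL k H\<^esub> G c) a) (hact M b m)) \<one>\<^sub>H"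
    by (intro sw_cong sw_linear_image[symmetric] linear_intros cl h m)
  also have "\<dots> = sw l.U (\<lambda>a b. l.u (hact (HL k H) a (G h)) (hact M b m)) \<one>\<^sub>H"
    using h by (intro sw_cong) (simp_all add: G_mult_lm[symmetric] HL_simps)
  also have "\<dots> = l.lpure (G h) m"
    using h m by (simp add: l.lpure_def l.diag_act_upure G_closed)
  finally show ?thesis .
qed

lemma lpure_unit_right:
  assumes h: "h \<in> carrier H" and m: "m \<in> carrier M"
  shows "r.lpure (hact M (fg' h) m) (G \<one>\<^sub>H) = r.lpure m (G h)"
proof -
  note cl = H.module_axioms l.M.module_axioms l.N.module_axioms r.module_utensor H.m_closed G_closed r.upure_closed
    l.hact_N H.one_closed M l.M.smult_closed l.N.smult_closed counit_closed
  interpret U: module k r.U by (rule r.module_utensor)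
  have T: "trilinear k H r.U (\<lambda>c d b. counit H (d \<bullet> h) \<odot>\<^bsub>r.U\<^esub> r.u (hact M c m) (G b))"
    by (intro trilinearI linear_intros cl h m)
  have "r.lpure (hact M (fg' h) m) (G \<one>\<^sub>H) =
    sw r.U (\<lambda>a b. r.u (hact M a (hact M (fg' h) m)) (hact (HL k H) b (G \<one>\<^sub>H))) \<one>\<^sub>H"
    using h m by (simp add: r.lpure_def r.diag_act_upure G_closed l.hact_N fg'_closed)
  also have "\<dots> = sw r.U (\<lambda>a b. r.u (sw M (\<lambda>c d. counit H (d \<bullet> h) \<odot>\<^bsub>M\<^esub> hact M c m) a) (G b)) \<one>\<^sub>H"
    using h m by (intro sw_cong) (simp_all add: HL_simps hact_mult_fg'[OF M])
  also have "\<dots> = sw r.U (\<lambda>a b. sw r.U (\<lambda>c d. r.u (counit H (d \<bullet> h) \<odot>\<^bsub>M\<^esub> hact M c m) (G b)) a) \<one>\<^sub>H"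
    by (intro sw_cong sw_linear_image linear_intros cl h m)
  also have "\<dots> = sw r.U (\<lambda>a b. sw r.U (\<lambda>c d. counit H (d \<bullet> h) \<odot>\<^bsub>r.U\<^esub> r.u (hact M c m) (G b)) a) \<one>\<^sub>H"
    by (intro sw_cong linear_map_smult[OF bilinear_left[OF r.bilinear_upure _ linear_map_id]] cl h m)
  also have "\<dots> = sw r.U (\<lambda>a b. sw r.U (\<lambda>c d. counit H (c \<bullet> h) \<odot>\<^bsub>r.U\<^esub> r.u (hact M a m) (G d)) b) \<one>\<^sub>H"
    by (rule sw_coassoc[OF r.module_utensor T H.one_closed])
  also have "\<dots> = sw r.U (\<lambda>a b. sw r.U (\<lambda>c d. r.u (hact M a m) (counit H (c \<bullet> h) \<odot>\<^bsub>HL k H\<^esub> G d)) b) \<one>\<^sub>H"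
    by (intro sw_cong linear_map_smult[OF bilinear_right[OF r.bilinear_upure _ linear_map_id], symmetric] cl h m)
  also have "\<dots> = sw r.U (\<lambda>a b. r.u (hact M a m) (sw (HL k H) (\<lambda>c d. counit H (c \<bullet> h) \<odot>\<^bsub>HL k H\<^esub> G d) b)) \<one>\<^sub>H"
    by (intro sw_cong sw_linear_image[symmetric] linear_intros cl h m)
  also have "\<dots> = sw r.U (\<lambda>a b. r.u (hact M a m) (hact (HL k H) b (G h))) \<one>\<^sub>H"
    using h by (intro sw_cong) (simp_all add: G_mult_rm[symmetric] HL_simps)
  also have "\<dots> = r.lpure m (G h)"
    using h m by (simp add: r.lpure_def r.diag_act_upure G_closed)
  finally show ?thesis .
qed

end

context
  fixes M N :: "('k, ('k, 'h, 'x) elt, 'h) hmodule"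
  assumes M: "left_module k H M" and N: "left_module k H N"
begin

interpretation A: two_modules k H M N by (rule two_modulesI[OF M N])

text \<open>
  Acting on one factor of \<open>m \<otimes>\<^sup>l n\<close> by \<open>f (g h)\<close> or \<open>f' (g h)\<close>.  By \<open>mult_fg\<close> and \<open>mult_fg'\<close> each of the
  four elements is \<open>\<epsilon> (1\<^sub>i h)\<close> times the tensor of the other two legs of \<open>\<Delta>\<^sup>2 1\<close>: the first two have
  \<open>i = 2\<close> and agree, while \<open>i = 1\<close> and \<open>i = 3\<close> give the diagonal action of \<open>f (g h)\<close> and of \<open>f' (g h)\<close>.
\<close>

lemma
  assumes h: "h \<in> carrier H" and m: "m \<in> carrier M" and n: "n \<in> carrier N"
  shows lpure_fg_right: "A.lpure m (hact N (fg h) n) =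
      sw A.U (\<lambda>a b. sw A.U (\<lambda>c d. counit H (c \<bullet> h) \<odot>\<^bsub>A.U\<^esub> A.u (hact M a m) (hact N d n)) b) \<one>\<^sub>H"
    and lpure_fg'_left: "A.lpure (hact M (fg' h) m) n =
      sw A.U (\<lambda>a b. sw A.U (\<lambda>c d. counit H (c \<bullet> h) \<odot>\<^bsub>A.U\<^esub> A.u (hact M a m) (hact N d n)) b) \<one>\<^sub>H"
    and lpure_fg_left: "A.lpure (hact M (fg h) m) n = A.D (fg h) (A.u m n)"
    and lpure_fg'_right: "A.lpure m (hact N (fg' h) n) = A.D (fg' h) (A.u m n)"
proof -
  interpret U: module k A.U by (rule A.module_utensor)
  note cl = H.module_axioms A.M.module_axioms A.N.module_axioms A.module_utensor H.m_closed A.upure_closed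
    A.hact_M A.hact_N H.one_closed M N A.M.smult_closed A.N.smult_closed U.smult_closed counit_closed
  \<comment> \<open>pulling a Sweedler sum with scalar coefficients out of one tensor factor\<close>
  have right: "sw A.U (\<lambda>a b. A.u (F a b) (sw N (\<lambda>c d. E c d \<odot>\<^bsub>N\<^esub> K c d) (L a b))) \<one>\<^sub>H =
      sw A.U (\<lambda>a b. sw A.U (\<lambda>c d. E c d \<odot>\<^bsub>A.U\<^esub> A.u (F a b) (K c d)) (L a b)) \<one>\<^sub>H"
    if "\<And>a b. a \<in> carrier H \<Longrightarrow> b \<in> carrier H \<Longrightarrow> F a b \<in> carrier M"
      "\<And>a b. a \<in> carrier H \<Longrightarrow> b \<in> carrier H \<Longrightarrow> L a b \<in> carrier H"
      "\<And>a b. a \<in> carrier H \<Longrightarrow> b \<in> carrier H \<Longrightarrow> E a b \<in> carrier k"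
      "\<And>a b. a \<in> carrier H \<Longrightarrow> b \<in> carrier H \<Longrightarrow> K a b \<in> carrier N" for F L E K
  proof (rule sw_cong[OF H.one_closed])
    fix a b assume ab: "a \<in> carrier H" "b \<in> carrier H"
    have "A.u (F a b) (sw N (\<lambda>c d. E c d \<odot>\<^bsub>N\<^esub> K c d) (L a b)) =
        sw A.U (\<lambda>c d. A.u (F a b) (E c d \<odot>\<^bsub>N\<^esub> K c d)) (L a b)"
      by (intro sw_linear_image linear_intros cl that ab)
    also have "\<dots> = sw A.U (\<lambda>c d. E c d \<odot>\<^bsub>A.U\<^esub> A.u (F a b) (K c d)) (L a b)"
      by (intro sw_cong linear_map_smult[OF bilinear_right[OF A.bilinear_upure _ linear_map_id]] cl that ab)
    finally show "A.u (F a b) (sw N (\<lambda>c d. E c d \<odot>\<^bsub>N\<^esub> K c d) (L a b)) = \<dots>" .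
  qed
  have left: "sw A.U (\<lambda>a b. A.u (sw M (\<lambda>c d. E c d \<odot>\<^bsub>M\<^esub> K c d) (L a b)) (F a b)) \<one>\<^sub>H =
      sw A.U (\<lambda>a b. sw A.U (\<lambda>c d. E c d \<odot>\<^bsub>A.U\<^esub> A.u (K c d) (F a b)) (L a b)) \<one>\<^sub>H"
    if "\<And>a b. a \<in> carrier H \<Longrightarrow> b \<in> carrier H \<Longrightarrow> F a b \<in> carrier N"
      "\<And>a b. a \<in> carrier H \<Longrightarrow> b \<in> carrier H \<Longrightarrow> L a b \<in> carrier H"
      "\<And>a b. a \<in> carrier H \<Longrightarrow> b \<in> carrier H \<Longrightarrow> E a b \<in> carrier k"
      "\<And>a b. a \<in> carrier H \<Longrightarrow> b \<in> carrier H \<Longrightarrow> K a b \<in> carrier M" for F L E K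
  proof (rule sw_cong[OF H.one_closed])
    fix a b assume ab: "a \<in> carrier H" "b \<in> carrier H"
    have "A.u (sw M (\<lambda>c d. E c d \<odot>\<^bsub>M\<^esub> K c d) (L a b)) (F a b) =
        sw A.U (\<lambda>c d. A.u (E c d \<odot>\<^bsub>M\<^esub> K c d) (F a b)) (L a b)"
      by (intro sw_linear_image linear_intros cl that ab)
    also have "\<dots> = sw A.U (\<lambda>c d. E c d \<odot>\<^bsub>A.U\<^esub> A.u (K c d) (F a b)) (L a b)"
      by (intro sw_cong linear_map_smult[OF bilinear_left[OF A.bilinear_upure _ linear_map_id]] cl that ab)
    finally show "A.u (sw M (\<lambda>c d. E c d \<odot>\<^bsub>M\<^esub> K c d) (L a b)) (F a b) = \<dots>" .
  qed
  have T1: "trilinear k H A.U (\<lambda>x y z. counit H (y \<bullet> h) \<odot>\<^bsub>A.U\<^esub> A.u (hact M x m) (hact N z n))"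
    by (intro trilinearI linear_intros cl h m n)
  have T2: "trilinear k H A.U (\<lambda>x y z. counit H (x \<bullet> h) \<odot>\<^bsub>A.U\<^esub> A.u (hact M y m) (hact N z n))"
    by (intro trilinearI linear_intros cl h m n)
  have T3: "trilinear k H A.U (\<lambda>x y z. counit H (z \<bullet> h) \<odot>\<^bsub>A.U\<^esub> A.u (hact M x m) (hact N y n))"
    by (intro trilinearI linear_intros cl h m n)
  have "A.lpure m (hact N (fg h) n) = sw A.U (\<lambda>a b. A.u (hact M a m) (hact N b (hact N (fg h) n))) \<one>\<^sub>H"
    using h m n by (simp add: A.lpure_def A.diag_act_upure A.hact_N fg_closed)
  also have "\<dots> = sw A.U (\<lambda>a b. A.u (hact M a m) (sw N (\<lambda>c d. counit H (c \<bullet> h) \<odot>\<^bsub>N\<^esub> hact N d n) b)) \<one>\<^sub>H"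
    using h n by (intro sw_cong) (simp_all add: hact_mult_fg[OF N])
  also have "\<dots> = sw A.U (\<lambda>a b. sw A.U (\<lambda>c d. counit H (c \<bullet> h) \<odot>\<^bsub>A.U\<^esub> A.u (hact M a m) (hact N d n)) b) \<one>\<^sub>H"
    by (rule right) (simp_all add: h m n A.hact_M A.hact_N)
  finally show "A.lpure m (hact N (fg h) n) = \<dots>" .
  have "A.lpure (hact M (fg' h) m) n = sw A.U (\<lambda>a b. A.u (hact M a (hact M (fg' h) m)) (hact N b n)) \<one>\<^sub>H"
    using h m n by (simp add: A.lpure_def A.diag_act_upure A.hact_M fg'_closed)
  also have "\<dots> = sw A.U (\<lambda>a b. A.u (sw M (\<lambda>c d. counit H (d \<bullet> h) \<odot>\<^bsub>M\<^esub> hact M c m) a) (hact N b n)) \<one>\<^sub>H"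
    using h m by (intro sw_cong) (simp_all add: hact_mult_fg'[OF M])
  also have "\<dots> = sw A.U (\<lambda>a b. sw A.U (\<lambda>c d. counit H (d \<bullet> h) \<odot>\<^bsub>A.U\<^esub> A.u (hact M c m) (hact N b n)) a) \<one>\<^sub>H"
    by (rule left) (simp_all add: h m n A.hact_M A.hact_N)
  also have "\<dots> = sw A.U (\<lambda>a b. sw A.U (\<lambda>c d. counit H (c \<bullet> h) \<odot>\<^bsub>A.U\<^esub> A.u (hact M a m) (hact N d n)) b) \<one>\<^sub>H"
    by (rule sw_coassoc[OF A.module_utensor T1 H.one_closed])
  finally show "A.lpure (hact M (fg' h) m) n = \<dots>" .
  have "A.lpure (hact M (fg h) m) n = sw A.U (\<lambda>a b. A.u (hact M a (hact M (fg h) m)) (hact N b n)) \<one>\<^sub>H"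
    using h m n by (simp add: A.lpure_def A.diag_act_upure A.hact_M fg_closed)
  also have "\<dots> = sw A.U (\<lambda>a b. A.u (sw M (\<lambda>c d. counit H (c \<bullet> h) \<odot>\<^bsub>M\<^esub> hact M d m) a) (hact N b n)) \<one>\<^sub>H"
    using h m by (intro sw_cong) (simp_all add: hact_mult_fg[OF M])
  also have "\<dots> = sw A.U (\<lambda>a b. sw A.U (\<lambda>c d. counit H (c \<bullet> h) \<odot>\<^bsub>A.U\<^esub> A.u (hact M d m) (hact N b n)) a) \<one>\<^sub>H"
    by (rule left) (simp_all add: h m n A.hact_M A.hact_N)
  also have "\<dots> = sw A.U (\<lambda>a b. sw A.U (\<lambda>c d. counit H (a \<bullet> h) \<odot>\<^bsub>A.U\<^esub> A.u (hact M c m) (hact N d n)) b) \<one>\<^sub>H"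
    by (rule sw_coassoc[OF A.module_utensor T2 H.one_closed])
  also have "\<dots> = sw A.U (\<lambda>a b. counit H (a \<bullet> h) \<odot>\<^bsub>A.U\<^esub> sw A.U (\<lambda>c d. A.u (hact M c m) (hact N d n)) b) \<one>\<^sub>H"
    by (intro sw_cong sw_linear_image[symmetric] linear_intros cl h m n)
  also have "\<dots> = sw A.U (\<lambda>a b. A.D (counit H (a \<bullet> h) \<odot>\<^bsub>H\<^esub> b) (A.u m n)) \<one>\<^sub>H"
    using h m n by (intro sw_cong)
      (simp_all add: A.diag_act_upure[symmetric] linear_map_smult[OF A.linear_map_diag_act_left] A.upure_closed)
  also have "\<dots> = A.D (fg h) (A.u m n)"
    unfolding fg_sw[OF h] using h m n
    by (intro sw_linear_image[symmetric] A.linear_map_diag_act_left cl) simp_all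
  finally show "A.lpure (hact M (fg h) m) n = A.D (fg h) (A.u m n)" .
  have "A.lpure m (hact N (fg' h) n) = sw A.U (\<lambda>a b. A.u (hact M a m) (hact N b (hact N (fg' h) n))) \<one>\<^sub>H"
    using h m n by (simp add: A.lpure_def A.diag_act_upure A.hact_N fg'_closed)
  also have "\<dots> = sw A.U (\<lambda>a b. A.u (hact M a m) (sw N (\<lambda>c d. counit H (d \<bullet> h) \<odot>\<^bsub>N\<^esub> hact N c n) b)) \<one>\<^sub>H"
    using h n by (intro sw_cong) (simp_all add: hact_mult_fg'[OF N])
  also have "\<dots> = sw A.U (\<lambda>a b. sw A.U (\<lambda>c d. counit H (d \<bullet> h) \<odot>\<^bsub>A.U\<^esub> A.u (hact M a m) (hact N c n)) b) \<one>\<^sub>H"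
    by (rule right) (simp_all add: h m n A.hact_M A.hact_N)
  also have "\<dots> = sw A.U (\<lambda>a b. sw A.U (\<lambda>c d. counit H (b \<bullet> h) \<odot>\<^bsub>A.U\<^esub> A.u (hact M c m) (hact N d n)) a) \<one>\<^sub>H"
    by (rule sw_coassoc[OF A.module_utensor T3 H.one_closed, symmetric])
  also have "\<dots> = sw A.U (\<lambda>a b. counit H (b \<bullet> h) \<odot>\<^bsub>A.U\<^esub> sw A.U (\<lambda>c d. A.u (hact M c m) (hact N d n)) a) \<one>\<^sub>H"
    by (intro sw_cong sw_linear_image[symmetric] linear_intros cl h m n)
  also have "\<dots> = sw A.U (\<lambda>a b. A.D (counit H (b \<bullet> h) \<odot>\<^bsub>H\<^esub> a) (A.u m n)) \<one>\<^sub>H"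
    using h m n by (intro sw_cong)
      (simp_all add: A.diag_act_upure[symmetric] linear_map_smult[OF A.linear_map_diag_act_left] A.upure_closed)
  also have "\<dots> = A.D (fg' h) (A.u m n)"
    unfolding fg'_sw[OF h] using h m n
    by (intro sw_linear_image[symmetric] A.linear_map_diag_act_left cl) simp_all
  finally show "A.lpure m (hact N (fg' h) n) = A.D (fg' h) (A.u m n)" .
qed

lemma lpure_balanced:
  "\<lbrakk>h \<in> carrier H; m \<in> carrier M; n \<in> carrier N\<rbrakk>
    \<Longrightarrow> A.lpure m (hact N (fg h) n) = A.lpure (hact M (fg' h) m) n"
  by (simp only: lpure_fg_right lpure_fg'_left)

end

end

section \<open>Concretely generated monoidal categories\<close>

lemma (in category) inverse_arrow_eq:
  assumes "inverse_pair C f g"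
  shows "inverse_arrow C f = g"
  unfolding inverse_arrow_def
proof (rule the_equality[of "inverse_pair C f"])
  fix g' assume g': "inverse_pair C f g'"
  have f: "f \<in> Hom C (Src C f) (Tgt C f)" using assms by (simp add: Hom_def inverse_pair_def)
  have h: "g \<in> Hom C (Tgt C f) (Src C f)" "g' \<in> Hom C (Tgt C f) (Src C f)"
    using assms g' by (simp_all add: inverse_pair_def)
  have "g' = (g \<cdot> f) \<cdot> g'" using Idn_left[OF h(2)] assms by (simp add: inverse_pair_def)
  also have "\<dots> = g \<cdot> (f \<cdot> g')" by (rule Cmp_assoc[OF h(2) f h(1), symmetric])
  also have "\<dots> = g" using Idn_right[OF h(1)] g' by (simp add: inverse_pair_def)
  finally show "g' = g" .
qed (rule assms)

text \<open>
  A category whose arrows are the extensional maps satisfying \<open>Lin\<close>, a strengthening of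
  linearity that is closed under composition and inverses.
\<close>

locale linear_category =
  fixes k :: "'k ring"
    and C :: "(('k, 'u, 'r) module_scheme, (('k, 'u, 'r) module_scheme, 'u) mor) mcat" (structure)
    and Lin :: "('k, 'u, 'r) module_scheme \<Rightarrow> ('k, 'u, 'r) module_scheme \<Rightarrow> ('u \<Rightarrow> 'u) \<Rightarrow> bool"
  assumes Ar_iff: "f \<in> Ar C \<longleftrightarrow> src f \<in> Ob C \<and> tgt f \<in> Ob C \<and> Lin (src f) (tgt f) (fn f) \<and>
      fn f \<in> extensional (carrier (src f))"
    and Src_eq: "Src C = src" and Tgt_eq: "Tgt C = tgt"
    and Idn_eq: "Idn C A = Mor A A (\<lambda>m\<in>carrier A. m)"
    and Cmp_eq: "g \<cdot> f = Mor (src f) (tgt g) (compose (carrier (src f)) (fn g) (fn f))"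
    and Ob_module: "A \<in> Ob C \<Longrightarrow> module k A"
    and Lin_linear: "Lin A B \<phi> \<Longrightarrow> linear_map k A B \<phi>"
    and Lin_cong: "A \<in> Ob C \<Longrightarrow> B \<in> Ob C \<Longrightarrow> Lin A B \<phi> \<Longrightarrow> (\<And>a. a \<in> carrier A \<Longrightarrow> \<phi> a = \<psi> a) \<Longrightarrow> Lin A B \<psi>"
    and Lin_id: "A \<in> Ob C \<Longrightarrow> Lin A A (\<lambda>a. a)"
    and Lin_compose: "Lin A B \<phi> \<Longrightarrow> Lin B D \<psi> \<Longrightarrow> Lin A D (\<lambda>a. \<psi> (\<phi> a))"
    and Lin_inverse: "A \<in> Ob C \<Longrightarrow> B \<in> Ob C \<Longrightarrow> Lin A B \<phi> \<Longrightarrow> (\<And>b. b \<in> carrier B \<Longrightarrow> \<psi> b \<in> carrier A)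
      \<Longrightarrow> (\<And>a. a \<in> carrier A \<Longrightarrow> \<psi> (\<phi> a) = a) \<Longrightarrow> (\<And>b. b \<in> carrier B \<Longrightarrow> \<phi> (\<psi> b) = b) \<Longrightarrow> Lin B A \<psi>"
begin

lemma Hom_iff: "f \<in> Hom C A B \<longleftrightarrow> f \<in> Ar C \<and> src f = A \<and> tgt f = B"
  by (simp add: Hom_def Src_eq Tgt_eq)

lemma HomD:
  assumes "f \<in> Hom C A B"
  shows "f \<in> Ar C" "src f = A" "tgt f = B" "A \<in> Ob C" "B \<in> Ob C"
  using assms by (auto simp: Hom_iff Ar_iff)

lemma Hom_linear: "f \<in> Hom C A B \<Longrightarrow> linear_map k A B (fn f)"
  by (auto simp: Hom_iff Ar_iff intro: Lin_linear)

lemma Hom_Lin: "f \<in> Hom C A B \<Longrightarrow> Lin A B (fn f)"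
  by (auto simp: Hom_iff Ar_iff)

lemma fn_closed: "f \<in> Ar C \<Longrightarrow> a \<in> carrier (src f) \<Longrightarrow> fn f a \<in> carrier (tgt f)"
  using linear_map_closed[OF Lin_linear] by (auto simp: Ar_iff)

lemma restrict_Ar: "A \<in> Ob C \<Longrightarrow> B \<in> Ob C \<Longrightarrow> Lin A B \<phi> \<Longrightarrow> Mor A B (\<lambda>a\<in>carrier A. \<phi> a) \<in> Ar C"
  unfolding Ar_iff by (auto intro: Lin_cong)

lemma src_simps [simp]: "src (Idn C A) = A" "tgt (Idn C A) = A" "src (g \<cdot> f) = src f" "tgt (g \<cdot> f) = tgt g"
  by (simp_all add: Idn_eq Cmp_eq)

lemma fn_Idn [simp]: "a \<in> carrier A \<Longrightarrow> fn (Idn C A) a = a"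
  by (simp add: Idn_eq)

lemma fn_Cmp [simp]: "a \<in> carrier (src f) \<Longrightarrow> fn (g \<cdot> f) a = fn g (fn f a)"
  by (simp add: Cmp_eq compose_def)

lemma Idn_Ar [simp]: "A \<in> Ob C \<Longrightarrow> Idn C A \<in> Ar C"
  unfolding Idn_eq by (rule restrict_Ar) (simp_all add: Lin_id)

lemma Cmp_Ar [simp]: "f \<in> Ar C \<Longrightarrow> g \<in> Ar C \<Longrightarrow> tgt f = src g \<Longrightarrow> g \<cdot> f \<in> Ar C"
  unfolding Cmp_eq compose_def by (rule restrict_Ar) (auto simp: Ar_iff intro: Lin_compose)

lemma arrow_eqI:
  assumes "f \<in> Ar C" "g \<in> Ar C" "src f = src g" "tgt f = tgt g"
    "\<And>a. a \<in> carrier (src f) \<Longrightarrow> fn f a = fn g a"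
  shows "f = g"
proof -
  have "fn f = fn g" using assms by (intro extensionalityI[of _ "carrier (src f)"]) (auto simp: Ar_iff)
  then show ?thesis using assms(3,4) by (cases f; cases g) simp
qed

lemma category: "category C"
proof
  fix f assume "f \<in> Ar C"
  then show "Src C f \<in> Ob C" "Tgt C f \<in> Ob C" by (simp_all add: Ar_iff Src_eq Tgt_eq)
next
  fix A assume "A \<in> Ob C"
  then show "Idn C A \<in> Hom C A A" by (simp add: Hom_iff)
next
  fix f g A B D assume "f \<in> Hom C A B" "g \<in> Hom C B D"
  then show "g \<cdot> f \<in> Hom C A D" by (simp add: Hom_iff)
next
  fix f A B assume f: "f \<in> Hom C A B"
  note f' = HomD[OF f]
  show "Idn C B \<cdot> f = f" "f \<cdot> Idn C A = f"
    using f' fn_closed[OF f'(1)] by (auto intro!: arrow_eqI)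
next
  fix f g h A B D E assume "f \<in> Hom C A B" "g \<in> Hom C B D" "h \<in> Hom C D E"
  then show "h \<cdot> (g \<cdot> f) = (h \<cdot> g) \<cdot> f"
    using fn_closed[of f] by (auto simp: Hom_iff intro!: arrow_eqI)
qed

sublocale category C by (rule category)

text \<open>
  An inverse map of underlying sets is enough: it inherits linearity and equivariance.
\<close>

lemma inverse_pairI:
  assumes f: "f \<in> Hom C A B" and j: "\<And>b. b \<in> carrier B \<Longrightarrow> j b \<in> carrier A"
    and "\<And>a. a \<in> carrier A \<Longrightarrow> j (fn f a) = a" "\<And>b. b \<in> carrier B \<Longrightarrow> fn f (j b) = b"
  shows "inverse_pair C f (Mor B A (\<lambda>b\<in>carrier B. j b))"
proof -
  note f' = HomD[OF f]
  have g: "Mor B A (\<lambda>b\<in>carrier B. j b) \<in> Ar C"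
    using Lin_inverse[OF f'(4,5) Hom_Lin[OF f] assms(2-4)] f' by (intro restrict_Ar) auto
  show ?thesis
    unfolding inverse_pair_def Hom_iff Src_eq Tgt_eq
    using f' g assms(2-4) fn_closed[OF f'(1)] by (auto intro!: arrow_eqI)
qed

end

text \<open>
  \<open>pt\<close> are the pure elements that span the tensor product, \<open>la\<close> and \<open>ra\<close> the values of the unit
  constraints on them, and \<open>e\<close> is the element of the unit object for which \<open>pt e a\<close> and \<open>pt a e\<close>
  invert the unit constraints.  The last assumption is the triangle identity on pure elements; the
  other coherence laws hold automatically, both sides having the same value on iterated pure
  elements.
\<close>

locale generated_monoidal_category = linear_category k C Lin
  for k :: "'k ring"
    and C :: "(('k, 'u, 'r) module_scheme, (('k, 'u, 'r) module_scheme, 'u) mor) mcat" (structure)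
    and Lin :: "('k, 'u, 'r) module_scheme \<Rightarrow> ('k, 'u, 'r) module_scheme \<Rightarrow> ('u \<Rightarrow> 'u) \<Rightarrow> bool" +
  fixes pt :: "('k, 'u, 'r) module_scheme \<Rightarrow> ('k, 'u, 'r) module_scheme \<Rightarrow> 'u \<Rightarrow> 'u \<Rightarrow> 'u"
    and tm :: "('k, 'u, 'r) module_scheme \<Rightarrow> ('k, 'u, 'r) module_scheme \<Rightarrow> ('u \<Rightarrow> 'u) \<Rightarrow> ('u \<Rightarrow> 'u) \<Rightarrow> 'u \<Rightarrow> 'u"
    and asc :: "('k, 'u, 'r) module_scheme \<Rightarrow> ('k, 'u, 'r) module_scheme \<Rightarrow> ('k, 'u, 'r) module_scheme \<Rightarrow> 'u \<Rightarrow> 'u"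
    and lun run :: "('k, 'u, 'r) module_scheme \<Rightarrow> 'u \<Rightarrow> 'u"
    and la ra :: "('k, 'u, 'r) module_scheme \<Rightarrow> 'u \<Rightarrow> 'u \<Rightarrow> 'u"
    and e :: 'u
  assumes TensO_closed: "A \<in> Ob C \<Longrightarrow> B \<in> Ob C \<Longrightarrow> A \<diamondop> B \<in> Ob C"
    and pt_generated: "A \<in> Ob C \<Longrightarrow> B \<in> Ob C \<Longrightarrow> generated k A B (A \<diamondop> B) (pt A B)"
    and TensA_eq: "f \<star> g = Mor (src f \<diamondop> src g) (tgt f \<diamondop> tgt g)
      (\<lambda>t\<in>carrier (src f \<diamondop> src g). tm (tgt f) (tgt g) (fn f) (fn g) t)"
    and tm_Lin: "\<lbrakk>A \<in> Ob C; B \<in> Ob C; A' \<in> Ob C; B' \<in> Ob C; Lin A A' \<phi>; Lin B B' \<psi>\<rbrakk>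
      \<Longrightarrow> Lin (A \<diamondop> B) (A' \<diamondop> B') (tm A' B' \<phi> \<psi>)"
    and tm_pt: "\<lbrakk>A \<in> Ob C; B \<in> Ob C; A' \<in> Ob C; B' \<in> Ob C; Lin A A' \<phi>; Lin B B' \<psi>; a \<in> carrier A; b \<in> carrier B\<rbrakk>
      \<Longrightarrow> tm A' B' \<phi> \<psi> (pt A B a b) = pt A' B' (\<phi> a) (\<psi> b)"
    and Asc_eq: "Asc C A B D = Mor ((A \<diamondop> B) \<diamondop> D) (A \<diamondop> (B \<diamondop> D)) (\<lambda>t\<in>carrier ((A \<diamondop> B) \<diamondop> D). asc A B D t)"
    and asc_Lin: "\<lbrakk>A \<in> Ob C; B \<in> Ob C; D \<in> Ob C\<rbrakk> \<Longrightarrow> Lin ((A \<diamondop> B) \<diamondop> D) (A \<diamondop> (B \<diamondop> D)) (asc A B D)"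
    and asc_pt: "\<lbrakk>A \<in> Ob C; B \<in> Ob C; D \<in> Ob C; a \<in> carrier A; b \<in> carrier B; d \<in> carrier D\<rbrakk>
      \<Longrightarrow> asc A B D (pt (A \<diamondop> B) D (pt A B a b) d) = pt A (B \<diamondop> D) a (pt B D b d)"
    and asc_inverse: "\<lbrakk>A \<in> Ob C; B \<in> Ob C; D \<in> Ob C\<rbrakk>
      \<Longrightarrow> \<exists>j. linear_map k (A \<diamondop> (B \<diamondop> D)) ((A \<diamondop> B) \<diamondop> D) j \<and>
        (\<forall>a\<in>carrier A. \<forall>b\<in>carrier B. \<forall>d\<in>carrier D.
          j (pt A (B \<diamondop> D) a (pt B D b d)) = pt (A \<diamondop> B) D (pt A B a b) d)"
    and UnitO_closed: "UnitO C \<in> Ob C"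
    and Lun_eq: "Lun C A = Mor (UnitO C \<diamondop> A) A (\<lambda>t\<in>carrier (UnitO C \<diamondop> A). lun A t)"
    and Run_eq: "Run C A = Mor (A \<diamondop> UnitO C) A (\<lambda>t\<in>carrier (A \<diamondop> UnitO C). run A t)"
    and lun_Lin: "A \<in> Ob C \<Longrightarrow> Lin (UnitO C \<diamondop> A) A (lun A)"
    and run_Lin: "A \<in> Ob C \<Longrightarrow> Lin (A \<diamondop> UnitO C) A (run A)"
    and lun_pt: "\<lbrakk>A \<in> Ob C; r \<in> carrier (UnitO C); a \<in> carrier A\<rbrakk> \<Longrightarrow> lun A (pt (UnitO C) A r a) = la A r a"
    and run_pt: "\<lbrakk>A \<in> Ob C; r \<in> carrier (UnitO C); a \<in> carrier A\<rbrakk> \<Longrightarrow> run A (pt A (UnitO C) a r) = ra A a r"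
    and la_natural: "\<lbrakk>A \<in> Ob C; B \<in> Ob C; Lin A B \<phi>; r \<in> carrier (UnitO C); a \<in> carrier A\<rbrakk> \<Longrightarrow> \<phi> (la A r a) = la B r (\<phi> a)"
    and ra_natural: "\<lbrakk>A \<in> Ob C; B \<in> Ob C; Lin A B \<phi>; r \<in> carrier (UnitO C); a \<in> carrier A\<rbrakk> \<Longrightarrow> \<phi> (ra A a r) = ra B (\<phi> a) r"
    and e_closed: "e \<in> carrier (UnitO C)"
    and la_e: "\<lbrakk>A \<in> Ob C; a \<in> carrier A\<rbrakk> \<Longrightarrow> la A e a = a"
    and ra_e: "\<lbrakk>A \<in> Ob C; a \<in> carrier A\<rbrakk> \<Longrightarrow> ra A a e = a"
    and pt_e_left: "\<lbrakk>A \<in> Ob C; r \<in> carrier (UnitO C); a \<in> carrier A\<rbrakk> \<Longrightarrow> pt (UnitO C) A e (la A r a) = pt (UnitO C) A r a"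
    and pt_e_right: "\<lbrakk>A \<in> Ob C; r \<in> carrier (UnitO C); a \<in> carrier A\<rbrakk> \<Longrightarrow> pt A (UnitO C) (ra A a r) e = pt A (UnitO C) a r"
    and pt_balanced: "\<lbrakk>A \<in> Ob C; B \<in> Ob C; r \<in> carrier (UnitO C); a \<in> carrier A; b \<in> carrier B\<rbrakk>
      \<Longrightarrow> pt A B a (la B r b) = pt A B (ra A a r) b"
begin

lemmas [simp] = TensO_closed UnitO_closed e_closed

lemma pt_closed [simp]: "A \<in> Ob C \<Longrightarrow> B \<in> Ob C \<Longrightarrow> a \<in> carrier A \<Longrightarrow> b \<in> carrier B \<Longrightarrow> pt A B a b \<in> carrier (A \<diamondop> B)"
  by (rule generatedD(5)[OF pt_generated])

lemma pt_linear_left: "A \<in> Ob C \<Longrightarrow> B \<in> Ob C \<Longrightarrow> b \<in> carrier B \<Longrightarrow> linear_map k A (A \<diamondop> B) (\<lambda>a. pt A B a b)"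
  by (rule bilinear_left[OF generatedD(4)[OF pt_generated] _ linear_map_id])

lemma pt_linear_right: "A \<in> Ob C \<Longrightarrow> B \<in> Ob C \<Longrightarrow> a \<in> carrier A \<Longrightarrow> linear_map k B (A \<diamondop> B) (\<lambda>b. pt A B a b)"
  by (rule bilinear_right[OF generatedD(4)[OF pt_generated] _ linear_map_id])

lemma tensor_src_simps [simp]:
  "src (f \<star> g) = src f \<diamondop> src g" "tgt (f \<star> g) = tgt f \<diamondop> tgt g"
  "src (Asc C A B D) = (A \<diamondop> B) \<diamondop> D" "tgt (Asc C A B D) = A \<diamondop> (B \<diamondop> D)"
  "src (Lun C A) = UnitO C \<diamondop> A" "tgt (Lun C A) = A" "src (Run C A) = A \<diamondop> UnitO C" "tgt (Run C A) = A"
  by (simp_all add: TensA_eq Asc_eq Lun_eq Run_eq)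

lemma TensA_Ar [simp]: "f \<in> Ar C \<Longrightarrow> g \<in> Ar C \<Longrightarrow> f \<star> g \<in> Ar C"
  unfolding TensA_eq by (rule restrict_Ar) (auto simp: Ar_iff intro!: tm_Lin)

lemma Asc_Ar [simp]: "\<lbrakk>A \<in> Ob C; B \<in> Ob C; D \<in> Ob C\<rbrakk> \<Longrightarrow> Asc C A B D \<in> Ar C"
  unfolding Asc_eq by (rule restrict_Ar) (auto intro!: asc_Lin)

lemma Lun_Ar [simp]: "A \<in> Ob C \<Longrightarrow> Lun C A \<in> Ar C"
  unfolding Lun_eq by (rule restrict_Ar) (auto intro!: lun_Lin)

lemma Run_Ar [simp]: "A \<in> Ob C \<Longrightarrow> Run C A \<in> Ar C"
  unfolding Run_eq by (rule restrict_Ar) (auto intro!: run_Lin)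

lemma fn_TensA [simp]:
  "\<lbrakk>f \<in> Ar C; g \<in> Ar C; src f = A; src g = B; a \<in> carrier A; b \<in> carrier B\<rbrakk>
    \<Longrightarrow> fn (f \<star> g) (pt A B a b) = pt (tgt f) (tgt g) (fn f a) (fn g b)"
  by (auto simp: TensA_eq Ar_iff tm_pt)

lemma fn_Asc [simp]: "\<lbrakk>A \<in> Ob C; B \<in> Ob C; D \<in> Ob C; a \<in> carrier A; b \<in> carrier B; d \<in> carrier D\<rbrakk>
      \<Longrightarrow> fn (Asc C A B D) (pt (A \<diamondop> B) D (pt A B a b) d) = pt A (B \<diamondop> D) a (pt B D b d)"
  by (simp add: Asc_eq asc_pt)

lemma fn_Lun [simp]: "\<lbrakk>A \<in> Ob C; r \<in> carrier (UnitO C); a \<in> carrier A\<rbrakk> \<Longrightarrow> fn (Lun C A) (pt (UnitO C) A r a) = la A r a"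
  by (simp add: Lun_eq lun_pt)

lemma fn_Run [simp]: "\<lbrakk>A \<in> Ob C; r \<in> carrier (UnitO C); a \<in> carrier A\<rbrakk> \<Longrightarrow> fn (Run C A) (pt A (UnitO C) a r) = ra A a r"
  by (simp add: Run_eq run_pt)

lemma la_closed [simp]: "\<lbrakk>A \<in> Ob C; r \<in> carrier (UnitO C); a \<in> carrier A\<rbrakk> \<Longrightarrow> la A r a \<in> carrier A"
  using fn_closed[OF Lun_Ar, of A "pt (UnitO C) A r a"] by simp

lemma ra_closed [simp]: "\<lbrakk>A \<in> Ob C; r \<in> carrier (UnitO C); a \<in> carrier A\<rbrakk> \<Longrightarrow> ra A a r \<in> carrier A"
  using fn_closed[OF Run_Ar, of A "pt A (UnitO C) a r"] by simp

lemma Ar_linear: "f \<in> Ar C \<Longrightarrow> src f = A \<Longrightarrow> tgt f = B \<Longrightarrow> linear_map k A B (fn f)"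
  by (auto simp: Ar_iff intro: Lin_linear)

lemma arrow_ext:
  assumes "A \<in> Ob C" "B \<in> Ob C" "f \<in> Ar C" "g \<in> Ar C" "src f = A \<diamondop> B" "src g = A \<diamondop> B" "tgt f = tgt g"
    and "\<And>a b. a \<in> carrier A \<Longrightarrow> b \<in> carrier B \<Longrightarrow> fn f (pt A B a b) = fn g (pt A B a b)"
  shows "f = g"
proof (rule arrow_eqI[OF assms(3,4)])
  fix t assume "t \<in> carrier (src f)"
  then have t: "t \<in> carrier (A \<diamondop> B)" by (simp add: assms)
  have T: "tgt f \<in> Ob C" using assms by (simp add: Ar_iff)
  show "fn f t = fn g t"
    by (rule generated_ext[OF pt_generated[OF assms(1,2)] Ob_module[OF T] Ar_linear[OF assms(3,5) HOL.refl]
        Ar_linear[OF assms(4,6) assms(7)[symmetric]] assms(8) t])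
qed (simp_all add: assms)

lemma arrow_ext3:
  assumes "A \<in> Ob C" "B \<in> Ob C" "D \<in> Ob C" "f \<in> Ar C" "g \<in> Ar C"
    "src f = (A \<diamondop> B) \<diamondop> D" "src g = (A \<diamondop> B) \<diamondop> D" "tgt f = tgt g"
    and eq: "\<And>a b d. a \<in> carrier A \<Longrightarrow> b \<in> carrier B \<Longrightarrow> d \<in> carrier D \<Longrightarrow>
      fn f (pt (A \<diamondop> B) D (pt A B a b) d) = fn g (pt (A \<diamondop> B) D (pt A B a b) d)"
  shows "f = g"
proof (rule arrow_ext[of "A \<diamondop> B" D])
  fix s d assume s: "s \<in> carrier (A \<diamondop> B)" and d: "d \<in> carrier D"
  note AB = TensO_closed[OF assms(1,2)]
  note l = pt_linear_left[OF AB assms(3) d]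
  have T: "tgt f \<in> Ob C" using assms by (simp add: Ar_iff)
  show "fn f (pt (A \<diamondop> B) D s d) = fn g (pt (A \<diamondop> B) D s d)"
    by (rule generated_ext[OF pt_generated[OF assms(1,2)] Ob_module[OF T]
        linear_map_compose[OF l Ar_linear[OF assms(4,6) HOL.refl]]
        linear_map_compose[OF l Ar_linear[OF assms(5,7) assms(8)[symmetric]]] eq[OF _ _ d] s])
qed (use assms in simp_all)

lemma arrow_ext4:
  assumes "A \<in> Ob C" "B \<in> Ob C" "D \<in> Ob C" "E \<in> Ob C" "f \<in> Ar C" "g \<in> Ar C"
    "src f = ((A \<diamondop> B) \<diamondop> D) \<diamondop> E" "src g = ((A \<diamondop> B) \<diamondop> D) \<diamondop> E" "tgt f = tgt g"
    and eq: "\<And>a b d x. a \<in> carrier A \<Longrightarrow> b \<in> carrier B \<Longrightarrow> d \<in> carrier D \<Longrightarrow> x \<in> carrier E \<Longrightarrow>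
      fn f (pt ((A \<diamondop> B) \<diamondop> D) E (pt (A \<diamondop> B) D (pt A B a b) d) x)
      = fn g (pt ((A \<diamondop> B) \<diamondop> D) E (pt (A \<diamondop> B) D (pt A B a b) d) x)"
  shows "f = g"
proof (rule arrow_ext3[of "A \<diamondop> B" D E])
  fix s d x assume s: "s \<in> carrier (A \<diamondop> B)" and d: "d \<in> carrier D" and x: "x \<in> carrier E"
  note AB = TensO_closed[OF assms(1,2)]
  note ABD = TensO_closed[OF AB assms(3)]
  note l = linear_map_compose[OF pt_linear_left[OF AB assms(3) d] pt_linear_left[OF ABD assms(4) x]]
  have T: "tgt f \<in> Ob C" using assms by (simp add: Ar_iff)
  show "fn f (pt ((A \<diamondop> B) \<diamondop> D) E (pt (A \<diamondop> B) D s d) x) = fn g (pt ((A \<diamondop> B) \<diamondop> D) E (pt (A \<diamondop> B) D s d) x)"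
    by (rule generated_ext[OF pt_generated[OF assms(1,2)] Ob_module[OF T]
        linear_map_compose[OF l Ar_linear[OF assms(5,7) HOL.refl]]
        linear_map_compose[OF l Ar_linear[OF assms(6,8) assms(9)[symmetric]]] eq[OF _ _ d x] s])
qed (use assms in simp_all)

lemma inverse_pair_Lun: "A \<in> Ob C \<Longrightarrow> inverse_pair C (Lun C A) (Mor A (UnitO C \<diamondop> A) (\<lambda>a\<in>carrier A. pt (UnitO C) A e a))"
proof (rule inverse_pairI)
  assume A: "A \<in> Ob C"
  then show L: "Lun C A \<in> Hom C (UnitO C \<diamondop> A) A" by (simp add: Hom_iff)
  show "fn (Lun C A) (pt (UnitO C) A e b) = b" if "b \<in> carrier A" for b using A that by (simp add: la_e)
  fix t assume t: "t \<in> carrier (UnitO C \<diamondop> A)"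
  show "pt (UnitO C) A e (fn (Lun C A) t) = t"
    by (rule generated_ext[OF pt_generated[OF UnitO_closed A] Ob_module[OF TensO_closed[OF UnitO_closed A]]
       linear_map_compose[OF Hom_linear[OF L] pt_linear_right] linear_map_id _ t]) (use A in \<open>simp_all add: pt_e_left\<close>)
qed simp_all

lemma inverse_pair_Run: "A \<in> Ob C \<Longrightarrow> inverse_pair C (Run C A) (Mor A (A \<diamondop> UnitO C) (\<lambda>a\<in>carrier A. pt A (UnitO C) a e))"
proof (rule inverse_pairI)
  assume A: "A \<in> Ob C"
  then show L: "Run C A \<in> Hom C (A \<diamondop> UnitO C) A" by (simp add: Hom_iff)
  show "fn (Run C A) (pt A (UnitO C) b e) = b" if "b \<in> carrier A" for b using A that by (simp add: ra_e)
  fix t assume t: "t \<in> carrier (A \<diamondop> UnitO C)"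
  show "pt A (UnitO C) (fn (Run C A) t) e = t"
    by (rule generated_ext[OF pt_generated[OF A UnitO_closed] Ob_module[OF TensO_closed[OF A UnitO_closed]]
       linear_map_compose[OF Hom_linear[OF L] pt_linear_left] linear_map_id _ t]) (use A in \<open>simp_all add: pt_e_right\<close>)
qed simp_all

lemma Asc_iso_arrow:
  assumes A: "A \<in> Ob C" "B \<in> Ob C" "D \<in> Ob C"
  shows "iso_arrow C (Asc C A B D)"
proof -
  obtain j where j: "linear_map k (A \<diamondop> (B \<diamondop> D)) ((A \<diamondop> B) \<diamondop> D) j"
    "\<And>a b d. a \<in> carrier A \<Longrightarrow> b \<in> carrier B \<Longrightarrow> d \<in> carrier D
      \<Longrightarrow> j (pt A (B \<diamondop> D) a (pt B D b d)) = pt (A \<diamondop> B) D (pt A B a b) d"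
    using asc_inverse[OF A] by blast
  have H: "Asc C A B D \<in> Hom C ((A \<diamondop> B) \<diamondop> D) (A \<diamondop> (B \<diamondop> D))" using A by (simp add: Hom_iff)
  have "inverse_pair C (Asc C A B D) (Mor (A \<diamondop> (B \<diamondop> D)) ((A \<diamondop> B) \<diamondop> D) (\<lambda>b\<in>carrier (A \<diamondop> (B \<diamondop> D)). j b))"
  proof (rule inverse_pairI[OF H linear_map_closed[OF j(1)]])
    show "j (fn (Asc C A B D) t) = t" if t: "t \<in> carrier ((A \<diamondop> B) \<diamondop> D)" for t
      by (rule generated_ext_left[OF pt_generated[OF A(1,2)] pt_generated[OF TensO_closed[OF A(1,2)] A(3)]
        Ob_module linear_map_compose[OF Hom_linear[OF H] j(1)] linear_map_id _ t]) (use A j(2) in simp_all)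
    show "fn (Asc C A B D) (j t) = t" if t: "t \<in> carrier (A \<diamondop> (B \<diamondop> D))" for t
      by (rule generated_ext_right[OF pt_generated[OF A(2,3)] pt_generated[OF A(1) TensO_closed[OF A(2,3)]]
        Ob_module linear_map_compose[OF j(1) Hom_linear[OF H]] linear_map_id _ t]) (use A j(2) in simp_all)
  qed
  then show ?thesis by (auto simp: iso_arrow_def)
qed

lemma monoidal_category: "monoidal_category C"
proof
  fix A B assume AB: "A \<in> Ob C" "B \<in> Ob C"
  then show "A \<diamondop> B \<in> Ob C" by simp
  show "Idn C A \<star> Idn C B = Idn C (A \<diamondop> B)" using AB by (intro arrow_ext[of A B]) simp_all
  show "(Idn C A \<star> Lun C B) \<cdot> Asc C A (UnitO C) B = Run C A \<star> Idn C B"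
    using AB by (intro arrow_ext3[of A "UnitO C" B]) (simp_all add: pt_balanced)
next
  fix f g A B A' B' assume fg: "f \<in> Hom C A B" "g \<in> Hom C A' B'"
  show "f \<star> g \<in> Hom C (A \<diamondop> A') (B \<diamondop> B')" using fg by (simp add: Hom_iff)
next
  fix f g f' g' A B D A' B' D'
  assume fg: "f \<in> Hom C A B" "g \<in> Hom C B D" "f' \<in> Hom C A' B'" "g' \<in> Hom C B' D'"
  show "(g \<cdot> f) \<star> (g' \<cdot> f') = (g \<star> g') \<cdot> (f \<star> f')"
    using HomD[OF fg(1)] HomD[OF fg(2)] HomD[OF fg(3)] HomD[OF fg(4)] fn_closed[of f] fn_closed[of f']
    by (intro arrow_ext[of A A']) simp_all
next
  show "UnitO C \<in> Ob C" by simp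
next
  fix A B D assume "A \<in> Ob C" "B \<in> Ob C" "D \<in> Ob C"
  then show "Asc C A B D \<in> Hom C ((A \<diamondop> B) \<diamondop> D) (A \<diamondop> (B \<diamondop> D))" "iso_arrow C (Asc C A B D)"
    by (simp_all add: Hom_iff Asc_iso_arrow)
next
  fix f g h A A' B B' D D' assume fg: "f \<in> Hom C A A'" "g \<in> Hom C B B'" "h \<in> Hom C D D'"
  show "Asc C A' B' D' \<cdot> ((f \<star> g) \<star> h) = (f \<star> (g \<star> h)) \<cdot> Asc C A B D"
    using HomD[OF fg(1)] HomD[OF fg(2)] HomD[OF fg(3)] fn_closed[of f] fn_closed[of g] fn_closed[of h]
    by (intro arrow_ext3[of A B D]) simp_all
next
  fix A assume A: "A \<in> Ob C"
  then show "Lun C A \<in> Hom C (UnitO C \<diamondop> A) A" "Run C A \<in> Hom C (A \<diamondop> UnitO C) A" by (simp_all add: Hom_iff)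
  show "iso_arrow C (Lun C A)" "iso_arrow C (Run C A)"
    using inverse_pair_Lun[OF A] inverse_pair_Run[OF A] by (auto simp: iso_arrow_def)
next
  fix f A B assume f: "f \<in> Hom C A B"
  note f' = HomD[OF f] fn_closed[of f]
  show "Lun C B \<cdot> (Idn C (UnitO C) \<star> f) = f \<cdot> Lun C A"
    using f' by (intro arrow_ext[of "UnitO C" A]) (simp_all add: la_natural[OF _ _ Hom_Lin[OF f]])
  show "Run C B \<cdot> (f \<star> Idn C (UnitO C)) = f \<cdot> Run C A"
    using f' by (intro arrow_ext[of A "UnitO C"]) (simp_all add: ra_natural[OF _ _ Hom_Lin[OF f]])
next
  fix A B D E assume "A \<in> Ob C" "B \<in> Ob C" "D \<in> Ob C" "E \<in> Ob C"
  then show "(Idn C A \<star> Asc C B D E) \<cdot> Asc C A (B \<diamondop> D) E \<cdot> (Asc C A B D \<star> Idn C E)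
        = Asc C A B (D \<diamondop> E) \<cdot> Asc C (A \<diamondop> B) D E"
    by (intro arrow_ext4[of A B D E]) simp_all
qed

end

section \<open>The two monoidal categories\<close>

lemma linear_map_inverse:
  assumes "module k A" "module k B" and f: "linear_map k A B \<phi>"
    and g: "\<And>b. b \<in> carrier B \<Longrightarrow> \<psi> b \<in> carrier A"
    and inv: "\<And>a. a \<in> carrier A \<Longrightarrow> \<psi> (\<phi> a) = a" "\<And>b. b \<in> carrier B \<Longrightarrow> \<phi> (\<psi> b) = b"
  shows "linear_map k B A \<psi>"
proof -
  interpret A: module k A by fact
  interpret B: module k B by fact
  show ?thesis
  proof (rule linear_mapI[OF g])
    fix b b' assume b: "b \<in> carrier B" "b' \<in> carrier B"
    then have "\<phi> (\<psi> b \<oplus>\<^bsub>A\<^esub> \<psi> b') = b \<oplus>\<^bsub>B\<^esub> b'"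
      using linear_map_add[OF f g g] inv(2) by simp
    then show "\<psi> (b \<oplus>\<^bsub>B\<^esub> b') = \<psi> b \<oplus>\<^bsub>A\<^esub> \<psi> b'"
      using inv(1)[of "\<psi> b \<oplus>\<^bsub>A\<^esub> \<psi> b'"] g b by simp
  next
    fix x b assume b: "x \<in> carrier k" "b \<in> carrier B"
    then have "\<phi> (x \<odot>\<^bsub>A\<^esub> \<psi> b) = x \<odot>\<^bsub>B\<^esub> b"
      using linear_map_smult[OF f _ g] inv(2) by simp
    then show "\<psi> (x \<odot>\<^bsub>B\<^esub> b) = x \<odot>\<^bsub>A\<^esub> \<psi> b"
      using inv(1)[of "x \<odot>\<^bsub>A\<^esub> \<psi> b"] g b by simp
  qed
qed

lemma kmod_cat_simps:
  "Ob (kmod_cat k) = {M. module k M}"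
  "Src (kmod_cat k) = src" "Tgt (kmod_cat k) = tgt"
  "TensO (kmod_cat k) = utensor k"
  "UnitO (kmod_cat k) = unit_module k"
  by (simp_all add: kmod_cat_def)

lemma hmod_cat_simps:
  "Ob (hmod_cat k H) = {M. left_module k H M}"
  "Src (hmod_cat k H) = src" "Tgt (hmod_cat k H) = tgt"
  "TensO (hmod_cat k H) = ltensor k H"
  "UnitO (hmod_cat k H) = HL k H"
  by (simp_all add: hmod_cat_def)

lemma linear_category_kmod: "linear_category k (kmod_cat k) (linear_map k)"
  by (rule linear_category.intro)
    (auto simp: kmod_cat_def intro: linear_map_cong linear_map_compose linear_map_id linear_map_inverse)

definition kassoc_fun where
  "kassoc_fun k M N P t = unf k M (utensor k N P) [(m, upure k N P n p). (s, p) \<leftarrow> terms t, (m, n) \<leftarrow> terms s]"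

lemma
  fixes M :: "('k, ('k, 'h, 'x) elt, 'r) module_scheme"
    and N :: "('k, ('k, 'h, 'x) elt, 's) module_scheme" and P :: "('k, ('k, 'h, 'x) elt, 't) module_scheme"
  assumes M: "module k M" and N: "module k N" and P: "module k P"
  shows linear_map_kassoc_fun:
      "linear_map k (utensor k (utensor k M N) P) (utensor k M (utensor k N P)) (kassoc_fun k M N P)"
    and kassoc_fun_upure_left: "\<lbrakk>s \<in> carrier (utensor k M N); p \<in> carrier P\<rbrakk> \<Longrightarrow>
      kassoc_fun k M N P (upure k (utensor k M N) P s p) =
      tsum (utensor k M (utensor k N P)) (\<lambda>m n. upure k M (utensor k N P) m (upure k N P n p)) (terms s)"
    and kassoc_fun_upure: "\<lbrakk>m \<in> carrier M; n \<in> carrier N; p \<in> carrier P\<rbrakk> \<Longrightarrow>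
      kassoc_fun k M N P (upure k (utensor k M N) P (upure k M N m n) p) =
      upure k M (utensor k N P) m (upure k N P n p)"
    and kassoc_fun_inverse: "\<exists>j. linear_map k (utensor k M (utensor k N P)) (utensor k (utensor k M N) P) j \<and>
      (\<forall>m\<in>carrier M. \<forall>n\<in>carrier N. \<forall>p\<in>carrier P.
        j (upure k M (utensor k N P) m (upure k N P n p)) = upure k (utensor k M N) P (upure k M N m n) p)"
proof -
  interpret MN: utensor_pair k M N by (rule utensor_pairI) fact+
  interpret NP: utensor_pair k N P by (rule utensor_pairI) fact+
  interpret l: utensor_pair k MN.U P by (rule utensor_pairI) (rule MN.module_utensor P)+
  interpret r: utensor_pair k M NP.U by (rule utensor_pairI) (rule NP.module_utensor M)+
  let ?A = "\<lambda>s p. tsum r.U (\<lambda>m n. r.u m (NP.u n p)) (terms s)"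
  note ax = M N P MN.module_utensor NP.module_utensor NP.bilinear_upure MN.utensor_terms(1)
    MN.linear_map_lift[OF r.module_utensor]
  have A: "bilinear k MN.U P r.U ?A" by (rule bilinear_assoc[OF ax])
  have eq: "kassoc_fun k M N P t = tsum r.U ?A (terms t)" if "t \<in> carrier l.U" for t
    using assoc_tsum[OF ax that] by (simp add: kassoc_fun_def)
  have B: "bilinear k M N r.U (\<lambda>m n. r.u m (NP.u n p))" if "p \<in> carrier P" for p
    by (intro linear_intros M N P NP.module_utensor NP.upure_closed that)
  show "linear_map k l.U r.U (kassoc_fun k M N P)"
    by (rule linear_map_cong[OF l.module_utensor l.linear_map_lift[OF r.module_utensor A]]) (simp add: eq)
  show left: "kassoc_fun k M N P (l.u s p) = ?A s p" if "s \<in> carrier MN.U" "p \<in> carrier P" for s p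
    using that by (simp add: eq l.upure_closed l.lift_upure[OF r.module_utensor A])
  show "kassoc_fun k M N P (l.u (MN.u m n) p) = r.u m (NP.u n p)"
    if "m \<in> carrier M" "n \<in> carrier N" "p \<in> carrier P" for m n p
    using that by (simp add: left MN.upure_closed MN.lift_upure[OF r.module_utensor B])
  let ?B = "\<lambda>m s. tsum l.U (\<lambda>n p. l.u (MN.u m n) p) (terms s)"
  have C: "bilinear k M NP.U l.U ?B"
    by (rule bilinear_assoc_inverse[OF M N P MN.module_utensor NP.module_utensor MN.bilinear_upure
      NP.utensor_terms(1) NP.linear_map_lift[OF l.module_utensor]])
  have D: "bilinear k N P l.U (\<lambda>n p. l.u (MN.u m n) p)" if "m \<in> carrier M" for m
    by (intro linear_intros M N P MN.module_utensor MN.upure_closed that)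
  have "linear_map k r.U l.U (\<lambda>t. tsum l.U ?B (terms t))"
    by (rule r.linear_map_lift[OF l.module_utensor C])
  moreover have "tsum l.U ?B (terms (r.u m (NP.u n p))) = l.u (MN.u m n) p"
    if "m \<in> carrier M" "n \<in> carrier N" "p \<in> carrier P" for m n p
    using that by (simp add: r.lift_upure[OF l.module_utensor C] NP.upure_closed NP.lift_upure[OF l.module_utensor D])
  ultimately show "\<exists>j. linear_map k r.U l.U j \<and>
      (\<forall>m\<in>carrier M. \<forall>n\<in>carrier N. \<forall>p\<in>carrier P. j (r.u m (NP.u n p)) = l.u (MN.u m n) p)" by blast
qed

lemma unit_module_simps:
  "carrier (unit_module k) = Scalar ` carrier k"
  "zero (unit_module k) = Scalar \<zero>\<^bsub>k\<^esub>"
  "add (unit_module k) r s = Scalar (the_scalar r \<oplus>\<^bsub>k\<^esub> the_scalar s)"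
  "smult (unit_module k) x r = Scalar (x \<otimes>\<^bsub>k\<^esub> the_scalar r)"
  by (simp_all add: unit_module_def)

lemma module_unit_module:
  assumes "cring k"
  shows "module k (unit_module k)"
proof -
  interpret cring k by fact
  show ?thesis
    by (intro moduleI abelian_groupI)
      (auto simp: unit_module_simps a_ac l_distr r_distr m_assoc is_cring intro: add.l_inv_ex)
qed

lemma linear_map_the_scalar: "linear_map k (unit_module k) (regular_module k) the_scalar"
  by (auto simp: linear_map_def unit_module_simps)

definition "klunit_fun M t = lsum M [the_scalar r \<odot>\<^bsub>M\<^esub> m. (r, m) \<leftarrow> terms t]"
definition "krunit_fun M t = lsum M [the_scalar r \<odot>\<^bsub>M\<^esub> m. (m, r) \<leftarrow> terms t]"

lemma
  fixes M :: "('k, ('k, 'h, 'x) elt) module"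
  assumes M: "module k M"
  shows linear_map_klunit_fun: "linear_map k (utensor k (unit_module k) M) M (klunit_fun M)"
    and klunit_fun_upure: "\<lbrakk>r \<in> carrier (unit_module k); m \<in> carrier M\<rbrakk>
        \<Longrightarrow> klunit_fun M (upure k (unit_module k) M r m) = the_scalar r \<odot>\<^bsub>M\<^esub> m"
    and linear_map_krunit_fun: "linear_map k (utensor k M (unit_module k)) M (krunit_fun M)"
    and krunit_fun_upure: "\<lbrakk>r \<in> carrier (unit_module k); m \<in> carrier M\<rbrakk>
        \<Longrightarrow> krunit_fun M (upure k M (unit_module k) m r) = the_scalar r \<odot>\<^bsub>M\<^esub> m"
proof -
  interpret M: module k M by fact
  let ?I = "unit_module k :: ('k, ('k, 'h, 'x) elt) module"
  have I: "module k ?I" by (rule module_unit_module[OF M.R.is_cring])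
  interpret l: utensor_pair k ?I M by (rule utensor_pairI[OF I M])
  interpret r: utensor_pair k M ?I by (rule utensor_pairI[OF M I])
  have sc: "r \<in> carrier ?I \<Longrightarrow> the_scalar r \<in> carrier k" for r by (auto simp: unit_module_simps)
  have B: "bilinear k ?I M M (\<lambda>r m. the_scalar r \<odot>\<^bsub>M\<^esub> m)" "bilinear k M ?I M (\<lambda>m r. the_scalar r \<odot>\<^bsub>M\<^esub> m)"
    by (intro linear_intros M sc linear_map_the_scalar; assumption)+
  have eq: "klunit_fun M = (\<lambda>t. tsum M (\<lambda>r m. the_scalar r \<odot>\<^bsub>M\<^esub> m) (terms t))"
    "krunit_fun M = (\<lambda>t. tsum M (\<lambda>m r. the_scalar r \<odot>\<^bsub>M\<^esub> m) (terms t))"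
    by (simp_all add: klunit_fun_def krunit_fun_def tsum_def fun_eq_iff)
  show "linear_map k l.U M (klunit_fun M)" "linear_map k r.U M (krunit_fun M)"
    unfolding eq by (rule l.linear_map_lift[OF M B(1)], rule r.linear_map_lift[OF M B(2)])
  show "klunit_fun M (l.u r m) = the_scalar r \<odot>\<^bsub>M\<^esub> m" "krunit_fun M (r.u m r) = the_scalar r \<odot>\<^bsub>M\<^esub> m"
    if "r \<in> carrier ?I" "m \<in> carrier M" for r m
    using that by (simp_all add: eq l.lift_upure[OF M B(1)] r.lift_upure[OF M B(2)])
qed

text \<open>
  Here \<open>e\<close> is the scalar \<open>1\<close>, and balance is balance of the tensor product over \<open>k\<close>.
\<close>

lemma kmod_generated_monoidal:
  assumes k: "cring k"
  shows "generated_monoidal_category k (kmod_cat k) (linear_map k) (upure k) (umap k) (kassoc_fun k)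
    klunit_fun krunit_fun (\<lambda>M r m. the_scalar r \<odot>\<^bsub>M\<^esub> m) (\<lambda>M m r. the_scalar r \<odot>\<^bsub>M\<^esub> m)
    (Scalar \<one>\<^bsub>k\<^esub> :: ('k, 'h, 'x) elt)"
proof -
  interpret linear_category k "kmod_cat k" "linear_map k" by (rule linear_category_kmod)
  interpret k: cring k by fact
  show ?thesis
  proof (rule generated_monoidal_category.intro[OF linear_category_axioms],
      rule generated_monoidal_category_axioms.intro, unfold kmod_cat_simps mem_Collect_eq, goal_cases)
    case (3 f g) then show ?case by (simp add: kmod_cat_def)
  next
    case (6 A B D) then show ?case by (simp add: kmod_cat_def kassoc_fun_def[abs_def])
  next
    case (11 A) then show ?case by (simp add: kmod_cat_def klunit_fun_def[abs_def])
  next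
    case (12 A) then show ?case by (simp add: kmod_cat_def krunit_fun_def[abs_def])
  next
    case (22 A r a)
    let ?I = "unit_module k :: ('k, ('k, 'h, 'x) elt) module"
    have I: "module k ?I" by (rule module_unit_module[OF k])
    obtain x where x: "x \<in> carrier k" "r = Scalar x" using 22 by (auto simp: unit_module_simps)
    have "upure k ?I A (Scalar \<one>\<^bsub>k\<^esub>) (x \<odot>\<^bsub>A\<^esub> a) = x \<odot>\<^bsub>utensor k ?I A\<^esub> upure k ?I A (Scalar \<one>\<^bsub>k\<^esub>) a"
      using x 22 I by (intro linear_map_smult[OF bilinear_right[OF bilinear_upure _ linear_map_id]])
         (auto simp: unit_module_simps)
    also have "\<dots> = upure k ?I A (x \<odot>\<^bsub>?I\<^esub> Scalar \<one>\<^bsub>k\<^esub>) a"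
      using x 22 I by (intro linear_map_smult[OF bilinear_left[OF bilinear_upure _ linear_map_id], symmetric])
         (auto simp: unit_module_simps)
    finally show ?case using x by (simp add: unit_module_simps)
  next
    case (23 A r a)
    let ?I = "unit_module k :: ('k, ('k, 'h, 'x) elt) module"
    have I: "module k ?I" by (rule module_unit_module[OF k])
    obtain x where x: "x \<in> carrier k" "r = Scalar x" using 23 by (auto simp: unit_module_simps)
    have "upure k A ?I (x \<odot>\<^bsub>A\<^esub> a) (Scalar \<one>\<^bsub>k\<^esub>) = x \<odot>\<^bsub>utensor k A ?I\<^esub> upure k A ?I a (Scalar \<one>\<^bsub>k\<^esub>)"
      using x 23 I by (intro linear_map_smult[OF bilinear_left[OF bilinear_upure _ linear_map_id]])
         (auto simp: unit_module_simps)
    also have "\<dots> = upure k A ?I a (x \<odot>\<^bsub>?I\<^esub> Scalar \<one>\<^bsub>k\<^esub>)"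
      using x 23 I by (intro linear_map_smult[OF bilinear_right[OF bilinear_upure _ linear_map_id], symmetric])
         (auto simp: unit_module_simps)
    finally show ?case using x by (simp add: unit_module_simps)
  next
    case (24 A B r a b)
    then have r: "the_scalar r \<in> carrier k" by (auto simp: unit_module_simps)
    have "upure k A B a (the_scalar r \<odot>\<^bsub>B\<^esub> b) = the_scalar r \<odot>\<^bsub>utensor k A B\<^esub> upure k A B a b"
      using r 24 by (intro linear_map_smult[OF bilinear_right[OF bilinear_upure _ linear_map_id]])
    also have "\<dots> = upure k A B (the_scalar r \<odot>\<^bsub>A\<^esub> a) b"
      using r 24 by (intro linear_map_smult[OF bilinear_left[OF bilinear_upure _ linear_map_id], symmetric])
    finally show ?case .
  qed (auto simp: module_utensor generated_utensor linear_map_umap umap_upure linear_map_kassoc_fun kassoc_fun_upure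
      kassoc_fun_inverse module_unit_module[OF k] linear_map_klunit_fun linear_map_krunit_fun klunit_fun_upure
      krunit_fun_upure linear_map_smult unit_module_simps module.smult_one)
qed

context unit_calculus
begin

lemma linear_category_hmod: "linear_category k (hmod_cat k H) hlinear"
proof (rule linear_category.intro, unfold hmod_cat_simps mem_Collect_eq, goal_cases)
  case (1 f) then show ?case by (auto simp: hmod_cat_def hlinear_def)
next
  case (8 A B \<phi> \<psi>)
  then show ?case
    using linear_map_cong[OF left_module_module[OF 8(1)], of B \<phi> \<psi>] hact_closed[OF 8(1)]
    by (simp add: hlinear_def)
next
  case (10 A B \<phi> D \<psi>)
  then show ?case using linear_map_closed[of k A B \<phi>] linear_map_compose[of k A B \<phi> D \<psi>]
    by (simp add: hlinear_def)
next
  case (11 A B \<phi> \<psi>)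
  have lin: "linear_map k A B \<phi>" using 11 by (simp add: hlinear_def)
  have "\<psi> (hact B h b) = hact A h (\<psi> b)" if "h \<in> carrier H" "b \<in> carrier B" for h b
  proof -
    have "\<phi> (hact A h (\<psi> b)) = hact B h b" using that 11 by (simp add: hlinear_def)
    then show ?thesis using 11(5)[OF hact_closed[OF 11(1) that(1) 11(4)[OF that(2)]]] by simp
  qed
  then show ?case
    using linear_map_inverse[OF left_module_module[OF 11(1)] left_module_module[OF 11(2)] lin 11(4-6)]
    by (simp add: hlinear_def)
qed (auto simp: hmod_cat_def hlinear_def left_module_module linear_map_id)

text \<open>
  Here \<open>e\<close> is the counit \<open>\<epsilon> = g 1\<close>.
\<close>

lemma hmod_generated_monoidal:
  "generated_monoidal_category k (hmod_cat k H) hlinear (two_modules.lpure k H) (umap k) assoc_fun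
    lunit_fun runit_fun (\<lambda>M \<phi> m. hact M (fmap_left H (the_functional \<phi>)) m)
    (\<lambda>M m \<phi>. hact M (fmap_right H (the_functional \<phi>)) m) (G \<one>\<^sub>H :: ('k, 'h, 'x) elt)"
proof -
  interpret linear_category k "hmod_cat k H" hlinear by (rule linear_category_hmod)
  have G: "(\<And>h. h \<in> carrier H \<Longrightarrow> r = G h \<Longrightarrow> thesis) \<Longrightarrow> thesis"
    if "r \<in> carrier (HL k H :: ('k, ('k, 'h, 'x) elt, 'h) hmodule)" for r thesis
    using that by (auto simp: HL_simps)
  show ?thesis
  proof (rule generated_monoidal_category.intro[OF linear_category_axioms],
      rule generated_monoidal_category_axioms.intro, unfold hmod_cat_simps mem_Collect_eq, goal_cases)
    case (3 f g) then show ?case by (simp add: hmod_cat_def)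
  next
    case (6 A B D) then show ?case by (simp add: hmod_cat_def assoc_fun_def[abs_def])
  next
    case (11 A) then show ?case by (simp add: hmod_cat_def lunit_fun_def[abs_def])
  next
    case (12 A) then show ?case by (simp add: hmod_cat_def runit_fun_def[abs_def])
  next
    case (15 A r a) then show ?case by (auto elim!: G simp: lunit_fun_lpure fmap_G)
  next
    case (16 A r a) then show ?case by (auto elim!: G simp: runit_fun_lpure fmap_G)
  next
    case (17 A B \<phi> r a) then show ?case by (auto elim!: G simp: fmap_G hlinear_def fg_closed)
  next
    case (18 A B \<phi> r a) then show ?case by (auto elim!: G simp: fmap_G hlinear_def fg'_closed)
  next
    case (22 A r a) then show ?case by (auto elim!: G simp: fmap_G lpure_unit_left fmap_G)
  next
    case (23 A r a) then show ?case by (auto elim!: G simp: fmap_G lpure_unit_right)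
  next
    case (24 A B r a b) then show ?case by (auto elim!: G simp: fmap_G lpure_balanced)
  qed (auto simp: left_module_ltensor generated_ltensor umap_ltensor hlinear_assoc_fun assoc_fun_lpure assoc_fun_inverse
      left_module_HL hlinear_lunit_fun hlinear_runit_fun fmap_G fg_one fg'_one left_module.one_hact G_closed)
qed

end

section \<open>Tensor products do not see the action\<close>

lemma forget_simps [simp]:
  "carrier (forget_ob M) = carrier M" "zero (forget_ob M) = zero M" "add (forget_ob M) = add M"
  "smult (forget_ob M) = smult M"
  by (simp_all add: forget_ob_def module.defs)

text \<open>
  The tensor relations involve only the module operations.  Hence a tensor product of
  \<open>H\<close>-modules is literally equal to that of the underlying modules.
\<close>

lemma teq_mono:
  assumes "teq k M N s t"
    and M: "carrier M' = carrier M" "zero M' = zero M" "add M' = add M" "smult M' = smult M"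
    and N: "carrier N' = carrier N" "zero N' = zero N" "add N' = add N" "smult N' = smult N"
  shows "teq k M' N' s t"
  using assms(1)
proof induction
  case (sym s t) show ?case by (rule teq.sym[OF sym.IH])
next
  case (trans s t u) then show ?case by (blast intro: teq.trans)
next
  case (zero n) then show ?case using teq.zero[of n N' k M'] by (simp add: M N)
next
  case (add_left m m' n) then show ?case using teq.add_left[of m M' m' n N' k] by (simp add: M N)
next
  case (add_right m n n') then show ?case using teq.add_right[of m M' n N' n' k] by (simp add: M N)
next
  case (balanced x m n) then show ?case using teq.balanced[of x k m M' n N'] by (simp add: M N)
next
  case (refl s) then show ?case by (intro teq.refl) (simp add: M N)
next
  case (comm s t) then show ?case by (intro teq.comm) (simp_all add: M N)
next
  case (append s t s' t') show ?case by (rule teq.append[OF append.IH])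
qed

lemma nf_forget [simp]: "nf k (forget_ob M) N = nf k M N"
  unfolding nf_def by (intro ext arg_cong[of _ _ Eps] iffI; erule teq_mono; simp)

lemma nf_forget' [simp]: "nf k M (forget_ob N) = nf k M N"
  unfolding nf_def by (intro ext arg_cong[of _ _ Eps] iffI; erule teq_mono; simp)

lemma unf_forget: "unf k (forget_ob M) N = unf k M N"
  and upure_forget: "upure k (forget_ob M) N = upure k M N"
  and umap_forget: "umap k (forget_ob M) N = umap k M N"
  and utensor_forget: "utensor k (forget_ob M) N = utensor k M N"
  by (simp_all add: utensor_def tensor_def unf_def[abs_def] upure_def[abs_def] umap_def[abs_def])

lemma unf_forget': "unf k M (forget_ob N) = unf k M N"
  and upure_forget': "upure k M (forget_ob N) = upure k M N"
  and umap_forget': "umap k M (forget_ob N) = umap k M N"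
  and utensor_forget': "utensor k M (forget_ob N) = utensor k M N"
  by (simp_all add: utensor_def tensor_def unf_def[abs_def] upure_def[abs_def] umap_def[abs_def])

lemmas forget_tensor = utensor_forget utensor_forget' upure_forget upure_forget' umap_forget umap_forget'
  unf_forget unf_forget'

lemma linear_map_forget [simp]: "linear_map k (forget_ob M) N = linear_map k M N"
  by (simp add: linear_map_def fun_eq_iff)

lemma linear_map_forget' [simp]: "linear_map k M (forget_ob N) = linear_map k M N"
  by (simp add: linear_map_def fun_eq_iff)

lemma module_forget:
  assumes "module k M"
  shows "module k (forget_ob M)"
proof -
  interpret M: module k M by fact
  show ?thesis
    by (intro moduleI abelian_groupI)
      (auto simp: M.a_ac M.smult_l_distr M.smult_r_distr M.smult_assoc1 M.R.is_cring intro: M.add.l_inv_ex)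
qed

lemma kassoc_fun_forget: "kassoc_fun k (forget_ob M) (forget_ob N) (forget_ob P) = kassoc_fun k M N P"
  by (simp add: kassoc_fun_def[abs_def] forget_tensor)

section \<open>The forgetful functor is monoidal and opmonoidal\<close>

text \<open>
  Both sides are \<open>1\<^sub>1 m \<otimes> (1\<^sub>2 n \<otimes> 1\<^sub>3 p)\<close>, reached from \<open>(\<Delta> \<otimes> H) \<Delta>\<close> and from \<open>(H \<otimes> \<Delta>) \<Delta>\<close>.  The
  functions \<open>f\<close>, \<open>f'\<close>, \<open>g\<close>, \<open>g'\<close> stand for inclusions and identities; they are arbitrary outside
  the relevant carriers, as the restricted functions underlying arrows are not identities there.
\<close>

lemma (in prebialgebra) inclusion_assoc:
  fixes M N P :: "('k, ('k, 'h, 'x) elt, 'h) hmodule"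
  assumes M: "left_module k H M" and N: "left_module k H N" and P: "left_module k H P"
    and mnp: "m \<in> carrier M" "n \<in> carrier N" "p \<in> carrier P"
    and f: "\<And>s. s \<in> carrier (ltensor k H M N) \<Longrightarrow> f s = s" "\<And>s. s \<in> carrier P \<Longrightarrow> f' s = s"
    and g: "\<And>s. s \<in> carrier (ltensor k H N P) \<Longrightarrow> g s = s" "\<And>s. s \<in> carrier M \<Longrightarrow> g' s = s"
  shows "kassoc_fun k M N P (umap k (utensor k M N) P f f' (tpure (ltensor k H M N) P (tpure M N m n) p)) =
    umap k M (utensor k N P) g' g (tpure M (ltensor k H N P) m (tpure N P n p))"
proof -
  interpret MN: two_modules k H M N by (rule two_modulesI) fact+
  interpret NP: two_modules k H N P by (rule two_modulesI) fact+
  interpret l: two_modules k H MN.L P by (rule two_modulesI) (rule P MN.left_module_ltensor)+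
  interpret r: two_modules k H M NP.L by (rule two_modulesI) (rule M NP.left_module_ltensor)+
  interpret l': utensor_pair k MN.U P by (rule utensor_pairI[OF MN.module_utensor NP.N.module_axioms])
  interpret r': utensor_pair k M NP.U by (rule utensor_pairI[OF MN.M.module_axioms NP.module_utensor])
  note mods = MN.M.module_axioms MN.N.module_axioms NP.N.module_axioms
  have lf: "linear_map k MN.L MN.U f" "linear_map k P P f'" "linear_map k NP.L NP.U g" "linear_map k M M g'"
    using f g by (auto intro: linear_map_cong[OF MN.module_ltensor MN.linear_map_from_ltensor[OF linear_map_id]]
      linear_map_cong[OF NP.module_ltensor NP.linear_map_from_ltensor[OF linear_map_id]]
      linear_map_cong[OF mods(3) linear_map_id] linear_map_cong[OF mods(1) linear_map_id])
  note lu = linear_map_umap[OF MN.module_utensor mods(3) MN.module_ltensor mods(3) lf(1,2)]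
    umap_upure[OF MN.module_utensor mods(3) MN.module_ltensor mods(3) lf(1,2)]
  note ru = linear_map_umap[OF mods(1) NP.module_utensor mods(1) NP.module_ltensor lf(4,3)]
    umap_upure[OF mods(1) NP.module_utensor mods(1) NP.module_ltensor lf(4,3)]
  have cl: "linear_map k l.U r'.U (\<lambda>t. kassoc_fun k M N P (umap k MN.U P f f' t))"
    by (rule linear_map_compose[OF lu(1) linear_map_kassoc_fun[OF mods]])
  have B: "bilinear k M N r'.U (\<lambda>m n. r'.u m (NP.u n p))" if "p \<in> carrier P" for p
    by (intro linear_intros mods NP.module_utensor NP.upure_closed that)
  have T: "trilinear k H r'.U (\<lambda>x y z. r'.u (hact M x m) (NP.u (hact N y n) (hact P z p)))"
    using mnp by (intro trilinearI linear_intros M N P mods NP.module_utensor NP.upure_closed MN.hact_M MN.hact_N NP.hact_N)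
  have "kassoc_fun k M N P (umap k MN.U P f f' (l.lpure (MN.lpure m n) p)) =
    sw r'.U (\<lambda>a b. kassoc_fun k M N P (umap k MN.U P f f' (l.u (hact MN.L a (MN.lpure m n)) (hact P b p)))) \<one>\<^sub>H"
    using mnp by (simp add: l.lpure_def l.diag_act_upure MN.lpure_closed)
      (intro sw_linear_image[OF l.module_utensor r'.module_utensor cl], simp_all add: l.upure_closed l.hact_M l.hact_N MN.lpure_closed)
  also have "\<dots> = sw r'.U (\<lambda>a b. sw r'.U (\<lambda>c d. r'.u (hact M c m) (NP.u (hact N d n) (hact P b p))) a) \<one>\<^sub>H"
  proof (rule sw_cong[OF H.one_closed])
    fix a b assume ab: "a \<in> carrier H" "b \<in> carrier H"
    have c: "hact MN.L a (MN.lpure m n) \<in> carrier MN.L" using ab mnp by (simp add: l.hact_M MN.lpure_closed)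
    then have c': "hact MN.L a (MN.lpure m n) \<in> carrier MN.U" by (simp add: MN.carrier_ltensor)
    show "kassoc_fun k M N P (umap k MN.U P f f' (l.u (hact MN.L a (MN.lpure m n)) (hact P b p))) =
      sw r'.U (\<lambda>c d. r'.u (hact M c m) (NP.u (hact N d n) (hact P b p))) a"
      using ab mnp c c' by (simp add: lu(2) f NP.hact_N kassoc_fun_upure_left[OF mods])
        (simp add: MN.hact_lpure MN.lift_diag_act[OF r'.module_utensor B[OF NP.hact_N]])
  qed
  also have "\<dots> = sw r'.U (\<lambda>a b. sw r'.U (\<lambda>c d. r'.u (hact M a m) (NP.u (hact N c n) (hact P d p))) b) \<one>\<^sub>H"
    by (rule sw_coassoc[OF r'.module_utensor T H.one_closed])
  also have "\<dots> = sw r'.U (\<lambda>a b. r'.u (hact M a m) (sw NP.U (\<lambda>c d. NP.u (hact N c n) (hact P d p)) b)) \<one>\<^sub>H"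
    using mnp by (intro sw_cong sw_linear_image[symmetric, OF NP.module_utensor r'.module_utensor]
        bilinear_right[OF r'.bilinear_upure _ linear_map_id])
      (simp_all add: NP.upure_closed MN.hact_M MN.hact_N NP.hact_N)
  also have "\<dots> = sw r'.U (\<lambda>a b. umap k M NP.U g' g (r.u (hact M a m) (hact NP.L b (NP.lpure n p)))) \<one>\<^sub>H"
    using mnp by (intro sw_cong)
      (simp_all add: ru(2) g MN.hact_M r.hact_N NP.lpure_closed, simp add: NP.hact_lpure NP.diag_act_upure)
  also have "\<dots> = umap k M NP.U g' g (r.lpure m (NP.lpure n p))"
    using mnp by (simp add: r.lpure_def r.diag_act_upure NP.lpure_closed)
      (intro sw_linear_image[symmetric, OF r.module_utensor r'.module_utensor ru(1)], simp_all add: r.upure_closed r.hact_M r.hact_N NP.lpure_closed)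
  finally show ?thesis .
qed

text \<open>
  The parameter \<open>atoms\<close> fixes the type of atoms, so that both categories are single objects
  in the locale.
\<close>

locale forgetful = unit_calculus k H
  for k :: "'k ring" and H :: "('k, 'h) prebialg" +
  fixes atoms :: "'x itself"
begin

abbreviation "KM \<equiv> kmod_cat k :: (('k, ('k, 'h, 'x) elt) module, (('k, ('k, 'h, 'x) elt) module, ('k, 'h, 'x) elt) mor) mcat"
abbreviation "HM \<equiv> hmod_cat k H :: (('k, ('k, 'h, 'x) elt, 'h) hmodule, (('k, ('k, 'h, 'x) elt, 'h) hmodule, ('k, 'h, 'x) elt) mor) mcat"
abbreviation tensor_HM (infixr "\<otimes>\<^sub>l" 65) where "A \<otimes>\<^sub>l B \<equiv> A \<diamondop>\<^bsub>HM\<^esub> B"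
abbreviation tensor_KM (infixr "\<otimes>\<^sub>k" 65) where "A \<otimes>\<^sub>k B \<equiv> A \<diamondop>\<^bsub>KM\<^esub> B"
abbreviation tensor_arrow_KM (infixr "\<star>\<^sub>k" 65) where "f \<star>\<^sub>k g \<equiv> f \<star>\<^bsub>KM\<^esub> g"
abbreviation compose_KM (infixr "\<cdot>\<^sub>k" 55) where "g \<cdot>\<^sub>k f \<equiv> g \<cdot>\<^bsub>KM\<^esub> f"
abbreviation mu ("\<mu>") where
  "\<mu> \<equiv> forget_mu2 k H :: ('k, ('k, 'h, 'x) elt, 'h) hmodule \<Rightarrow> ('k, ('k, 'h, 'x) elt, 'h) hmodule \<Rightarrow> _"
abbreviation nu ("\<nu>") where
  "\<nu> \<equiv> forget_nu2 k H :: ('k, ('k, 'h, 'x) elt, 'h) hmodule \<Rightarrow> ('k, ('k, 'h, 'x) elt, 'h) hmodule \<Rightarrow> _"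

sublocale K: generated_monoidal_category k KM "linear_map k" "upure k" "umap k" "kassoc_fun k"
    klunit_fun krunit_fun "\<lambda>M r m. the_scalar r \<odot>\<^bsub>M\<^esub> m" "\<lambda>M m r. the_scalar r \<odot>\<^bsub>M\<^esub> m" "Scalar \<one>\<^bsub>k\<^esub>"
  by (rule kmod_generated_monoidal[OF k.is_cring])

sublocale C: generated_monoidal_category k HM hlinear "two_modules.lpure k H" "umap k" assoc_fun
    lunit_fun runit_fun "\<lambda>M \<phi> m. hact M (fmap_left H (the_functional \<phi>)) m"
    "\<lambda>M m \<phi>. hact M (fmap_right H (the_functional \<phi>)) m" "G \<one>\<^sub>H"
  by (rule hmod_generated_monoidal)

lemma Ob_HM: "M \<in> Ob HM \<longleftrightarrow> left_module k H M" by (simp add: hmod_cat_simps)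

lemma forget_ob_Ob [simp]: "M \<in> Ob HM \<Longrightarrow> forget_ob M \<in> Ob KM"
  by (simp add: hmod_cat_simps kmod_cat_simps module_forget left_module_module)

lemma forget_ar_simps [simp]:
  "src (forget_ar f) = forget_ob (src f)" "tgt (forget_ar f) = forget_ob (tgt f)" "fn (forget_ar f) = fn f"
  by (simp_all add: forget_ar_def)

lemma forget_ar_Ar [simp]: "f \<in> Ar HM \<Longrightarrow> forget_ar f \<in> Ar KM"
  by (auto simp: K.Ar_iff C.Ar_iff hlinear_def)

lemma forget_cat_functor: "cat_functor HM KM forget_ob forget_ar"
proof (rule cat_functor.intro[OF C.category K.category], rule cat_functor_axioms.intro)
  fix A assume A: "A \<in> Ob HM"
  then show "forget_ob A \<in> Ob KM" by simp
  show "forget_ar (Idn HM A) = Idn KM (forget_ob A)"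
    using A by (intro K.arrow_eqI) simp_all
next
  fix f A B assume "f \<in> Hom HM A B"
  then show "forget_ar f \<in> Hom KM (forget_ob A) (forget_ob B)" by (simp add: C.Hom_iff K.Hom_iff)
next
  fix f g A B E assume "f \<in> Hom HM A B" "g \<in> Hom HM B E"
  then show "forget_ar (g \<cdot>\<^bsub>HM\<^esub> f) = forget_ar g \<cdot>\<^sub>k forget_ar f"
    by (intro K.arrow_eqI) (auto simp: C.Hom_iff)
qed

lemma TensO_forget: "forget_ob A \<otimes>\<^sub>k forget_ob B = utensor k A B"
  by (simp add: kmod_cat_simps forget_tensor)

lemma TensO_HM: "A \<otimes>\<^sub>l B = ltensor k H A B"
  by (simp add: hmod_cat_simps)

lemma mu2_simps [simp]:
  "src (\<mu> A B) = forget_ob A \<otimes>\<^sub>k forget_ob B" "tgt (\<mu> A B) = forget_ob (A \<otimes>\<^sub>l B)"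
  by (simp_all add: forget_mu2_def kmod_cat_simps hmod_cat_simps)

lemma mu2_fn: "t \<in> carrier (utensor k A B) \<Longrightarrow> fn (\<mu> A B) t = diag_act k H A B \<one>\<^sub>H t"
  by (simp add: forget_mu2_def)

lemma mu2_Ar [simp]:
  assumes "A \<in> Ob HM" "B \<in> Ob HM"
  shows "\<mu> A B \<in> Ar KM"
proof -
  interpret two_modules k H A B using assms by (intro two_modulesI) (simp_all add: Ob_HM)
  have "\<mu> A B = Mor (forget_ob A \<otimes>\<^sub>k forget_ob B) (forget_ob (A \<otimes>\<^sub>l B))
    (\<lambda>t\<in>carrier (forget_ob A \<otimes>\<^sub>k forget_ob B). D \<one>\<^sub>H t)"
    by (simp add: forget_mu2_def TensO_forget TensO_HM forget_tensor)
  moreover have "U \<in> Ob KM" "forget_ob L \<in> Ob KM"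
    by (simp_all add: kmod_cat_simps module_forget module_ltensor module_utensor)
  ultimately show ?thesis
    using linear_map_proj by (simp only:) (rule K.restrict_Ar, simp_all add: TensO_forget TensO_HM)
qed

lemma mu2_upure [simp]:
  assumes "A \<in> Ob HM" "B \<in> Ob HM" "a \<in> carrier A" "b \<in> carrier B"
  shows "fn (\<mu> A B) (upure k (forget_ob A) (forget_ob B) a b) = tpure A B a b"
proof -
  interpret two_modules k H A B using assms by (intro two_modulesI) (simp_all add: Ob_HM)
  show ?thesis using assms by (simp add: forget_tensor mu2_fn upure_closed lpure_def)
qed

lemma mu0_simps [simp]: "src (forget_mu0 k H) = UnitO KM" "tgt (forget_mu0 k H) = forget_ob (UnitO HM)"
  by (simp_all add: forget_mu0_def kmod_cat_simps hmod_cat_simps)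

lemma UnitO_KM: "r \<in> carrier (UnitO KM) \<longleftrightarrow> (\<exists>x\<in>carrier k. r = Scalar x)"
  by (auto simp: kmod_cat_simps unit_module_simps)

lemma UnitO_HM: "r \<in> carrier (UnitO HM) \<longleftrightarrow> (\<exists>h\<in>carrier H. r = G h)"
  by (auto simp: hmod_cat_simps HL_simps)

lemma G_UnitO [simp]: "h \<in> carrier H \<Longrightarrow> G h \<in> carrier (UnitO HM)"
  by (auto simp: UnitO_HM)

lemma Scalar_UnitO [simp]: "x \<in> carrier k \<Longrightarrow> Scalar x \<in> carrier (UnitO KM)"
  by (auto simp: UnitO_KM)

lemma mu0_Scalar [simp]: "x \<in> carrier k \<Longrightarrow> fn (forget_mu0 k H) (Scalar x) = (G (x \<odot>\<^bsub>H\<^esub> \<one>\<^sub>H) :: ('k, 'h, 'x) elt)"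
  by (simp add: forget_mu0_def unit_module_simps)
    (rule Functional_eq_G, simp add: smult_mult_right linear_map_smult[OF counit_linear])

lemma mu0_Ar [simp]: "forget_mu0 k H \<in> Ar KM"
proof -
  have "linear_map k (UnitO KM) (forget_ob (UnitO HM)) (fn (forget_mu0 k H))"
    by (auto simp: linear_map_def UnitO_KM UnitO_HM kmod_cat_simps hmod_cat_simps unit_module_simps HL_simps
      H.smult_l_distr H.smult_assoc1)
  then show ?thesis unfolding K.Ar_iff by simp (simp add: forget_mu0_def kmod_cat_simps)
qed

lemma forget_monoidal: "monoidal_functor HM KM forget_ob forget_ar \<mu> (forget_mu0 k H)"
proof (rule monoidal_functor.intro[OF C.monoidal_category K.monoidal_category forget_cat_functor],
    rule monoidal_functor_axioms.intro)
  fix A B assume "A \<in> Ob HM" "B \<in> Ob HM"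
  then show "\<mu> A B \<in> Hom KM (forget_ob A \<otimes>\<^sub>k forget_ob B) (forget_ob (A \<otimes>\<^sub>l B))"
    by (simp add: K.Hom_iff)
next
  fix f g A A' B B' assume f: "f \<in> Hom HM A A'" and g: "g \<in> Hom HM B B'"
  show "\<mu> A' B' \<cdot>\<^sub>k (forget_ar f \<star>\<^sub>k forget_ar g) = forget_ar (f \<star>\<^bsub>HM\<^esub> g) \<cdot>\<^sub>k \<mu> A B"
    using C.HomD[OF f] C.HomD[OF g] C.fn_closed[of f] C.fn_closed[of g]
    by (intro K.arrow_ext[of "forget_ob A" "forget_ob B"]) simp_all
next
  show "forget_mu0 k H \<in> Hom KM (UnitO KM) (forget_ob (UnitO HM))" by (simp add: K.Hom_iff)
next
  fix A B E assume "A \<in> Ob HM" "B \<in> Ob HM" "E \<in> Ob HM"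
  then show "forget_ar (Asc HM A B E) \<cdot>\<^sub>k \<mu> (A \<otimes>\<^sub>l B) E \<cdot>\<^sub>k (\<mu> A B \<star>\<^sub>k Idn KM (forget_ob E))
      = \<mu> A (B \<otimes>\<^sub>l E) \<cdot>\<^sub>k (Idn KM (forget_ob A) \<star>\<^sub>k \<mu> B E) \<cdot>\<^sub>k Asc KM (forget_ob A) (forget_ob B) (forget_ob E)"
    by (intro K.arrow_ext3[of "forget_ob A" "forget_ob B" "forget_ob E"]) simp_all
next
  fix A assume A: "A \<in> Ob HM"
  have lA: "left_module k H A" using A by (simp add: Ob_HM)
  have fg: "hact A (fg (x \<odot>\<^bsub>H\<^esub> \<one>\<^sub>H)) a = x \<odot>\<^bsub>A\<^esub> a" "hact A (fg' (x \<odot>\<^bsub>H\<^esub> \<one>\<^sub>H)) a = x \<odot>\<^bsub>A\<^esub> a"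
    if "x \<in> carrier k" "a \<in> carrier A" for x a
    using that linear_map_smult[OF linear_map_fg[OF linear_map_id]] linear_map_smult[OF linear_map_fg'[OF linear_map_id]]
    by (simp_all add: fg_one fg'_one left_module.smult_hact[OF lA] left_module.one_hact[OF lA])
  have G: "G (x \<odot>\<^bsub>H\<^esub> \<one>\<^sub>H) \<in> carrier (UnitO HM)" if "x \<in> carrier k" for x
    using that by (auto simp: UnitO_HM)
  show "forget_ar (Lun HM A) \<cdot>\<^sub>k \<mu> (UnitO HM) A \<cdot>\<^sub>k (forget_mu0 k H \<star>\<^sub>k Idn KM (forget_ob A)) = Lun KM (forget_ob A)"
    using A by (intro K.arrow_ext[of "UnitO KM" "forget_ob A"]) (auto simp: UnitO_KM G fmap_G fg)
  show "forget_ar (Run HM A) \<cdot>\<^sub>k \<mu> A (UnitO HM) \<cdot>\<^sub>k (Idn KM (forget_ob A) \<star>\<^sub>k forget_mu0 k H) = Run KM (forget_ob A)"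
    using A by (intro K.arrow_ext[of "forget_ob A" "UnitO KM"]) (auto simp: UnitO_KM G fmap_G fg)
qed

lemma nu2_simps [simp]:
  "tgt (\<nu> A B) = forget_ob A \<otimes>\<^sub>k forget_ob B" "src (\<nu> A B) = forget_ob (A \<otimes>\<^sub>l B)"
  by (simp_all add: forget_nu2_def kmod_cat_simps hmod_cat_simps)

lemma nu2_fn [simp]: "t \<in> carrier (A \<otimes>\<^sub>l B) \<Longrightarrow> fn (\<nu> A B) t = t"
  by (simp add: forget_nu2_def TensO_HM)

lemma nu2_Ar [simp]:
  assumes "A \<in> Ob HM" "B \<in> Ob HM"
  shows "\<nu> A B \<in> Ar KM"
proof -
  interpret two_modules k H A B using assms by (intro two_modulesI) (simp_all add: Ob_HM)
  have "\<nu> A B = Mor (forget_ob (A \<otimes>\<^sub>l B)) (forget_ob A \<otimes>\<^sub>k forget_ob B)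
    (\<lambda>t\<in>carrier (forget_ob (A \<otimes>\<^sub>l B)). t)"
    by (simp add: forget_nu2_def TensO_forget TensO_HM forget_tensor)
  moreover have "U \<in> Ob KM" "forget_ob L \<in> Ob KM"
    by (simp_all add: kmod_cat_simps module_forget module_ltensor module_utensor)
  ultimately show ?thesis
    using linear_map_from_ltensor[OF linear_map_id]
    by (simp only:) (rule K.restrict_Ar, simp_all add: TensO_forget TensO_HM)
qed

lemma nu0_simps [simp]: "tgt (forget_nu0 k H) = UnitO KM" "src (forget_nu0 k H) = forget_ob (UnitO HM)"
  by (simp_all add: forget_nu0_def kmod_cat_simps hmod_cat_simps)

lemma nu0_fn [simp]: "h \<in> carrier H \<Longrightarrow> fn (forget_nu0 k H) (G h) = (Scalar (counit H h) :: ('k, 'h, 'x) elt)"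
  by (simp add: forget_nu0_def G_closed G_apply)

lemma nu0_Ar [simp]: "forget_nu0 k H \<in> Ar KM"
proof -
  have "linear_map k (forget_ob (UnitO HM)) (UnitO KM) (fn (forget_nu0 k H))"
    using linear_map_add[OF counit_linear] linear_map_smult[OF counit_linear]
    by (auto simp: linear_map_def UnitO_KM UnitO_HM kmod_cat_simps hmod_cat_simps unit_module_simps HL_simps)
  then show ?thesis unfolding K.Ar_iff by simp (simp add: forget_nu0_def hmod_cat_simps)
qed

text \<open>
  Arrows of \<open>k\<close>-modules that start at \<open>U (A \<otimes>\<^sup>l B)\<close> are compared on the elements \<open>a \<otimes>\<^sup>l b\<close>, which are
  not pure tensors of \<open>U A \<otimes> U B\<close>.
\<close>

lemma forget_arrow_eqI:
  assumes "f \<in> Ar KM" "g \<in> Ar KM" "src f = forget_ob (A \<otimes>\<^sub>l B)" "src g = forget_ob (A \<otimes>\<^sub>l B)" "tgt f = tgt g"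
    and A: "A \<in> Ob HM" and B: "B \<in> Ob HM"
    and eq: "\<And>a b. a \<in> carrier A \<Longrightarrow> b \<in> carrier B \<Longrightarrow> fn f (tpure A B a b) = fn g (tpure A B a b)"
  shows "f = g"
proof (rule K.arrow_eqI[OF assms(1,2)])
  fix t assume "t \<in> carrier (src f)"
  then have t: "t \<in> carrier (A \<otimes>\<^sub>l B)" by (simp add: assms)
  have T: "tgt f \<in> Ob KM" using assms by (simp add: K.Ar_iff)
  have lin: "linear_map k (A \<otimes>\<^sub>l B) (tgt f) (fn f)" "linear_map k (A \<otimes>\<^sub>l B) (tgt f) (fn g)"
    using K.Ar_linear[OF assms(1,3) HOL.refl] K.Ar_linear[OF assms(2,4) assms(5)[symmetric]] by simp_all
  show "fn f t = fn g t"
    by (rule generated_ext[OF C.pt_generated[OF A B] K.Ob_module[OF T] lin eq t])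
qed (simp_all add: assms)

lemma forget_arrow_eqI3:
  assumes "f \<in> Ar KM" "g \<in> Ar KM" "src f = forget_ob ((A \<otimes>\<^sub>l B) \<otimes>\<^sub>l E)" "src g = forget_ob ((A \<otimes>\<^sub>l B) \<otimes>\<^sub>l E)" "tgt f = tgt g"
    and A: "A \<in> Ob HM" and B: "B \<in> Ob HM" and E: "E \<in> Ob HM"
    and eq: "\<And>a b e. a \<in> carrier A \<Longrightarrow> b \<in> carrier B \<Longrightarrow> e \<in> carrier E \<Longrightarrow>
      fn f (tpure (A \<otimes>\<^sub>l B) E (tpure A B a b) e) = fn g (tpure (A \<otimes>\<^sub>l B) E (tpure A B a b) e)"
  shows "f = g"
proof (rule K.arrow_eqI[OF assms(1,2)])
  fix t assume "t \<in> carrier (src f)"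
  then have t: "t \<in> carrier ((A \<otimes>\<^sub>l B) \<otimes>\<^sub>l E)" by (simp add: assms)
  have T: "tgt f \<in> Ob KM" using assms by (simp add: K.Ar_iff)
  have lin: "linear_map k ((A \<otimes>\<^sub>l B) \<otimes>\<^sub>l E) (tgt f) (fn f)" "linear_map k ((A \<otimes>\<^sub>l B) \<otimes>\<^sub>l E) (tgt f) (fn g)"
    using K.Ar_linear[OF assms(1,3) HOL.refl] K.Ar_linear[OF assms(2,4) assms(5)[symmetric]] by simp_all
  show "fn f t = fn g t"
    by (rule generated_ext_left[OF C.pt_generated[OF A B] C.pt_generated[OF C.TensO_closed[OF A B] E] K.Ob_module[OF T] lin eq t])
qed (simp_all add: assms)

lemma fn_K_TensA: "t \<in> carrier (src f \<otimes>\<^sub>k src g) \<Longrightarrow> fn (f \<star>\<^sub>k g) t = umap k (tgt f) (tgt g) (fn f) (fn g) t"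
  by (simp add: K.TensA_eq)

lemma fn_K_Asc: "t \<in> carrier ((A \<otimes>\<^sub>k B) \<otimes>\<^sub>k D) \<Longrightarrow> fn (Asc KM A B D) t = kassoc_fun k A B D t"
  by (simp add: K.Asc_eq)

lemma ltensor_in_utensor: "A \<in> Ob HM \<Longrightarrow> B \<in> Ob HM \<Longrightarrow> t \<in> carrier (A \<otimes>\<^sub>l B) \<Longrightarrow> t \<in> carrier (forget_ob A \<otimes>\<^sub>k forget_ob B)"
  using K.fn_closed[OF nu2_Ar, of A B t] by simp

lemma nu2_natural:
  assumes f: "f \<in> Hom HM A A'" and g: "g \<in> Hom HM B B'"
  shows "\<nu> A' B' \<cdot>\<^sub>k forget_ar (f \<star>\<^bsub>HM\<^esub> g) = (forget_ar f \<star>\<^sub>k forget_ar g) \<cdot>\<^sub>k \<nu> A B"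
proof (rule K.arrow_eqI)
  note f' = C.HomD[OF f] and g' = C.HomD[OF g]
  show "\<nu> A' B' \<cdot>\<^sub>k forget_ar (f \<star>\<^bsub>HM\<^esub> g) \<in> Ar KM"
    "(forget_ar f \<star>\<^sub>k forget_ar g) \<cdot>\<^sub>k \<nu> A B \<in> Ar KM" using f' g' by simp_all
  fix t assume "t \<in> carrier (src (\<nu> A' B' \<cdot>\<^sub>k forget_ar (f \<star>\<^bsub>HM\<^esub> g)))"
  then have t: "t \<in> carrier (A \<otimes>\<^sub>l B)" using f' g' by simp
  then have t': "t \<in> carrier (forget_ob A \<otimes>\<^sub>k forget_ob B)" using f' g' by (intro ltensor_in_utensor)
  have "fn (f \<star>\<^bsub>HM\<^esub> g) t \<in> carrier (A' \<otimes>\<^sub>l B')" using C.fn_closed[OF C.TensA_Ar[OF f'(1) g'(1)]] f' g' t by simp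
  moreover have "fn (f \<star>\<^bsub>HM\<^esub> g) t = umap k A' B' (fn f) (fn g) t" using f' g' t by (simp add: C.TensA_eq)
  ultimately show "fn (\<nu> A' B' \<cdot>\<^sub>k forget_ar (f \<star>\<^bsub>HM\<^esub> g)) t =
      fn ((forget_ar f \<star>\<^sub>k forget_ar g) \<cdot>\<^sub>k \<nu> A B) t"
    using f' g' t t' by (simp add: fn_K_TensA forget_tensor)
qed (use C.HomD[OF f] C.HomD[OF g] in simp_all)

lemma nu2_assoc:
  assumes ob: "A \<in> Ob HM" "B \<in> Ob HM" "E \<in> Ob HM"
  shows "Asc KM (forget_ob A) (forget_ob B) (forget_ob E) \<cdot>\<^sub>k (\<nu> A B \<star>\<^sub>k Idn KM (forget_ob E)) \<cdot>\<^sub>k \<nu> (A \<otimes>\<^sub>l B) E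
        = (Idn KM (forget_ob A) \<star>\<^sub>k \<nu> B E) \<cdot>\<^sub>k \<nu> A (B \<otimes>\<^sub>l E) \<cdot>\<^sub>k forget_ar (Asc HM A B E)"
proof (rule forget_arrow_eqI3[of _ _ A B E])
  fix a b e assume abe: "a \<in> carrier A" "b \<in> carrier B" "e \<in> carrier E"
  let ?t = "tpure (A \<otimes>\<^sub>l B) E (tpure A B a b) e" and ?s = "tpure A (B \<otimes>\<^sub>l E) a (tpure B E b e)"
  have c: "tpure A B a b \<in> carrier (A \<otimes>\<^sub>l B)" "tpure B E b e \<in> carrier (B \<otimes>\<^sub>l E)"
    "?t \<in> carrier ((A \<otimes>\<^sub>l B) \<otimes>\<^sub>l E)" "?s \<in> carrier (A \<otimes>\<^sub>l (B \<otimes>\<^sub>l E))"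
    using ob abe by simp_all
  have c': "?t \<in> carrier (forget_ob (A \<otimes>\<^sub>l B) \<otimes>\<^sub>k forget_ob E)"
     "?s \<in> carrier (forget_ob A \<otimes>\<^sub>k forget_ob (B \<otimes>\<^sub>l E))"
    using ob c by (auto intro!: ltensor_in_utensor)
  have m: "fn (\<nu> A B \<star>\<^sub>k Idn KM (forget_ob E)) ?t \<in> carrier ((forget_ob A \<otimes>\<^sub>k forget_ob B) \<otimes>\<^sub>k forget_ob E)"
    using K.fn_closed[of "\<nu> A B \<star>\<^sub>k Idn KM (forget_ob E)" ?t] ob c' by simp
  have "fn (Asc KM (forget_ob A) (forget_ob B) (forget_ob E)) (fn (\<nu> A B \<star>\<^sub>k Idn KM (forget_ob E)) ?t) =
      kassoc_fun k A B E (umap k (utensor k A B) E (fn (\<nu> A B)) (fn (Idn KM (forget_ob E))) ?t)"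
    using m c'(1) by (simp add: fn_K_Asc fn_K_TensA) (simp add: TensO_forget forget_tensor kassoc_fun_forget)
  also have "\<dots> = umap k A (utensor k B E) (fn (Idn KM (forget_ob A))) (fn (\<nu> B E)) ?s"
    using ob unfolding TensO_HM by (intro inclusion_assoc abe) (simp_all add: Ob_HM TensO_HM[symmetric])
  also have "\<dots> = fn (Idn KM (forget_ob A) \<star>\<^sub>k \<nu> B E) ?s"
    using c'(2) by (simp add: fn_K_TensA) (simp add: TensO_forget forget_tensor)
  finally show "fn (Asc KM (forget_ob A) (forget_ob B) (forget_ob E) \<cdot>\<^sub>k (\<nu> A B \<star>\<^sub>k Idn KM (forget_ob E)) \<cdot>\<^sub>k \<nu> (A \<otimes>\<^sub>l B) E) ?t =
     fn ((Idn KM (forget_ob A) \<star>\<^sub>k \<nu> B E) \<cdot>\<^sub>k \<nu> A (B \<otimes>\<^sub>l E) \<cdot>\<^sub>k forget_ar (Asc HM A B E)) ?t"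
    using ob abe c c' by simp
qed (use ob in simp_all)

text \<open>
  On \<open>g h \<otimes>\<^sup>l a = g (1\<^sub>1 h) \<otimes> 1\<^sub>2 a\<close> the left-hand side is \<open>\<epsilon> (1\<^sub>1 h) 1\<^sub>2 a = f (g h) a\<close>.
\<close>

lemma nu0_left:
  assumes ob: "A \<in> Ob HM"
  shows "Lun KM (forget_ob A) \<cdot>\<^sub>k (forget_nu0 k H \<star>\<^sub>k Idn KM (forget_ob A)) \<cdot>\<^sub>k \<nu> (UnitO HM) A = forget_ar (Lun HM A)"
proof (rule forget_arrow_eqI[of _ _ "UnitO HM" A])
  fix r a assume r: "r \<in> carrier (UnitO HM)" and a: "a \<in> carrier A"
  then obtain h where h: "h \<in> carrier H" "r = G h" by (auto simp: UnitO_HM)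
  have lA: "left_module k H A" using ob by (simp add: Ob_HM)
  interpret two_modules k H "UnitO HM" A using ob C.UnitO_closed by (intro two_modulesI) (simp_all add: Ob_HM)
  let ?f = "Lun KM (forget_ob A) \<cdot>\<^sub>k (forget_nu0 k H \<star>\<^sub>k Idn KM (forget_ob A))"
  have f: "?f \<in> Ar KM" "src ?f = forget_ob (UnitO HM) \<otimes>\<^sub>k forget_ob A" "tgt ?f = forget_ob A" using ob by simp_all
  have lin: "linear_map k U A (fn ?f)" using K.Ar_linear[OF f] by (simp add: TensO_forget)
  have u: "fn ?f (u (G h) a) = counit H h \<odot>\<^bsub>A\<^esub> a" if "h \<in> carrier H" "a \<in> carrier A" for h a
  proof -
    have "u (G h) a \<in> carrier (forget_ob (UnitO HM) \<otimes>\<^sub>k forget_ob A)"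
      using that upure_closed by (simp add: TensO_forget)
    moreover have "u (G h) a = upure k (forget_ob (UnitO HM)) (forget_ob A) (G h) a" by (simp add: forget_tensor)
    ultimately show ?thesis using that ob by simp
  qed
  have act: "hact (UnitO HM) x (G h) = G (x \<bullet> h)" if "x \<in> carrier H" for x
    using that h by (simp add: hmod_cat_simps HL_simps)
  have "fn ?f (lpure r a) = sw A (\<lambda>x y. fn ?f (u (hact (UnitO HM) x (G h)) (hact A y a))) \<one>\<^sub>H"
    using r a unfolding h(2) by (simp only: lpure_def diag_act_upure H.one_closed)
      (intro sw_linear_image[OF module_utensor N.module_axioms lin], simp_all add: upure_closed hact_M hact_N)
  also have "\<dots> = sw A (\<lambda>x y. counit H (x \<bullet> h) \<odot>\<^bsub>A\<^esub> hact A y a) \<one>\<^sub>H"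
    using h a by (intro sw_cong) (simp_all only: act u hact_N H.m_closed H.one_closed)
  also have "\<dots> = hact A (fg h) a"
    using hact_mult_fg[OF lA H.one_closed h(1) a] hact_closed[OF lA fg_closed[OF h(1)] a]
    by (simp add: left_module.one_hact[OF lA])
  also have "\<dots> = fn (forget_ar (Lun HM A)) (lpure r a)" using ob r a h(2) by (simp add: fmap_G)
  finally show "fn (Lun KM (forget_ob A) \<cdot>\<^sub>k (forget_nu0 k H \<star>\<^sub>k Idn KM (forget_ob A)) \<cdot>\<^sub>k \<nu> (UnitO HM) A) (lpure r a)
    = fn (forget_ar (Lun HM A)) (lpure r a)"
    using ob r a ltensor_in_utensor[of "UnitO HM" A "lpure r a"] by simp
qed (use ob in simp_all)

lemma nu0_right:
  assumes ob: "A \<in> Ob HM"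
  shows "Run KM (forget_ob A) \<cdot>\<^sub>k (Idn KM (forget_ob A) \<star>\<^sub>k forget_nu0 k H) \<cdot>\<^sub>k \<nu> A (UnitO HM) = forget_ar (Run HM A)"
proof (rule forget_arrow_eqI[of _ _ A "UnitO HM"])
  fix a r assume r: "r \<in> carrier (UnitO HM)" and a: "a \<in> carrier A"
  then obtain h where h: "h \<in> carrier H" "r = G h" by (auto simp: UnitO_HM)
  have lA: "left_module k H A" using ob by (simp add: Ob_HM)
  interpret two_modules k H A "UnitO HM" using ob C.UnitO_closed by (intro two_modulesI) (simp_all add: Ob_HM)
  let ?f = "Run KM (forget_ob A) \<cdot>\<^sub>k (Idn KM (forget_ob A) \<star>\<^sub>k forget_nu0 k H)"
  have f: "?f \<in> Ar KM" "src ?f = forget_ob A \<otimes>\<^sub>k forget_ob (UnitO HM)" "tgt ?f = forget_ob A" using ob by simp_all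
  have lin: "linear_map k U A (fn ?f)" using K.Ar_linear[OF f] by (simp add: TensO_forget)
  have u: "fn ?f (u a (G h)) = counit H h \<odot>\<^bsub>A\<^esub> a" if "h \<in> carrier H" "a \<in> carrier A" for h a
  proof -
    have "u a (G h) \<in> carrier (forget_ob A \<otimes>\<^sub>k forget_ob (UnitO HM))"
      using that upure_closed by (simp add: TensO_forget)
    moreover have "u a (G h) = upure k (forget_ob A) (forget_ob (UnitO HM)) a (G h)" by (simp add: forget_tensor)
    ultimately show ?thesis using that ob by simp
  qed
  have act: "hact (UnitO HM) x (G h) = G (x \<bullet> h)" if "x \<in> carrier H" for x
    using that h by (simp add: hmod_cat_simps HL_simps)
  have "fn ?f (lpure a r) = sw A (\<lambda>x y. fn ?f (u (hact A x a) (hact (UnitO HM) y (G h)))) \<one>\<^sub>H"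
    using r a unfolding h(2) by (simp only: lpure_def diag_act_upure H.one_closed)
      (intro sw_linear_image[OF module_utensor M.module_axioms lin], simp_all add: upure_closed hact_M hact_N)
  also have "\<dots> = sw A (\<lambda>x y. counit H (y \<bullet> h) \<odot>\<^bsub>A\<^esub> hact A x a) \<one>\<^sub>H"
    using h a by (intro sw_cong) (simp_all only: act u hact_M H.m_closed H.one_closed)
  also have "\<dots> = hact A (fg' h) a"
    using hact_mult_fg'[OF lA H.one_closed h(1) a] hact_closed[OF lA fg'_closed[OF h(1)] a]
    by (simp add: left_module.one_hact[OF lA])
  also have "\<dots> = fn (forget_ar (Run HM A)) (lpure a r)" using ob r a h(2) by (simp add: fmap_G)
  finally show "fn (Run KM (forget_ob A) \<cdot>\<^sub>k (Idn KM (forget_ob A) \<star>\<^sub>k forget_nu0 k H) \<cdot>\<^sub>k \<nu> A (UnitO HM)) (lpure a r)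
    = fn (forget_ar (Run HM A)) (lpure a r)"
    using ob r a ltensor_in_utensor[of A "UnitO HM" "lpure a r"] by simp
qed (use ob in simp_all)

lemma forget_opmonoidal: "opmonoidal_functor HM KM forget_ob forget_ar \<nu> (forget_nu0 k H)"
  by (rule opmonoidal_functor.intro[OF C.monoidal_category K.monoidal_category forget_cat_functor],
      rule opmonoidal_functor_axioms.intro)
    (simp_all add: K.Hom_iff nu2_natural nu2_assoc nu0_left nu0_right)

end

section \<open>Quotients of modules\<close>

text \<open>
  The first isomorphism theorem, for cosets of the kernel and the map that picks the common value
  of \<open>f\<close> on a coset.
\<close>

lemma
  fixes U :: "('k, 'u, 'r) module_scheme" and L :: "('k, 'v, 's) module_scheme"
  assumes U: "module k U" and L: "module k L" and f: "linear_map k U L f"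
    and K: "K = {t \<in> carrier U. f t = \<zero>\<^bsub>L\<^esub>}"
  shows coset_kernel: "t \<in> carrier U \<Longrightarrow> K +>\<^bsub>U\<^esub> t = {s \<in> carrier U. f s = f t}"
    and module_iso_quotient_kernel: "f ` carrier U = carrier L \<Longrightarrow>
      module_iso k (quotient_module U K) L (\<lambda>X. the_elem (f ` X))"
proof -
  interpret U: module k U by fact
  interpret L: module k L by fact
  note fc = linear_map_closed[OF f] and fa = linear_map_add[OF f] and fs = linear_map_smult[OF f]
  have fi: "f (\<ominus>\<^bsub>U\<^esub> t) = \<ominus>\<^bsub>L\<^esub> f t" if "t \<in> carrier U" for t
    using that fa[of "\<ominus>\<^bsub>U\<^esub> t" t] linear_map_zero[OF U L f] fc
    by (intro L.minus_equality[symmetric]) (simp_all add: U.l_neg)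
  have coset: "K +>\<^bsub>U\<^esub> t = {s \<in> carrier U. f s = f t}" if t: "t \<in> carrier U" for t
  proof
    show "K +>\<^bsub>U\<^esub> t \<subseteq> {s \<in> carrier U. f s = f t}" using t fc by (auto simp: a_r_coset_def' K fa)
    show "{s \<in> carrier U. f s = f t} \<subseteq> K +>\<^bsub>U\<^esub> t"
    proof
      fix s assume s: "s \<in> {s \<in> carrier U. f s = f t}"
      then have "s \<oplus>\<^bsub>U\<^esub> \<ominus>\<^bsub>U\<^esub> t \<in> K" using t fc by (simp add: K fa fi L.r_neg)
      moreover have "s = (s \<oplus>\<^bsub>U\<^esub> \<ominus>\<^bsub>U\<^esub> t) \<oplus>\<^bsub>U\<^esub> t" using s t by (simp add: U.a_assoc U.l_neg)
      ultimately show "s \<in> K +>\<^bsub>U\<^esub> t" unfolding a_r_coset_def' by blast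
    qed
  qed
  then show "t \<in> carrier U \<Longrightarrow> K +>\<^bsub>U\<^esub> t = {s \<in> carrier U. f s = f t}" .
  assume surj: "f ` carrier U = carrier L"
  let ?Q = "quotient_module U K" and ?F = "\<lambda>t. {s \<in> carrier U. f s = f t}"
  have Q: "carrier ?Q = ?F ` carrier U"
    using coset by (auto simp: quotient_module_def A_RCOSETS_def')
  have the: "the_elem (f ` ?F t) = f t" if "t \<in> carrier U" for t
  proof -
    have "f ` ?F t = {f t}" using that by auto
    then show ?thesis by simp
  qed
  have add: "?F t \<oplus>\<^bsub>?Q\<^esub> ?F s = ?F (t \<oplus>\<^bsub>U\<^esub> s)" if t: "t \<in> carrier U" "s \<in> carrier U" for t s
  proof -
    have "?F t \<oplus>\<^bsub>?Q\<^esub> ?F s = (\<Union>x\<in>?F t. \<Union>y\<in>?F s. {x \<oplus>\<^bsub>U\<^esub> y})"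
      by (simp add: quotient_module_def set_add_def')
    also have "\<dots> = ?F (t \<oplus>\<^bsub>U\<^esub> s)"
    proof
      show "(\<Union>x\<in>?F t. \<Union>y\<in>?F s. {x \<oplus>\<^bsub>U\<^esub> y}) \<subseteq> ?F (t \<oplus>\<^bsub>U\<^esub> s)" using t by (auto simp: fa)
      show "?F (t \<oplus>\<^bsub>U\<^esub> s) \<subseteq> (\<Union>x\<in>?F t. \<Union>y\<in>?F s. {x \<oplus>\<^bsub>U\<^esub> y})"
      proof
        fix z assume z: "z \<in> ?F (t \<oplus>\<^bsub>U\<^esub> s)"
        have "z \<oplus>\<^bsub>U\<^esub> \<ominus>\<^bsub>U\<^esub> s \<in> ?F t" using z t fc by (simp add: fa fi L.a_assoc L.r_neg)
        moreover have "z = (z \<oplus>\<^bsub>U\<^esub> \<ominus>\<^bsub>U\<^esub> s) \<oplus>\<^bsub>U\<^esub> s" using z t by (simp add: U.a_assoc U.l_neg)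
        moreover have "s \<in> ?F s" using t by simp
        ultimately show "z \<in> (\<Union>x\<in>?F t. \<Union>y\<in>?F s. {x \<oplus>\<^bsub>U\<^esub> y})" by blast
      qed
    qed
    finally show ?thesis .
  qed
  have smult: "x \<odot>\<^bsub>?Q\<^esub> ?F t = ?F (x \<odot>\<^bsub>U\<^esub> t)" if t: "x \<in> carrier k" "t \<in> carrier U" for x t
  proof -
    have "x \<odot>\<^bsub>?Q\<^esub> ?F t = (\<Union>m\<in>?F t. K +>\<^bsub>U\<^esub> (x \<odot>\<^bsub>U\<^esub> m))" by (simp add: quotient_module_def)
    also have "\<dots> = (\<Union>m\<in>?F t. ?F (x \<odot>\<^bsub>U\<^esub> t))" using t by (intro SUP_cong) (auto simp: coset fs)
    also have "\<dots> = ?F (x \<odot>\<^bsub>U\<^esub> t)" using t(2) by blast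
    finally show ?thesis .
  qed
  show "module_iso k ?Q L (\<lambda>X. the_elem (f ` X))"
    unfolding module_iso_def
  proof
    show "linear_map k ?Q L (\<lambda>X. the_elem (f ` X))"
    proof (rule linear_mapI; unfold Q; elim imageE)
      fix X t assume "X = ?F t" "t \<in> carrier U"
      then show "the_elem (f ` X) \<in> carrier L" by (simp only: the fc)
    next
      fix X Y t s assume "X = ?F t" "t \<in> carrier U" "Y = ?F s" "s \<in> carrier U"
      then show "the_elem (f ` (X \<oplus>\<^bsub>?Q\<^esub> Y)) = the_elem (f ` X) \<oplus>\<^bsub>L\<^esub> the_elem (f ` Y)"
        by (simp only: the add U.a_closed) (simp only: fa)
    next
      fix x X t assume "x \<in> carrier k" "X = ?F t" "t \<in> carrier U"
      then show "the_elem (f ` (x \<odot>\<^bsub>?Q\<^esub> X)) = x \<odot>\<^bsub>L\<^esub> the_elem (f ` X)"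
        by (simp only: the smult U.smult_closed) (simp only: fs)
    qed
    show "bij_betw (\<lambda>X. the_elem (f ` X)) (carrier ?Q) (carrier L)"
      unfolding bij_betw_def
    proof
      show "inj_on (\<lambda>X. the_elem (f ` X)) (carrier ?Q)" by (rule inj_onI, unfold Q, elim imageE) (simp only: the)
      show "(\<lambda>X. the_elem (f ` X)) ` carrier ?Q = carrier L"
        unfolding Q image_image surj[symmetric] by (intro image_cong) (simp_all only: the)
    qed
  qed
qed

section \<open>Consequences of comonoidality\<close>

context unit_calculus
begin

text \<open>
  \<open>1\<^sub>1 \<otimes> 1\<^sub>2 = 1\<^sub>1 \<otimes> f (g 1\<^sub>2)\<close>: apply \<open>\<epsilon>\<close> to the middle leg of (rc).
\<close>

lemma sw_one_right_comonoidal: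
  assumes rc: "right_comonoidal k H" and P: "module k P" and B: "bilinear k H H P B"
  shows "sw P B \<one>\<^sub>H = sw P (\<lambda>a b. B a (fg b)) \<one>\<^sub>H"
proof -
  have T: "trilinear k H P (\<lambda>x y z. counit H y \<odot>\<^bsub>P\<^esub> B x z)"
    by (intro trilinearI linear_intros P bilinear_left[OF B] bilinear_right[OF B] bilinear_closed[OF B]) simp_all
  have "sw P B \<one>\<^sub>H = sw P (\<lambda>a b. sw P (\<lambda>c d. counit H d \<odot>\<^bsub>P\<^esub> B c b) a) \<one>\<^sub>H"
    by (intro sw_cong sw_counit_right[symmetric] P bilinear_left[OF B] linear_map_id) simp_all
  also have "\<dots> = sw P (\<lambda>a b. sw P (\<lambda>c d. counit H (c \<bullet> b) \<odot>\<^bsub>P\<^esub> B a d) \<one>\<^sub>H) \<one>\<^sub>H"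
    by (rule sw_unit_middle[OF P T, where F = "\<lambda>b c. c \<bullet> b"]) (use rc in \<open>simp_all add: right_comonoidal_def\<close>)
  also have "\<dots> = sw P (\<lambda>a b. sw P (\<lambda>c d. B a (counit H (c \<bullet> b) \<odot>\<^bsub>H\<^esub> d)) \<one>\<^sub>H) \<one>\<^sub>H"
    by (intro sw_cong linear_map_smult[symmetric, OF bilinear_right[OF B _ linear_map_id]]) simp_all
  also have "\<dots> = sw P (\<lambda>a b. B a (fg b)) \<one>\<^sub>H"
    by (intro sw_cong) (simp_all add: fg_sw sw_linear_image[OF H.module_axioms P bilinear_right[OF B _ linear_map_id]])
  finally show ?thesis .
qed

text \<open>
  \<open>1\<^sub>1 \<otimes> 1\<^sub>2 = f' (g 1\<^sub>1) \<otimes> 1\<^sub>2\<close>: apply \<open>\<epsilon>\<close> to the middle leg of (lc).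
\<close>

lemma sw_one_left_comonoidal:
  assumes lc: "left_comonoidal k H" and P: "module k P" and B: "bilinear k H H P B"
  shows "sw P B \<one>\<^sub>H = sw P (\<lambda>a b. B (fg' a) b) \<one>\<^sub>H"
proof -
  interpret P: module k P by fact
  have T: "trilinear k H P (\<lambda>x y z. counit H y \<odot>\<^bsub>P\<^esub> B x z)"
    by (intro trilinearI linear_intros P bilinear_left[OF B] bilinear_right[OF B] bilinear_closed[OF B]) simp_all
  have "sw P B \<one>\<^sub>H = sw P (\<lambda>a b. sw P (\<lambda>c d. counit H d \<odot>\<^bsub>P\<^esub> B c b) a) \<one>\<^sub>H"
    by (intro sw_cong sw_counit_right[symmetric] P bilinear_left[OF B] linear_map_id) simp_all
  also have "\<dots> = sw P (\<lambda>a b. sw P (\<lambda>c d. counit H (b \<bullet> c) \<odot>\<^bsub>P\<^esub> B a d) \<one>\<^sub>H) \<one>\<^sub>H"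
    by (rule sw_unit_middle[OF P T, where F = "\<lambda>b c. b \<bullet> c"]) (use lc in \<open>simp_all add: left_comonoidal_def\<close>)
  also have "\<dots> = sw P (\<lambda>c d. sw P (\<lambda>a b. counit H (b \<bullet> c) \<odot>\<^bsub>P\<^esub> B a d) \<one>\<^sub>H) \<one>\<^sub>H"
    by (rule sw_swap[OF P]) (simp_all add: bilinear_closed[OF B])
  also have "\<dots> = sw P (\<lambda>c d. sw P (\<lambda>a b. B (counit H (b \<bullet> c) \<odot>\<^bsub>H\<^esub> a) d) \<one>\<^sub>H) \<one>\<^sub>H"
    by (intro sw_cong linear_map_smult[symmetric, OF bilinear_left[OF B _ linear_map_id]]) simp_all
  also have "\<dots> = sw P (\<lambda>a b. B (fg' a) b) \<one>\<^sub>H"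
    by (intro sw_cong) (simp_all add: fg'_sw sw_linear_image[OF H.module_axioms P bilinear_left[OF B _ linear_map_id]])
  finally show ?thesis .
qed

lemma sw_fg_one: "sw H (\<lambda>a b. fg a \<bullet> b) \<one>\<^sub>H = \<one>\<^sub>H"
proof -
  have "sw H (\<lambda>a b. fg a \<bullet> b) \<one>\<^sub>H = sw H (\<lambda>a b. fg (a \<bullet> \<one>\<^sub>H) \<bullet> b) \<one>\<^sub>H"
    by (intro sw_cong) simp_all
  then show ?thesis by (simp add: sw_fg_mult fg_one)
qed

lemma sw_fg'_one: "sw H (\<lambda>a b. fg' b \<bullet> a) \<one>\<^sub>H = \<one>\<^sub>H"
proof -
  have "sw H (\<lambda>a b. fg' b \<bullet> a) \<one>\<^sub>H = sw H (\<lambda>a b. fg' (b \<bullet> \<one>\<^sub>H) \<bullet> a) \<one>\<^sub>H"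
    by (intro sw_cong) simp_all
  then show ?thesis by (simp add: sw_fg'_mult fg'_one)
qed

end

section \<open>Essential strength\<close>

lemma umap_cong:
  assumes "module k M" "module k N" "t \<in> carrier (utensor k M N)"
    and "\<And>m. m \<in> carrier M \<Longrightarrow> f m = f' m" "\<And>n. n \<in> carrier N \<Longrightarrow> g n = g' n"
  shows "umap k M' N' f g t = umap k M' N' f' g' t"
proof -
  have "set (terms t) \<subseteq> carrier M \<times> carrier N"
    by (rule utensor_pair.utensor_terms(1)[OF utensor_pairI[OF assms(1,2)] assms(3)])
  then have "map (map_prod f g) (terms t) = map (map_prod f' g') (terms t)"
    using assms(4,5) by (intro map_cong) auto
  then show ?thesis by (simp only: umap_def)
qed

lemma (in abelian_group) tsum_minus:
  assumes "set s \<subseteq> A \<times> A'" "\<And>a b. a \<in> A \<Longrightarrow> b \<in> A' \<Longrightarrow> B a b \<in> carrier G"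
    and "\<And>a b. a \<in> A \<Longrightarrow> b \<in> A' \<Longrightarrow> B' a b \<in> carrier G"
  shows "tsum G (\<lambda>a b. B a b \<ominus> B' a b) s = tsum G B s \<ominus> tsum G B' s"
  using assms(1)
proof (induction s)
  case Nil
  show ?case using r_neg[OF zero_closed] unfolding tsum_simps minus_eq by (rule HOL.sym)
next
  case (Cons p s)
  obtain a b where p: "p = (a, b)" by (cases p)
  have c: "tsum G B s \<in> carrier G" "tsum G B' s \<in> carrier G"
    using Cons.prems assms(2,3) by (auto intro!: tsum_closed[of s A A'])
  show ?case using Cons p c assms(2)[of a b] assms(3)[of a b]
    by (simp add: minus_eq minus_add a_ac)
qed

lemma submodule_zero: "submodule S k U \<Longrightarrow> \<zero>\<^bsub>U\<^esub> \<in> S"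
  using subgroup.one_closed[OF submodule.axioms(1)] by fastforce

lemma submodule_tsum:
  assumes "module k U" "submodule S k U" "set s \<subseteq> A \<times> A'" "\<And>a b. a \<in> A \<Longrightarrow> b \<in> A' \<Longrightarrow> B a b \<in> S"
  shows "tsum U B s \<in> S"
  using assms(3)
proof (induction s)
  case Nil then show ?case by (simp add: submodule_zero[OF assms(2)])
next
  case (Cons p s)
  then show ?case using assms(4)[of "fst p" "snd p"] module.submoduleE(5)[OF assms(1,2)] by (cases p) simp
qed

lemma submodule_kernel:
  assumes U: "module k U" and L: "module k L" and f: "linear_map k U L f"
  shows "submodule {t \<in> carrier U. f t = \<zero>\<^bsub>L\<^esub>} k U"
proof -
  interpret U: module k U by fact
  interpret L: module k L by fact
  have inv: "\<ominus>\<^bsub>U\<^esub> t = (\<ominus>\<^bsub>k\<^esub> \<one>\<^bsub>k\<^esub>) \<odot>\<^bsub>U\<^esub> t" if "t \<in> carrier U" for t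
    using that U.smult_l_minus[of "\<one>\<^bsub>k\<^esub>" t] by simp
  show ?thesis
    by (rule U.submoduleI)
      (auto simp: inv linear_map_add[OF f] linear_map_smult[OF f] linear_map_zero[OF U L f])
qed

context unit_calculus
begin

context
  fixes M N :: "('k, ('k, 'h, 'x) elt, 'h) hmodule"
  assumes M: "left_module k H M" and N: "left_module k H N"
begin

interpretation A: two_modules k H M N by (rule two_modulesI[OF M N])

text \<open>
  If \<open>\<pi> t = 0\<close> then \<open>t = t - \<pi> t\<close>, so it suffices that \<open>m \<otimes> n - m \<otimes>\<^sup>l n\<close> lies in every submodule \<open>S\<close>
  that contains the relations \<open>f' \<phi> m \<otimes> n - m \<otimes> f \<phi> n\<close>.  Under (rc) the difference is the sum of the relations
  for \<open>g 1\<^sub>2\<close>, \<open>1\<^sub>1 m\<close>, \<open>n\<close>; under (lc) its negative is the sum of those for \<open>g 1\<^sub>1\<close>, \<open>m\<close>, \<open>1\<^sub>2 n\<close>.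
\<close>

lemma balanced_generators_span:
  assumes comonoidal: "right_comonoidal k H \<or> left_comonoidal k H"
    and S: "submodule S k A.U"
    and gen: "\<And>h m n. h \<in> carrier H \<Longrightarrow> m \<in> carrier M \<Longrightarrow> n \<in> carrier N \<Longrightarrow>
       A.u (hact M (fg' h) m) n \<ominus>\<^bsub>A.U\<^esub> A.u m (hact N (fg h) n) \<in> S"
    and t: "t \<in> carrier A.U" "A.D \<one>\<^sub>H t = \<zero>\<^bsub>A.U\<^esub>"
  shows "t \<in> S"
proof -
  interpret U: module k A.U by (rule A.module_utensor)
  note mods = A.M.module_axioms A.N.module_axioms A.module_utensor H.module_axioms
  have diff: "A.u m n \<ominus>\<^bsub>A.U\<^esub> A.lpure m n \<in> S" if mn: "m \<in> carrier M" "n \<in> carrier N" for m n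
  proof -
    have lpure: "A.lpure m n = sw A.U (\<lambda>a b. A.u (hact M a m) (hact N b n)) \<one>\<^sub>H"
      using mn by (simp add: A.lpure_def A.diag_act_upure)
    note B = A.bilinear_upure_hact[OF mn]
    have c: "A.u (hact M a m) (hact N b n) \<in> carrier A.U" if "a \<in> carrier H" "b \<in> carrier H" for a b
      using that mn by (simp add: A.upure_closed A.hact_M A.hact_N)
    from comonoidal show ?thesis
    proof
      assume rc: "right_comonoidal k H"
      have l: "A.lpure m n = sw A.U (\<lambda>a b. A.u (hact M a m) (hact N (fg b) n)) \<one>\<^sub>H"
        unfolding lpure by (rule sw_one_right_comonoidal[OF rc mods(3) B])
      have "A.u m n = A.u (hact M (sw H (\<lambda>a b. fg' b \<bullet> a) \<one>\<^sub>H) m) n"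
        using mn by (simp add: sw_fg'_one left_module.one_hact[OF M])
      also have "\<dots> = sw A.U (\<lambda>a b. A.u (hact M (fg' b \<bullet> a) m) n) \<one>\<^sub>H"
        by (intro sw_linear_image linear_intros mods M mn) (simp_all add: fg'_closed)
      also have "\<dots> = sw A.U (\<lambda>a b. A.u (hact M (fg' b) (hact M a m)) n) \<one>\<^sub>H"
        using mn by (intro sw_cong) (simp_all add: fg'_closed left_module.mult_hact[OF M])
      finally have "A.u m n \<ominus>\<^bsub>A.U\<^esub> A.lpure m n =
          sw A.U (\<lambda>a b. A.u (hact M (fg' b) (hact M a m)) n \<ominus>\<^bsub>A.U\<^esub> A.u (hact M a m) (hact N (fg b) n)) \<one>\<^sub>H"
        unfolding l sw_def using mn
        by (simp only: U.tsum_minus[OF comult_valid[OF H.one_closed]] A.upure_closed A.hact_M A.hact_N fg_closed fg'_closed)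
      also have "\<dots> \<in> S"
        unfolding sw_def
        by (rule submodule_tsum[OF mods(3) S comult_valid[OF H.one_closed] gen]) (simp_all add: mn A.hact_M)
      finally show ?thesis .
    next
      assume lc: "left_comonoidal k H"
      have l: "A.lpure m n = sw A.U (\<lambda>a b. A.u (hact M (fg' a) m) (hact N b n)) \<one>\<^sub>H"
        unfolding lpure by (rule sw_one_left_comonoidal[OF lc mods(3) B])
      have "A.u m n = A.u m (hact N (sw H (\<lambda>a b. fg a \<bullet> b) \<one>\<^sub>H) n)"
        using mn by (simp add: sw_fg_one left_module.one_hact[OF N])
      also have "\<dots> = sw A.U (\<lambda>a b. A.u m (hact N (fg a \<bullet> b) n)) \<one>\<^sub>H"
        by (intro sw_linear_image linear_intros mods N mn) (simp_all add: fg_closed)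
      also have "\<dots> = sw A.U (\<lambda>a b. A.u m (hact N (fg a) (hact N b n))) \<one>\<^sub>H"
        using mn by (intro sw_cong) (simp_all add: fg_closed left_module.mult_hact[OF N])
      finally have "A.lpure m n \<ominus>\<^bsub>A.U\<^esub> A.u m n =
          sw A.U (\<lambda>a b. A.u (hact M (fg' a) m) (hact N b n) \<ominus>\<^bsub>A.U\<^esub> A.u m (hact N (fg a) (hact N b n))) \<one>\<^sub>H"
        unfolding l sw_def using mn
        by (simp only: U.tsum_minus[OF comult_valid[OF H.one_closed]] A.upure_closed A.hact_M A.hact_N fg_closed fg'_closed)
      also have "\<dots> \<in> S"
        unfolding sw_def
        by (rule submodule_tsum[OF mods(3) S comult_valid[OF H.one_closed] gen]) (simp_all add: mn A.hact_N)
      finally have "\<ominus>\<^bsub>A.U\<^esub> (A.lpure m n \<ominus>\<^bsub>A.U\<^esub> A.u m n) \<in> S" by (rule U.submoduleE(3)[OF S])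
      moreover have "A.lpure m n \<in> carrier A.U" using A.lpure_closed[OF mn] by (simp add: A.carrier_ltensor)
      ultimately show ?thesis using A.upure_closed[OF mn] by (simp add: U.minus_eq U.minus_add U.a_comm)
    qed
  qed
  note v = A.utensor_terms[OF t(1)]
  have lc: "A.lpure m n \<in> carrier A.U" if "m \<in> carrier M" "n \<in> carrier N" for m n
    using A.lpure_closed[OF that] by (simp add: A.carrier_ltensor)
  have "t = t \<ominus>\<^bsub>A.U\<^esub> A.D \<one>\<^sub>H t" using t by (simp add: U.minus_eq)
  also have "A.D \<one>\<^sub>H t = tsum A.U A.lpure (terms t)"
  proof -
    have "A.D \<one>\<^sub>H (tsum A.U A.u (terms t)) = tsum A.U A.lpure (terms t)"
      unfolding A.lpure_def[abs_def]
      by (rule linear_map_tsum[OF mods(3,3) A.linear_map_diag_act[OF H.one_closed] v(1) A.upure_closed])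
    then show ?thesis by (simp only: v(2))
  qed
  also have "t \<ominus>\<^bsub>A.U\<^esub> tsum A.U A.lpure (terms t) = tsum A.U A.u (terms t) \<ominus>\<^bsub>A.U\<^esub> tsum A.U A.lpure (terms t)"
    by (simp only: v(2))
  also have "\<dots> = tsum A.U (\<lambda>m n. A.u m n \<ominus>\<^bsub>A.U\<^esub> A.lpure m n) (terms t)"
    by (rule U.tsum_minus[OF v(1) A.upure_closed lc, symmetric])
  also have "\<dots> \<in> S" by (rule submodule_tsum[OF mods(3) S v(1) diff])
  finally show ?thesis .
qed

lemma balanced_kernel:
  assumes comonoidal: "right_comonoidal k H \<or> left_comonoidal k H"
  shows "span_of k A.U {A.u (hact M (fg' h) m) n \<ominus>\<^bsub>A.U\<^esub> A.u m (hact N (fg h) n) | m h n.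
      m \<in> carrier M \<and> h \<in> carrier H \<and> n \<in> carrier N} = {t \<in> carrier A.U. A.D \<one>\<^sub>H t = \<zero>\<^bsub>A.U\<^esub>}"
    (is "span_of k A.U ?G = ?K")
proof
  interpret U: module k A.U by (rule A.module_utensor)
  note lin = A.linear_map_diag_act[OF H.one_closed]
  have minus: "x \<ominus>\<^bsub>A.U\<^esub> y = x \<oplus>\<^bsub>A.U\<^esub> (\<ominus>\<^bsub>k\<^esub> \<one>\<^bsub>k\<^esub>) \<odot>\<^bsub>A.U\<^esub> y" if "y \<in> carrier A.U" for x y
    using that U.smult_l_minus[of "\<one>\<^bsub>k\<^esub>" y] by (simp add: U.minus_eq)
  have "?G \<subseteq> ?K"
  proof clarify
    fix m h n assume a: "m \<in> carrier M" "h \<in> carrier H" "n \<in> carrier N"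
    have c: "A.u (hact M (fg' h) m) n \<in> carrier A.U" "A.u m (hact N (fg h) n) \<in> carrier A.U"
      using a by (simp_all add: A.upure_closed A.hact_M A.hact_N fg_closed fg'_closed)
    have "A.D \<one>\<^sub>H (A.u (hact M (fg' h) m) n) = A.D \<one>\<^sub>H (A.u m (hact N (fg h) n))"
      using lpure_balanced[OF M N a(2,1,3)] by (simp add: A.lpure_def)
    then show "A.u (hact M (fg' h) m) n \<ominus>\<^bsub>A.U\<^esub> A.u m (hact N (fg h) n) \<in> carrier A.U \<and>
      A.D \<one>\<^sub>H (A.u (hact M (fg' h) m) n \<ominus>\<^bsub>A.U\<^esub> A.u m (hact N (fg h) n)) = \<zero>\<^bsub>A.U\<^esub>"
      using c A.diag_act_closed[OF H.one_closed c(2)]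
      by (simp add: minus linear_map_add[OF lin] linear_map_smult[OF lin]) (simp add: minus[symmetric] U.r_neg U.minus_eq)
  qed
  then show "span_of k A.U ?G \<subseteq> ?K"
    using submodule_kernel[OF A.module_utensor A.module_utensor lin] by (auto simp: span_of_def)
  show "?K \<subseteq> span_of k A.U ?G"
    unfolding span_of_def
  proof (intro subsetI InterI)
    fix t S assume t: "t \<in> ?K" and S: "S \<in> {S. submodule S k A.U \<and> ?G \<subseteq> S}"
    show "t \<in> S" by (rule balanced_generators_span[OF comonoidal]) (use S t in auto)
  qed
qed

text \<open>
  Since \<open>f (g h) (m \<otimes>\<^sup>l n) = f (g h) m \<otimes>\<^sup>l n\<close> and \<open>f' (g h) (m \<otimes>\<^sup>l n) = m \<otimes>\<^sup>l f' (g h) n\<close>, the actions of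
  \<open>U I\<close> on \<open>U (M \<otimes>\<^sup>l N)\<close> come from the left action on \<open>U M\<close> and the right action on \<open>U N\<close>.
\<close>

lemma umap_fg_diag_act:
  assumes h: "h \<in> carrier H" and t: "t \<in> carrier A.U"
  shows "A.D \<one>\<^sub>H (umap k M N (hact M (fg h)) id t) = A.D (fg h) (A.D \<one>\<^sub>H t)"
    and "A.D \<one>\<^sub>H (umap k M N id (hact N (fg' h)) t) = A.D (fg' h) (A.D \<one>\<^sub>H t)"
    and "umap k M N (hact M (fg h)) id t \<in> carrier A.U"
    and "umap k M N id (hact N (fg' h)) t \<in> carrier A.U"
proof -
  note mods = A.M.module_axioms A.N.module_axioms
  have l: "linear_map k M M (hact M (fg h))" "linear_map k N N id" "linear_map k M M id" "linear_map k N N (hact N (fg' h))"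
    using linear_map_hact_right[OF M fg_closed[OF h] linear_map_id] linear_map_hact_right[OF N fg'_closed[OF h] linear_map_id]
      linear_map_id by (simp_all add: id_def)
  note u1 = linear_map_umap[OF mods mods l(1,2)] umap_upure[OF mods mods l(1,2)]
  note u2 = linear_map_umap[OF mods mods l(3,4)] umap_upure[OF mods mods l(3,4)]
  note D = A.linear_map_diag_act
  have D1: "A.D x (A.D \<one>\<^sub>H t) = A.D x t" if "x \<in> carrier H" "t \<in> carrier A.U" for x t
    using A.diag_act_mult[of x "\<one>\<^sub>H" t] that by simp
  show "A.D \<one>\<^sub>H (umap k M N (hact M (fg h)) id t) = A.D (fg h) (A.D \<one>\<^sub>H t)"
    by (rule A.utensor_ext[OF A.module_utensor linear_map_compose[OF u1(1) D[OF H.one_closed]]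
      linear_map_compose[OF D[OF H.one_closed] D[OF fg_closed[OF h]]] _ t])
      (use lpure_fg_left[OF M N h] in \<open>simp add: u1(2) D1 A.upure_closed fg_closed h A.lpure_def\<close>)
  show "A.D \<one>\<^sub>H (umap k M N id (hact N (fg' h)) t) = A.D (fg' h) (A.D \<one>\<^sub>H t)"
    by (rule A.utensor_ext[OF A.module_utensor linear_map_compose[OF u2(1) D[OF H.one_closed]]
      linear_map_compose[OF D[OF H.one_closed] D[OF fg'_closed[OF h]]] _ t])
      (use lpure_fg'_right[OF M N h] in \<open>simp add: u2(2) D1 A.upure_closed fg'_closed h A.lpure_def\<close>)
  show "umap k M N (hact M (fg h)) id t \<in> carrier A.U" "umap k M N id (hact N (fg' h)) t \<in> carrier A.U"
    using linear_map_closed[OF u1(1) t] linear_map_closed[OF u2(1) t] by simp_all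
qed

text \<open>
  The two sides of the equation are \<open>1\<^sub>1 m \<otimes> (g 1\<^sub>2 \<otimes> n)\<close> and \<open>m \<otimes> (g 1\<^sub>1 \<otimes> 1\<^sub>2 n)\<close> for \<open>t = m \<otimes> n\<close>.  Under (rc)
  contract by \<open>m \<otimes> (\<phi> \<otimes> n) \<mapsto> m \<otimes> f \<phi> n\<close>: this gives \<open>1\<^sub>1 m \<otimes> f (g 1\<^sub>2) n = \<pi> t\<close> and
  \<open>m \<otimes> f (g 1\<^sub>1) 1\<^sub>2 n = t\<close>.  Under (lc) contract by \<open>m \<otimes> (\<phi> \<otimes> n) \<mapsto> f' \<phi> m \<otimes> n\<close>: this gives \<open>t\<close> and \<open>\<pi> t\<close>.
\<close>

lemma cotensor_fixed:
  assumes comonoidal: "right_comonoidal k H \<or> left_comonoidal k H"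
    and t: "t \<in> carrier A.U"
    and eq: "kassoc_fun k M (HL k H) N (umap k (utensor k M (HL k H)) N (\<lambda>m. tpure M (HL k H) m (G \<one>\<^sub>H)) id t)
      = umap k M (utensor k (HL k H) N) id (\<lambda>n. tpure (HL k H) N (G \<one>\<^sub>H) n) t"
  shows "A.D \<one>\<^sub>H t = t"
proof -
  let ?I = "HL k H :: ('k, ('k, 'h, 'x) elt, 'h) hmodule"
  interpret l: two_modules k H ?I N by (rule two_modulesI[OF left_module_HL N])
  interpret r: two_modules k H M ?I by (rule two_modulesI[OF M left_module_HL])
  interpret W: utensor_pair k M l.U by (rule utensor_pairI[OF A.M.module_axioms l.module_utensor])
  interpret W': utensor_pair k r.U N by (rule utensor_pairI[OF r.module_utensor A.N.module_axioms])
  note mods = A.M.module_axioms A.N.module_axioms A.module_utensor H.module_axioms l.M.module_axioms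
    l.module_utensor r.module_utensor W.module_utensor
  have G1: "G \<one>\<^sub>H \<in> carrier ?I" by (simp add: G_closed)
  have ll: "linear_map k N l.U (\<lambda>n. l.lpure (G \<one>\<^sub>H) n)"
    by (rule l.linear_map_ltensor_into[OF bilinear_right[OF l.bilinear_lpure G1 linear_map_id]])
  have rl: "linear_map k M r.U (\<lambda>m. r.lpure m (G \<one>\<^sub>H))"
    by (rule r.linear_map_ltensor_into[OF bilinear_left[OF r.bilinear_lpure G1 linear_map_id]])
  have idl: "linear_map k N N id" "linear_map k M M id" using linear_map_id by (simp_all add: id_def)
  let ?L = "\<lambda>t. kassoc_fun k M ?I N (umap k r.U N (\<lambda>m. r.lpure m (G \<one>\<^sub>H)) id t)"
  let ?R = "\<lambda>t. umap k M l.U id (\<lambda>n. l.lpure (G \<one>\<^sub>H) n) t"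
  have Ll: "linear_map k A.U W.U ?L"
    by (rule linear_map_compose[OF linear_map_umap[OF mods(7,2,1,2) rl idl(1)] linear_map_kassoc_fun[OF mods(1,5,2)]])
  have Rl: "linear_map k A.U W.U ?R" by (rule linear_map_umap[OF mods(1,6,1,2) idl(2) ll])
  have L: "?L (A.u m n) = tsum W.U (\<lambda>m' \<phi>. W.u m' (l.u \<phi> n)) (terms (r.lpure m (G \<one>\<^sub>H)))"
    if "m \<in> carrier M" "n \<in> carrier N" for m n
    using that linear_map_closed[OF rl]
    by (simp add: umap_upure[OF mods(7,2,1,2) rl idl(1)] kassoc_fun_upure_left[OF mods(1,5,2)])
  have R: "?R (A.u m n) = W.u m (l.lpure (G \<one>\<^sub>H) n)" if "m \<in> carrier M" "n \<in> carrier N" for m n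
    using that by (simp add: umap_upure[OF mods(1,6,1,2) idl(2) ll])
  have rv: "set (terms (r.lpure m (G \<one>\<^sub>H))) \<subseteq> carrier M \<times> carrier ?I" if "m \<in> carrier M" for m
    by (rule r.ltensor_terms[OF r.lpure_closed[OF that G1]])
  have Wc: "W.u m' (l.u \<phi> n) \<in> carrier W.U" if "m' \<in> carrier M" "\<phi> \<in> carrier ?I" "n \<in> carrier N" for m' \<phi> n
    by (intro W.upure_closed l.upure_closed that)
  have act: "hact ?I a (G \<one>\<^sub>H) = G a" if "a \<in> carrier H" for a using that by (simp add: HL_simps)
  have lpure: "A.lpure m n = sw A.U (\<lambda>a b. A.u (hact M a m) (hact N b n)) \<one>\<^sub>H"
    if "m \<in> carrier M" "n \<in> carrier N" for m n
    using that by (simp add: A.lpure_def A.diag_act_upure)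
  from comonoidal show ?thesis
  proof
    assume rc: "right_comonoidal k H"
    let ?P = "umap k M N id (lunit_fun N)"
    note P = linear_map_umap[OF mods(1,2,1,6) idl(2) linear_map_lunit_fun[OF N]]
      umap_upure[OF mods(1,2,1,6) idl(2) linear_map_lunit_fun[OF N]]
    have lu: "lunit_fun N (l.u \<phi> n) = hact N (fmap_left H (the_functional \<phi>)) n"
      if "\<phi> \<in> carrier ?I" "n \<in> carrier N" for \<phi> n
    proof -
      have B: "bilinear k ?I N N (\<lambda>\<phi> m. hact N (fmap_left H (the_functional \<phi>)) m)"
        by (intro linear_intros N linear_map_closed[OF linear_map_fmap_left] linear_map_fmap_left)
      show ?thesis using l.lift_upure[OF mods(2) B that] by (simp add: lunit_fun_def tsum_def)
    qed
    have "?P (?L t) = A.D \<one>\<^sub>H t"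
    proof (rule A.utensor_ext[OF mods(3) linear_map_compose[OF Ll P(1)] A.linear_map_diag_act[OF H.one_closed] _ t])
      fix m n assume mn: "m \<in> carrier M" "n \<in> carrier N"
      have B: "bilinear k M ?I A.U (\<lambda>m' \<phi>. A.u m' (hact N (fmap_left H (the_functional \<phi>)) n))"
        by (intro linear_intros mods N mn A.hact_N linear_map_closed[OF linear_map_fmap_left] linear_map_fmap_left)
      have "?P (?L (A.u m n)) = tsum A.U (\<lambda>m' \<phi>. ?P (W.u m' (l.u \<phi> n))) (terms (r.lpure m (G \<one>\<^sub>H)))"
        unfolding L[OF mn] by (rule linear_map_tsum[OF mods(8,3) P(1) rv[OF mn(1)] Wc[OF _ _ mn(2)]])
      also have "\<dots> = tsum A.U (\<lambda>m' \<phi>. A.u m' (hact N (fmap_left H (the_functional \<phi>)) n)) (terms (r.lpure m (G \<one>\<^sub>H)))"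
        by (rule tsum_cong'[OF rv[OF mn(1)]]) (simp add: P(2) l.upure_closed mn lu)
      also have "\<dots> = sw A.U (\<lambda>a b. A.u (hact M a m) (hact N (fmap_left H (the_functional (hact ?I b (G \<one>\<^sub>H)))) n)) \<one>\<^sub>H"
        unfolding r.lpure_def by (rule r.lift_diag_act[OF mods(3) B H.one_closed mn(1) G1])
      also have "\<dots> = sw A.U (\<lambda>a b. A.u (hact M a m) (hact N (fg b) n)) \<one>\<^sub>H"
        by (intro sw_cong) (simp_all add: act fmap_G)
      also have "\<dots> = A.D \<one>\<^sub>H (A.u m n)"
        using sw_one_right_comonoidal[OF rc mods(3) A.bilinear_upure_hact[OF mn]] lpure[OF mn] by (simp add: A.lpure_def)
      finally show "?P (?L (A.u m n)) = A.D \<one>\<^sub>H (A.u m n)" .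
    qed
    moreover have "?P (?R t) = t"
    proof (rule A.utensor_ext[OF mods(3) linear_map_compose[OF Rl P(1)] linear_map_id _ t])
      fix m n assume mn: "m \<in> carrier M" "n \<in> carrier N"
      then show "?P (?R (A.u m n)) = A.u m n"
        using linear_map_closed[OF ll]
        by (simp add: R P(2) lunit_fun_lpure[OF N] fg_one left_module.one_hact[OF N])
    qed
    ultimately show ?thesis using eq by simp
  next
    assume lc: "left_comonoidal k H"
    let ?B = "\<lambda>m s. tsum A.U (\<lambda>\<phi> n. A.u (hact M (fmap_right H (the_functional \<phi>)) m) n) (terms s)"
    let ?P = "\<lambda>t. tsum A.U ?B (terms t)"
    have C: "bilinear k ?I N A.U (\<lambda>\<phi> n. A.u (hact M (fmap_right H (the_functional \<phi>)) m) n)" if "m \<in> carrier M" for m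
      by (intro linear_intros mods M that A.hact_M linear_map_closed[OF linear_map_fmap_right] linear_map_fmap_right)
    have B: "bilinear k M l.U A.U ?B"
    proof (rule bilinearI)
      fix s assume s: "s \<in> carrier l.U"
      show "linear_map k M A.U (\<lambda>m. ?B m s)"
        by (rule linear_map_tsum_family[OF mods(1,3) l.utensor_terms(1)[OF s]])
          (intro linear_intros mods M linear_map_closed[OF linear_map_fmap_right])
    qed (rule l.linear_map_lift[OF mods(3) C])
    note P = W.linear_map_lift[OF mods(3) B] W.lift_upure[OF mods(3) B]
    have "?P (?R t) = A.D \<one>\<^sub>H t"
    proof (rule A.utensor_ext[OF mods(3) linear_map_compose[OF Rl P(1)] A.linear_map_diag_act[OF H.one_closed] _ t])
      fix m n assume mn: "m \<in> carrier M" "n \<in> carrier N"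
      have "?P (?R (A.u m n)) = ?B m (l.lpure (G \<one>\<^sub>H) n)"
        unfolding R[OF mn] by (rule P(2)[OF mn(1) linear_map_closed[OF ll mn(2)]])
      also have "\<dots> = sw A.U (\<lambda>a b. A.u (hact M (fmap_right H (the_functional (hact ?I a (G \<one>\<^sub>H)))) m) (hact N b n)) \<one>\<^sub>H"
        unfolding l.lpure_def by (rule l.lift_diag_act[OF mods(3) C[OF mn(1)] H.one_closed G1 mn(2)])
      also have "\<dots> = sw A.U (\<lambda>a b. A.u (hact M (fg' a) m) (hact N b n)) \<one>\<^sub>H"
        by (intro sw_cong) (simp_all add: act fmap_G)
      also have "\<dots> = A.D \<one>\<^sub>H (A.u m n)"
        using sw_one_left_comonoidal[OF lc mods(3) A.bilinear_upure_hact[OF mn]] lpure[OF mn] by (simp add: A.lpure_def)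
      finally show "?P (?R (A.u m n)) = A.D \<one>\<^sub>H (A.u m n)" .
    qed
    moreover have "?P (?L t) = t"
    proof (rule A.utensor_ext[OF mods(3) linear_map_compose[OF Ll P(1)] linear_map_id _ t])
      fix m n assume mn: "m \<in> carrier M" "n \<in> carrier N"
      have "?P (?L (A.u m n)) = tsum A.U (\<lambda>m' \<phi>. ?P (W.u m' (l.u \<phi> n))) (terms (r.lpure m (G \<one>\<^sub>H)))"
        unfolding L[OF mn] by (rule linear_map_tsum[OF mods(8,3) P(1) rv[OF mn(1)] Wc[OF _ _ mn(2)]])
      also have "\<dots> = tsum A.U (\<lambda>m' \<phi>. A.u (hact M (fmap_right H (the_functional \<phi>)) m') n) (terms (r.lpure m (G \<one>\<^sub>H)))"
        by (rule tsum_cong'[OF rv[OF mn(1)]]) (simp add: P(2) l.upure_closed mn l.lift_upure[OF mods(3) C])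
      also have "\<dots> = A.u (tsum M (\<lambda>m' \<phi>. hact M (fmap_right H (the_functional \<phi>)) m') (terms (r.lpure m (G \<one>\<^sub>H)))) n"
        by (rule linear_map_tsum[symmetric, OF mods(1,3) bilinear_left[OF A.bilinear_upure mn(2) linear_map_id] rv[OF mn(1)]])
          (intro A.hact_M linear_map_closed[OF linear_map_fmap_right])
      also have "tsum M (\<lambda>m' \<phi>. hact M (fmap_right H (the_functional \<phi>)) m') (terms (r.lpure m (G \<one>\<^sub>H))) = m"
        using runit_fun_lpure[OF M H.one_closed mn(1)] mn by (simp add: runit_fun_def tsum_def fg'_one left_module.one_hact[OF M])
      finally show "?P (?L (A.u m n)) = A.u m n" .
    qed
    ultimately show ?thesis using eq by simp
  qed
qed

end

end

text \<open>
  Coassociativity of \<open>\<nu>\<close> turns one side into the other up to the arrow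
  \<open>A \<diamondop> B \<rightarrow> A \<diamondop> (I \<diamondop> B)\<close>, which is \<open>\<alpha> \<cdot> (\<rho>\<^sup>-\<^sup>1 \<diamondop> B)\<close> on one side and \<open>A \<diamondop> \<lambda>\<^sup>-\<^sup>1\<close> on the other.
  These agree by the triangle identity.
\<close>

lemma (in opmonoidal_functor) nu2_cotensor:
  assumes A: "A \<in> Ob C" and B: "B \<in> Ob C"
    and r: "inverse_pair C (Run C A) r" and l: "inverse_pair C (Lun C B) l"
  shows "(Asc D (Fo A) (Fo (UnitO C)) (Fo B) \<cdot>\<^bsub>D\<^esub> ((nu2 A (UnitO C) \<cdot>\<^bsub>D\<^esub> Fa r) \<star>\<^bsub>D\<^esub> Idn D (Fo B))) \<cdot>\<^bsub>D\<^esub> nu2 A B =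
    (Idn D (Fo A) \<star>\<^bsub>D\<^esub> (nu2 (UnitO C) B \<cdot>\<^bsub>D\<^esub> Fa l)) \<cdot>\<^bsub>D\<^esub> nu2 A B"
proof -
  let ?I = "UnitO C"
  let ?iA = "Idn D (Fo A)" and ?iB = "Idn D (Fo B)"
  have Lun: "Lun C B \<in> Hom C (?I \<diamondop>\<^bsub>C\<^esub> B) B" and Run: "Run C A \<in> Hom C (A \<diamondop>\<^bsub>C\<^esub> ?I) A"
    using A B by (simp_all add: C.Lun_Hom C.Run_Hom)
  have rH: "r \<in> Hom C A (A \<diamondop>\<^bsub>C\<^esub> ?I)" and lH: "l \<in> Hom C B (?I \<diamondop>\<^bsub>C\<^esub> B)"
    and inv: "Run C A \<cdot>\<^bsub>C\<^esub> r = Idn C A" "l \<cdot>\<^bsub>C\<^esub> Lun C B = Idn C (?I \<diamondop>\<^bsub>C\<^esub> B)"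
    using r l Lun Run by (auto simp: inverse_pair_def Hom_def)
  note Ob = A B C.UnitO_Ob C.TensO_Ob[OF A C.UnitO_Ob] C.TensO_Ob[OF C.UnitO_Ob B] C.TensO_Ob[OF A B]
  note idC = C.Idn_Hom[OF A] C.Idn_Hom[OF B] and idD = D.Idn_Hom[OF Fo_Ob[OF A]] D.Idn_Hom[OF Fo_Ob[OF B]]
  note rB = C.TensA_Hom[OF rH idC(2)] and Al = C.TensA_Hom[OF idC(1) lH]
  note Asc = C.Asc_Hom[OF A C.UnitO_Ob B]
  have asc: "Asc C A ?I B \<cdot>\<^bsub>C\<^esub> (r \<star>\<^bsub>C\<^esub> Idn C B) = Idn C A \<star>\<^bsub>C\<^esub> l"
  proof -
    let ?x = "Asc C A ?I B \<cdot>\<^bsub>C\<^esub> (r \<star>\<^bsub>C\<^esub> Idn C B)"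
    have x: "?x \<in> Hom C (A \<diamondop>\<^bsub>C\<^esub> B) (A \<diamondop>\<^bsub>C\<^esub> (?I \<diamondop>\<^bsub>C\<^esub> B))" by (rule C.Cmp_Hom[OF rB Asc])
    note AL = C.TensA_Hom[OF idC(1) Lun]
    have "(Idn C A \<star>\<^bsub>C\<^esub> Lun C B) \<cdot>\<^bsub>C\<^esub> ?x = (Run C A \<star>\<^bsub>C\<^esub> Idn C B) \<cdot>\<^bsub>C\<^esub> (r \<star>\<^bsub>C\<^esub> Idn C B)"
      by (simp only: C.Cmp_assoc[OF rB Asc AL] C.triangle[OF A B])
    also have "\<dots> = Idn C (A \<diamondop>\<^bsub>C\<^esub> B)"
      by (simp only: C.TensA_Cmp[OF rH Run idC(2) idC(2), symmetric] inv C.Idn_left[OF idC(2)] C.TensA_Idn[OF A B])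
    finally have *: "(Idn C A \<star>\<^bsub>C\<^esub> Lun C B) \<cdot>\<^bsub>C\<^esub> ?x = Idn C (A \<diamondop>\<^bsub>C\<^esub> B)" .
    have "(Idn C A \<star>\<^bsub>C\<^esub> l) \<cdot>\<^bsub>C\<^esub> (Idn C A \<star>\<^bsub>C\<^esub> Lun C B) = Idn C (A \<diamondop>\<^bsub>C\<^esub> (?I \<diamondop>\<^bsub>C\<^esub> B))"
      by (simp only: C.TensA_Cmp[OF idC(1) idC(1) Lun lH, symmetric] inv C.Idn_left[OF idC(1)] C.TensA_Idn[OF A Ob(5)])
    then have "?x = ((Idn C A \<star>\<^bsub>C\<^esub> l) \<cdot>\<^bsub>C\<^esub> (Idn C A \<star>\<^bsub>C\<^esub> Lun C B)) \<cdot>\<^bsub>C\<^esub> ?x"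
      by (simp only: C.Idn_left[OF x])
    also have "\<dots> = Idn C A \<star>\<^bsub>C\<^esub> l"
      by (simp only: C.Cmp_assoc[OF x AL Al, symmetric] * C.Idn_right[OF Al])
    finally show ?thesis .
  qed
  note n = nu2_Hom[OF A B] nu2_Hom[OF A C.UnitO_Ob] nu2_Hom[OF C.UnitO_Ob B] nu2_Hom[OF Ob(4) B] nu2_Hom[OF A Ob(5)]
  note Fr = Fa_Hom[OF rH] and Fl = Fa_Hom[OF lH] and FrB = Fa_Hom[OF rB] and FAl = Fa_Hom[OF Al] and FAsc = Fa_Hom[OF Asc]
  note ascD = D.Asc_Hom[OF Fo_Ob[OF A] Fo_Ob[OF C.UnitO_Ob] Fo_Ob[OF B]]
  note rB' = D.TensA_Hom[OF Fr idD(2)] and Al' = D.TensA_Hom[OF idD(1) Fl]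
  note nB = D.TensA_Hom[OF n(2) idD(2)] and An = D.TensA_Hom[OF idD(1) n(3)]
  have right: "((nu2 A ?I \<cdot>\<^bsub>D\<^esub> Fa r) \<star>\<^bsub>D\<^esub> ?iB) \<cdot>\<^bsub>D\<^esub> nu2 A B
      = ((nu2 A ?I \<star>\<^bsub>D\<^esub> ?iB) \<cdot>\<^bsub>D\<^esub> nu2 (A \<diamondop>\<^bsub>C\<^esub> ?I) B) \<cdot>\<^bsub>D\<^esub> Fa (r \<star>\<^bsub>C\<^esub> Idn C B)"
  proof -
    have "(nu2 A ?I \<cdot>\<^bsub>D\<^esub> Fa r) \<star>\<^bsub>D\<^esub> ?iB = (nu2 A ?I \<star>\<^bsub>D\<^esub> ?iB) \<cdot>\<^bsub>D\<^esub> (Fa r \<star>\<^bsub>D\<^esub> ?iB)"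
      using D.TensA_Cmp[OF Fr n(2) idD(2) idD(2)] by (simp only: D.Idn_left[OF idD(2)])
    moreover have "(Fa r \<star>\<^bsub>D\<^esub> ?iB) \<cdot>\<^bsub>D\<^esub> nu2 A B = nu2 (A \<diamondop>\<^bsub>C\<^esub> ?I) B \<cdot>\<^bsub>D\<^esub> Fa (r \<star>\<^bsub>C\<^esub> Idn C B)"
      by (simp only: nu2_natural[OF rH idC(2)] Fa_Idn[OF B])
    ultimately show ?thesis
      by (simp only: D.Cmp_assoc[OF n(1) rB' nB, symmetric] D.Cmp_assoc[OF FrB n(4) nB])
  qed
  have left: "(?iA \<star>\<^bsub>D\<^esub> (nu2 ?I B \<cdot>\<^bsub>D\<^esub> Fa l)) \<cdot>\<^bsub>D\<^esub> nu2 A B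
      = (?iA \<star>\<^bsub>D\<^esub> nu2 ?I B) \<cdot>\<^bsub>D\<^esub> (nu2 A (?I \<diamondop>\<^bsub>C\<^esub> B) \<cdot>\<^bsub>D\<^esub> Fa (Idn C A \<star>\<^bsub>C\<^esub> l))"
  proof -
    have "?iA \<star>\<^bsub>D\<^esub> (nu2 ?I B \<cdot>\<^bsub>D\<^esub> Fa l) = (?iA \<star>\<^bsub>D\<^esub> nu2 ?I B) \<cdot>\<^bsub>D\<^esub> (?iA \<star>\<^bsub>D\<^esub> Fa l)"
      using D.TensA_Cmp[OF idD(1) idD(1) Fl n(3)] by (simp only: D.Idn_left[OF idD(1)])
    moreover have "(?iA \<star>\<^bsub>D\<^esub> Fa l) \<cdot>\<^bsub>D\<^esub> nu2 A B = nu2 A (?I \<diamondop>\<^bsub>C\<^esub> B) \<cdot>\<^bsub>D\<^esub> Fa (Idn C A \<star>\<^bsub>C\<^esub> l)"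
      by (simp only: nu2_natural[OF idC(1) lH] Fa_Idn[OF A])
    ultimately show ?thesis by (simp only: D.Cmp_assoc[OF n(1) Al' An, symmetric])
  qed
  note nBn = D.Cmp_Hom[OF n(4) nB] and nA = D.Cmp_Hom[OF FAsc n(5)]
  have comp: "(nu2 A ?I \<cdot>\<^bsub>D\<^esub> Fa r) \<star>\<^bsub>D\<^esub> ?iB \<in> Hom D (Fo A \<diamondop>\<^bsub>D\<^esub> Fo B) ((Fo A \<diamondop>\<^bsub>D\<^esub> Fo ?I) \<diamondop>\<^bsub>D\<^esub> Fo B)"
    by (rule D.TensA_Hom[OF D.Cmp_Hom[OF Fr n(2)] idD(2)])
  have "(Asc D (Fo A) (Fo ?I) (Fo B) \<cdot>\<^bsub>D\<^esub> ((nu2 A ?I \<cdot>\<^bsub>D\<^esub> Fa r) \<star>\<^bsub>D\<^esub> ?iB)) \<cdot>\<^bsub>D\<^esub> nu2 A B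
     = (Asc D (Fo A) (Fo ?I) (Fo B) \<cdot>\<^bsub>D\<^esub> (nu2 A ?I \<star>\<^bsub>D\<^esub> ?iB) \<cdot>\<^bsub>D\<^esub> nu2 (A \<diamondop>\<^bsub>C\<^esub> ?I) B) \<cdot>\<^bsub>D\<^esub> Fa (r \<star>\<^bsub>C\<^esub> Idn C B)"
    by (simp only: D.Cmp_assoc[OF n(1) comp ascD, symmetric] right D.Cmp_assoc[OF FrB nBn ascD])
  also have "\<dots> = ((?iA \<star>\<^bsub>D\<^esub> nu2 ?I B) \<cdot>\<^bsub>D\<^esub> nu2 A (?I \<diamondop>\<^bsub>C\<^esub> B) \<cdot>\<^bsub>D\<^esub> Fa (Asc C A ?I B)) \<cdot>\<^bsub>D\<^esub> Fa (r \<star>\<^bsub>C\<^esub> Idn C B)"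
    by (simp only: nu2_assoc[OF A C.UnitO_Ob B])
  also have "\<dots> = (?iA \<star>\<^bsub>D\<^esub> nu2 ?I B) \<cdot>\<^bsub>D\<^esub> (nu2 A (?I \<diamondop>\<^bsub>C\<^esub> B) \<cdot>\<^bsub>D\<^esub> Fa (Idn C A \<star>\<^bsub>C\<^esub> l))"
    by (simp only: D.Cmp_assoc[OF FrB nA An, symmetric] D.Cmp_assoc[OF FrB FAsc n(5), symmetric] Fa_Cmp[OF rB Asc, symmetric] asc)
  finally show ?thesis by (simp only: left)
qed

context forgetful
begin

abbreviation "Lact \<equiv> lact k HM forget_ob forget_ar \<mu>"
abbreviation "Ract \<equiv> ract k HM forget_ob forget_ar \<mu>"

lemma Lact_G: "M \<in> Ob HM \<Longrightarrow> h \<in> carrier H \<Longrightarrow> m \<in> carrier M \<Longrightarrow> Lact M (G h) m = hact M (fg h) m"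
  by (simp add: lact_def fmap_G)

lemma Ract_G: "M \<in> Ob HM \<Longrightarrow> h \<in> carrier H \<Longrightarrow> m \<in> carrier M \<Longrightarrow> Ract M m (G h) = hact M (fg' h) m"
  by (simp add: ract_def fmap_G)

text \<open>
  The induced map is the first isomorphism theorem for \<open>\<pi>\<close>.  An action on a coset is a union of
  cosets of elements with one common image under \<open>\<pi>\<close>, so the induced map is determined by that image.
\<close>

lemma forget_ess_strong_monoidal:
  assumes comonoidal: "right_comonoidal k H \<or> left_comonoidal k H"
  shows "ess_strong_monoidal k HM forget_ob forget_ar \<mu> (forget_mu0 k H)"
  unfolding ess_strong_monoidal_def
proof (intro conjI ballI forget_monoidal)
  fix M N :: "('k, ('k, 'h, 'x) elt, 'h) hmodule" assume M: "M \<in> Ob HM" and N: "N \<in> Ob HM"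
  have lM: "left_module k H M" and lN: "left_module k H N" using M N by (simp_all add: Ob_HM)
  interpret A: two_modules k H M N by (rule two_modulesI[OF lM lN])
  let ?K = "rel_tensor_kernel k HM forget_ob forget_ar \<mu> M N"
  let ?Q = "rel_tensor k HM forget_ob forget_ar \<mu> M N"
  let ?i = "induced_map \<mu> M N :: ('k, 'h, 'x) elt set \<Rightarrow> ('k, 'h, 'x) elt"
  let ?f = "fn (\<mu> M N)"
  have f: "?f t = A.D \<one>\<^sub>H t" if "t \<in> carrier A.U" for t by (rule mu2_fn[OF that])
  have "{upure k (forget_ob M) (forget_ob N) (Ract M m r) n \<ominus>\<^bsub>utensor k (forget_ob M) (forget_ob N)\<^esub>
       upure k (forget_ob M) (forget_ob N) m (Lact N r n) | m r n.
     m \<in> carrier (forget_ob M) \<and> r \<in> carrier (forget_ob (UnitO HM)) \<and> n \<in> carrier (forget_ob N)} =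
     {A.u (hact M (fg' h) m) n \<ominus>\<^bsub>A.U\<^esub> A.u m (hact N (fg h) n) | m h n.
      m \<in> carrier M \<and> h \<in> carrier H \<and> n \<in> carrier N}"
    (is "?G = ?G'")
  proof
    show "?G \<subseteq> ?G'"
    proof clarify
      fix m r n assume a: "m \<in> carrier (forget_ob M)" "r \<in> carrier (forget_ob (UnitO HM))" "n \<in> carrier (forget_ob N)"
      then obtain h where h: "h \<in> carrier H" "r = G h" by (auto simp: UnitO_HM)
      show "\<exists>m' h n'. upure k (forget_ob M) (forget_ob N) (Ract M m r) n \<ominus>\<^bsub>utensor k (forget_ob M) (forget_ob N)\<^esub>
          upure k (forget_ob M) (forget_ob N) m (Lact N r n) =
          A.u (hact M (fg' h) m') n' \<ominus>\<^bsub>A.U\<^esub> A.u m' (hact N (fg h) n') \<and> m' \<in> carrier M \<and> h \<in> carrier H \<and> n' \<in> carrier N"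
        using a h M N by (intro exI[of _ m] exI[of _ h] exI[of _ n]) (simp add: Lact_G Ract_G forget_tensor)
    qed
    show "?G' \<subseteq> ?G"
    proof clarify
      fix m h n assume a: "m \<in> carrier M" "h \<in> carrier H" "n \<in> carrier N"
      show "\<exists>m' r n'. A.u (hact M (fg' h) m) n \<ominus>\<^bsub>A.U\<^esub> A.u m (hact N (fg h) n) =
          upure k (forget_ob M) (forget_ob N) (Ract M m' r) n' \<ominus>\<^bsub>utensor k (forget_ob M) (forget_ob N)\<^esub>
          upure k (forget_ob M) (forget_ob N) m' (Lact N r n') \<and>
          m' \<in> carrier (forget_ob M) \<and> r \<in> carrier (forget_ob (UnitO HM)) \<and> n' \<in> carrier (forget_ob N)"
        using a M N by (intro exI[of _ m] exI[of _ "G h"] exI[of _ n]) (simp add: Lact_G Ract_G forget_tensor)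
    qed
  qed
  then have "?K = {t \<in> carrier A.U. A.D \<one>\<^sub>H t = \<zero>\<^bsub>A.U\<^esub>}"
    unfolding rel_tensor_kernel_def using balanced_kernel[OF lM lN comonoidal] by (simp add: forget_tensor)
  then have K: "?K = {t \<in> carrier A.U. ?f t = \<zero>\<^bsub>A.L\<^esub>}" using f by (auto simp: ltensor_simps)
  have lin: "linear_map k A.U A.L ?f"
    by (rule linear_map_cong[OF A.module_utensor A.linear_map_proj]) (simp add: f)
  have surj: "?f ` carrier A.U = carrier A.L" by (simp add: f ltensor_simps)
  have Q: "?Q = quotient_module A.U ?K" by (simp add: rel_tensor_def forget_tensor)
  have "module_iso k ?Q A.L ?i"
    unfolding Q induced_map_def[abs_def] by (rule module_iso_quotient_kernel[OF A.module_utensor A.module_ltensor lin K surj])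
  then show "module_iso k ?Q (forget_ob (M \<otimes>\<^sub>l N)) ?i"
    by (simp add: module_iso_def TensO_HM)
  fix r X assume r: "r \<in> carrier (forget_ob (UnitO HM))" and X: "X \<in> carrier ?Q"
  obtain h where h: "h \<in> carrier H" "r = G h" using r by (auto simp: UnitO_HM)
  note coset = coset_kernel[OF A.module_utensor A.module_ltensor lin K]
  obtain t where t: "t \<in> carrier A.U" "X = {s \<in> carrier A.U. ?f s = ?f t}"
    using X coset unfolding Q by (auto simp: quotient_module_def A_RCOSETS_def')
  have const: "?i (\<Union>s\<in>X. ?K +>\<^bsub>A.U\<^esub> w s) = y"
    if w: "\<And>s. s \<in> X \<Longrightarrow> w s \<in> carrier A.U" "\<And>s. s \<in> X \<Longrightarrow> ?f (w s) = y" for w y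
  proof -
    have "(\<Union>s\<in>X. ?K +>\<^bsub>A.U\<^esub> w s) = (\<Union>s\<in>X. {s' \<in> carrier A.U. ?f s' = y})"
      using coset[OF w(1)] w(2) by (intro SUP_cong) simp_all
    also have "\<dots> = {s' \<in> carrier A.U. ?f s' = y}" using t by auto
    finally have "(\<Union>s\<in>X. ?K +>\<^bsub>A.U\<^esub> w s) = {s' \<in> carrier A.U. ?f s' = y}" .
    moreover have "?f ` {s' \<in> carrier A.U. ?f s' = y} = {y}" using w[of t] t by auto
    ultimately show ?thesis by (simp only: induced_map_def the_elem_eq)
  qed
  have iX: "?i X = A.D \<one>\<^sub>H t"
  proof -
    have "?f ` X = {?f t}" using t by auto
    then show ?thesis using f[OF t(1)] by (simp add: induced_map_def)
  qed
  have DX: "A.D \<one>\<^sub>H s = A.D \<one>\<^sub>H t" if "s \<in> X" for s using that t f by auto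
  have Dt: "A.D \<one>\<^sub>H t \<in> carrier A.L" by (rule A.diag_act_in[OF H.one_closed t(1)])
  have sU: "s \<in> carrier A.U" if "s \<in> X" for s using that t by simp
  note um_cong = umap_cong[OF A.M.module_axioms A.N.module_axioms sU]
  have um: "umap k (forget_ob M) (forget_ob N) (Lact M r) id s = umap k M N (hact M (fg h)) id s" if "s \<in> X" for s
    unfolding forget_tensor using h M N that by (intro um_cong) (simp_all add: Lact_G)
  have um': "umap k (forget_ob M) (forget_ob N) id (\<lambda>n. Ract N n r) s = umap k M N id (hact N (fg' h)) s" if "s \<in> X" for s
    unfolding forget_tensor using h M N that by (intro um_cong) (simp_all add: Ract_G)
  note act = umap_fg_diag_act[OF lM lN h(1) sU]
  have MN: "M \<otimes>\<^sub>l N \<in> Ob HM" using M N by simp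
  show "?i (rel_tensor_lact k HM forget_ob forget_ar \<mu> M N r X) = Lact (M \<otimes>\<^sub>l N) r (?i X)"
  proof -
    have "?i (rel_tensor_lact k HM forget_ob forget_ar \<mu> M N r X) = A.D (fg h) (A.D \<one>\<^sub>H t)"
      unfolding rel_tensor_lact_def forget_tensor(1,2) by (rule const) (simp_all add: um act f DX)
    also have "\<dots> = Lact (M \<otimes>\<^sub>l N) r (?i X)"
      using Lact_G[OF MN h(1)] Dt by (simp add: h(2) iX TensO_HM ltensor_simps(5))
    finally show ?thesis .
  qed
  show "?i (rel_tensor_ract k HM forget_ob forget_ar \<mu> M N X r) = Ract (M \<otimes>\<^sub>l N) (?i X) r"
  proof -
    have "?i (rel_tensor_ract k HM forget_ob forget_ar \<mu> M N X r) = A.D (fg' h) (A.D \<one>\<^sub>H t)"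
      unfolding rel_tensor_ract_def forget_tensor(1,2) by (rule const) (simp_all add: um' act f DX)
    also have "\<dots> = Ract (M \<otimes>\<^sub>l N) (?i X) r"
      using Ract_G[OF MN h(1)] Dt by (simp add: h(2) iX TensO_HM ltensor_simps(5))
    finally show ?thesis .
  qed
qed

abbreviation "Rcoact \<equiv> rcoact k HM forget_ar \<nu>"
abbreviation "Lcoact \<equiv> lcoact k HM forget_ar \<nu>"

lemma coactions:
  assumes M: "M \<in> Ob HM"
  shows "Rcoact M \<in> Ar KM" "src (Rcoact M) = forget_ob M" "tgt (Rcoact M) = forget_ob M \<otimes>\<^sub>k forget_ob (UnitO HM)"
    "m \<in> carrier M \<Longrightarrow> fn (Rcoact M) m = tpure M (UnitO HM) m (G \<one>\<^sub>H)"
    "Lcoact M \<in> Ar KM" "src (Lcoact M) = forget_ob M" "tgt (Lcoact M) = forget_ob (UnitO HM) \<otimes>\<^sub>k forget_ob M"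
    "m \<in> carrier M \<Longrightarrow> fn (Lcoact M) m = tpure (UnitO HM) M (G \<one>\<^sub>H) m"
proof -
  note r = C.inverse_pair_Run[OF M] and l = C.inverse_pair_Lun[OF M]
  note eq = C.inverse_arrow_eq[OF r] C.inverse_arrow_eq[OF l]
  have Ar: "Mor M (M \<otimes>\<^sub>l UnitO HM) (\<lambda>a\<in>carrier M. tpure M (UnitO HM) a (G \<one>\<^sub>H)) \<in> Ar HM"
    "Mor M (UnitO HM \<otimes>\<^sub>l M) (\<lambda>a\<in>carrier M. tpure (UnitO HM) M (G \<one>\<^sub>H) a) \<in> Ar HM"
    using r l unfolding inverse_pair_def Hom_def by blast+
  show "Rcoact M \<in> Ar KM" "src (Rcoact M) = forget_ob M" "tgt (Rcoact M) = forget_ob M \<otimes>\<^sub>k forget_ob (UnitO HM)"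
    "Lcoact M \<in> Ar KM" "src (Lcoact M) = forget_ob M" "tgt (Lcoact M) = forget_ob (UnitO HM) \<otimes>\<^sub>k forget_ob M"
    using M Ar by (simp_all add: rcoact_def lcoact_def eq)
  show "m \<in> carrier M \<Longrightarrow> fn (Rcoact M) m = tpure M (UnitO HM) m (G \<one>\<^sub>H)"
    "m \<in> carrier M \<Longrightarrow> fn (Lcoact M) m = tpure (UnitO HM) M (G \<one>\<^sub>H) m"
    using M by (simp_all add: rcoact_def lcoact_def eq)
qed

lemma forget_ess_strong_opmonoidal:
  assumes comonoidal: "right_comonoidal k H \<or> left_comonoidal k H"
  shows "ess_strong_opmonoidal k HM forget_ob forget_ar \<nu> (forget_nu0 k H)"
  unfolding ess_strong_opmonoidal_def
proof (intro conjI ballI forget_opmonoidal)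
  fix M N :: "('k, ('k, 'h, 'x) elt, 'h) hmodule" assume M: "M \<in> Ob HM" and N: "N \<in> Ob HM"
  interpret F: opmonoidal_functor HM KM forget_ob forget_ar "\<nu>" "forget_nu0 k H" by (rule forget_opmonoidal)
  have lM: "left_module k H M" and lN: "left_module k H N" using M N by (simp_all add: Ob_HM)
  interpret A: two_modules k H M N by (rule two_modulesI[OF lM lN])
  let ?I = "UnitO HM"
  let ?l = "Asc KM (forget_ob M) (forget_ob ?I) (forget_ob N) \<cdot>\<^sub>k (Rcoact M \<star>\<^sub>k Idn KM (forget_ob N))"
  let ?r = "Idn KM (forget_ob M) \<star>\<^sub>k Lcoact N"
  let ?E = "cotensor k HM forget_ob forget_ar \<nu> M N"
  note co = coactions[OF M] coactions[OF N]
  have UK: "forget_ob M \<otimes>\<^sub>k forget_ob N = A.U" by (rule TensO_forget)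
  have E: "carrier ?E = {t \<in> carrier A.U. fn ?l t = fn ?r t}" "add ?E = add A.U" "smult ?E = smult A.U"
    by (simp_all add: cotensor_def Let_def forget_tensor)
  have "t \<in> carrier A.L" if t: "t \<in> carrier A.U" "fn ?l t = fn ?r t" for t
  proof -
    have tK: "t \<in> carrier (forget_ob M \<otimes>\<^sub>k forget_ob N)" using t by (simp add: UK)
    let ?x = "umap k (utensor k M ?I) N (fn (Rcoact M)) (fn (Idn KM (forget_ob N))) t"
    have x: "?x = fn (Rcoact M \<star>\<^sub>k Idn KM (forget_ob N)) t"
      using tK co by (simp add: fn_K_TensA) (simp add: TensO_forget forget_tensor)
    have "fn (Rcoact M \<star>\<^sub>k Idn KM (forget_ob N)) t \<in> carrier ((forget_ob M \<otimes>\<^sub>k forget_ob ?I) \<otimes>\<^sub>k forget_ob N)"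
      using K.fn_closed[of "Rcoact M \<star>\<^sub>k Idn KM (forget_ob N)" t] tK co N by simp
    then have "fn ?l t = kassoc_fun k M ?I N ?x"
      using tK co by (simp add: fn_K_Asc x kassoc_fun_forget)
    also have "?x = umap k (utensor k M ?I) N (\<lambda>m. tpure M ?I m (G \<one>\<^sub>H)) id t"
      by (rule umap_cong[OF A.M.module_axioms A.N.module_axioms t(1)]) (simp_all add: co)
    finally have l: "fn ?l t = kassoc_fun k M ?I N (umap k (utensor k M ?I) N (\<lambda>m. tpure M ?I m (G \<one>\<^sub>H)) id t)" .
    have "fn ?r t = umap k M (utensor k ?I N) (fn (Idn KM (forget_ob M))) (fn (Lcoact N)) t"
      using tK co by (simp add: fn_K_TensA) (simp add: TensO_forget forget_tensor)
    also have "\<dots> = umap k M (utensor k ?I N) id (\<lambda>n. tpure ?I N (G \<one>\<^sub>H) n) t"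
      by (rule umap_cong[OF A.M.module_axioms A.N.module_axioms t(1)]) (simp_all add: co)
    finally have "A.D \<one>\<^sub>H t = t"
      using cotensor_fixed[OF lM lN comonoidal t(1)] t(2) l by (simp add: hmod_cat_simps)
    then show ?thesis using t by (simp add: A.carrier_ltensor)
  qed
  moreover have "t \<in> carrier A.U \<and> fn ?l t = fn ?r t" if t: "t \<in> carrier A.L" for t
  proof -
    have tL: "t \<in> carrier (M \<otimes>\<^sub>l N)" using t by (simp add: TensO_HM)
    have tU: "t \<in> carrier A.U" using t by (simp add: A.carrier_ltensor)
    have "?l \<cdot>\<^sub>k \<nu> M N = ?r \<cdot>\<^sub>k \<nu> M N"
      using F.nu2_cotensor[OF M N C.inverse_pair_Run[OF M] C.inverse_pair_Lun[OF N]]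
      by (simp only: rcoact_def lcoact_def C.inverse_arrow_eq[OF C.inverse_pair_Run[OF M]]
         C.inverse_arrow_eq[OF C.inverse_pair_Lun[OF N]])
    then have "fn (?l \<cdot>\<^sub>k \<nu> M N) t = fn (?r \<cdot>\<^sub>k \<nu> M N) t" by (simp only:)
    moreover have "fn (g \<cdot>\<^sub>k \<nu> M N) t = fn g t" for g
      using tL by simp
    ultimately show ?thesis using tU by simp
  qed
  ultimately have car: "carrier ?E = carrier A.L" unfolding E by blast
  have nu: "fn (\<nu> M N) t = t" if "t \<in> carrier A.L" for t using that by (simp add: TensO_HM)
  have "module_iso k A.L ?E (fn (\<nu> M N))"
    unfolding module_iso_def linear_map_def car E(2,3)
  proof (intro conjI)
    interpret L: module k A.L by (rule A.module_ltensor)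
    show "fn (\<nu> M N) \<in> carrier A.L \<rightarrow> carrier A.L" by (simp add: nu)
    have "bij_betw id (carrier A.L) (carrier A.L)" by simp
    then show "bij_betw (fn (\<nu> M N)) (carrier A.L) (carrier A.L)"
      by (rule bij_betw_cong[THEN iffD1, rotated]) (simp add: nu)
    show "\<forall>m\<in>carrier A.L. \<forall>m'\<in>carrier A.L. fn (\<nu> M N) (m \<oplus>\<^bsub>A.L\<^esub> m') =
        fn (\<nu> M N) m \<oplus>\<^bsub>A.U\<^esub> fn (\<nu> M N) m'"
      using nu L.a_closed by (simp add: ltensor_simps(3))
    show "\<forall>x\<in>carrier k. \<forall>m\<in>carrier A.L. fn (\<nu> M N) (x \<odot>\<^bsub>A.L\<^esub> m) = x \<odot>\<^bsub>A.U\<^esub> fn (\<nu> M N) m"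
      using nu L.smult_closed by (simp add: ltensor_simps(4))
  qed
  then show "module_iso k (forget_ob (M \<otimes>\<^sub>l N)) ?E (fn (\<nu> M N))"
    by (simp add: module_iso_def TensO_HM)
qed

end

theorem theorem2p4:
  fixes k :: "'k ring" and H :: "('k, 'h) prebialg"
    and HM :: "(('k, ('k, 'h, 'x) elt, 'h) hmodule,
                (('k, ('k, 'h, 'x) elt, 'h) hmodule, ('k, 'h, 'x) elt) mor) mcat"
  assumes "monoidal_prebialgebra k H"
  defines "HM \<equiv> hmod_cat k H"
  shows "monoidal_functor HM (kmod_cat k) forget_ob forget_ar (forget_mu2 k H) (forget_mu0 k H) \<and>
    opmonoidal_functor HM (kmod_cat k) forget_ob forget_ar (forget_nu2 k H) (forget_nu0 k H) \<and>
    (right_comonoidal k H \<or> left_comonoidal k H \<longrightarrow>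
      ess_strong_monoidal k HM forget_ob forget_ar (forget_mu2 k H) (forget_mu0 k H) \<and>
      ess_strong_opmonoidal k HM forget_ob forget_ar (forget_nu2 k H) (forget_nu0 k H))"
proof -
  interpret monoidal_prebialgebra k H by fact
  interpret forgetful k H "TYPE('x)" ..
  show ?thesis
    unfolding HM_def
    using forget_monoidal forget_opmonoidal forget_ess_strong_monoidal forget_ess_strong_opmonoidal by blast
qed

end
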